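(* Let $\Gamma$ be a discrete group, let $(A_n,\tau_n)$ be a sequence of unital tracial $C^*$-algebras with $\sup_n\|\tau_n\|<\infty$, and let $\rho_n:\Gamma\to U(A_n)$ be a sequence of unital maps such that $\|\rho_n(a)\rho_n(b)-\rho_n(ab)\|\to0$ for all $a,b\in\Gamma$. Let $$H=\frac{c_0(\mathbb{N},\tau_{n*}(K_0(A_n)))}{c_{00}(\mathbb{N},\tau_{n*}(K_0(A_n)))}\subset Q(\mathbb{C}).$$ Then the associated class $[\rho]\in H^2(\Gamma,Q(\mathbb{C}))$ belongs to the image of the map $H^2(\Gamma,H)\to H^2(\Gamma,Q(\mathbb{C}))$ induced by the inclusion $H\subset Q(\mathbb{C})$.
   Context: A trace $\tau_n$ on $A_n$ is a continuous linear functional with $\tau_n(xy)=\tau_n(yx)$; it is extended to matrices over $A_n$ by summing over the diagonal and induces a homomorphism $\tau_{n*}:K_0(A_n)\to\mathbb{C}$. A map $\rho_n$ is unital if $\rho_n(e)=1_n$. For $\|u-1\|<1$, $\log(u)=-\sum_{k\ge1}(1-u)^k/k$. $Q(\mathbb{C})=c_0(\mathbb{N},\mathbb{C})/c_{00}(\mathbb{N},\mathbb{C})$ (null sequences modulo finitely supported sequences). $c_0(\mathbb{N},\tau_{n*}(K_0(A_n)))$ is the group of null sequences $(x_n)_n$ with $x_n\in\tau_{n*}(K_0(A_n))$ for all $n$, and $c_{00}(\mathbb{N},\tau_{n*}(K_0(A_n)))$ is its subgroup of finitely supported sequences. All these groups are trivial $\Gamma$-modules; $H^2(\Gamma,\cdot)$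 is group cohomology (2-cocycles modulo coboundaries $\gamma(a)-\gamma(ab)+\gamma(b)$). The class $[\rho]\in H^2(\Gamma,Q(\mathbb{C}))$ is the class of the 2-cocycle $\omega(a,b)=\left(\frac{1}{2\pi i}\tau_n(\log(\rho_n(a)\rho_n(b)\rho_n(ab)^{-1}))\right)_n$ (components defined for all large $n$). *)

theory Defs
  imports "HOL-Analysis.Analysis" "HOL-Algebra.Coset" "HOL-Algebra.Ring"
begin

section \<open>Unital \<open>C\<^sup>*\<close>-algebras and traces\<close>

text \<open>
  The algebras of a sequence have to be allowed to vary, so they are records with an explicit
  carrier rather than types.
\<close>

record 'a cstar = "'a ring" +
  scale :: "complex \<Rightarrow> 'a \<Rightarrow> 'a"
  star :: "'a \<Rightarrow> 'a"
  cnorm :: "'a \<Rightarrow> real"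

text \<open>
  The distance is set to \<open>0\<close> off the carrier only because the locale \<^locale>\<open>Metric_space\<close>
  wants non-negativity and symmetry on the whole type.
\<close>

definition cdist :: "('a, 'm) cstar_scheme \<Rightarrow> 'a \<Rightarrow> 'a \<Rightarrow> real" where
  "cdist A x y =
     (if x \<in> carrier A \<and> y \<in> carrier A then cnorm A (x \<ominus>\<^bsub>A\<^esub> y) else 0)"

abbreviation ctopology :: "('a, 'm) cstar_scheme \<Rightarrow> 'a topology" where
  "ctopology A \<equiv> Metric_space.mtopology (carrier A) (cdist A)"

locale unital_cstar_algebra = ring A for A :: "('a, 'm) cstar_scheme" (structure) +
  assumes scale_closed [simp]: "x \<in> carrier A \<Longrightarrow> scale A c x \<in> carrier A"
    and scale_one: "x \<in> carrier A \<Longrightarrow> scale A 1 x = x"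
    and scale_scale: "x \<in> carrier A \<Longrightarrow> scale A c (scale A d x) = scale A (c * d) x"
    and scale_add_left: "x \<in> carrier A \<Longrightarrow> scale A (c + d) x = scale A c x \<oplus> scale A d x"
    and scale_add_right:
      "\<lbrakk>x \<in> carrier A; y \<in> carrier A\<rbrakk> \<Longrightarrow> scale A c (x \<oplus> y) = scale A c x \<oplus> scale A c y"
    and scale_mult_left:
      "\<lbrakk>x \<in> carrier A; y \<in> carrier A\<rbrakk> \<Longrightarrow> scale A c x \<otimes> y = scale A c (x \<otimes> y)"
    and scale_mult_right:
      "\<lbrakk>x \<in> carrier A; y \<in> carrier A\<rbrakk> \<Longrightarrow> x \<otimes> scale A c y = scale A c (x \<otimes> y)"
    and star_closed [simp]: "x \<in> carrier A \<Longrightarrow> star A x \<in> carrier A"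
    and star_star: "x \<in> carrier A \<Longrightarrow> star A (star A x) = x"
    and star_add: "\<lbrakk>x \<in> carrier A; y \<in> carrier A\<rbrakk> \<Longrightarrow> star A (x \<oplus> y) = star A x \<oplus> star A y"
    and star_scale: "x \<in> carrier A \<Longrightarrow> star A (scale A c x) = scale A (cnj c) (star A x)"
    and star_mult: "\<lbrakk>x \<in> carrier A; y \<in> carrier A\<rbrakk> \<Longrightarrow> star A (x \<otimes> y) = star A y \<otimes> star A x"
    and cnorm_nonneg: "x \<in> carrier A \<Longrightarrow> 0 \<le> cnorm A x"
    and cnorm_eq_0: "x \<in> carrier A \<Longrightarrow> cnorm A x = 0 \<longleftrightarrow> x = \<zero>"
    and cnorm_triangle:
      "\<lbrakk>x \<in> carrier A; y \<in> carrier A\<rbrakk> \<Longrightarrow> cnorm A (x \<oplus> y) \<le> cnorm A x + cnorm A y"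
    and cnorm_scale: "x \<in> carrier A \<Longrightarrow> cnorm A (scale A c x) = cmod c * cnorm A x"
    and cnorm_mult:
      "\<lbrakk>x \<in> carrier A; y \<in> carrier A\<rbrakk> \<Longrightarrow> cnorm A (x \<otimes> y) \<le> cnorm A x * cnorm A y"
    and cstar_identity: "x \<in> carrier A \<Longrightarrow> cnorm A (star A x \<otimes> x) = (cnorm A x)\<^sup>2"
    and complete: "Metric_space.mcomplete (carrier A) (cdist A)"

text \<open>Traces are not required to be positive or normalised.\<close>

locale tracial_cstar_algebra = unital_cstar_algebra A
  for A :: "('a, 'm) cstar_scheme" (structure) and \<tau> :: "'a \<Rightarrow> complex" +
  assumes trace_add: "\<lbrakk>x \<in> carrier A; y \<in> carrier A\<rbrakk> \<Longrightarrow> \<tau> (x \<oplus> y) = \<tau> x + \<tau> y"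
    and trace_scale: "x \<in> carrier A \<Longrightarrow> \<tau> (scale A c x) = c * \<tau> x"
    and trace_continuous: "continuous_map (ctopology A) euclidean \<tau>"
    and trace_commute: "\<lbrakk>x \<in> carrier A; y \<in> carrier A\<rbrakk> \<Longrightarrow> \<tau> (x \<otimes> y) = \<tau> (y \<otimes> x)"

definition functional_norm :: "('a, 'm) cstar_scheme \<Rightarrow> ('a \<Rightarrow> complex) \<Rightarrow> real" where
  "functional_norm A \<tau> = (SUP x\<in>{x \<in> carrier A. cnorm A x \<le> 1}. cmod (\<tau> x))"

definition unitaries :: "('a, 'm) cstar_scheme \<Rightarrow> 'a set" where
  "unitaries A =
     {u \<in> carrier A. star A u \<otimes>\<^bsub>A\<^esub> u = \<one>\<^bsub>A\<^esub> \<and> u \<otimes>\<^bsub>A\<^esub> star A u = \<one>\<^bsub>A\<^esub>}"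

text \<open>The norm limit of the series exists when \<open>\<parallel>u - 1\<parallel> < 1\<close>; it is unspecified otherwise.\<close>

definition clog :: "('a, 'm) cstar_scheme \<Rightarrow> 'a \<Rightarrow> 'a" where
  "clog A u = (THE l. limitin (ctopology A)
     (\<lambda>N. \<ominus>\<^bsub>A\<^esub> (\<Oplus>\<^bsub>A\<^esub>k\<in>{1..N}. scale A (1 / of_nat k) ((\<one>\<^bsub>A\<^esub> \<ominus>\<^bsub>A\<^esub> u) [^]\<^bsub>A\<^esub> k)))
     l sequentially)"


section \<open>\<open>K\<^sub>0\<close> and the map induced by a trace\<close>

text \<open>
  An \<open>m \<times> n\<close> matrix is a function on pairs of indices that vanishes outside the range, so that
  equality of matrices is equality of functions.
\<close>

definition matrices :: "('a, 'm) cstar_scheme \<Rightarrow> nat \<Rightarrow> nat \<Rightarrow> (nat \<Rightarrow> nat \<Rightarrow> 'a) set" where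
  "matrices A m n = {p. (\<forall>i j. p i j \<in> carrier A) \<and>
                        (\<forall>i j. \<not> (i < m \<and> j < n) \<longrightarrow> p i j = \<zero>\<^bsub>A\<^esub>)}"

text \<open>Product of an \<open>m \<times> k\<close> and a \<open>k \<times> n\<close> matrix.\<close>

definition matrix_prod ::
  "('a, 'm) cstar_scheme \<Rightarrow> nat \<Rightarrow> (nat \<Rightarrow> nat \<Rightarrow> 'a) \<Rightarrow> (nat \<Rightarrow> nat \<Rightarrow> 'a) \<Rightarrow> nat \<Rightarrow> nat \<Rightarrow> 'a" where
  "matrix_prod A k p q = (\<lambda>i j. \<Oplus>\<^bsub>A\<^esub>t\<in>{..<k}. p i t \<otimes>\<^bsub>A\<^esub> q t j)"

definition matrix_star ::
  "('a, 'm) cstar_scheme \<Rightarrow> (nat \<Rightarrow> nat \<Rightarrow> 'a) \<Rightarrow> nat \<Rightarrow> nat \<Rightarrow> 'a" where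
  "matrix_star A p = (\<lambda>i j. star A (p j i))"

text \<open>The disjoint union over \<open>k\<close> of the sets of projections in \<open>M\<^sub>k(A)\<close>.\<close>

definition projections :: "('a, 'm) cstar_scheme \<Rightarrow> (nat \<times> (nat \<Rightarrow> nat \<Rightarrow> 'a)) set" where
  "projections A =
     {(k, p). p \<in> matrices A k k \<and> matrix_prod A k p p = p \<and> matrix_star A p = p}"

fun mvn_equiv ::
  "('a, 'm) cstar_scheme \<Rightarrow> nat \<times> (nat \<Rightarrow> nat \<Rightarrow> 'a) \<Rightarrow> nat \<times> (nat \<Rightarrow> nat \<Rightarrow> 'a) \<Rightarrow> bool" where
  "mvn_equiv A (k, p) (l, q) \<longleftrightarrow>
     (\<exists>v \<in> matrices A l k. matrix_prod A l (matrix_star A v) v = p \<and>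
                           matrix_prod A k v (matrix_star A v) = q)"

fun direct_sum ::
  "('a, 'm) cstar_scheme \<Rightarrow> nat \<times> (nat \<Rightarrow> nat \<Rightarrow> 'a) \<Rightarrow> nat \<times> (nat \<Rightarrow> nat \<Rightarrow> 'a)
     \<Rightarrow> nat \<times> (nat \<Rightarrow> nat \<Rightarrow> 'a)" where
  "direct_sum A (k, p) (l, q) =
     (k + l, \<lambda>i j. if i < k \<and> j < k then p i j
                   else if k \<le> i \<and> k \<le> j then q (i - k) (j - k) else \<zero>\<^bsub>A\<^esub>)"

text \<open>
  The Grothendieck group of the monoid of Murray--von Neumann classes: the pair \<open>(p, q)\<close> stands
  for the formal difference \<open>[p] - [q]\<close>, and
  \<open>[p] - [q] = [p'] - [q']\<close> iff \<open>p \<oplus> q' \<oplus> r \<sim> p' \<oplus> q \<oplus> r\<close> for some projection \<open>r\<close>.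
\<close>

definition K0_rel :: "('a, 'm) cstar_scheme \<Rightarrow>
    ((nat \<times> (nat \<Rightarrow> nat \<Rightarrow> 'a)) \<times> (nat \<times> (nat \<Rightarrow> nat \<Rightarrow> 'a))) rel" where
  "K0_rel A = {((p, q), (p', q')).
     p \<in> projections A \<and> q \<in> projections A \<and> p' \<in> projections A \<and> q' \<in> projections A \<and>
     (\<exists>r \<in> projections A. mvn_equiv A (direct_sum A (direct_sum A p q') r)
                                      (direct_sum A (direct_sum A p' q) r))}"

definition K0 :: "('a, 'm) cstar_scheme \<Rightarrow>
    ((nat \<times> (nat \<Rightarrow> nat \<Rightarrow> 'a)) \<times> (nat \<times> (nat \<Rightarrow> nat \<Rightarrow> 'a))) set monoid" where
  "K0 A = \<lparr>carrier = (projections A \<times> projections A) // K0_rel A,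
           mult = (\<lambda>X Y. \<Union>(p, q)\<in>X. \<Union>(p', q')\<in>Y.
                     K0_rel A `` {(direct_sum A p p', direct_sum A q q')}),
           one = K0_rel A `` {((0, \<lambda>_ _. \<zero>\<^bsub>A\<^esub>), (0, \<lambda>_ _. \<zero>\<^bsub>A\<^esub>))}\<rparr>"

fun matrix_trace :: "('a \<Rightarrow> complex) \<Rightarrow> nat \<times> (nat \<Rightarrow> nat \<Rightarrow> 'a) \<Rightarrow> complex" where
  "matrix_trace \<tau> (k, p) = (\<Sum>i<k. \<tau> (p i i))"

text \<open>
  \<open>\<tau>\<^sub>*([p] - [q]) = \<tau>(p) - \<tau>(q)\<close>; independence of the representatives is proved at the end of
  this theory.
\<close>

definition K0_trace :: "('a \<Rightarrow> complex) \<Rightarrow>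
    ((nat \<times> (nat \<Rightarrow> nat \<Rightarrow> 'a)) \<times> (nat \<times> (nat \<Rightarrow> nat \<Rightarrow> 'a))) set \<Rightarrow> complex" where
  "K0_trace \<tau> X = the_elem ((\<lambda>(p, q). matrix_trace \<tau> p - matrix_trace \<tau> q) ` X)"


section \<open>Null sequences modulo finitely supported sequences\<close>

definition c0 :: "(nat \<Rightarrow> complex set) \<Rightarrow> (nat \<Rightarrow> complex) monoid" where
  "c0 G = \<lparr>carrier = {x. (\<forall>n. x n \<in> G n) \<and> x \<longlonglongrightarrow> 0},
           mult = (\<lambda>x y n. x n + y n), one = (\<lambda>n. 0)\<rparr>"

definition c00 :: "(nat \<Rightarrow> complex set) \<Rightarrow> (nat \<Rightarrow> complex) set" where
  "c00 G = {x. (\<forall>n. x n \<in> G n) \<and> finite {n. x n \<noteq> 0}}"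

definition Q :: "(nat \<Rightarrow> complex set) \<Rightarrow> (nat \<Rightarrow> complex) set monoid" where
  "Q G = c0 G Mod c00 G"

abbreviation QC :: "(nat \<Rightarrow> complex) set monoid" where
  "QC \<equiv> Q (\<lambda>_. UNIV)"

abbreviation QC_class :: "(nat \<Rightarrow> complex) \<Rightarrow> (nat \<Rightarrow> complex) set" where
  "QC_class x \<equiv> c00 (\<lambda>_. UNIV) #>\<^bsub>c0 (\<lambda>_. UNIV)\<^esub> x"

text \<open>
  The inclusion of \<open>Q G\<close> in \<open>Q(\<complex>)\<close>. Elements of \<open>Q G\<close> are cosets of the smaller group
  \<open>c00 G\<close>, so it is not the identity on the underlying sets: a coset goes to the coset of
  \<open>c00(\<complex>)\<close> that contains it.
\<close>

definition Q_incl :: "(nat \<Rightarrow> complex) set \<Rightarrow> (nat \<Rightarrow> complex) set" where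
  "Q_incl X = (\<Union>x\<in>X. QC_class x)"


section \<open>Second cohomology with trivial coefficients\<close>

text \<open>
  The coefficient module is a commutative group in multiplicative notation; cochains are
  extensional functions.
\<close>

definition Z2 :: "('g, 'u) monoid_scheme \<Rightarrow> ('b, 'v) monoid_scheme \<Rightarrow> ('g \<times> 'g \<Rightarrow> 'b) monoid" where
  "Z2 \<Gamma> M = \<lparr>carrier = {\<omega> \<in> carrier \<Gamma> \<times> carrier \<Gamma> \<rightarrow>\<^sub>E carrier M.
       \<forall>a\<in>carrier \<Gamma>. \<forall>b\<in>carrier \<Gamma>. \<forall>c\<in>carrier \<Gamma>.
         \<omega> (b, c) \<otimes>\<^bsub>M\<^esub> inv\<^bsub>M\<^esub> \<omega> (a \<otimes>\<^bsub>\<Gamma>\<^esub> b, c) \<otimes>\<^bsub>M\<^esub> \<omega> (a, b \<otimes>\<^bsub>\<Gamma>\<^esub> c) \<otimes>\<^bsub>M\<^esub> inv\<^bsub>M\<^esub> \<omega> (a, b)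
         = \<one>\<^bsub>M\<^esub>},
     mult = (\<lambda>\<omega> \<omega>'. \<lambda>x\<in>carrier \<Gamma> \<times> carrier \<Gamma>. \<omega> x \<otimes>\<^bsub>M\<^esub> \<omega>' x),
     one = (\<lambda>x\<in>carrier \<Gamma> \<times> carrier \<Gamma>. \<one>\<^bsub>M\<^esub>)\<rparr>"

definition coboundary ::
  "('g, 'u) monoid_scheme \<Rightarrow> ('b, 'v) monoid_scheme \<Rightarrow> ('g \<Rightarrow> 'b) \<Rightarrow> 'g \<times> 'g \<Rightarrow> 'b" where
  "coboundary \<Gamma> M \<gamma> = (\<lambda>(a, b)\<in>carrier \<Gamma> \<times> carrier \<Gamma>.
     \<gamma> a \<otimes>\<^bsub>M\<^esub> inv\<^bsub>M\<^esub> \<gamma> (a \<otimes>\<^bsub>\<Gamma>\<^esub> b) \<otimes>\<^bsub>M\<^esub> \<gamma> b)"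

definition B2 :: "('g, 'u) monoid_scheme \<Rightarrow> ('b, 'v) monoid_scheme \<Rightarrow> ('g \<times> 'g \<Rightarrow> 'b) set" where
  "B2 \<Gamma> M = coboundary \<Gamma> M ` (carrier \<Gamma> \<rightarrow> carrier M)"

definition H2 :: "('g, 'u) monoid_scheme \<Rightarrow> ('b, 'v) monoid_scheme \<Rightarrow> ('g \<times> 'g \<Rightarrow> 'b) set monoid" where
  "H2 \<Gamma> M = Z2 \<Gamma> M Mod B2 \<Gamma> M"

definition H2_class ::
  "('g, 'u) monoid_scheme \<Rightarrow> ('b, 'v) monoid_scheme \<Rightarrow> ('g \<times> 'g \<Rightarrow> 'b) \<Rightarrow> ('g \<times> 'g \<Rightarrow> 'b) set" where
  "H2_class \<Gamma> M \<omega> = B2 \<Gamma> M #>\<^bsub>Z2 \<Gamma> M\<^esub> \<omega>"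

text \<open>
  The map into \<open>H\<^sup>2(\<Gamma>, N)\<close> induced by a homomorphism \<open>f\<close> into \<open>N\<close>. The union ranges over the
  representatives of a class, all of which yield the same coset.
\<close>

definition H2_map :: "('g, 'u) monoid_scheme \<Rightarrow> ('c, 'w) monoid_scheme \<Rightarrow> ('b \<Rightarrow> 'c) \<Rightarrow>
    ('g \<times> 'g \<Rightarrow> 'b) set \<Rightarrow> ('g \<times> 'g \<Rightarrow> 'c) set" where
  "H2_map \<Gamma> N f X =
     (\<Union>\<omega>\<in>X. H2_class \<Gamma> N (\<lambda>x\<in>carrier \<Gamma> \<times> carrier \<Gamma>. f (\<omega> x)))"


section \<open>The class of an asymptotic homomorphism\<close>

text \<open>
  A component for which the logarithm series need not converge is set to \<open>0\<close>. For fixed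
  \<open>(a, b)\<close> this concerns finitely many \<open>n\<close> only, so the class in \<open>Q(\<complex>)\<close> does not depend on it.
\<close>

definition defect_seq :: "('g, 'u) monoid_scheme \<Rightarrow> (nat \<Rightarrow> ('a, 'm) cstar_scheme) \<Rightarrow>
    (nat \<Rightarrow> 'a \<Rightarrow> complex) \<Rightarrow> (nat \<Rightarrow> 'g \<Rightarrow> 'a) \<Rightarrow> 'g \<Rightarrow> 'g \<Rightarrow> nat \<Rightarrow> complex" where
  "defect_seq \<Gamma> A \<tau> \<rho> a b n =
     (let u = \<rho> n a \<otimes>\<^bsub>A n\<^esub> \<rho> n b \<otimes>\<^bsub>A n\<^esub> inv\<^bsub>A n\<^esub> (\<rho> n (a \<otimes>\<^bsub>\<Gamma>\<^esub> b))
      in if cnorm (A n) (u \<ominus>\<^bsub>A n\<^esub> \<one>\<^bsub>A n\<^esub>) < 1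
         then 1 / (2 * complex_of_real pi * \<i>) * \<tau> n (clog (A n) u) else 0)"

definition asymp_hom_class :: "('g, 'u) monoid_scheme \<Rightarrow> (nat \<Rightarrow> ('a, 'm) cstar_scheme) \<Rightarrow>
    (nat \<Rightarrow> 'a \<Rightarrow> complex) \<Rightarrow> (nat \<Rightarrow> 'g \<Rightarrow> 'a) \<Rightarrow>
    ('g \<times> 'g \<Rightarrow> (nat \<Rightarrow> complex) set) set" where
  "asymp_hom_class \<Gamma> A \<tau> \<rho> = H2_class \<Gamma> QC
     (\<lambda>(a, b)\<in>carrier \<Gamma> \<times> carrier \<Gamma>. QC_class (defect_seq \<Gamma> A \<tau> \<rho> a b))"


section \<open>Well-definedness\<close>

lemma (in unital_cstar_algebra) Metric_space_cdist: "Metric_space (carrier A) (cdist A)"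
proof
  have neg: "cnorm A (\<ominus> x) = cnorm A x" if "x \<in> carrier A" for x
  proof -
    have "scale A 0 x \<oplus> scale A 0 x = scale A 0 x"
      using scale_add_left[OF that, of 0 0] by simp
    then have "scale A 0 x = \<zero>"
      using that by (metis add.r_cancel_one' scale_closed)
    then have "scale A (-1) x \<oplus> x = \<zero>"
      using scale_add_left[OF that, of "-1" 1] scale_one[OF that] by simp
    then have "\<ominus> x = scale A (-1) x"
      using that minus_equality scale_closed by blast
    then show ?thesis
      using cnorm_scale[OF that, of "-1"] by simp
  qed
  fix x y
  show "0 \<le> cdist A x y"
    by (simp add: cdist_def cnorm_nonneg)
  show "cdist A x y = cdist A y x"
  proof (cases "x \<in> carrier A \<and> y \<in> carrier A")
    case True
    then have "\<ominus> (x \<ominus> y) = y \<ominus> x"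
      by (simp add: a_minus_def minus_add a_comm)
    then show ?thesis
      using neg[of "x \<ominus> y"] True by (simp add: cdist_def)
  qed (auto simp: cdist_def)
next
  fix x y assume "x \<in> carrier A" "y \<in> carrier A"
  then show "cdist A x y = 0 \<longleftrightarrow> x = y"
    by (metis (no_types, lifting) a_minus_def a_inv_closed cdist_def cnorm_eq_0 minus_closed
        minus_equality minus_minus r_neg)
next
  fix x y z assume *: "x \<in> carrier A" "y \<in> carrier A" "z \<in> carrier A"
  have "x \<ominus> z = (x \<ominus> y) \<oplus> (y \<ominus> z)"
    using * by (simp add: a_minus_def a_assoc r_neg1)
  then show "cdist A x z \<le> cdist A x y + cdist A y z"
    using * cnorm_triangle[of "x \<ominus> y" "y \<ominus> z"] by (simp add: cdist_def)
qed

context tracial_cstar_algebra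
begin

lemma trace_zero: "\<tau> \<zero> = 0"
  using trace_add[of \<zero> \<zero>] by simp

lemma trace_finsum:
  assumes "finite S" "f \<in> S \<rightarrow> carrier A"
  shows "\<tau> (finsum A f S) = (\<Sum>s\<in>S. \<tau> (f s))"
  using assms
proof (induction S)
  case empty
  then show ?case by (simp add: trace_zero)
next
  case (insert s S)
  then have "f \<in> S \<rightarrow> carrier A" "f s \<in> carrier A" by auto
  with insert show ?case by (simp add: trace_add)
qed

lemma matrix_trace_mvn:
  assumes "mvn_equiv A p q"
  shows "matrix_trace \<tau> p = matrix_trace \<tau> q"
proof -
  obtain k p' l q' where pq: "p = (k, p')" "q = (l, q')" by (metis surj_pair)
  obtain v where v: "v \<in> matrices A l k"
    and p': "p' = matrix_prod A l (matrix_star A v) v"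
    and q': "q' = matrix_prod A k v (matrix_star A v)"
    using assms by (auto simp: pq)
  have vc: "v i j \<in> carrier A" for i j using v by (auto simp: matrices_def)
  have "matrix_trace \<tau> p = (\<Sum>i<k. \<Sum>t<l. \<tau> (star A (v t i) \<otimes> v t i))"
    unfolding pq p' by (simp add: matrix_prod_def matrix_star_def trace_finsum vc)
  also have "\<dots> = (\<Sum>t<l. \<Sum>i<k. \<tau> (v t i \<otimes> star A (v t i)))"
    by (subst sum.swap) (simp add: trace_commute vc)
  also have "\<dots> = matrix_trace \<tau> q"
    unfolding pq q' by (simp add: matrix_prod_def matrix_star_def trace_finsum vc)
  finally show ?thesis .
qed

lemma matrix_trace_direct_sum:
  "matrix_trace \<tau> (direct_sum A p q) = matrix_trace \<tau> p + matrix_trace \<tau> q"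
proof -
  obtain k p' l q' where pq: "p = (k, p')" "q = (l, q')" by (metis surj_pair)
  let ?f = "\<lambda>i. \<tau> (if i < k \<and> i < k then p' i i
                   else if k \<le> i \<and> k \<le> i then q' (i - k) (i - k) else \<zero>)"
  have "sum ?f {..<k + l} = sum ?f {..<k} + sum ?f {k..<k + l}"
    by (metis (no_types, lifting) atLeast0LessThan le_add1 le0 sum.atLeastLessThan_concat)
  moreover have "sum ?f {k..<k + l} = (\<Sum>i<l. \<tau> (q' i i))"
    using sum.shift_bounds_nat_ivl[of ?f 0 k l] by (simp add: atLeast0LessThan add.commute)
  ultimately show ?thesis by (simp add: pq)
qed

lemma mvn_equiv_refl:
  assumes "p \<in> projections A" shows "mvn_equiv A p p"
  using assms by (cases p) (auto simp: projections_def intro!: bexI)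

lemma star_zero: "star A \<zero> = \<zero>"
  using star_add[of \<zero> \<zero>] by (metis add.r_cancel_one' r_zero star_closed zero_closed)

lemma direct_sum_projection:
  assumes "p \<in> projections A" "q \<in> projections A"
  shows "direct_sum A p q \<in> projections A"
proof -
  obtain k p' l q' where pq: "p = (k, p')" "q = (l, q')" by (metis surj_pair)
  have pc: "p' i j \<in> carrier A" and qc: "q' i j \<in> carrier A" for i j
    using assms by (auto simp: pq projections_def matrices_def)
  have p0: "p' i j = \<zero>" if "\<not> (i < k \<and> j < k)" for i j
    using assms that unfolding pq projections_def matrices_def by blast
  have q0: "q' i j = \<zero>" if "\<not> (i < l \<and> j < l)" for i j
    using assms that unfolding pq projections_def matrices_def by blast
  have pp: "(\<Oplus>t\<in>{..<k}. p' i t \<otimes> p' t j) = p' i j" for i j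
    using assms by (auto simp: pq projections_def matrix_prod_def dest: fun_cong)
  have qq: "(\<Oplus>t\<in>{..<l}. q' i t \<otimes> q' t j) = q' i j" for i j
    using assms by (auto simp: pq projections_def matrix_prod_def dest: fun_cong)
  have ps: "star A (p' j i) = p' i j" and qs: "star A (q' j i) = q' i j" for i j
    using assms by (auto simp: pq projections_def matrix_star_def dest: fun_cong)
  define d where "d = (\<lambda>i j. if i < k \<and> j < k then p' i j
                   else if k \<le> i \<and> k \<le> j then q' (i - k) (j - k) else \<zero>)"
  have dc: "d i j \<in> carrier A" for i j by (simp add: d_def pc qc)
  have "d \<in> matrices A (k + l) (k + l)"
  proof -
    have "d i j = \<zero>" if "\<not> (i < k + l \<and> j < k + l)" for i j
      using that by (auto simp: d_def intro!: q0)
    then show ?thesis by (auto simp: matrices_def dc)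
  qed
  moreover have "matrix_star A d = d"
    by (auto simp: matrix_star_def d_def ps qs star_zero fun_eq_iff)
  moreover have "matrix_prod A (k + l) d d = d"
  proof (intro ext)
    fix i j
    have split: "{..<k + l} = {..<k} \<union> (\<lambda>t. t + k) ` {..<l}"
    proof (intro equalityI subsetI)
      fix t assume "t \<in> {..<k + l}"
      then show "t \<in> {..<k} \<union> (\<lambda>t. t + k) ` {..<l}"
        by (cases "t < k") (auto intro!: image_eqI[of _ _ "t - k"])
    qed auto
    have "matrix_prod A (k + l) d d i j
        = (\<Oplus>t\<in>{..<k}. d i t \<otimes> d t j) \<oplus> (\<Oplus>t\<in>(\<lambda>t. t + k) ` {..<l}. d i t \<otimes> d t j)"
      unfolding matrix_prod_def split
      by (intro add.finprod_Un_disjoint) (auto simp: dc)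
    also have "(\<Oplus>t\<in>(\<lambda>t. t + k) ` {..<l}. d i t \<otimes> d t j)
        = (\<Oplus>t\<in>{..<l}. d i (t + k) \<otimes> d (t + k) j)"
      by (intro add.finprod_reindex) (auto simp: dc inj_on_def)
    also have "(\<Oplus>t\<in>{..<l}. d i (t + k) \<otimes> d (t + k) j)
        = (if k \<le> i \<and> k \<le> j then q' (i - k) (j - k) else \<zero>)"
    proof (cases "k \<le> i \<and> k \<le> j")
      case True
      then show ?thesis by (simp add: d_def qq)
    next
      case False
      then have "d i (t + k) \<otimes> d (t + k) j = \<zero>" for t
        by (auto simp: d_def qc)
      then show ?thesis using False by (auto simp: finsum_zero)
    qed
    also have "(\<Oplus>t\<in>{..<k}. d i t \<otimes> d t j) = (if i < k \<and> j < k then p' i j else \<zero>)"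
    proof (cases "i < k \<and> j < k")
      case True
      have "(\<Oplus>t\<in>{..<k}. d i t \<otimes> d t j) = (\<Oplus>t\<in>{..<k}. p' i t \<otimes> p' t j)"
        using True by (intro finsum_cong') (auto simp: d_def pc)
      then show ?thesis using True by (simp add: pp)
    next
      case False
      then have "(\<Oplus>t\<in>{..<k}. d i t \<otimes> d t j) = (\<Oplus>t\<in>{..<k}. \<zero>)"
        by (intro finsum_cong') (auto simp: d_def pc)
      then show ?thesis using False by (auto simp: finsum_zero)
    qed
    finally show "matrix_prod A (k + l) d d i j = d i j"
      by (auto simp: d_def pc qc)
  qed
  ultimately show ?thesis
    by (simp add: pq projections_def d_def)
qed

lemma K0_rel_refl:
  assumes "p \<in> projections A" "q \<in> projections A"
  shows "((p, q), (p, q)) \<in> K0_rel A"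
proof -
  have "direct_sum A (direct_sum A p q) p \<in> projections A"
    by (intro direct_sum_projection assms)
  then have "mvn_equiv A (direct_sum A (direct_sum A p q) p) (direct_sum A (direct_sum A p q) p)"
    by (rule mvn_equiv_refl)
  then show ?thesis
    using assms unfolding K0_rel_def by blast
qed

lemma K0_trace_class:
  assumes pq: "p \<in> projections A" "q \<in> projections A"
  shows "K0_trace \<tau> (K0_rel A `` {(p, q)}) = matrix_trace \<tau> p - matrix_trace \<tau> q"
proof -
  have "matrix_trace \<tau> p' - matrix_trace \<tau> q' = matrix_trace \<tau> p - matrix_trace \<tau> q"
    if "((p, q), (p', q')) \<in> K0_rel A" for p' q'
  proof -
    have "\<exists>r. mvn_equiv A (direct_sum A (direct_sum A p q') r)
                                (direct_sum A (direct_sum A p' q) r)"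
      using that unfolding K0_rel_def by blast
    then obtain r where "mvn_equiv A (direct_sum A (direct_sum A p q') r)
                                (direct_sum A (direct_sum A p' q) r)" by blast
    from matrix_trace_mvn[OF this] show ?thesis
      by (simp add: matrix_trace_direct_sum algebra_simps)
  qed
  note eq = this
  let ?f = "\<lambda>(p, q). matrix_trace \<tau> p - matrix_trace \<tau> q"
  have "the_elem (?f ` (K0_rel A `` {(p, q)})) = ?f (p, q)"
  proof (rule the_elem_image_unique)
    show "K0_rel A `` {(p, q)} \<noteq> {}"
      using K0_rel_refl[OF pq] by (metis Image_singleton_iff empty_iff)
    fix y assume "y \<in> K0_rel A `` {(p, q)}"
    moreover obtain p' q' where "y = (p', q')" by (rule prod.exhaust)
    ultimately show "?f y = ?f (p, q)"
      using eq[of p' q'] by (simp only: Image_singleton_iff prod.case)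
  qed
  then show ?thesis by (simp only: K0_trace_def prod.case)
qed

lemma K0_trace_image:
  "K0_trace \<tau> ` carrier (K0 A) =
     {matrix_trace \<tau> p - matrix_trace \<tau> q |p q. p \<in> projections A \<and> q \<in> projections A}"
proof (intro equalityI subsetI)
  fix z assume "z \<in> K0_trace \<tau> ` carrier (K0 A)"
  then obtain X where X: "X \<in> (projections A \<times> projections A) // K0_rel A" "z = K0_trace \<tau> X"
    by (auto simp: K0_def)
  from X(1) obtain x where "x \<in> projections A \<times> projections A" "X = K0_rel A `` {x}"
    by (rule quotientE)
  then obtain p q where "p \<in> projections A" "q \<in> projections A" "X = K0_rel A `` {(p, q)}"
    by blast
  then show "z \<in> {matrix_trace \<tau> p - matrix_trace \<tau> q |p q. p \<in> projections A \<and> q \<in> projections A}"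
    using X(2) K0_trace_class by blast
next
  fix z
  assume "z \<in> {matrix_trace \<tau> p - matrix_trace \<tau> q |p q. p \<in> projections A \<and> q \<in> projections A}"
  then obtain p q where pq: "p \<in> projections A" "q \<in> projections A"
    and "z = matrix_trace \<tau> p - matrix_trace \<tau> q" by blast
  then have "z = K0_trace \<tau> (K0_rel A `` {(p, q)})" by (simp add: K0_trace_class)
  moreover have "K0_rel A `` {(p, q)} \<in> carrier (K0 A)"
    using pq by (simp add: K0_def quotientI)
  ultimately show "z \<in> K0_trace \<tau> ` carrier (K0 A)" by (rule image_eqI)
qed

lemma K0_trace_imageI:
  assumes "p \<in> projections A" "q \<in> projections A"
  shows "matrix_trace \<tau> p - matrix_trace \<tau> q \<in> K0_trace \<tau> ` carrier (K0 A)"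
  unfolding K0_trace_image mem_Collect_eq by (rule exI[of _ p], rule exI[of _ q]) (intro conjI refl assms)

lemma K0_trace_image_zero: "0 \<in> K0_trace \<tau> ` carrier (K0 A)"
proof -
  have "(0, \<lambda>_ _. \<zero>) \<in> projections A"
    by (auto simp: projections_def matrices_def matrix_prod_def matrix_star_def star_zero)
  from K0_trace_imageI[OF this this] show ?thesis by simp
qed

lemma K0_trace_image_diff:
  assumes "x \<in> K0_trace \<tau> ` carrier (K0 A)" "y \<in> K0_trace \<tau> ` carrier (K0 A)"
  shows "x - y \<in> K0_trace \<tau> ` carrier (K0 A)"
proof -
  obtain p q where pq: "p \<in> projections A" "q \<in> projections A"
    and x: "x = matrix_trace \<tau> p - matrix_trace \<tau> q"
    using assms(1) unfolding K0_trace_image mem_Collect_eq by (elim exE conjE)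
  obtain p' q' where pq': "p' \<in> projections A" "q' \<in> projections A"
    and y: "y = matrix_trace \<tau> p' - matrix_trace \<tau> q'"
    using assms(2) unfolding K0_trace_image mem_Collect_eq by (elim exE conjE)
  have "x - y = matrix_trace \<tau> (direct_sum A p q') - matrix_trace \<tau> (direct_sum A q p')"
    by (simp add: matrix_trace_direct_sum x y)
  then show ?thesis
    using K0_trace_imageI[OF direct_sum_projection[OF pq(1) pq'(2)] direct_sum_projection[OF pq(2) pq'(1)]]
    by simp
qed

end

lemma c0_comm_group:
  assumes "\<And>n. 0 \<in> G n" "\<And>n x y. \<lbrakk>x \<in> G n; y \<in> G n\<rbrakk> \<Longrightarrow> x - y \<in> G n"
  shows "comm_group (c0 G)"
proof (rule comm_groupI)
  have neg: "- x \<in> G n" if "x \<in> G n" for n x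
    using assms(2)[OF assms(1) that] by simp
  have add: "x + y \<in> G n" if "x \<in> G n" "y \<in> G n" for n x y
    using assms(2)[OF that(1) neg[OF that(2)]] by simp
  show "x \<otimes>\<^bsub>c0 G\<^esub> y \<in> carrier (c0 G)" if "x \<in> carrier (c0 G)" "y \<in> carrier (c0 G)" for x y
    using that tendsto_add[of x 0 sequentially y 0] by (auto simp: c0_def add)
  show "\<exists>y\<in>carrier (c0 G). y \<otimes>\<^bsub>c0 G\<^esub> x = \<one>\<^bsub>c0 G\<^esub>" if "x \<in> carrier (c0 G)" for x
    using that tendsto_minus[of x 0 sequentially]
    by (intro bexI[of _ "\<lambda>n. - x n"]) (auto simp: c0_def neg)
qed (auto simp: c0_def assms(1) add_ac)

lemma c00_subgroup:
  assumes "\<And>n. 0 \<in> G n" "\<And>n x y. \<lbrakk>x \<in> G n; y \<in> G n\<rbrakk> \<Longrightarrow> x - y \<in> G n"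
  shows "subgroup (c00 G) (c0 G)"
proof -
  interpret comm_group "c0 G" by (rule c0_comm_group[OF assms])
  have neg: "- x \<in> G n" if "x \<in> G n" for n x
    using assms(2)[OF assms(1) that] by simp
  have add: "x + y \<in> G n" if "x \<in> G n" "y \<in> G n" for n x y
    using assms(2)[OF that(1) neg[OF that(2)]] by simp
  have lim: "x \<longlonglongrightarrow> 0" if "finite {n. x n \<noteq> 0}" for x :: "nat \<Rightarrow> complex"
  proof (rule tendsto_eventually)
    show "\<forall>\<^sub>F n in sequentially. x n = 0"
      using that by (simp add: eventually_cofinite flip: cofinite_eq_sequentially)
  qed
  have inv: "inv\<^bsub>c0 G\<^esub> x = (\<lambda>n. - x n)" if "x \<in> carrier (c0 G)" for x
    using that tendsto_minus[of x 0 sequentially]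
    by (intro inv_equality) (auto simp: c0_def neg)
  show ?thesis
  proof (rule subgroupI)
    show "c00 G \<subseteq> carrier (c0 G)" by (auto simp: c00_def c0_def lim)
    then show "inv\<^bsub>c0 G\<^esub> x \<in> c00 G" if "x \<in> c00 G" for x
      using that inv[of x] by (auto simp: c00_def neg)
    show "c00 G \<noteq> {}" using assms(1) by (auto simp: c00_def intro!: exI[of _ "\<lambda>_. 0"])
    show "x \<otimes>\<^bsub>c0 G\<^esub> y \<in> c00 G" if "x \<in> c00 G" "y \<in> c00 G" for x y
    proof -
      have "{n. x n + y n \<noteq> 0} \<subseteq> {n. x n \<noteq> 0} \<union> {n. y n \<noteq> 0}" by auto
      then show ?thesis
        using that by (auto simp: c00_def c0_def add intro: finite_subset)
    qed
  qed
qed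

lemma Z2_comm_group:
  assumes "group \<Gamma>" "comm_group M"
  shows "comm_group (Z2 \<Gamma> M)"
proof -
  interpret \<Gamma>: group \<Gamma> by fact
  interpret M: comm_group M by fact
  have rearrange: "(w1 \<otimes>\<^bsub>M\<^esub> v1) \<otimes>\<^bsub>M\<^esub> inv\<^bsub>M\<^esub> (w2 \<otimes>\<^bsub>M\<^esub> v2) \<otimes>\<^bsub>M\<^esub> (w3 \<otimes>\<^bsub>M\<^esub> v3) \<otimes>\<^bsub>M\<^esub> inv\<^bsub>M\<^esub> (w4 \<otimes>\<^bsub>M\<^esub> v4)
     = (w1 \<otimes>\<^bsub>M\<^esub> inv\<^bsub>M\<^esub> w2 \<otimes>\<^bsub>M\<^esub> w3 \<otimes>\<^bsub>M\<^esub> inv\<^bsub>M\<^esub> w4) \<otimes>\<^bsub>M\<^esub> (v1 \<otimes>\<^bsub>M\<^esub> inv\<^bsub>M\<^esub> v2 \<otimes>\<^bsub>M\<^esub> v3 \<otimes>\<^bsub>M\<^esub> inv\<^bsub>M\<^esub> v4)"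
    if "w1 \<in> carrier M" "w2 \<in> carrier M" "w3 \<in> carrier M" "w4 \<in> carrier M"
      "v1 \<in> carrier M" "v2 \<in> carrier M" "v3 \<in> carrier M" "v4 \<in> carrier M" for w1 w2 w3 w4 v1 v2 v3 v4
    using that by (simp add: M.inv_mult M.m_ac)
  have inv4: "inv\<^bsub>M\<^esub> w1 \<otimes>\<^bsub>M\<^esub> w2 \<otimes>\<^bsub>M\<^esub> inv\<^bsub>M\<^esub> w3 \<otimes>\<^bsub>M\<^esub> w4
      = inv\<^bsub>M\<^esub> (w1 \<otimes>\<^bsub>M\<^esub> inv\<^bsub>M\<^esub> w2 \<otimes>\<^bsub>M\<^esub> w3 \<otimes>\<^bsub>M\<^esub> inv\<^bsub>M\<^esub> w4)"
    if "w1 \<in> carrier M" "w2 \<in> carrier M" "w3 \<in> carrier M" "w4 \<in> carrier M" for w1 w2 w3 w4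
    using that by (simp add: M.inv_mult M.m_ac)
  show ?thesis
  proof (rule comm_groupI)
    fix x y assume "x \<in> carrier (Z2 \<Gamma> M)" "y \<in> carrier (Z2 \<Gamma> M)"
    moreover from this have "x p \<in> carrier M" "y p \<in> carrier M" if "p \<in> carrier \<Gamma> \<times> carrier \<Gamma>" for p
      using that by (auto simp: Z2_def)
    ultimately show "x \<otimes>\<^bsub>Z2 \<Gamma> M\<^esub> y \<in> carrier (Z2 \<Gamma> M)"
      by (simp add: Z2_def rearrange)
  next
    show "\<one>\<^bsub>Z2 \<Gamma> M\<^esub> \<in> carrier (Z2 \<Gamma> M)" by (simp add: Z2_def)
  next
    fix x assume x: "x \<in> carrier (Z2 \<Gamma> M)"
    then have xc: "x p \<in> carrier M" if "p \<in> carrier \<Gamma> \<times> carrier \<Gamma>" for p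
      using that by (auto simp: Z2_def)
    have "(\<lambda>p\<in>carrier \<Gamma> \<times> carrier \<Gamma>. inv\<^bsub>M\<^esub> x p) \<in> carrier (Z2 \<Gamma> M)"
      using x xc by (simp add: Z2_def inv4)
    moreover have "(\<lambda>p\<in>carrier \<Gamma> \<times> carrier \<Gamma>. inv\<^bsub>M\<^esub> x p) \<otimes>\<^bsub>Z2 \<Gamma> M\<^esub> x = \<one>\<^bsub>Z2 \<Gamma> M\<^esub>"
      using xc by (auto simp: Z2_def restrict_def fun_eq_iff)
    ultimately show "\<exists>y\<in>carrier (Z2 \<Gamma> M). y \<otimes>\<^bsub>Z2 \<Gamma> M\<^esub> x = \<one>\<^bsub>Z2 \<Gamma> M\<^esub>" by blast
    show "\<one>\<^bsub>Z2 \<Gamma> M\<^esub> \<otimes>\<^bsub>Z2 \<Gamma> M\<^esub> x = x"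
      using x xc by (auto simp: Z2_def restrict_def fun_eq_iff PiE_def extensional_def)
  next
    fix x y assume x: "x \<in> carrier (Z2 \<Gamma> M)" and y: "y \<in> carrier (Z2 \<Gamma> M)"
    then have c: "x p \<in> carrier M" "y p \<in> carrier M" if "p \<in> carrier \<Gamma> \<times> carrier \<Gamma>" for p
      using that by (auto simp: Z2_def)
    show "x \<otimes>\<^bsub>Z2 \<Gamma> M\<^esub> y = y \<otimes>\<^bsub>Z2 \<Gamma> M\<^esub> x"
      using c by (auto simp: Z2_def restrict_def fun_eq_iff M.m_comm)
    fix z assume z: "z \<in> carrier (Z2 \<Gamma> M)"
    then have "z p \<in> carrier M" if "p \<in> carrier \<Gamma> \<times> carrier \<Gamma>" for p
      using that by (auto simp: Z2_def)
    with c show "x \<otimes>\<^bsub>Z2 \<Gamma> M\<^esub> y \<otimes>\<^bsub>Z2 \<Gamma> M\<^esub> z = x \<otimes>\<^bsub>Z2 \<Gamma> M\<^esub> (y \<otimes>\<^bsub>Z2 \<Gamma> M\<^esub> z)"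
      by (auto simp: Z2_def restrict_def fun_eq_iff M.m_assoc)
  qed
qed

lemma B2_subset_Z2:
  assumes "group \<Gamma>" "comm_group M"
  shows "B2 \<Gamma> M \<subseteq> carrier (Z2 \<Gamma> M)"
proof
  interpret \<Gamma>: group \<Gamma> by fact
  interpret M: comm_group M by fact
  fix \<omega> assume "\<omega> \<in> B2 \<Gamma> M"
  then obtain \<gamma> where \<gamma>: "\<gamma> \<in> carrier \<Gamma> \<rightarrow> carrier M" and \<omega>: "\<omega> = coboundary \<Gamma> M \<gamma>"
    by (auto simp: B2_def)
  have gc: "\<gamma> a \<in> carrier M" if "a \<in> carrier \<Gamma>" for a using \<gamma> that by auto
  have id: "(b \<otimes>\<^bsub>M\<^esub> inv\<^bsub>M\<^esub> bc \<otimes>\<^bsub>M\<^esub> c) \<otimes>\<^bsub>M\<^esub> inv\<^bsub>M\<^esub> (ab \<otimes>\<^bsub>M\<^esub> inv\<^bsub>M\<^esub> abc \<otimes>\<^bsub>M\<^esub> c)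
       \<otimes>\<^bsub>M\<^esub> (a \<otimes>\<^bsub>M\<^esub> inv\<^bsub>M\<^esub> abc \<otimes>\<^bsub>M\<^esub> bc) \<otimes>\<^bsub>M\<^esub> inv\<^bsub>M\<^esub> (a \<otimes>\<^bsub>M\<^esub> inv\<^bsub>M\<^esub> ab \<otimes>\<^bsub>M\<^esub> b) = \<one>\<^bsub>M\<^esub>"
    if "a \<in> carrier M" "b \<in> carrier M" "c \<in> carrier M" "ab \<in> carrier M" "bc \<in> carrier M" "abc \<in> carrier M"
    for a b c ab bc abc
  proof -
    have "(b \<otimes>\<^bsub>M\<^esub> inv\<^bsub>M\<^esub> bc \<otimes>\<^bsub>M\<^esub> c) \<otimes>\<^bsub>M\<^esub> inv\<^bsub>M\<^esub> (ab \<otimes>\<^bsub>M\<^esub> inv\<^bsub>M\<^esub> abc \<otimes>\<^bsub>M\<^esub> c)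
       \<otimes>\<^bsub>M\<^esub> (a \<otimes>\<^bsub>M\<^esub> inv\<^bsub>M\<^esub> abc \<otimes>\<^bsub>M\<^esub> bc) \<otimes>\<^bsub>M\<^esub> inv\<^bsub>M\<^esub> (a \<otimes>\<^bsub>M\<^esub> inv\<^bsub>M\<^esub> ab \<otimes>\<^bsub>M\<^esub> b)
      = (a \<otimes>\<^bsub>M\<^esub> inv\<^bsub>M\<^esub> a) \<otimes>\<^bsub>M\<^esub> ((b \<otimes>\<^bsub>M\<^esub> inv\<^bsub>M\<^esub> b) \<otimes>\<^bsub>M\<^esub> ((c \<otimes>\<^bsub>M\<^esub> inv\<^bsub>M\<^esub> c) \<otimes>\<^bsub>M\<^esub>
        ((ab \<otimes>\<^bsub>M\<^esub> inv\<^bsub>M\<^esub> ab) \<otimes>\<^bsub>M\<^esub> ((bc \<otimes>\<^bsub>M\<^esub> inv\<^bsub>M\<^esub> bc) \<otimes>\<^bsub>M\<^esub> (abc \<otimes>\<^bsub>M\<^esub> inv\<^bsub>M\<^esub> abc)))))"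
      using that by (simp add: M.inv_mult M.m_ac del: M.r_inv M.l_inv M.Units_r_inv M.Units_l_inv)
    then show ?thesis using that by simp
  qed
  show "\<omega> \<in> carrier (Z2 \<Gamma> M)"
    unfolding \<omega> by (auto simp: Z2_def coboundary_def gc id \<Gamma>.m_assoc)
qed

lemma B2_subgroup:
  assumes "group \<Gamma>" "comm_group M"
  shows "subgroup (B2 \<Gamma> M) (Z2 \<Gamma> M)"
proof -
  interpret \<Gamma>: group \<Gamma> by fact
  interpret M: comm_group M by fact
  interpret Z: comm_group "Z2 \<Gamma> M" by (rule Z2_comm_group[OF assms])
  note sub = B2_subset_Z2[OF assms]
  have mult: "coboundary \<Gamma> M \<gamma> \<otimes>\<^bsub>Z2 \<Gamma> M\<^esub> coboundary \<Gamma> M \<gamma>'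
      = coboundary \<Gamma> M (\<lambda>a. \<gamma> a \<otimes>\<^bsub>M\<^esub> \<gamma>' a)"
    if "\<gamma> \<in> carrier \<Gamma> \<rightarrow> carrier M" "\<gamma>' \<in> carrier \<Gamma> \<rightarrow> carrier M" for \<gamma> \<gamma>'
  proof -
    have "\<gamma> a \<in> carrier M" "\<gamma>' a \<in> carrier M" if "a \<in> carrier \<Gamma>" for a
      using that \<open>\<gamma> \<in> _\<close> \<open>\<gamma>' \<in> _\<close> by auto
    then show ?thesis
      by (auto simp: Z2_def coboundary_def restrict_def fun_eq_iff M.inv_mult M.m_ac)
  qed
  have one: "coboundary \<Gamma> M (\<lambda>_. \<one>\<^bsub>M\<^esub>) = \<one>\<^bsub>Z2 \<Gamma> M\<^esub>"
    by (auto simp: Z2_def coboundary_def restrict_def fun_eq_iff)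
  show ?thesis
  proof (rule Z.subgroupI)
    show "B2 \<Gamma> M \<subseteq> carrier (Z2 \<Gamma> M)" by (rule sub)
    show "B2 \<Gamma> M \<noteq> {}" by (auto simp: B2_def)
    fix x assume "x \<in> B2 \<Gamma> M"
    then obtain \<gamma> where \<gamma>: "\<gamma> \<in> carrier \<Gamma> \<rightarrow> carrier M" and x: "x = coboundary \<Gamma> M \<gamma>"
      by (auto simp: B2_def)
    let ?\<gamma>' = "\<lambda>a. inv\<^bsub>M\<^esub> \<gamma> a"
    have \<gamma>': "?\<gamma>' \<in> carrier \<Gamma> \<rightarrow> carrier M" using \<gamma> by auto
    have "coboundary \<Gamma> M (\<lambda>a. ?\<gamma>' a \<otimes>\<^bsub>M\<^esub> \<gamma> a) = coboundary \<Gamma> M (\<lambda>_. \<one>\<^bsub>M\<^esub>)"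
    proof -
      have "\<gamma> a \<in> carrier M" if "a \<in> carrier \<Gamma>" for a using that \<gamma> by auto
      then show ?thesis by (auto simp: coboundary_def restrict_def fun_eq_iff)
    qed
    then have "coboundary \<Gamma> M ?\<gamma>' \<otimes>\<^bsub>Z2 \<Gamma> M\<^esub> x = \<one>\<^bsub>Z2 \<Gamma> M\<^esub>"
      unfolding x mult[OF \<gamma>' \<gamma>] one .
    moreover have "coboundary \<Gamma> M ?\<gamma>' \<in> B2 \<Gamma> M" using \<gamma>' unfolding B2_def by blast
    moreover from this have "inv\<^bsub>Z2 \<Gamma> M\<^esub> x = coboundary \<Gamma> M ?\<gamma>'"
      using Z.inv_equality[of "coboundary \<Gamma> M ?\<gamma>'" x] sub \<open>x \<in> B2 \<Gamma> M\<close> calculation(1) by blast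
    ultimately show "inv\<^bsub>Z2 \<Gamma> M\<^esub> x \<in> B2 \<Gamma> M"
      by simp
    fix y assume "y \<in> B2 \<Gamma> M"
    then obtain \<gamma>2 where \<gamma>2: "\<gamma>2 \<in> carrier \<Gamma> \<rightarrow> carrier M" and y: "y = coboundary \<Gamma> M \<gamma>2"
      by (auto simp: B2_def)
    have "(\<lambda>a. \<gamma> a \<otimes>\<^bsub>M\<^esub> \<gamma>2 a) \<in> carrier \<Gamma> \<rightarrow> carrier M" using \<gamma> \<gamma>2 by auto
    then show "x \<otimes>\<^bsub>Z2 \<Gamma> M\<^esub> y \<in> B2 \<Gamma> M"
      unfolding x y mult[OF \<gamma> \<gamma>2] B2_def by blast
  qed
qed

end

theory Submission
  imports Defs "HOL-Algebra.Generated_Groups"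
begin

text \<open>
  Let \<open>E\<close> be the group of all sequences of unitaries, \<open>N\<close> the normal subgroup of the sequences that
  tend to \<open>1\<close>, and \<open>M\<close> the null sequences modulo those with eventually \<open>x\<^sub>n \<in> \<tau>\<^sub>n\<^sub>*(K\<^sub>0(A\<^sub>n))\<close>. The map
  \<open>u \<mapsto> \<tau>(log u) / 2\<pi>i\<close> is a homomorphism \<open>N \<rightarrow> M\<close>. It vanishes on \<open>N \<inter> [E, E]\<close>, so, \<open>M\<close> being
  divisible, it extends to a homomorphism \<open>\<Phi> : E \<rightarrow> M\<close>, and subtracting from the cocycle the coboundary
  of a lift of \<open>\<Phi>((\<rho>\<^sub>n a)\<^sub>n)\<close> leaves a cocycle with values in \<open>H\<close>.

  The vanishing on commutators is the analytic core: if a product \<open>u\<close> of \<open>L\<close> commutators of unitaries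
  of \<open>A\<close> is close to \<open>1\<close>, how close depending on \<open>L\<close> only, then \<open>\<tau>(log u) / 2\<pi>i \<in> \<tau>\<^sub>*(K\<^sub>0(A))\<close>. In
  \<open>M\<^sub>2(A)\<close> a rotation joins \<open>1\<close> to \<open>diag(u, 1)\<close> by a path \<open>W\<close> of unitaries that is a trigonometric
  polynomial, of degree and size bounded in terms of \<open>L\<close>, with \<open>\<tau>(W\<^sup>* W') = 0\<close>. Correcting its end by
  the small element \<open>diag(u, 1) - 1\<close> closes it up to an almost unitary loop \<open>P\<close>, whose winding number
  \<open>\<tau>(P\<^sup>-\<^sup>1 P')\<close>, integrated, is \<open>- \<tau>(log u)\<close>. The loop is taken to be a trigonometric polynomial of a
  degree that does not depend on the algebra; a finite Toeplitz-type matrix built from the coefficients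
  of \<open>P\<close> and of \<open>P\<^sup>-\<^sup>1\<close> is an idempotent with that winding number, up to a multiple of \<open>\<tau>(1)\<close>, as its
  trace, and it is close to being self-adjoint, hence similar to a projection.
\<close>

text \<open>What shapes the proof is uniformity. The algebras of the sequence are unrelated, while
  the conclusion concerns almost all n at once, so nothing in the analytic core may be chosen after
  the algebra. The path \<open>W\<close> enters only through finitely many coefficients; closing it
  up is thus a matter of finitely many scalar functions, which are approximated once for each
  \<open>L\<close>. The size of the final matrix grows with the quality of this approximation, so
  the estimates must not see the size: they are made in the Wiener norm, the sum of the norms of the
  Fourier coefficients, which bounds row and column sums of Toeplitz matrices of every size. How
  close \<open>u\<close> has to be to 1 is fixed last and may depend on the degree. Only the initial
  data are C*-algebraic: matrices get a row-sum norm, which requires no representation of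
  \<open>A\<close>, and a projection is recovered at the end from an almost self-adjoint
  idempotent.\<close>

section \<open>Banach algebras with involution, limits and the Neumann series\<close>

locale involutive_banach_algebra = ring A for A :: "('a, 'm) cstar_scheme" (structure) +
  assumes scale_closed [simp, intro]: "x \<in> carrier A \<Longrightarrow> scale A c x \<in> carrier A"
    and scale_one: "x \<in> carrier A \<Longrightarrow> scale A 1 x = x"
    and scale_scale: "x \<in> carrier A \<Longrightarrow> scale A c (scale A d x) = scale A (c * d) x"
    and scale_add_left: "x \<in> carrier A \<Longrightarrow> scale A (c + d) x = scale A c x \<oplus> scale A d x"
    and scale_add_right:
      "\<lbrakk>x \<in> carrier A; y \<in> carrier A\<rbrakk> \<Longrightarrow> scale A c (x \<oplus> y) = scale A c x \<oplus> scale A c y"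
    and scale_mult_left:
      "\<lbrakk>x \<in> carrier A; y \<in> carrier A\<rbrakk> \<Longrightarrow> scale A c x \<otimes> y = scale A c (x \<otimes> y)"
    and scale_mult_right:
      "\<lbrakk>x \<in> carrier A; y \<in> carrier A\<rbrakk> \<Longrightarrow> x \<otimes> scale A c y = scale A c (x \<otimes> y)"
    and star_closed [simp, intro]: "x \<in> carrier A \<Longrightarrow> star A x \<in> carrier A"
    and star_star: "x \<in> carrier A \<Longrightarrow> star A (star A x) = x"
    and star_add: "\<lbrakk>x \<in> carrier A; y \<in> carrier A\<rbrakk> \<Longrightarrow> star A (x \<oplus> y) = star A x \<oplus> star A y"
    and star_scale: "x \<in> carrier A \<Longrightarrow> star A (scale A c x) = scale A (cnj c) (star A x)"
    and star_mult: "\<lbrakk>x \<in> carrier A; y \<in> carrier A\<rbrakk> \<Longrightarrow> star A (x \<otimes> y) = star A y \<otimes> star A x"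
    and cnorm_nonneg: "x \<in> carrier A \<Longrightarrow> 0 \<le> cnorm A x"
    and cnorm_eq_0: "x \<in> carrier A \<Longrightarrow> cnorm A x = 0 \<longleftrightarrow> x = \<zero>"
    and cnorm_triangle:
      "\<lbrakk>x \<in> carrier A; y \<in> carrier A\<rbrakk> \<Longrightarrow> cnorm A (x \<oplus> y) \<le> cnorm A x + cnorm A y"
    and cnorm_scale: "x \<in> carrier A \<Longrightarrow> cnorm A (scale A c x) = cmod c * cnorm A x"
    and cnorm_mult:
      "\<lbrakk>x \<in> carrier A; y \<in> carrier A\<rbrakk> \<Longrightarrow> cnorm A (x \<otimes> y) \<le> cnorm A x * cnorm A y"
    and cnorm_one: "cnorm A \<one> \<le> 1"
    and Cauchy_limit:
      "\<lbrakk>\<And>n. f n \<in> carrier A; \<And>e. 0 < e \<Longrightarrow> \<exists>M. \<forall>m\<ge>M. \<forall>n\<ge>M. cnorm A (f m \<ominus> f n) < e\<rbrakk>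
        \<Longrightarrow> \<exists>l\<in>carrier A. (\<lambda>n. cnorm A (f n \<ominus> l)) \<longlonglongrightarrow> 0"
begin

lemma minus_mult:
  assumes "x \<in> carrier A" "y \<in> carrier A" "z \<in> carrier A"
  shows "x \<otimes> (y \<ominus> z) = x \<otimes> y \<ominus> x \<otimes> z" "(y \<ominus> z) \<otimes> x = y \<otimes> x \<ominus> z \<otimes> x"
  using assms by (simp_all add: a_minus_def l_distr r_distr l_minus r_minus)

lemma minus_trans:
  assumes "x \<in> carrier A" "y \<in> carrier A" "z \<in> carrier A"
  shows "(x \<ominus> y) \<oplus> (y \<ominus> z) = x \<ominus> z"
  using assms by (simp add: a_minus_def a_assoc r_neg1)

lemma minus_self [simp]: "x \<in> carrier A \<Longrightarrow> x \<ominus> x = \<zero>"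
  by (simp add: a_minus_def r_neg)

lemma minus_eq_zero_iff:
  assumes "x \<in> carrier A" "y \<in> carrier A" shows "x \<ominus> y = \<zero> \<longleftrightarrow> x = y"
  using assms by (metis minus_self a_minus_def a_inv_closed minus_equality minus_minus)

lemma minus_add_cancel:
  assumes "x \<in> carrier A" "y \<in> carrier A"
  shows "(x \<ominus> y) \<oplus> y = x" "x \<oplus> (y \<ominus> x) = y" "(x \<oplus> y) \<ominus> y = x" "(x \<oplus> y) \<ominus> x = y"
    "x \<ominus> (x \<ominus> y) = y"
proof -
  show "(x \<ominus> y) \<oplus> y = x" "(x \<oplus> y) \<ominus> y = x"
    using assms by (simp_all add: a_minus_def a_assoc l_neg r_neg)
  have yx: "y \<oplus> \<ominus> x \<oplus> x = y" using assms by (simp add: a_assoc l_neg)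
  then show "x \<oplus> (y \<ominus> x) = y" using assms a_comm[of x "y \<oplus> \<ominus> x"] by (simp add: a_minus_def)
  then show "(x \<oplus> y) \<ominus> x = y" using assms by (simp add: a_minus_def a_assoc)
  show "x \<ominus> (x \<ominus> y) = y" using assms by (simp add: a_minus_def minus_add r_neg2)
qed

lemma minus_add_distrib:
  assumes "x \<in> carrier A" "y \<in> carrier A" "x' \<in> carrier A" "y' \<in> carrier A"
  shows "(x \<oplus> y) \<ominus> (x' \<oplus> y') = (x \<ominus> x') \<oplus> (y \<ominus> y')"
  using assms by (simp add: a_minus_def minus_add a_ac)

lemma scale_zero_left [simp]: "x \<in> carrier A \<Longrightarrow> scale A 0 x = \<zero>"
  using scale_add_left[of x 0 0] add.r_cancel_one'[of "scale A 0 x" "scale A 0 x"] by simp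

lemma scale_zero_right [simp]: "scale A c \<zero> = \<zero>"
  using scale_add_right[of \<zero> \<zero> c] add.r_cancel_one'[of "scale A c \<zero>" "scale A c \<zero>"] by simp

lemma minus_eq_scale: "x \<in> carrier A \<Longrightarrow> \<ominus> x = scale A (- 1) x"
  using minus_equality[of "scale A (- 1) x" x] scale_add_left[of x "- 1" 1] by (simp add: scale_one)

lemma scale_minus_left: "x \<in> carrier A \<Longrightarrow> scale A (- c) x = \<ominus> scale A c x"
  by (simp add: minus_eq_scale scale_scale)

lemma scale_diff_left: "x \<in> carrier A \<Longrightarrow> scale A (c - d) x = scale A c x \<ominus> scale A d x"
  using scale_add_left[of x c "- d"] by (simp add: scale_minus_left a_minus_def)

lemma scale_minus_right: "x \<in> carrier A \<Longrightarrow> scale A c (\<ominus> x) = \<ominus> scale A c x"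
  by (simp add: minus_eq_scale scale_scale)

lemma scale_mult_scale:
  "\<lbrakk>x \<in> carrier A; y \<in> carrier A\<rbrakk> \<Longrightarrow> scale A c x \<otimes> scale A d y = scale A (c * d) (x \<otimes> y)"
  by (simp add: scale_mult_left[of x "scale A d y"] scale_mult_right[of x y] scale_scale)

lemma scale_finsum:
  assumes "finite S" "f \<in> S \<rightarrow> carrier A"
  shows "scale A c (finsum A f S) = (\<Oplus>s\<in>S. scale A c (f s))"
  using assms
proof (induction S)
  case (insert s S)
  then have "f \<in> S \<rightarrow> carrier A" "f s \<in> carrier A" by auto
  with insert show ?case by (simp add: scale_add_right Pi_iff)
qed simp

lemma finsum_scale:
  assumes "finite S" "x \<in> carrier A"
  shows "(\<Oplus>s\<in>S. scale A (g s) x) = scale A (sum g S) x"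
  using assms by (induction S) (simp_all add: scale_add_left)

lemma star_zero [simp]: "star A \<zero> = \<zero>"
  by (metis add.r_cancel_one' r_zero star_add star_closed zero_closed)

lemma star_one [simp]: "star A \<one> = \<one>"
  by (metis l_one one_closed r_one star_closed star_mult star_star)

lemma star_minus: "x \<in> carrier A \<Longrightarrow> star A (\<ominus> x) = \<ominus> star A x"
  by (simp add: minus_eq_scale star_scale)

lemma star_diff:
  "\<lbrakk>x \<in> carrier A; y \<in> carrier A\<rbrakk> \<Longrightarrow> star A (x \<ominus> y) = star A x \<ominus> star A y"
  by (simp add: a_minus_def star_add star_minus)

lemma star_finsum:
  assumes "finite S" "f \<in> S \<rightarrow> carrier A"
  shows "star A (finsum A f S) = (\<Oplus>s\<in>S. star A (f s))"
  using assms
proof (induction S)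
  case (insert s S)
  then have "f \<in> S \<rightarrow> carrier A" "f s \<in> carrier A" by auto
  with insert show ?case by (simp add: star_add Pi_iff)
qed simp

lemma finsum_diff:
  assumes "finite S" "f \<in> S \<rightarrow> carrier A" "g \<in> S \<rightarrow> carrier A"
  shows "(\<Oplus>s\<in>S. f s \<ominus> g s) = finsum A f S \<ominus> finsum A g S"
proof -
  have F: "finsum A f S \<in> carrier A" "finsum A g S \<in> carrier A" using assms(2,3) by (rule_tac [!] finsum_closed)
  have "(\<Oplus>s\<in>S. f s \<ominus> g s) = (\<Oplus>s\<in>S. f s \<oplus> scale A (-1) (g s))"
    apply (rule finsum_cong') apply (rule refl)
    subgoal using assms by (simp add: Pi_iff)
    subgoal for i using assms minus_eq_scale[of "g i"] by (simp add: a_minus_def Pi_iff)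
    done
  also have "\<dots> = finsum A f S \<oplus> (\<Oplus>s\<in>S. scale A (-1) (g s))"
    apply (rule finsum_addf) using assms by (simp_all add: Pi_iff)
  also have "(\<Oplus>s\<in>S. scale A (-1) (g s)) = scale A (-1) (finsum A g S)"
    using assms(1,3) by (rule scale_finsum[symmetric])
  also have "\<dots> = \<ominus> finsum A g S" using F minus_eq_scale by metis
  finally show ?thesis unfolding a_minus_def .
qed

lemma cnorm_zero [simp]: "cnorm A \<zero> = 0"
  by (simp add: cnorm_eq_0)

lemma cnorm_minus [simp]: "x \<in> carrier A \<Longrightarrow> cnorm A (\<ominus> x) = cnorm A x"
  by (simp add: minus_eq_scale cnorm_scale)

lemma cnorm_minus_commute:
  assumes "x \<in> carrier A" "y \<in> carrier A" shows "cnorm A (x \<ominus> y) = cnorm A (y \<ominus> x)"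
  using cnorm_minus[of "x \<ominus> y"] assms by (simp add: a_minus_def minus_add a_comm)

lemma cnorm_diff_triangle:
  assumes "x \<in> carrier A" "y \<in> carrier A" shows "cnorm A (x \<ominus> y) \<le> cnorm A x + cnorm A y"
  using cnorm_triangle[of x "\<ominus> y"] assms by (simp add: a_minus_def)

lemma cnorm_le_add_diff:
  assumes "x \<in> carrier A" "y \<in> carrier A" shows "cnorm A x \<le> cnorm A y + cnorm A (x \<ominus> y)"
  using cnorm_triangle[of y "x \<ominus> y"] assms by (simp add: minus_add_cancel)

lemma cnorm_trans:
  assumes "x \<in> carrier A" "y \<in> carrier A" "z \<in> carrier A"
  shows "cnorm A (x \<ominus> z) \<le> cnorm A (x \<ominus> y) + cnorm A (y \<ominus> z)"
  using cnorm_triangle[of "x \<ominus> y" "y \<ominus> z"] assms by (simp add: minus_trans)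

lemma cnorm_mult_le:
  assumes "x \<in> carrier A" "y \<in> carrier A" "cnorm A x \<le> r" "cnorm A y \<le> s"
  shows "cnorm A (x \<otimes> y) \<le> r * s"
proof -
  have "0 \<le> r" using assms cnorm_nonneg order_trans by blast
  then show ?thesis
    using cnorm_mult[OF assms(1,2)] mult_mono[OF assms(3,4)] cnorm_nonneg[OF assms(2)] by linarith
qed

lemma cnorm_finsum:
  assumes "finite S" "f \<in> S \<rightarrow> carrier A"
  shows "cnorm A (finsum A f S) \<le> (\<Sum>s\<in>S. cnorm A (f s))"
  using assms
proof (induction S)
  case (insert s S)
  then have "f \<in> S \<rightarrow> carrier A" "f s \<in> carrier A" by auto
  with insert show ?case
    using cnorm_triangle[of "f s" "finsum A f S"] by (simp add: Pi_iff)
qed simp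

lemma cnorm_pow:
  assumes "x \<in> carrier A" shows "cnorm A (x [^] (n::nat)) \<le> cnorm A x ^ n"
proof (induction n)
  case 0
  then show ?case by (simp add: cnorm_one)
next
  case (Suc n)
  have "cnorm A (x [^] n \<otimes> x) \<le> cnorm A (x [^] n) * cnorm A x"
    using assms by (intro cnorm_mult) auto
  also have "\<dots> \<le> cnorm A x ^ n * cnorm A x"
    using Suc cnorm_nonneg[OF assms] by (rule mult_right_mono)
  finally show ?case by (simp add: mult.commute)
qed

lemma cnorm_pow_le:
  assumes "x \<in> carrier A" "cnorm A x \<le> r" shows "cnorm A (x [^] (n::nat)) \<le> r ^ n"
  using cnorm_pow[OF assms(1), of n] power_mono[OF assms(2) cnorm_nonneg[OF assms(1)], of n] by linarith

text \<open>The carrier conditions are built in, so that limit laws can be chained without side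
  conditions.\<close>

definition tends :: "(nat \<Rightarrow> 'a) \<Rightarrow> 'a \<Rightarrow> bool" where
  "tends x l \<longleftrightarrow> (\<forall>n. x n \<in> carrier A) \<and> l \<in> carrier A \<and> (\<lambda>n. cnorm A (x n \<ominus> l)) \<longlonglongrightarrow> 0"

lemma tendsI_bound:
  assumes "\<And>n. x n \<in> carrier A" "l \<in> carrier A" "\<And>n. cnorm A (x n \<ominus> l) \<le> g n" "g \<longlonglongrightarrow> 0"
  shows "tends x l"
  unfolding tends_def
  using assms by (auto intro!: tendsto_sandwich[OF _ _ tendsto_const assms(4)] simp: cnorm_nonneg)

lemma tends_unique:
  assumes "tends x l" "tends x l'" shows "l = l'"
proof -
  have c: "\<And>n. x n \<in> carrier A" "l \<in> carrier A" "l' \<in> carrier A"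
    using assms by (auto simp: tends_def)
  have "(\<lambda>n. cnorm A (x n \<ominus> l) + cnorm A (x n \<ominus> l')) \<longlonglongrightarrow> 0 + 0"
    using assms by (intro tendsto_add) (auto simp: tends_def)
  moreover have "cnorm A (l \<ominus> l') \<le> cnorm A (x n \<ominus> l) + cnorm A (x n \<ominus> l')" for n
    using cnorm_trans[of l "x n" l'] cnorm_minus_commute[of l "x n"] c by simp
  ultimately have "cnorm A (l \<ominus> l') \<le> 0"
    using LIMSEQ_le_const[of _ 0 "cnorm A (l \<ominus> l')"] by auto
  then have "l \<ominus> l' = \<zero>"
    using cnorm_nonneg[of "l \<ominus> l'"] cnorm_eq_0[of "l \<ominus> l'"] c by simp
  then show ?thesis using c minus_eq_zero_iff by blast
qed

lemma tends_const: "l \<in> carrier A \<Longrightarrow> tends (\<lambda>_. l) l"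
  by (simp add: tends_def)

lemma tends_add:
  assumes "tends x l" "tends y m" shows "tends (\<lambda>n. x n \<oplus> y n) (l \<oplus> m)"
proof (rule tendsI_bound)
  have c: "\<And>n. x n \<in> carrier A" "\<And>n. y n \<in> carrier A" "l \<in> carrier A" "m \<in> carrier A"
    using assms by (auto simp: tends_def)
  then show "\<And>n. x n \<oplus> y n \<in> carrier A" "l \<oplus> m \<in> carrier A" by auto
  show "cnorm A (x n \<oplus> y n \<ominus> (l \<oplus> m)) \<le> cnorm A (x n \<ominus> l) + cnorm A (y n \<ominus> m)" for n
    using c cnorm_triangle by (simp add: minus_add_distrib)
  show "(\<lambda>n. cnorm A (x n \<ominus> l) + cnorm A (y n \<ominus> m)) \<longlonglongrightarrow> 0"
    using assms tendsto_add_zero by (auto simp: tends_def)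
qed

lemma tends_mult_left:
  assumes "tends x l" "a \<in> carrier A" shows "tends (\<lambda>n. a \<otimes> x n) (a \<otimes> l)"
proof (rule tendsI_bound)
  have c: "\<And>n. x n \<in> carrier A" "l \<in> carrier A" using assms by (auto simp: tends_def)
  then show "\<And>n. a \<otimes> x n \<in> carrier A" "a \<otimes> l \<in> carrier A" using assms by auto
  show "cnorm A (a \<otimes> x n \<ominus> a \<otimes> l) \<le> cnorm A a * cnorm A (x n \<ominus> l)" for n
    using c cnorm_mult[of a "x n \<ominus> l"] assms by (simp add: minus_mult)
  show "(\<lambda>n. cnorm A a * cnorm A (x n \<ominus> l)) \<longlonglongrightarrow> 0"
    using assms tendsto_mult_right_zero by (auto simp: tends_def)
qed

lemma tends_mult_right:
  assumes "tends x l" "a \<in> carrier A" shows "tends (\<lambda>n. x n \<otimes> a) (l \<otimes> a)"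
proof (rule tendsI_bound)
  have c: "\<And>n. x n \<in> carrier A" "l \<in> carrier A" using assms by (auto simp: tends_def)
  then show "\<And>n. x n \<otimes> a \<in> carrier A" "l \<otimes> a \<in> carrier A" using assms by auto
  show "cnorm A (x n \<otimes> a \<ominus> l \<otimes> a) \<le> cnorm A (x n \<ominus> l) * cnorm A a" for n
    using c cnorm_mult[of "x n \<ominus> l" a] assms by (simp add: minus_mult)
  show "(\<lambda>n. cnorm A (x n \<ominus> l) * cnorm A a) \<longlonglongrightarrow> 0"
    using assms tendsto_mult_left_zero by (auto simp: tends_def)
qed

lemma tends_finsum:
  assumes "finite S" "\<And>s. s \<in> S \<Longrightarrow> tends (x s) (l s)"
  shows "tends (\<lambda>n. \<Oplus>s\<in>S. x s n) (finsum A l S)"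
  using assms
proof (induction S)
  case empty
  then show ?case by (simp add: tends_const)
next
  case (insert s S)
  then have "tends (\<lambda>n. x s n \<oplus> (\<Oplus>s\<in>S. x s n)) (l s \<oplus> finsum A l S)"
    by (intro tends_add) auto
  moreover have "(\<lambda>n. x s n) \<in> UNIV \<rightarrow> carrier A" "l s \<in> carrier A" "l \<in> S \<rightarrow> carrier A"
    "\<And>n. (\<lambda>s. x s n) \<in> S \<rightarrow> carrier A" "\<And>n. x s n \<in> carrier A"
    using insert by (auto simp: tends_def)
  ultimately show ?case using insert by simp
qed

lemma tends_cnorm_le:
  assumes "tends x l" "\<And>n. cnorm A (x n) \<le> r" shows "cnorm A l \<le> r"
proof -
  have c: "\<And>n. x n \<in> carrier A" "l \<in> carrier A" using assms by (auto simp: tends_def)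
  have "cnorm A l \<le> r + cnorm A (x n \<ominus> l)" for n
    using cnorm_le_add_diff[of l "x n"] cnorm_minus_commute[of l "x n"] assms(2)[of n] c by simp
  moreover have "(\<lambda>n. r + cnorm A (x n \<ominus> l)) \<longlonglongrightarrow> r + 0"
    using assms by (intro tendsto_add tendsto_const) (auto simp: tends_def)
  ultimately show ?thesis
    using LIMSEQ_le_const[of "\<lambda>n. r + cnorm A (x n \<ominus> l)" "r + 0" "cnorm A l"] by simp
qed

text \<open>Comparison with a real series, by completeness. The bound on the sum is part of the
  conclusion because the limit is available only under the quantifier.\<close>

lemma series_converges:
  assumes f: "\<And>k. f k \<in> carrier A" and le: "\<And>k. cnorm A (f k) \<le> g k" and g: "summable g"
  shows "\<exists>l. tends (\<lambda>n. \<Oplus>k\<in>{..<n}. f k) l \<and> cnorm A l \<le> suminf g"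
proof -
  let ?s = "\<lambda>n. \<Oplus>k\<in>{..<n}. f k"
  have g0: "0 \<le> g k" for k using le[of k] cnorm_nonneg[OF f, of k] by linarith
  have s: "?s n \<in> carrier A" for n using f by auto
  have diff: "cnorm A (?s m \<ominus> ?s n) \<le> (\<Sum>k\<in>{n..<m}. g k)" if "n \<le> m" for m n
  proof -
    have "{..<m} = {..<n} \<union> {n..<m}" using that by auto
    then have "?s m = ?s n \<oplus> (\<Oplus>k\<in>{n..<m}. f k)"
      using f by (simp add: add.finprod_Un_disjoint ivl_disj_int)
    then have "?s m \<ominus> ?s n = (\<Oplus>k\<in>{n..<m}. f k)"
      using f by (simp add: minus_add_cancel)
    then show ?thesis
      using cnorm_finsum[of "{n..<m}" f] f sum_mono[of "{n..<m}" "\<lambda>k. cnorm A (f k)" g] le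
      by (simp add: Pi_iff)
  qed
  have "\<exists>l\<in>carrier A. (\<lambda>n. cnorm A (?s n \<ominus> l)) \<longlonglongrightarrow> 0"
  proof (rule Cauchy_limit[OF s])
    fix e :: real assume "0 < e"
    then obtain M where M: "\<And>m n. m \<ge> M \<Longrightarrow> norm (sum g {m..<n}) < e"
      using g unfolding summable_Cauchy by blast
    have "cnorm A (?s m \<ominus> ?s n) < e" if "m \<ge> M" "n \<ge> M" for m n
    proof (cases "n \<le> m")
      case True
      then show ?thesis using diff[of n m] M[OF \<open>n \<ge> M\<close>, of m] by simp
    next
      case False
      then show ?thesis
        using diff[of m n] M[OF \<open>m \<ge> M\<close>, of n] cnorm_minus_commute[OF s s] by simp
    qed
    then show "\<exists>M. \<forall>m\<ge>M. \<forall>n\<ge>M. cnorm A (?s m \<ominus> ?s n) < e" by blast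
  qed
  then obtain l where l: "tends ?s l" using s by (auto simp: tends_def)
  moreover have "cnorm A (?s n) \<le> suminf g" for n
  proof -
    have "cnorm A (?s n) \<le> (\<Sum>k<n. cnorm A (f k))"
      using f by (intro cnorm_finsum) auto
    also have "\<dots> \<le> (\<Sum>k<n. g k)" by (intro sum_mono le)
    also have "\<dots> \<le> suminf g" using g g0 by (intro sum_le_suminf) auto
    finally show ?thesis .
  qed
  ultimately show ?thesis using tends_cnorm_le by blast
qed

lemma pow_Suc_left: "x \<in> carrier A \<Longrightarrow> x [^] Suc n = x \<otimes> x [^] (n::nat)"
  using nat_pow_Suc2 by blast

lemma geometric_partial_sum:
  assumes "y \<in> carrier A"
  shows "(\<Oplus>k\<in>{..<n}. y [^] k) \<otimes> (\<one> \<ominus> y) = \<one> \<ominus> y [^] (n::nat)"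
    "(\<one> \<ominus> y) \<otimes> (\<Oplus>k\<in>{..<n}. y [^] k) = \<one> \<ominus> y [^] (n::nat)"
proof (induction n)
  case 0
  show "(\<Oplus>k\<in>{..<0::nat}. y [^] k) \<otimes> (\<one> \<ominus> y) = \<one> \<ominus> y [^] (0::nat)"
    "(\<one> \<ominus> y) \<otimes> (\<Oplus>k\<in>{..<0::nat}. y [^] k) = \<one> \<ominus> y [^] (0::nat)"
    using assms by auto
next
  case (Suc n)
  have c: "y [^] n \<in> carrier A" "(\<Oplus>k\<in>{..<n}. y [^] k) \<in> carrier A" using assms by auto
  have *: "y [^] n \<otimes> (\<one> \<ominus> y) = y [^] n \<ominus> y [^] Suc n" "(\<one> \<ominus> y) \<otimes> y [^] n = y [^] n \<ominus> y [^] Suc n"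
    using assms pow_Suc_left[OF assms, of n] by (simp_all add: minus_mult)
  have s: "(\<Oplus>k\<in>{..<Suc n}. y [^] k) = y [^] n \<oplus> (\<Oplus>k\<in>{..<n}. y [^] k)"
    using assms by (simp add: lessThan_Suc Pi_iff)
  show "(\<Oplus>k\<in>{..<Suc n}. y [^] k) \<otimes> (\<one> \<ominus> y) = \<one> \<ominus> y [^] Suc n"
    "(\<one> \<ominus> y) \<otimes> (\<Oplus>k\<in>{..<Suc n}. y [^] k) = \<one> \<ominus> y [^] Suc n"
    unfolding s using Suc c assms * minus_trans[of \<one> "y [^] n" "y [^] Suc n"]
    by (simp_all add: l_distr r_distr a_comm)
qed

text \<open>Convergence of the partial sums is recorded along with the inverse:
  \<open>tlog_has_integral\<close> reads off from it the series of the derivative of the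
  logarithm.\<close>

lemma neumann:
  assumes y: "y \<in> carrier A" "cnorm A y \<le> r" "r < 1"
  shows "\<exists>z\<in>carrier A. z \<otimes> (\<one> \<ominus> y) = \<one> \<and> (\<one> \<ominus> y) \<otimes> z = \<one> \<and>
    tends (\<lambda>n. \<Oplus>k\<in>{..<n}. y [^] k) z \<and> cnorm A z \<le> 1 / (1 - r)"
proof -
  have r0: "0 \<le> r" using y cnorm_nonneg[of y] by linarith
  have "\<exists>z. tends (\<lambda>n. \<Oplus>k\<in>{..<n}. y [^] k) z \<and> cnorm A z \<le> (\<Sum>n. r ^ n)"
    using y r0 by (intro series_converges cnorm_pow_le summable_geometric) auto
  then obtain z where z: "tends (\<lambda>n. \<Oplus>k\<in>{..<n}. y [^] k) z" "cnorm A z \<le> 1 / (1 - r)"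
    using r0 y suminf_geometric[of r] by auto
  have c: "z \<in> carrier A" "\<one> \<ominus> y \<in> carrier A" using z y by (auto simp: tends_def)
  have lim: "tends (\<lambda>n. \<one> \<ominus> y [^] n) \<one>"
  proof (rule tendsI_bound)
    show "cnorm A (\<one> \<ominus> y [^] n \<ominus> \<one>) \<le> r ^ n" for n
    proof -
      have "\<one> \<ominus> y [^] n \<ominus> \<one> = \<ominus> (y [^] n)"
        using y by (simp add: a_minus_def minus_add a_comm[of _ "\<ominus> \<one>"] r_neg1)
      then show ?thesis using cnorm_pow_le[OF y(1,2), of n] y by simp
    qed
    show "(\<lambda>n. r ^ n) \<longlonglongrightarrow> 0" using r0 y by (simp add: LIMSEQ_realpow_zero)
  qed (use y in auto)
  have "tends (\<lambda>n. \<one> \<ominus> y [^] n) (z \<otimes> (\<one> \<ominus> y))"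
    using tends_mult_right[OF z(1) c(2)] geometric_partial_sum[OF y(1)] by simp
  moreover have "tends (\<lambda>n. \<one> \<ominus> y [^] n) ((\<one> \<ominus> y) \<otimes> z)"
    using tends_mult_left[OF z(1) c(2)] geometric_partial_sum[OF y(1)] by simp
  ultimately show ?thesis using lim tends_unique z c by blast
qed

end

section \<open>Bounded traces\<close>

locale tracial_banach_algebra = involutive_banach_algebra A
  for A :: "('a, 'm) cstar_scheme" (structure) and \<tau> :: "'a \<Rightarrow> complex" +
  assumes trace_add: "\<lbrakk>x \<in> carrier A; y \<in> carrier A\<rbrakk> \<Longrightarrow> \<tau> (x \<oplus> y) = \<tau> x + \<tau> y"
    and trace_scale: "x \<in> carrier A \<Longrightarrow> \<tau> (scale A c x) = c * \<tau> x"
    and trace_bounded: "\<exists>T. \<forall>x\<in>carrier A. cmod (\<tau> x) \<le> T * cnorm A x"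
    and trace_commute: "\<lbrakk>x \<in> carrier A; y \<in> carrier A\<rbrakk> \<Longrightarrow> \<tau> (x \<otimes> y) = \<tau> (y \<otimes> x)"
begin

lemma trace_zero [simp]: "\<tau> \<zero> = 0"
  using trace_scale[of \<zero> 0] by simp

lemma trace_minus: "x \<in> carrier A \<Longrightarrow> \<tau> (\<ominus> x) = - \<tau> x"
  by (simp add: minus_eq_scale trace_scale)

lemma trace_diff: "\<lbrakk>x \<in> carrier A; y \<in> carrier A\<rbrakk> \<Longrightarrow> \<tau> (x \<ominus> y) = \<tau> x - \<tau> y"
  by (simp add: a_minus_def trace_add trace_minus)

lemma trace_finsum:
  assumes "finite S" "f \<in> S \<rightarrow> carrier A"
  shows "\<tau> (finsum A f S) = (\<Sum>s\<in>S. \<tau> (f s))"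
  using assms
proof (induction S)
  case (insert s S)
  then have "f \<in> S \<rightarrow> carrier A" "f s \<in> carrier A" by auto
  with insert show ?case by (simp add: trace_add Pi_iff)
qed simp

text \<open>Some bound for this one algebra; it serves convergence only. Where a bound uniform in
  the sequence matters, as in \<open>lg_null\<close>, the constant is an explicit parameter of
  \<open>tlog_bound\<close>.\<close>

definition trace_bd :: real where
  "trace_bd = (SOME T. 0 \<le> T \<and> (\<forall>x\<in>carrier A. cmod (\<tau> x) \<le> T * cnorm A x))"

lemma trace_bd: "0 \<le> trace_bd" "x \<in> carrier A \<Longrightarrow> cmod (\<tau> x) \<le> trace_bd * cnorm A x"
proof -
  obtain T where T: "\<And>x. x \<in> carrier A \<Longrightarrow> cmod (\<tau> x) \<le> T * cnorm A x" using trace_bounded by blast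
  have "cmod (\<tau> x) \<le> max T 0 * cnorm A x" if "x \<in> carrier A" for x
    using T[OF that] cnorm_nonneg[OF that] mult_right_mono[of T "max T 0" "cnorm A x"] by linarith
  then have "\<exists>T. 0 \<le> T \<and> (\<forall>x\<in>carrier A. cmod (\<tau> x) \<le> T * cnorm A x)"
    by (intro exI[of _ "max T 0"]) auto
  from someI_ex[OF this] show "0 \<le> trace_bd" "x \<in> carrier A \<Longrightarrow> cmod (\<tau> x) \<le> trace_bd * cnorm A x"
    unfolding trace_bd_def by auto
qed

lemma trace_bd_le: "x \<in> carrier A \<Longrightarrow> cnorm A x \<le> r \<Longrightarrow> cmod (\<tau> x) \<le> trace_bd * r"
  using trace_bd(2)[of x] mult_left_mono[OF _ trace_bd(1), of "cnorm A x" r] by linarith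

lemma tends_trace:
  assumes "tends x l" shows "(\<lambda>n. \<tau> (x n)) \<longlonglongrightarrow> \<tau> l"
proof -
  have c: "\<And>n. x n \<in> carrier A" "l \<in> carrier A" using assms by (auto simp: tends_def)
  have "(\<lambda>n. trace_bd * cnorm A (x n \<ominus> l)) \<longlonglongrightarrow> trace_bd * 0"
    using assms by (intro tendsto_mult tendsto_const) (auto simp: tends_def)
  then have lim: "(\<lambda>n. trace_bd * cnorm A (x n \<ominus> l)) \<longlonglongrightarrow> 0" by simp
  have "norm (\<tau> (x n) - \<tau> l) \<le> trace_bd * cnorm A (x n \<ominus> l)" for n
    using trace_bd(2)[of "x n \<ominus> l"] c(1)[of n] c(2) by (simp add: trace_diff)
  then have "(\<lambda>n. \<tau> (x n) - \<tau> l) \<longlonglongrightarrow> 0"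
    by (intro Lim_null_comparison[OF _ lim] always_eventually allI)
  then show ?thesis by (simp add: LIM_zero_iff)
qed

end

lemma (in abelian_monoid) finsum_swap:
  assumes "finite S" "finite T" "\<And>s t. s \<in> S \<Longrightarrow> t \<in> T \<Longrightarrow> f s t \<in> carrier G"
  shows "(\<Oplus>s\<in>S. \<Oplus>t\<in>T. f s t) = (\<Oplus>t\<in>T. \<Oplus>s\<in>S. f s t)"
  using assms(1,3)
proof (induction S)
  case empty
  then show ?case by (simp add: finsum_zero)
next
  case (insert s S)
  have c: "(\<lambda>t. f s t) \<in> T \<rightarrow> carrier G" "(\<lambda>t. \<Oplus>s\<in>S. f s t) \<in> T \<rightarrow> carrier G"
    "(\<lambda>s. \<Oplus>t\<in>T. f s t) \<in> S \<rightarrow> carrier G" "(\<Oplus>t\<in>T. f s t) \<in> carrier G"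
    using insert.prems by (auto intro!: finsum_closed)
  have "(\<Oplus>s\<in>insert s S. \<Oplus>t\<in>T. f s t) = (\<Oplus>t\<in>T. f s t) \<oplus> (\<Oplus>t\<in>T. \<Oplus>s\<in>S. f s t)"
    using insert c by simp
  also have "\<dots> = (\<Oplus>t\<in>T. f s t \<oplus> (\<Oplus>s\<in>S. f s t))"
    using c by simp
  also have "\<dots> = (\<Oplus>t\<in>T. \<Oplus>s\<in>insert s S. f s t)"
  proof (rule finsum_cong'[OF refl])
    show "(\<lambda>t. \<Oplus>s\<in>insert s S. f s t) \<in> T \<rightarrow> carrier G"
      using insert.prems by (auto intro!: finsum_closed)
    show "f s t \<oplus> (\<Oplus>s\<in>S. f s t) = (\<Oplus>s\<in>insert s S. f s t)" if "t \<in> T" for t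
      using insert.hyps insert.prems that by (intro finsum_insert[symmetric]) auto
  qed
  finally show ?case .
qed

section \<open>\<open>C\<^sup>*\<close>-algebras\<close>

context unital_cstar_algebra
begin

lemma cnorm_star: "x \<in> carrier A \<Longrightarrow> cnorm A (star A x) = cnorm A x"
proof -
  have le: "cnorm A x \<le> cnorm A (star A x)" if x: "x \<in> carrier A" for x
  proof (cases "cnorm A x = 0")
    case True
    then show ?thesis using x cnorm_nonneg by simp
  next
    case False
    then have "0 < cnorm A x" using cnorm_nonneg[OF x] by simp
    moreover have "cnorm A x * cnorm A x \<le> cnorm A (star A x) * cnorm A x"
      using cstar_identity[OF x] cnorm_mult[of "star A x" x] x by (simp add: power2_eq_square)
    ultimately show ?thesis by simp
  qed
  assume "x \<in> carrier A"
  then show ?thesis using le[of x] le[of "star A x"] by (simp add: star_star)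
qed

lemma star_one_eq: "star A \<one> = \<one>"
  using star_mult[of "star A \<one>" \<one>] star_star[of \<one>] by simp

lemma cnorm_one_le: "cnorm A \<one> \<le> 1"
proof -
  have "cnorm A \<one> = cnorm A \<one> * cnorm A \<one>"
    using cstar_identity[of \<one>] by (simp add: star_one_eq power2_eq_square)
  then show ?thesis by (cases "cnorm A \<one> = 0") auto
qed

lemma involutive_banach_algebra: "involutive_banach_algebra A"
proof unfold_locales
  fix f :: "nat \<Rightarrow> 'a"
  assume f: "\<And>n. f n \<in> carrier A"
    and C: "\<And>e. 0 < e \<Longrightarrow> \<exists>M. \<forall>m\<ge>M. \<forall>n\<ge>M. cnorm A (f m \<ominus> f n) < e"
  interpret M: Metric_space "carrier A" "cdist A" by (rule Metric_space_cdist)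
  have "M.MCauchy f"
    unfolding M.MCauchy_def
  proof (intro conjI allI impI)
    show "range f \<subseteq> carrier A" using f by auto
    fix e :: real assume "0 < e"
    from C[OF this] show "\<exists>N. \<forall>n n'. N \<le> n \<longrightarrow> N \<le> n' \<longrightarrow> cdist A (f n) (f n') < e"
      using f by (auto simp: cdist_def)
  qed
  then obtain l where "limitin M.mtopology f l sequentially"
    using complete unfolding M.mcomplete_def by blast
  then have l: "l \<in> carrier A" "(\<lambda>n. cdist A (f n) l) \<longlonglongrightarrow> 0"
    by (auto simp: M.limitin_metric_dist_null)
  then show "\<exists>l\<in>carrier A. (\<lambda>n. cnorm A (f n \<ominus> l)) \<longlonglongrightarrow> 0"
    using f by (auto simp: cdist_def)
qed (simp_all add: scale_one scale_scale scale_add_left scale_add_right scale_mult_left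
    scale_mult_right star_star star_add star_scale star_mult cnorm_nonneg cnorm_eq_0
    cnorm_triangle cnorm_scale cnorm_mult cnorm_one_le)

end

context tracial_cstar_algebra
begin

text \<open>Continuity at 0 gives a ball on which the trace is below 1, hence boundedness on the
  unit ball. Only then is the supremum in \<open>functional_norm\<close> a genuine one, and a bound
  on it a bound on the trace.\<close>

lemma functional_norm:
  "bdd_above ((\<lambda>x. cmod (\<tau> x)) ` {x \<in> carrier A. cnorm A x \<le> 1})"
  "x \<in> carrier A \<Longrightarrow> cmod (\<tau> x) \<le> functional_norm A \<tau> * cnorm A x"
proof -
  interpret B: involutive_banach_algebra A by (rule involutive_banach_algebra)
  interpret M: Metric_space "carrier A" "cdist A" by (rule Metric_space_cdist)
  have "openin M.mtopology {x \<in> topspace M.mtopology. \<tau> x \<in> ball 0 1}"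
    using trace_continuous by (rule openin_continuous_map_preimage) simp
  then have "openin M.mtopology {x \<in> carrier A. \<tau> x \<in> ball 0 1}" by simp
  then obtain r where r: "0 < r" "M.mball \<zero> r \<subseteq> {x \<in> carrier A. \<tau> x \<in> ball 0 1}"
    unfolding M.openin_mtopology using trace_zero by auto
  have lt: "cmod (\<tau> x) < 1" if "x \<in> carrier A" "cnorm A x < r" for x
  proof -
    have "x \<in> M.mball \<zero> r"
      using that B.cnorm_minus[of x] by (simp add: M.in_mball cdist_def a_minus_def)
    then show ?thesis using r(2) by auto
  qed
  have bd: "cmod (\<tau> x) \<le> 2 / r" if x: "x \<in> carrier A" "cnorm A x \<le> 1" for x
  proof -
    \<comment> \<open>The factor r / 2 instead of r keeps the scaled element strictly inside the
      open ball.\<close>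
    have "cnorm A (scale A (of_real (r / 2)) x) = r / 2 * cnorm A x"
      using x r cnorm_scale by simp
    also have "\<dots> \<le> r / 2 * 1"
      using x r by (intro mult_left_mono) auto
    finally have "cmod (\<tau> (scale A (of_real (r / 2)) x)) < 1"
      using x r by (intro lt) auto
    moreover have "\<tau> (scale A (of_real (r / 2)) x) = of_real (r / 2) * \<tau> x"
      using x(1) by (rule trace_scale)
    ultimately have "cmod (of_real (r / 2) * \<tau> x) < 1" by (simp only:)
    then have "r / 2 * cmod (\<tau> x) < 1"
      unfolding norm_mult norm_of_real using r by simp
    then show ?thesis using r by (simp add: field_simps)
  qed
  show bdd: "bdd_above ((\<lambda>x. cmod (\<tau> x)) ` {x \<in> carrier A. cnorm A x \<le> 1})"
    using bd by (intro bdd_aboveI[of _ "2 / r"]) auto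
  assume x: "x \<in> carrier A"
  show "cmod (\<tau> x) \<le> functional_norm A \<tau> * cnorm A x"
  proof (cases "cnorm A x = 0")
    case True
    then have "x = \<zero>" using x cnorm_eq_0 by simp
    then show ?thesis using trace_zero True by simp
  next
    case False
    then have pos: "0 < cnorm A x" using cnorm_nonneg[OF x] by simp
    let ?y = "scale A (of_real (1 / cnorm A x)) x"
    have y: "?y \<in> carrier A" "cnorm A ?y \<le> 1"
      using x pos cnorm_scale[OF x, of "of_real (1 / cnorm A x)"]
      by (auto simp: norm_of_real norm_divide)
    have "cmod (\<tau> ?y) \<le> functional_norm A \<tau>"
      unfolding functional_norm_def using y by (intro cSUP_upper bdd) auto
    moreover have "\<tau> ?y = of_real (1 / cnorm A x) * \<tau> x" using x by (rule trace_scale)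
    ultimately have "1 / cnorm A x * cmod (\<tau> x) \<le> functional_norm A \<tau>"
      using pos by (simp add: norm_mult norm_divide)
    then show ?thesis using pos by (simp add: field_simps)
  qed
qed

lemma tracial_banach_algebra: "tracial_banach_algebra A \<tau>"
  by (intro tracial_banach_algebra.intro tracial_banach_algebra_axioms.intro
      involutive_banach_algebra trace_add trace_scale trace_commute)
    (use functional_norm(2) in auto)

end

section \<open>Matrix algebras\<close>

text \<open>Row sums make the norm submultiplicative and complete by elementary estimates, whereas
  the C*-norm of a matrix algebra would call for a representation of \<open>A\<close>. The inserted
  0 covers k = 0, where there are no rows.\<close>

definition mat_norm :: "nat \<Rightarrow> ('a, 'm) cstar_scheme \<Rightarrow> (nat \<Rightarrow> nat \<Rightarrow> 'a) \<Rightarrow> real" where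
  "mat_norm k A x = Max (insert 0 ((\<lambda>i. \<Sum>j<k. cnorm A (x i j)) ` {..<k}))"

text \<open>An instance of the same record type, so that all results on Banach algebras with
  involution apply again to matrices, and then to matrices over matrices.\<close>

definition Mat :: "nat \<Rightarrow> ('a, 'm) cstar_scheme \<Rightarrow> (nat \<Rightarrow> nat \<Rightarrow> 'a) cstar" where
  "Mat k A = \<lparr>carrier = matrices A k k, mult = matrix_prod A k,
     one = (\<lambda>i j. if i < k \<and> i = j then \<one>\<^bsub>A\<^esub> else \<zero>\<^bsub>A\<^esub>), zero = (\<lambda>_ _. \<zero>\<^bsub>A\<^esub>),
     add = (\<lambda>x y i j. x i j \<oplus>\<^bsub>A\<^esub> y i j), scale = (\<lambda>c x i j. scale A c (x i j)),
     star = matrix_star A, cnorm = mat_norm k A\<rparr>"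

lemma Mat_simps [simp]:
  "carrier (Mat k A) = matrices A k k" "mult (Mat k A) = matrix_prod A k"
  "one (Mat k A) = (\<lambda>i j. if i < k \<and> i = j then \<one>\<^bsub>A\<^esub> else \<zero>\<^bsub>A\<^esub>)"
  "zero (Mat k A) = (\<lambda>_ _. \<zero>\<^bsub>A\<^esub>)" "add (Mat k A) = (\<lambda>x y i j. x i j \<oplus>\<^bsub>A\<^esub> y i j)"
  "scale (Mat k A) = (\<lambda>c x i j. scale A c (x i j))" "star (Mat k A) = matrix_star A"
  "cnorm (Mat k A) = mat_norm k A"
  by (simp_all add: Mat_def)

lemma mat_norm_le_iff:
  "mat_norm k A x \<le> r \<longleftrightarrow> 0 \<le> r \<and> (\<forall>i<k. (\<Sum>j<k. cnorm A (x i j)) \<le> r)"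
  unfolding mat_norm_def by (subst Max_le_iff) auto

lemma mat_norm_nonneg: "0 \<le> mat_norm k A x"
  unfolding mat_norm_def by (rule Max_ge) auto

lemma mat_norm_row: "i < k \<Longrightarrow> (\<Sum>j<k. cnorm A (x i j)) \<le> mat_norm k A x"
  using mat_norm_le_iff[of k A x "mat_norm k A x"] by auto

lemma matrices_entry: "x \<in> matrices A m n \<Longrightarrow> x i j \<in> carrier A"
  by (simp add: matrices_def)

lemma matrices_outside: "x \<in> matrices A m n \<Longrightarrow> \<not> (i < m \<and> j < n) \<Longrightarrow> x i j = \<zero>\<^bsub>A\<^esub>"
  unfolding matrices_def by blast

lemma matricesI:
  "\<lbrakk>\<And>i j. x i j \<in> carrier A; \<And>i j. \<not> (i < m \<and> j < n) \<Longrightarrow> x i j = \<zero>\<^bsub>A\<^esub>\<rbrakk> \<Longrightarrow> x \<in> matrices A m n"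
  unfolding matrices_def by blast

context involutive_banach_algebra
begin

lemma matrix_prod_entry:
  assumes "\<And>i j. x i j \<in> carrier A" "\<And>i j. y i j \<in> carrier A"
  shows "matrix_prod A k x y i j \<in> carrier A"
  using assms by (auto simp: matrix_prod_def)

lemma matrix_prod_closed:
  assumes "x \<in> matrices A m k" "y \<in> matrices A k n" shows "matrix_prod A k x y \<in> matrices A m n"
proof (rule matricesI)
  show "matrix_prod A k x y i j \<in> carrier A" for i j
    using assms matrices_entry by (intro matrix_prod_entry) fast+
  fix i j assume *: "\<not> (i < m \<and> j < n)"
  have "x i t \<otimes> y t j = \<zero>" for t
    using * matrices_outside[OF assms(1), of i t] matrices_outside[OF assms(2), of t j]
      matrices_entry[OF assms(1), of i t] matrices_entry[OF assms(2), of t j] by auto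
  then show "matrix_prod A k x y i j = \<zero>" by (simp add: matrix_prod_def finsum_zero)
qed

lemma matrix_prod_assoc:
  assumes x: "\<And>i j. x i j \<in> carrier A" and y: "\<And>i j. y i j \<in> carrier A" and z: "\<And>i j. z i j \<in> carrier A"
  shows "matrix_prod A l (matrix_prod A k x y) z = matrix_prod A k x (matrix_prod A l y z)"
proof (intro ext)
  fix i j
  have "matrix_prod A l (matrix_prod A k x y) z i j
      = (\<Oplus>t\<in>{..<l}. \<Oplus>s\<in>{..<k}. (x i s \<otimes> y s t) \<otimes> z t j)"
    unfolding matrix_prod_def using assms
    by (intro finsum_cong' refl) (auto intro!: finsum_ldistr)
  also have "\<dots> = (\<Oplus>s\<in>{..<k}. \<Oplus>t\<in>{..<l}. (x i s \<otimes> y s t) \<otimes> z t j)"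
    using assms by (intro finsum_swap) auto
  also have "\<dots> = matrix_prod A k x (matrix_prod A l y z) i j"
    unfolding matrix_prod_def
  proof (rule finsum_cong'[OF refl])
    fix s
    have "x i s \<otimes> (\<Oplus>t\<in>{..<l}. y s t \<otimes> z t j) = (\<Oplus>t\<in>{..<l}. x i s \<otimes> (y s t \<otimes> z t j))"
      using assms by (intro finsum_rdistr) auto
    then show "(\<Oplus>t\<in>{..<l}. (x i s \<otimes> y s t) \<otimes> z t j) = x i s \<otimes> (\<Oplus>t\<in>{..<l}. y s t \<otimes> z t j)"
      using assms by (simp add: m_assoc)
  qed (use assms in auto)
  finally show "matrix_prod A l (matrix_prod A k x y) z i j = matrix_prod A k x (matrix_prod A l y z) i j" .
qed

lemma Mat_ring: "ring (Mat k A)"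
proof (rule ringI)
  show "abelian_group (Mat k A)"
  proof (rule abelian_groupI)
    fix x assume "x \<in> carrier (Mat k A)"
    then show "\<exists>y\<in>carrier (Mat k A). y \<oplus>\<^bsub>Mat k A\<^esub> x = \<zero>\<^bsub>Mat k A\<^esub>"
      by (intro bexI[of _ "\<lambda>i j. \<ominus> (x i j)"]) (auto simp: matrices_def l_neg fun_eq_iff)
  qed (auto simp: matrices_def fun_eq_iff a_ac)
  show "monoid (Mat k A)"
  proof (rule monoidI)
    show "x \<otimes>\<^bsub>Mat k A\<^esub> y \<in> carrier (Mat k A)" if "x \<in> carrier (Mat k A)" "y \<in> carrier (Mat k A)" for x y
      using that by (simp add: matrix_prod_closed)
    show "\<one>\<^bsub>Mat k A\<^esub> \<in> carrier (Mat k A)" by (auto simp: matrices_def)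
    show "x \<otimes>\<^bsub>Mat k A\<^esub> y \<otimes>\<^bsub>Mat k A\<^esub> z = x \<otimes>\<^bsub>Mat k A\<^esub> (y \<otimes>\<^bsub>Mat k A\<^esub> z)"
      if "x \<in> carrier (Mat k A)" "y \<in> carrier (Mat k A)" "z \<in> carrier (Mat k A)" for x y z
      using that by (simp add: matrix_prod_assoc matrices_entry)
    fix x assume "x \<in> carrier (Mat k A)"
    then have x: "x i j \<in> carrier A" "\<not> (i < k \<and> j < k) \<Longrightarrow> x i j = \<zero>" for i j
      using matrices_entry matrices_outside by fastforce+
    show "\<one>\<^bsub>Mat k A\<^esub> \<otimes>\<^bsub>Mat k A\<^esub> x = x"
    proof (intro ext)
      fix i j
      have "(\<Oplus>t\<in>{..<k}. (if i < k \<and> i = t then \<one> else \<zero>) \<otimes> x t j)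
          = (\<Oplus>t\<in>{..<k}. if i = t then x t j else \<zero>)"
        using x by (intro finsum_cong' refl) auto
      also have "\<dots> = x i j"
        using x finsum_singleton[of i "{..<k}" "\<lambda>t. x t j"]
        by (cases "i < k") (auto simp: finsum_zero intro!: add.finprod_one_eqI)
      finally show "(\<one>\<^bsub>Mat k A\<^esub> \<otimes>\<^bsub>Mat k A\<^esub> x) i j = x i j" by (simp add: matrix_prod_def)
    qed
    show "x \<otimes>\<^bsub>Mat k A\<^esub> \<one>\<^bsub>Mat k A\<^esub> = x"
    proof (intro ext)
      fix i j
      have "(\<Oplus>t\<in>{..<k}. x i t \<otimes> (if t < k \<and> t = j then \<one> else \<zero>))
          = (\<Oplus>t\<in>{..<k}. if j = t then x i t else \<zero>)"
        using x by (intro finsum_cong' refl) auto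
      also have "\<dots> = x i j"
        using x finsum_singleton[of j "{..<k}" "\<lambda>t. x i t"]
        by (cases "j < k") (auto simp: finsum_zero intro!: add.finprod_one_eqI)
      finally show "(x \<otimes>\<^bsub>Mat k A\<^esub> \<one>\<^bsub>Mat k A\<^esub>) i j = x i j" by (simp add: matrix_prod_def)
    qed
  qed
  fix x y z assume "x \<in> carrier (Mat k A)" "y \<in> carrier (Mat k A)" "z \<in> carrier (Mat k A)"
  then have c: "\<And>i j. x i j \<in> carrier A" "\<And>i j. y i j \<in> carrier A" "\<And>i j. z i j \<in> carrier A"
    by (simp_all add: matrices_entry)
  show "(x \<oplus>\<^bsub>Mat k A\<^esub> y) \<otimes>\<^bsub>Mat k A\<^esub> z = x \<otimes>\<^bsub>Mat k A\<^esub> z \<oplus>\<^bsub>Mat k A\<^esub> y \<otimes>\<^bsub>Mat k A\<^esub> z"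
    "z \<otimes>\<^bsub>Mat k A\<^esub> (x \<oplus>\<^bsub>Mat k A\<^esub> y) = z \<otimes>\<^bsub>Mat k A\<^esub> x \<oplus>\<^bsub>Mat k A\<^esub> z \<otimes>\<^bsub>Mat k A\<^esub> y"
    using c by (simp_all add: matrix_prod_def l_distr r_distr fun_eq_iff Pi_iff)
qed

lemma Mat_minus:
  assumes "x \<in> matrices A k k" "y \<in> matrices A k k"
  shows "x \<ominus>\<^bsub>Mat k A\<^esub> y = (\<lambda>i j. x i j \<ominus> y i j)"
proof -
  interpret M: ring "Mat k A" by (rule Mat_ring)
  have c: "x i j \<in> carrier A" "y i j \<in> carrier A" for i j using assms by (simp_all add: matrices_entry)
  have m: "(\<lambda>i j. x i j \<ominus> y i j) \<in> matrices A k k"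
  proof (rule matricesI)
    show "x i j \<ominus> y i j = \<zero>" if "\<not> (i < k \<and> j < k)" for i j
      using matrices_outside[OF assms(1) that] matrices_outside[OF assms(2) that] by simp
  qed (use c in auto)
  have "(\<lambda>i j. x i j \<ominus> y i j) \<oplus>\<^bsub>Mat k A\<^esub> y = x"
    using c by (simp add: minus_add_cancel)
  then have "x \<ominus>\<^bsub>Mat k A\<^esub> y = ((\<lambda>i j. x i j \<ominus> y i j) \<oplus>\<^bsub>Mat k A\<^esub> y) \<oplus>\<^bsub>Mat k A\<^esub> (\<ominus>\<^bsub>Mat k A\<^esub> y)"
    by (simp add: a_minus_def)
  also have "\<dots> = (\<lambda>i j. x i j \<ominus> y i j) \<oplus>\<^bsub>Mat k A\<^esub> (y \<oplus>\<^bsub>Mat k A\<^esub> (\<ominus>\<^bsub>Mat k A\<^esub> y))"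
    using assms m by (intro M.a_assoc M.a_inv_closed) simp_all
  also have "y \<oplus>\<^bsub>Mat k A\<^esub> (\<ominus>\<^bsub>Mat k A\<^esub> y) = \<zero>\<^bsub>Mat k A\<^esub>"
    using assms by (intro M.r_neg) simp
  also have "(\<lambda>i j. x i j \<ominus> y i j) \<oplus>\<^bsub>Mat k A\<^esub> \<zero>\<^bsub>Mat k A\<^esub> = (\<lambda>i j. x i j \<ominus> y i j)"
    using m by (intro M.r_zero) simp
  finally show ?thesis .
qed

lemma mat_norm_prod_le:
  assumes "x \<in> matrices A k k" "y \<in> matrices A k k"
  shows "mat_norm k A (matrix_prod A k x y) \<le> mat_norm k A x * mat_norm k A y"
proof -
  have c: "x i j \<in> carrier A" "y i j \<in> carrier A" for i j using assms by (simp_all add: matrices_entry)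
  have "(\<Sum>j<k. cnorm A (matrix_prod A k x y i j)) \<le> mat_norm k A x * mat_norm k A y" if i: "i < k" for i
  proof -
    have "(\<Sum>j<k. cnorm A (matrix_prod A k x y i j))
        \<le> (\<Sum>j<k. \<Sum>t<k. cnorm A (x i t) * cnorm A (y t j))"
    proof (rule sum_mono)
      fix j
      have "cnorm A (matrix_prod A k x y i j) \<le> (\<Sum>t<k. cnorm A (x i t \<otimes> y t j))"
        unfolding matrix_prod_def using c by (intro cnorm_finsum) auto
      also have "\<dots> \<le> (\<Sum>t<k. cnorm A (x i t) * cnorm A (y t j))"
        using c by (intro sum_mono cnorm_mult)
      finally show "cnorm A (matrix_prod A k x y i j) \<le> (\<Sum>t<k. cnorm A (x i t) * cnorm A (y t j))" .
    qed
    also have "\<dots> = (\<Sum>t<k. cnorm A (x i t) * (\<Sum>j<k. cnorm A (y t j)))"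
      by (subst sum.swap) (simp add: sum_distrib_left)
    also have "\<dots> \<le> (\<Sum>t<k. cnorm A (x i t) * mat_norm k A y)"
      using c by (intro sum_mono mult_left_mono mat_norm_row cnorm_nonneg) auto
    also have "\<dots> \<le> mat_norm k A x * mat_norm k A y"
      unfolding sum_distrib_right[symmetric]
      by (intro mult_right_mono mat_norm_row i mat_norm_nonneg)
    finally show ?thesis .
  qed
  then show ?thesis
    by (simp add: mat_norm_le_iff mat_norm_nonneg)
qed

lemma cnorm_entry_le:
  assumes "x \<in> matrices A k k" shows "cnorm A (x i j) \<le> mat_norm k A x"
proof (cases "i < k \<and> j < k")
  case True
  then have "cnorm A (x i j) \<le> (\<Sum>j<k. cnorm A (x i j))"
    using matrices_entry[OF assms] by (intro member_le_sum) (auto simp: cnorm_nonneg)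
  also have "\<dots> \<le> mat_norm k A x" using True by (intro mat_norm_row) auto
  finally show ?thesis .
next
  case False
  then show ?thesis using matrices_outside[OF assms False] by (simp add: mat_norm_nonneg)
qed

lemma matrix_star_closed: "x \<in> matrices A m n \<Longrightarrow> matrix_star A x \<in> matrices A n m"
  by (rule matricesI) (auto simp: matrix_star_def matrices_entry matrices_outside)

lemma matrix_star_prod:
  assumes "\<And>i j. x i j \<in> carrier A" "\<And>i j. y i j \<in> carrier A"
  shows "matrix_star A (matrix_prod A k x y) = matrix_prod A k (matrix_star A y) (matrix_star A x)"
  using assms by (auto simp: matrix_star_def matrix_prod_def star_finsum star_mult fun_eq_iff Pi_iff)

text \<open>Limits are taken entry by entry; the row-sum norm lies between the norm of an entry and
  the finite sum of the norms of all entries.\<close>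

lemma Mat_Cauchy_limit:
  assumes f: "\<And>n. f n \<in> matrices A k k"
    and C: "\<And>e. 0 < e \<Longrightarrow> \<exists>M. \<forall>m\<ge>M. \<forall>n\<ge>M. mat_norm k A (\<lambda>i j. f m i j \<ominus> f n i j) < e"
  shows "\<exists>l\<in>matrices A k k. (\<lambda>n. mat_norm k A (\<lambda>i j. f n i j \<ominus> l i j)) \<longlonglongrightarrow> 0"
proof -
  have c: "f n i j \<in> carrier A" for n i j using matrices_entry[OF f] .
  have d: "(\<lambda>i j. f m i j \<ominus> f n i j) \<in> matrices A k k" for m n
  proof (rule matricesI)
    show "f m i j \<ominus> f n i j = \<zero>" if "\<not> (i < k \<and> j < k)" for i j
      using matrices_outside[OF f that] by simp
  qed (use c in auto)
  have "\<exists>l\<in>carrier A. (\<lambda>n. cnorm A (f n i j \<ominus> l)) \<longlonglongrightarrow> 0" for i j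
  proof (rule Cauchy_limit)
    fix e :: real assume "0 < e"
    from C[OF this] show "\<exists>M. \<forall>m\<ge>M. \<forall>n\<ge>M. cnorm A (f m i j \<ominus> f n i j) < e"
      by (elim ex_forward all_forward imp_forward) (assumption | rule order_le_less_trans[OF cnorm_entry_le[OF d]])+
  qed (rule c)
  then obtain l0 where l0: "\<And>i j. l0 i j \<in> carrier A" "\<And>i j. (\<lambda>n. cnorm A (f n i j \<ominus> l0 i j)) \<longlonglongrightarrow> 0"
    by metis
  define l where "l = (\<lambda>i j. if i < k \<and> j < k then l0 i j else \<zero>)"
  have l: "l \<in> matrices A k k" using l0 by (intro matricesI) (auto simp: l_def)
  have lc: "l i j \<in> carrier A" for i j using l by (rule matrices_entry)
  have bound: "mat_norm k A (\<lambda>i j. f n i j \<ominus> l i j) \<le> (\<Sum>i<k. \<Sum>j<k. cnorm A (f n i j \<ominus> l i j))" for n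
    unfolding mat_norm_le_iff
  proof (intro conjI allI impI)
    show "0 \<le> (\<Sum>i<k. \<Sum>j<k. cnorm A (f n i j \<ominus> l i j))"
      using c lc by (intro sum_nonneg cnorm_nonneg) auto
    show "(\<Sum>j<k. cnorm A (f n i j \<ominus> l i j)) \<le> (\<Sum>i<k. \<Sum>j<k. cnorm A (f n i j \<ominus> l i j))" if "i < k" for i
      using that c lc
      by (intro member_le_sum[of i "{..<k}" "\<lambda>i. \<Sum>j<k. cnorm A (f n i j \<ominus> l i j)"] sum_nonneg cnorm_nonneg) auto
  qed
  have "(\<lambda>n. \<Sum>i<k. \<Sum>j<k. cnorm A (f n i j \<ominus> l i j)) \<longlonglongrightarrow> (\<Sum>i<k. \<Sum>j<k. 0)"
    using l0 by (intro tendsto_sum) (auto simp: l_def)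
  then have lim: "(\<lambda>n. \<Sum>i<k. \<Sum>j<k. cnorm A (f n i j \<ominus> l i j)) \<longlonglongrightarrow> 0" by simp
  have "(\<lambda>n. mat_norm k A (\<lambda>i j. f n i j \<ominus> l i j)) \<longlonglongrightarrow> 0"
    by (rule tendsto_sandwich[OF _ _ tendsto_const lim]) (auto simp: mat_norm_nonneg bound)
  then show ?thesis using l by blast
qed

theorem Mat_involutive_banach_algebra: "involutive_banach_algebra (Mat k A)"
proof (intro involutive_banach_algebra.intro Mat_ring involutive_banach_algebra_axioms.intro)
  fix f :: "nat \<Rightarrow> nat \<Rightarrow> nat \<Rightarrow> 'a"
  assume f: "\<And>n. f n \<in> carrier (Mat k A)"
    and C: "\<And>e. 0 < e \<Longrightarrow> \<exists>M. \<forall>m\<ge>M. \<forall>n\<ge>M. cnorm (Mat k A) (f m \<ominus>\<^bsub>Mat k A\<^esub> f n) < e"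
  have f': "\<And>n. f n \<in> matrices A k k" using f by simp
  have "\<exists>l\<in>matrices A k k. (\<lambda>n. mat_norm k A (\<lambda>i j. f n i j \<ominus> l i j)) \<longlonglongrightarrow> 0"
    using C by (intro Mat_Cauchy_limit f') (simp add: Mat_minus f')
  then show "\<exists>l\<in>carrier (Mat k A). (\<lambda>n. cnorm (Mat k A) (f n \<ominus>\<^bsub>Mat k A\<^esub> l)) \<longlonglongrightarrow> 0"
    by (auto simp: Mat_minus f')
next
  fix x y assume "x \<in> carrier (Mat k A)" "y \<in> carrier (Mat k A)"
  then have xm: "x \<in> matrices A k k" "y \<in> matrices A k k"
    and c: "\<And>i j. x i j \<in> carrier A" "\<And>i j. y i j \<in> carrier A"
    by (simp_all add: matrices_entry)
  show "scale (Mat k A) c x \<otimes>\<^bsub>Mat k A\<^esub> y = scale (Mat k A) c (x \<otimes>\<^bsub>Mat k A\<^esub> y)" for c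
    using c by (simp add: matrix_prod_def scale_mult_left scale_finsum fun_eq_iff Pi_iff)
  show "x \<otimes>\<^bsub>Mat k A\<^esub> scale (Mat k A) c y = scale (Mat k A) c (x \<otimes>\<^bsub>Mat k A\<^esub> y)" for c
    using c by (simp add: matrix_prod_def scale_mult_right scale_finsum fun_eq_iff Pi_iff)
  show "star (Mat k A) (x \<otimes>\<^bsub>Mat k A\<^esub> y) = star (Mat k A) y \<otimes>\<^bsub>Mat k A\<^esub> star (Mat k A) x"
    using c by (simp add: matrix_star_prod)
  show "cnorm (Mat k A) (x \<otimes>\<^bsub>Mat k A\<^esub> y) \<le> cnorm (Mat k A) x * cnorm (Mat k A) y"
    using xm by (simp add: mat_norm_prod_le)
  show "cnorm (Mat k A) (x \<oplus>\<^bsub>Mat k A\<^esub> y) \<le> cnorm (Mat k A) x + cnorm (Mat k A) y"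
    unfolding Mat_simps mat_norm_le_iff
  proof (intro conjI allI impI)
    show "0 \<le> mat_norm k A x + mat_norm k A y" by (simp add: mat_norm_nonneg)
    fix i assume "i < k"
    have "(\<Sum>j<k. cnorm A (x i j \<oplus> y i j)) \<le> (\<Sum>j<k. cnorm A (x i j) + cnorm A (y i j))"
      using c by (intro sum_mono cnorm_triangle)
    also have "\<dots> \<le> mat_norm k A x + mat_norm k A y"
      unfolding sum.distrib using \<open>i < k\<close> by (intro add_mono mat_norm_row)
    finally show "(\<Sum>j<k. cnorm A (x i j \<oplus> y i j)) \<le> mat_norm k A x + mat_norm k A y" .
  qed
next
  fix x assume "x \<in> carrier (Mat k A)"
  then have xm: "x \<in> matrices A k k" and c: "\<And>i j. x i j \<in> carrier A"
    by (simp_all add: matrices_entry)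
  show "cnorm (Mat k A) x = 0 \<longleftrightarrow> x = \<zero>\<^bsub>Mat k A\<^esub>"
  proof
    assume "cnorm (Mat k A) x = 0"
    then have "cnorm A (x i j) \<le> 0" for i j using cnorm_entry_le[OF xm, of i j] by simp
    then have "x i j = \<zero>" for i j
      using cnorm_nonneg[OF c, of i j] cnorm_eq_0[OF c, of i j] by (simp add: order_antisym)
    then show "x = \<zero>\<^bsub>Mat k A\<^esub>" by (simp add: fun_eq_iff)
  next
    assume "x = \<zero>\<^bsub>Mat k A\<^esub>"
    then have "mat_norm k A x \<le> 0" by (simp add: mat_norm_le_iff)
    then show "cnorm (Mat k A) x = 0" using mat_norm_nonneg[of k A x] by simp
  qed
  have le: "mat_norm k A (\<lambda>i j. scale A c (y i j)) \<le> cmod c * mat_norm k A y"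
    if "\<And>i j. y i j \<in> carrier A" for c y
    unfolding mat_norm_le_iff using that
    by (auto simp: cnorm_scale mat_norm_nonneg sum_distrib_left[symmetric] intro!: mult_left_mono mat_norm_row)
  show "cnorm (Mat k A) (scale (Mat k A) d x) = cmod d * cnorm (Mat k A) x" for d
  proof (cases "d = 0")
    case True
    have "mat_norm k A (\<lambda>i j. \<zero>) \<le> 0" by (simp add: mat_norm_le_iff)
    then show ?thesis using True c mat_norm_nonneg[of k A "\<lambda>i j. \<zero>"] by simp
  next
    case False
    \<comment> \<open>The reverse inequality is \<open>le\<close> for the inverse scalar.\<close>
    have "mat_norm k A x \<le> cmod (inverse d) * mat_norm k A (\<lambda>i j. scale A d (x i j))"
      using le[of "\<lambda>i j. scale A d (x i j)" "inverse d"] c False by (simp add: scale_scale scale_one)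
    then have "cmod d * mat_norm k A x \<le> mat_norm k A (\<lambda>i j. scale A d (x i j))"
      using False by (simp add: norm_divide field_simps)
    then show ?thesis using le[of x d] c by simp
  qed
next
  show "cnorm (Mat k A) \<one>\<^bsub>Mat k A\<^esub> \<le> 1"
    unfolding Mat_simps mat_norm_le_iff
  proof (intro conjI allI impI)
    fix i assume "i < k"
    have "(\<Sum>j<k. cnorm A (if i < k \<and> i = j then \<one> else \<zero>)) = (\<Sum>j<k. if i = j then cnorm A \<one> else 0)"
      using \<open>i < k\<close> by (intro sum.cong) auto
    also have "\<dots> \<le> 1" using \<open>i < k\<close> cnorm_one by simp
    finally show "(\<Sum>j<k. cnorm A (if i < k \<and> i = j then \<one> else \<zero>)) \<le> 1" .
  qed simp
qed (auto simp: matrices_def fun_eq_iff scale_one scale_scale scale_add_left scale_add_right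
    matrix_star_def star_star star_add star_scale mat_norm_nonneg)

end

definition mat_trace :: "nat \<Rightarrow> ('a \<Rightarrow> complex) \<Rightarrow> (nat \<Rightarrow> nat \<Rightarrow> 'a) \<Rightarrow> complex" where
  "mat_trace k \<tau> x = (\<Sum>i<k. \<tau> (x i i))"

theorem (in tracial_banach_algebra) Mat_tracial_banach_algebra:
  "tracial_banach_algebra (Mat k A) (mat_trace k \<tau>)"
proof (intro tracial_banach_algebra.intro Mat_involutive_banach_algebra tracial_banach_algebra_axioms.intro)
  fix x y assume "x \<in> carrier (Mat k A)" "y \<in> carrier (Mat k A)"
  then have c: "\<And>i j. x i j \<in> carrier A" "\<And>i j. y i j \<in> carrier A"
    by (simp_all add: matrices_entry)
  show "mat_trace k \<tau> (x \<oplus>\<^bsub>Mat k A\<^esub> y) = mat_trace k \<tau> x + mat_trace k \<tau> y"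
    using c by (simp add: mat_trace_def trace_add sum.distrib)
  have "mat_trace k \<tau> (matrix_prod A k x y) = (\<Sum>i<k. \<Sum>t<k. \<tau> (x i t \<otimes> y t i))"
    using c by (simp add: mat_trace_def matrix_prod_def trace_finsum Pi_iff)
  also have "\<dots> = (\<Sum>t<k. \<Sum>i<k. \<tau> (y t i \<otimes> x i t))"
    using c by (subst sum.swap) (simp add: trace_commute)
  also have "\<dots> = mat_trace k \<tau> (matrix_prod A k y x)"
    using c by (simp add: mat_trace_def matrix_prod_def trace_finsum Pi_iff)
  finally show "mat_trace k \<tau> (x \<otimes>\<^bsub>Mat k A\<^esub> y) = mat_trace k \<tau> (y \<otimes>\<^bsub>Mat k A\<^esub> x)" by simp
next
  fix x c assume "x \<in> carrier (Mat k A)"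
  then have "\<And>i j. x i j \<in> carrier A" by (simp add: matrices_entry)
  then show "mat_trace k \<tau> (scale (Mat k A) c x) = c * mat_trace k \<tau> x"
    by (simp add: mat_trace_def trace_scale sum_distrib_left)
next
  show "\<exists>T. \<forall>x\<in>carrier (Mat k A). cmod (mat_trace k \<tau> x) \<le> T * cnorm (Mat k A) x"
  proof (intro exI[of _ "real k * trace_bd"] ballI)
    fix x assume "x \<in> carrier (Mat k A)"
    then have x: "x \<in> matrices A k k" by simp
    have "cmod (mat_trace k \<tau> x) \<le> (\<Sum>i<k. cmod (\<tau> (x i i)))"
      unfolding mat_trace_def by (rule norm_sum)
    also have "\<dots> \<le> (\<Sum>i<k. trace_bd * mat_norm k A x)"
      using x by (intro sum_mono trace_bd_le cnorm_entry_le) (auto simp: matrices_entry)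
    finally show "cmod (mat_trace k \<tau> x) \<le> real k * trace_bd * cnorm (Mat k A) x" by simp
  qed
qed

section \<open>Differentiable curves and the trace of the logarithm\<close>

context involutive_banach_algebra
begin

text \<open>The difference quotient is written out with \<open>cnorm\<close> because the algebra is
  a carrier set and not a type. The curve has to stay in the carrier at all times, so that the laws
  of the algebra apply to every quotient.\<close>

definition has_der :: "(real \<Rightarrow> 'a) \<Rightarrow> 'a \<Rightarrow> real \<Rightarrow> bool" where
  "has_der f f' x \<longleftrightarrow> (\<forall>t. f t \<in> carrier A) \<and> f' \<in> carrier A \<and>
     ((\<lambda>y. cnorm A ((f y \<ominus> f x) \<ominus> scale A (of_real (y - x)) f') / \<bar>y - x\<bar>) \<longlongrightarrow> 0) (at x)"

lemma has_der_closed: "has_der f f' x \<Longrightarrow> f t \<in> carrier A" "has_der f f' x \<Longrightarrow> f' \<in> carrier A"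
  by (simp_all add: has_der_def)

lemma has_derI_bound:
  assumes "\<And>t. f t \<in> carrier A" "f' \<in> carrier A"
    "\<And>y. y \<noteq> x \<Longrightarrow> cnorm A ((f y \<ominus> f x) \<ominus> scale A (of_real (y - x)) f') / \<bar>y - x\<bar> \<le> g y"
    "(g \<longlongrightarrow> 0) (at x)"
  shows "has_der f f' x"
  unfolding has_der_def
proof (intro conjI allI tendsto_sandwich[OF _ _ tendsto_const assms(4)])
  show "\<forall>\<^sub>F y in at x. 0 \<le> cnorm A ((f y \<ominus> f x) \<ominus> scale A (of_real (y - x)) f') / \<bar>y - x\<bar>"
    using assms(1,2) by (intro always_eventually allI divide_nonneg_nonneg cnorm_nonneg) auto
  show "\<forall>\<^sub>F y in at x. cnorm A ((f y \<ominus> f x) \<ominus> scale A (of_real (y - x)) f') / \<bar>y - x\<bar> \<le> g y"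
    using assms(3) by (auto simp: eventually_at intro!: exI[of _ 1])
qed (use assms in auto)

lemma has_der_scale:
  assumes g: "(g has_vector_derivative g') (at x)" and c: "c \<in> carrier A"
  shows "has_der (\<lambda>t. scale A (g t) c) (scale A g' c) x"
proof (rule has_derI_bound)
  have "((\<lambda>y. norm (g y - g x - (y - x) *\<^sub>R g') / norm (y - x)) \<longlongrightarrow> 0) (at x)"
    using g unfolding has_vector_derivative_def has_derivative_iff_norm by auto
  then have "((\<lambda>y. norm (g y - g x - (y - x) *\<^sub>R g') / norm (y - x) * cnorm A c) \<longlongrightarrow> 0 * cnorm A c) (at x)"
    by (intro tendsto_mult tendsto_const)
  then show "((\<lambda>y. norm (g y - g x - (y - x) *\<^sub>R g') / norm (y - x) * cnorm A c) \<longlongrightarrow> 0) (at x)" by simp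
  show "cnorm A (scale A (g y) c \<ominus> scale A (g x) c \<ominus> scale A (of_real (y - x)) (scale A g' c)) / \<bar>y - x\<bar>
      \<le> norm (g y - g x - (y - x) *\<^sub>R g') / norm (y - x) * cnorm A c" for y
  proof -
    have "scale A (g y) c \<ominus> scale A (g x) c \<ominus> scale A (of_real (y - x)) (scale A g' c)
        = scale A (g y - g x - (y - x) *\<^sub>R g') c"
      using c by (simp add: scale_scale scale_diff_left scaleR_conv_of_real)
    then show ?thesis using c by (simp add: cnorm_scale)
  qed
qed (use c in auto)

lemma has_der_const: "c \<in> carrier A \<Longrightarrow> has_der (\<lambda>t. c) \<zero> x"
  using has_der_scale[of "\<lambda>_. 1" 0 x c] by (simp add: scale_one)

lemma has_der_add:
  assumes "has_der f f' x" "has_der g g' x" shows "has_der (\<lambda>t. f t \<oplus> g t) (f' \<oplus> g') x"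
proof (rule has_derI_bound)
  have c: "\<And>t. f t \<in> carrier A" "\<And>t. g t \<in> carrier A" "f' \<in> carrier A" "g' \<in> carrier A"
    using assms by (auto simp: has_der_def)
  then show "\<And>t. f t \<oplus> g t \<in> carrier A" "f' \<oplus> g' \<in> carrier A" by auto
  let ?q = "\<lambda>f f' y. cnorm A ((f y \<ominus> f x) \<ominus> scale A (of_real (y - x)) f') / \<bar>y - x\<bar>"
  have "((\<lambda>y. ?q f f' y + ?q g g' y) \<longlongrightarrow> 0 + 0) (at x)"
    using assms by (intro tendsto_add) (auto simp: has_der_def)
  then show "((\<lambda>y. ?q f f' y + ?q g g' y) \<longlongrightarrow> 0) (at x)" by simp
  show "?q (\<lambda>t. f t \<oplus> g t) (f' \<oplus> g') y \<le> ?q f f' y + ?q g g' y" for y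
  proof -
    have "(f y \<oplus> g y) \<ominus> (f x \<oplus> g x) \<ominus> scale A (of_real (y - x)) (f' \<oplus> g')
       = (f y \<ominus> f x \<ominus> scale A (of_real (y - x)) f') \<oplus> (g y \<ominus> g x \<ominus> scale A (of_real (y - x)) g')"
      using c by (simp add: scale_add_right minus_add_distrib)
    then show ?thesis
      using c cnorm_triangle[of "f y \<ominus> f x \<ominus> scale A (of_real (y - x)) f'" "g y \<ominus> g x \<ominus> scale A (of_real (y - x)) g'"]
      by (simp add: divide_right_mono add_divide_distrib[symmetric])
  qed
qed

lemma has_der_finsum:
  assumes "finite S" "\<And>s. s \<in> S \<Longrightarrow> has_der (f s) (f' s) x"
  shows "has_der (\<lambda>t. \<Oplus>s\<in>S. f s t) (\<Oplus>s\<in>S. f' s) x"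
  using assms
proof (induction S)
  case empty
  then show ?case using has_der_const[of \<zero>] by simp
next
  case (insert s S)
  then have "has_der (\<lambda>t. f s t \<oplus> (\<Oplus>s\<in>S. f s t)) (f' s \<oplus> (\<Oplus>s\<in>S. f' s)) x"
    by (intro has_der_add) auto
  moreover have "\<And>t. (\<lambda>s. f s t) \<in> S \<rightarrow> carrier A" "\<And>t. f s t \<in> carrier A"
    "f' \<in> S \<rightarrow> carrier A" "f' s \<in> carrier A"
    using insert.prems has_der_closed by blast+
  ultimately show ?case using insert.hyps by simp
qed

lemma has_der_continuous:
  assumes "has_der f f' x" shows "((\<lambda>y. cnorm A (f y \<ominus> f x)) \<longlongrightarrow> 0) (at x)"
proof -
  have c: "\<And>t. f t \<in> carrier A" "f' \<in> carrier A" using assms by (auto simp: has_der_def)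
  let ?q = "\<lambda>y. cnorm A ((f y \<ominus> f x) \<ominus> scale A (of_real (y - x)) f') / \<bar>y - x\<bar>"
  have "((\<lambda>y. \<bar>y - x\<bar> * (cnorm A f' + ?q y)) \<longlongrightarrow> \<bar>x - x\<bar> * (cnorm A f' + 0)) (at x)"
    using assms by (intro tendsto_intros) (auto simp: has_der_def)
  then have lim: "((\<lambda>y. \<bar>y - x\<bar> * (cnorm A f' + ?q y)) \<longlongrightarrow> 0) (at x)" by simp
  have "cnorm A (f y \<ominus> f x) \<le> \<bar>y - x\<bar> * (cnorm A f' + ?q y)" if "y \<noteq> x" for y
  proof -
    have "cnorm A (f y \<ominus> f x) \<le> cnorm A (scale A (of_real (y - x)) f') + cnorm A ((f y \<ominus> f x) \<ominus> scale A (of_real (y - x)) f')"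
      using c by (intro cnorm_le_add_diff) auto
    also have "cnorm A (scale A (of_real (y - x)) f') = \<bar>y - x\<bar> * cnorm A f'"
      unfolding cnorm_scale[OF c(2)] norm_of_real by simp
    finally show ?thesis using that by (simp add: distrib_left)
  qed
  then show ?thesis
    using c by (intro tendsto_sandwich[OF _ _ tendsto_const lim])
      (auto simp: eventually_at cnorm_nonneg intro!: exI[of _ 1])
qed

lemma has_der_mult:
  assumes "has_der f f' x" "has_der g g' x"
  shows "has_der (\<lambda>t. f t \<otimes> g t) (f' \<otimes> g x \<oplus> f x \<otimes> g') x"
proof (rule has_derI_bound)
  have c: "\<And>t. f t \<in> carrier A" "\<And>t. g t \<in> carrier A" "f' \<in> carrier A" "g' \<in> carrier A"
    using assms by (auto simp: has_der_def)
  then show "\<And>t. f t \<otimes> g t \<in> carrier A" "f' \<otimes> g x \<oplus> f x \<otimes> g' \<in> carrier A" by auto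
  let ?q = "\<lambda>f f' y. cnorm A ((f y \<ominus> f x) \<ominus> scale A (of_real (y - x)) f') / \<bar>y - x\<bar>"
  let ?b = "\<lambda>y. ?q f f' y * (cnorm A (g x) + cnorm A (g y \<ominus> g x)) + (cnorm A f' * cnorm A (g y \<ominus> g x)
     + cnorm A (f x) * ?q g g' y)"
  have "(?b \<longlongrightarrow> 0 * (cnorm A (g x) + 0) + (cnorm A f' * 0 + cnorm A (f x) * 0)) (at x)"
    using assms has_der_continuous[OF assms(2)] by (intro tendsto_intros) (auto simp: has_der_def)
  then show "(?b \<longlongrightarrow> 0) (at x)" by simp
  fix y assume "y \<noteq> x"
  let ?h = "of_real (y - x) :: complex"
  \<comment> \<open>The remainder of the product consists of the remainder of f times g y, of a
    product of the two increments up to the remainder of f, and of f x times the remainder of g;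
    each is small compared with y - x.\<close>
  have eq: "f y \<otimes> g y \<ominus> f x \<otimes> g x \<ominus> scale A ?h (f' \<otimes> g x \<oplus> f x \<otimes> g')
     = (f y \<ominus> f x \<ominus> scale A ?h f') \<otimes> g y \<oplus> (scale A ?h f' \<otimes> (g y \<ominus> g x) \<oplus> f x \<otimes> (g y \<ominus> g x \<ominus> scale A ?h g'))"
  proof -
    have "(f y \<ominus> f x \<ominus> scale A ?h f') \<otimes> g y = (f y \<otimes> g y \<ominus> f x \<otimes> g y) \<ominus> scale A ?h (f' \<otimes> g y)"
      using c by (simp add: minus_mult scale_mult_left)
    moreover have "scale A ?h f' \<otimes> (g y \<ominus> g x) = scale A ?h (f' \<otimes> g y) \<ominus> scale A ?h (f' \<otimes> g x)"
      using c by (simp add: minus_mult scale_mult_left)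
    moreover have "f x \<otimes> (g y \<ominus> g x \<ominus> scale A ?h g') = (f x \<otimes> g y \<ominus> f x \<otimes> g x) \<ominus> scale A ?h (f x \<otimes> g')"
      using c by (simp add: minus_mult scale_mult_right)
    moreover have "(p \<ominus> q \<ominus> r) \<oplus> ((r \<ominus> s) \<oplus> ((q \<ominus> u) \<ominus> v)) = p \<ominus> u \<ominus> (s \<oplus> v)"
      if "p \<in> carrier A" "q \<in> carrier A" "r \<in> carrier A" "s \<in> carrier A" "u \<in> carrier A" "v \<in> carrier A" for p q r s u v
    proof -
      have "(p \<ominus> q \<ominus> r) \<oplus> ((r \<ominus> s) \<oplus> ((q \<ominus> u) \<ominus> v)) = ((p \<ominus> q \<ominus> r) \<oplus> (r \<ominus> s)) \<oplus> ((q \<ominus> u) \<ominus> v)"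
        using that by (simp add: a_assoc)
      also have "(p \<ominus> q \<ominus> r) \<oplus> (r \<ominus> s) = p \<ominus> q \<ominus> s" using that by (simp add: minus_trans)
      also have "(p \<ominus> q \<ominus> s) \<oplus> ((q \<ominus> u) \<ominus> v) = ((p \<ominus> q) \<oplus> (q \<ominus> u)) \<ominus> (s \<oplus> v)"
        using that by (simp add: minus_add_distrib)
      also have "(p \<ominus> q) \<oplus> (q \<ominus> u) = p \<ominus> u" using that by (simp add: minus_trans)
      finally show ?thesis .
    qed
    ultimately show ?thesis
      using c by (simp add: scale_add_right)
  qed
  have "cnorm A (f y \<otimes> g y \<ominus> f x \<otimes> g x \<ominus> scale A ?h (f' \<otimes> g x \<oplus> f x \<otimes> g'))
     \<le> cnorm A ((f y \<ominus> f x \<ominus> scale A ?h f') \<otimes> g y) + (cnorm A (scale A ?h f' \<otimes> (g y \<ominus> g x))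
       + cnorm A (f x \<otimes> (g y \<ominus> g x \<ominus> scale A ?h g')))"
    unfolding eq using c by (intro order_trans[OF cnorm_triangle] add_mono order_refl cnorm_triangle) auto
  also have "\<dots> \<le> cnorm A (f y \<ominus> f x \<ominus> scale A ?h f') * (cnorm A (g x) + cnorm A (g y \<ominus> g x))
       + (\<bar>y - x\<bar> * cnorm A f' * cnorm A (g y \<ominus> g x) + cnorm A (f x) * cnorm A (g y \<ominus> g x \<ominus> scale A ?h g'))"
  proof (intro add_mono)
    show "cnorm A ((f y \<ominus> f x \<ominus> scale A ?h f') \<otimes> g y)
       \<le> cnorm A (f y \<ominus> f x \<ominus> scale A ?h f') * (cnorm A (g x) + cnorm A (g y \<ominus> g x))"
      using c by (intro cnorm_mult_le cnorm_le_add_diff) auto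
    have "cnorm A (scale A ?h f') = \<bar>y - x\<bar> * cnorm A f'"
      unfolding cnorm_scale[OF c(3)] norm_of_real by simp
    then show "cnorm A (scale A ?h f' \<otimes> (g y \<ominus> g x)) \<le> \<bar>y - x\<bar> * cnorm A f' * cnorm A (g y \<ominus> g x)"
      using c by (intro cnorm_mult_le) auto
    show "cnorm A (f x \<otimes> (g y \<ominus> g x \<ominus> scale A ?h g')) \<le> cnorm A (f x) * cnorm A (g y \<ominus> g x \<ominus> scale A ?h g')"
      using c by (intro cnorm_mult) auto
  qed
  finally have le: "cnorm A (f y \<otimes> g y \<ominus> f x \<otimes> g x \<ominus> scale A ?h (f' \<otimes> g x \<oplus> f x \<otimes> g')) \<le> \<dots>" .
  have "X / h \<le> P / h * (G + E) + (F * E + C * (R / h))"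
    if "X \<le> P * (G + E) + (h * F * E + C * R)" "h > 0" for X P G E F C R h :: real
    using divide_right_mono[OF that(1), of h] that(2) by (simp add: add_divide_distrib)
  from this[OF le] show "?q (\<lambda>t. f t \<otimes> g t) (f' \<otimes> g x \<oplus> f x \<otimes> g') y \<le> ?b y"
    using \<open>y \<noteq> x\<close> by simp
qed

lemma pow_mult_commute: "x \<in> carrier A \<Longrightarrow> x [^] (m::nat) \<otimes> x [^] (n::nat) = x [^] (m + n)"
  by (rule nat_pow_mult)

end

lemma of_real_has_vector_derivative: "((of_real :: real \<Rightarrow> complex) has_vector_derivative 1) (at t)"
  by (simp add: has_vector_derivative_def scaleR_conv_of_real bounded_linear_imp_has_derivative
      bounded_linear_of_real)

context tracial_banach_algebra
begin

lemma has_der_trace: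
  assumes "has_der f f' x" shows "((\<lambda>t. \<tau> (f t)) has_vector_derivative \<tau> f') (at x)"
  unfolding has_vector_derivative_def has_derivative_iff_norm
proof (intro conjI)
  show "bounded_linear (\<lambda>h. h *\<^sub>R \<tau> f')" by (rule bounded_linear_scaleR_left)
  have c: "\<And>t. f t \<in> carrier A" "f' \<in> carrier A" using assms by (auto simp: has_der_def)
  let ?q = "\<lambda>y. cnorm A ((f y \<ominus> f x) \<ominus> scale A (of_real (y - x)) f') / \<bar>y - x\<bar>"
  have "((\<lambda>y. trace_bd * ?q y) \<longlongrightarrow> trace_bd * 0) (at x)"
    using assms by (intro tendsto_intros) (auto simp: has_der_def)
  then have lim: "((\<lambda>y. trace_bd * ?q y) \<longlongrightarrow> 0) (at x)" by simp
  show "((\<lambda>y. norm (\<tau> (f y) - \<tau> (f x) - (y - x) *\<^sub>R \<tau> f') / norm (y - x)) \<longlongrightarrow> 0) (at x)"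
  proof (rule tendsto_sandwich[OF _ _ tendsto_const lim]; intro always_eventually allI)
    fix y
    have "\<tau> (f y) - \<tau> (f x) - (y - x) *\<^sub>R \<tau> f' = \<tau> ((f y \<ominus> f x) \<ominus> scale A (of_real (y - x)) f')"
      using c by (simp add: trace_diff trace_scale scaleR_conv_of_real)
    then have "norm (\<tau> (f y) - \<tau> (f x) - (y - x) *\<^sub>R \<tau> f')
        \<le> trace_bd * cnorm A ((f y \<ominus> f x) \<ominus> scale A (of_real (y - x)) f')"
      using c by (simp only: trace_bd minus_closed scale_closed)
    then show "norm (\<tau> (f y) - \<tau> (f x) - (y - x) *\<^sub>R \<tau> f') / norm (y - x) \<le> trace_bd * ?q y"
      by (simp add: divide_right_mono)
  qed simp
qed

text \<open>Without commutativity the derivative d of a power is a sum of terms in which f' stands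
  between powers of f. Paired with a further power of f under the trace they all become equal. The
  additional exponent m carries the induction. The truncated subtraction is harmless: it can matter
  only for n = 0, where the factor n vanishes.\<close>

lemma has_der_pow:
  assumes "has_der f f' x"
  shows "\<exists>d. has_der (\<lambda>t. f t [^] (n::nat)) d x \<and>
     (\<forall>m::nat. \<tau> (d \<otimes> f x [^] m) = of_nat n * \<tau> (f x [^] (n + m - 1) \<otimes> f'))"
proof (induction n)
  case 0
  have "has_der (\<lambda>t. f t [^] (0::nat)) \<zero> x" using has_der_const[of \<one>] by simp
  then show ?case using assms by (intro exI[of _ \<zero>]) (simp add: has_der_closed)
next
  case (Suc n)
  have c: "\<And>t. f t \<in> carrier A" "f' \<in> carrier A" using assms by (auto simp: has_der_def)
  from Suc obtain d where d: "has_der (\<lambda>t. f t [^] n) d x"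
    "\<And>m::nat. \<tau> (d \<otimes> f x [^] m) = of_nat n * \<tau> (f x [^] (n + m - 1) \<otimes> f')" by blast
  have dc: "d \<in> carrier A" using d by (simp add: has_der_def)
  let ?e = "d \<otimes> f x \<oplus> f x [^] n \<otimes> f'"
  have "has_der (\<lambda>t. f t [^] Suc n) ?e x"
    using has_der_mult[OF d(1) assms] by simp
  moreover have "\<tau> (?e \<otimes> f x [^] m) = of_nat (Suc n) * \<tau> (f x [^] (Suc n + m - 1) \<otimes> f')" for m :: nat
  proof -
    have "\<tau> (?e \<otimes> f x [^] m) = \<tau> (d \<otimes> f x [^] Suc m) + \<tau> (f x [^] n \<otimes> f' \<otimes> f x [^] m)"
      using c dc pow_Suc_left[OF c(1), of x m] by (simp add: l_distr trace_add m_assoc)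
    also have "\<tau> (f x [^] n \<otimes> f' \<otimes> f x [^] m) = \<tau> (f x [^] (n + m) \<otimes> f')"
    proof -
      have "\<tau> (f x [^] n \<otimes> f' \<otimes> f x [^] m) = \<tau> (f x [^] m \<otimes> (f x [^] n \<otimes> f'))"
        using c by (intro trace_commute) auto
      also have "f x [^] m \<otimes> (f x [^] n \<otimes> f') = f x [^] (n + m) \<otimes> f'"
        using c by (simp add: m_assoc[symmetric] pow_mult_commute add.commute)
      finally show ?thesis .
    qed
    finally show ?thesis using d(2)[of "Suc m"] by (simp add: algebra_simps)
  qed
  ultimately show ?case by blast
qed

lemma has_vector_derivative_trace_pow:
  assumes "has_der f f' x"
  shows "((\<lambda>t. \<tau> (f t [^] Suc n)) has_vector_derivative of_nat (Suc n) * \<tau> (f x [^] n \<otimes> f')) (at x)"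
proof -
  obtain d where d: "has_der (\<lambda>t. f t [^] Suc n) d x"
     "\<And>m::nat. \<tau> (d \<otimes> f x [^] m) = of_nat (Suc n) * \<tau> (f x [^] (Suc n + m - 1) \<otimes> f')"
    using has_der_pow[OF assms, of "Suc n"] by blast
  have "d \<in> carrier A" using d by (simp add: has_der_def)
  then have "\<tau> d = of_nat (Suc n) * \<tau> (f x [^] n \<otimes> f')" using d(2)[of 0] by simp
  then show ?thesis using has_der_trace[OF d(1)] by simp
qed

text \<open>The trace of the logarithm as a scalar series; differentiating it never involves the
  logarithm itself, which would not differentiate termwise in a simple way. Agreement with
  \<open>clog\<close> is \<open>trace_clog\<close>.\<close>

definition tlog :: "'a \<Rightarrow> complex" where
  "tlog u = - (\<Sum>k. \<tau> ((\<one> \<ominus> u) [^] Suc k) / of_nat (Suc k))"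

lemma tlog_term_bound:
  assumes "y \<in> carrier A" "cnorm A y \<le> r" and T: "\<And>x. x \<in> carrier A \<Longrightarrow> cmod (\<tau> x) \<le> T * cnorm A x" "0 \<le> T"
  shows "cmod (\<tau> (y [^] Suc k) / of_nat (Suc k)) \<le> T * r * r ^ k"
proof -
  have "cmod (\<tau> (y [^] Suc k) / of_nat (Suc k)) \<le> cmod (\<tau> (y [^] Suc k))"
    using divide_left_mono[of 1 "real (Suc k)" "cmod (\<tau> (y [^] Suc k))"]
    by (simp add: norm_divide del: of_nat_Suc nat_pow_Suc)
  also have "\<dots> \<le> T * cnorm A (y [^] Suc k)" using assms by (intro T) auto
  also have "\<dots> \<le> T * r ^ Suc k" using assms by (intro mult_left_mono cnorm_pow_le) auto
  finally show ?thesis by (simp add: mult.assoc)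
qed

lemma tlog_summable:
  assumes "y \<in> carrier A" "cnorm A y < 1"
  shows "summable (\<lambda>k. \<tau> (y [^] Suc k) / of_nat (Suc k))"
proof (rule summable_comparison_test')
  show "summable (\<lambda>k. trace_bd * cnorm A y * cnorm A y ^ k)"
    using assms cnorm_nonneg by (intro summable_mult summable_geometric) auto
  show "norm (\<tau> (y [^] Suc k) / of_nat (Suc k)) \<le> trace_bd * cnorm A y * cnorm A y ^ k" for k
    using assms trace_bd by (intro tlog_term_bound) auto
qed

text \<open>The factor 2 bounds the geometric series 1 / (1 - r) for r at most 1 / 2. The constant T
  is left open so that one value can serve all algebras of a sequence.\<close>

lemma tlog_bound:
  assumes u: "u \<in> carrier A" "cnorm A (\<one> \<ominus> u) \<le> 1 / 2"
    and T: "\<And>x. x \<in> carrier A \<Longrightarrow> cmod (\<tau> x) \<le> T * cnorm A x" "0 \<le> T"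
  shows "cmod (tlog u) \<le> 2 * T * cnorm A (\<one> \<ominus> u)"
proof -
  let ?r = "cnorm A (\<one> \<ominus> u)"
  have r: "0 \<le> ?r" using u cnorm_nonneg by auto
  have s: "summable (\<lambda>k. T * ?r * ?r ^ k)"
    using r u by (intro summable_mult summable_geometric) auto
  have "cmod (\<Sum>k. \<tau> ((\<one> \<ominus> u) [^] Suc k) / of_nat (Suc k)) \<le> (\<Sum>k. T * ?r * ?r ^ k)"
    using u T by (intro norm_suminf_le s tlog_term_bound) auto
  also have "\<dots> = T * ?r * (1 / (1 - ?r))"
    using r u suminf_geometric[of ?r] by (subst suminf_mult) auto
  also have "\<dots> \<le> T * ?r * 2"
    using r u T by (intro mult_left_mono mult_nonneg_nonneg) (auto simp: field_simps)
  finally show ?thesis by (simp add: tlog_def mult_ac)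
qed

lemma tlog_one [simp]: "tlog \<one> = 0"
proof -
  have "\<tau> ((\<one> \<ominus> \<one>) [^] Suc k) / of_nat (Suc k) = 0" for k by simp
  then show ?thesis unfolding tlog_def by simp
qed

lemma tlog_conj:
  assumes c: "u \<in> carrier A" "v \<in> carrier A" "w \<in> carrier A" and vw: "v \<otimes> w = \<one>" "w \<otimes> v = \<one>"
  shows "tlog (v \<otimes> u \<otimes> w) = tlog u"
proof -
  have one: "\<one> \<ominus> v \<otimes> u \<otimes> w = v \<otimes> (\<one> \<ominus> u) \<otimes> w"
    using c vw by (simp add: minus_mult)
  have pow: "(v \<otimes> y \<otimes> w) [^] k = v \<otimes> y [^] k \<otimes> w" if "y \<in> carrier A" for k :: nat and y
  proof (induction k)
    case 0
    then show ?case using c vw by simp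
  next
    case (Suc k)
    have "v \<otimes> y [^] k \<otimes> w \<otimes> (v \<otimes> y \<otimes> w) = v \<otimes> y [^] k \<otimes> (w \<otimes> v) \<otimes> y \<otimes> w"
      using c that by (simp add: m_assoc)
    then show ?case using Suc c that vw by (simp add: m_assoc)
  qed
  have "\<tau> (v \<otimes> y \<otimes> w) = \<tau> y" if "y \<in> carrier A" for y
    using trace_commute[of "v \<otimes> y" w] that c vw by (simp add: m_assoc[symmetric])
  then have "\<tau> ((\<one> \<ominus> v \<otimes> u \<otimes> w) [^] k) = \<tau> ((\<one> \<ominus> u) [^] k)" for k :: nat
    unfolding one using c by (simp add: pow)
  then show ?thesis unfolding tlog_def by (simp only:)
qed

text \<open>Under the trace the powers of 1 - Y differentiate as if everything commuted, and the
  series of derivatives is the Neumann series of the inverse of Y applied to Y'. So the trace of the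
  logarithm is a primitive of the trace of the logarithmic derivative. Any left inverse Z is
  allowed, so that no regularity of the inverse has to be established.\<close>

lemma tlog_has_integral:
  assumes ab: "a \<le> b" and Y: "\<And>t. t \<in> {a..b} \<Longrightarrow> has_der Y (Y' t) t"
    and near: "\<And>t. t \<in> {a..b} \<Longrightarrow> cnorm A (\<one> \<ominus> Y t) \<le> r" "r < 1"
    and bd: "\<And>t. t \<in> {a..b} \<Longrightarrow> cnorm A (Y' t) \<le> M"
    and Z: "\<And>t. t \<in> {a..b} \<Longrightarrow> Z t \<in> carrier A" "\<And>t. t \<in> {a..b} \<Longrightarrow> Z t \<otimes> Y t = \<one>"
  shows "((\<lambda>t. \<tau> (Z t \<otimes> Y' t)) has_integral (tlog (Y b) - tlog (Y a))) {a..b}"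
proof -
  have Yc: "Y t \<in> carrier A" for t using Y[of a] ab has_der_closed(1) by auto
  have Y'c: "Y' t \<in> carrier A" if "t \<in> {a..b}" for t using Y[OF that] by (simp add: has_der_def)
  have r0: "0 \<le> r" using near(1)[of a] ab cnorm_nonneg[of "\<one> \<ominus> Y a"] Yc by auto
  have M0: "0 \<le> M" using bd[of a] ab cnorm_nonneg[OF Y'c, of a] by auto
  let ?f = "\<lambda>n t. - \<tau> ((\<one> \<ominus> Y t) [^] Suc n) / of_nat (Suc n)"
  let ?a = "\<lambda>(n::nat) t. \<tau> ((\<one> \<ominus> Y t) [^] n \<otimes> Y' t)"
  have abd: "cmod (?a n t) \<le> trace_bd * M * r ^ n" if "t \<in> {a..b}" for n t
  proof -
    have "cmod (?a n t) \<le> trace_bd * (r ^ n * M)"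
      using Yc Y'c that near bd by (intro trace_bd_le cnorm_mult_le cnorm_pow_le) auto
    then show ?thesis by (simp add: mult_ac)
  qed
  have sums: "(\<lambda>n. ?a n t) sums \<tau> (Z t \<otimes> Y' t)" if t: "t \<in> {a..b}" for t
  proof -
    obtain z where z: "z \<in> carrier A" "(\<one> \<ominus> (\<one> \<ominus> Y t)) \<otimes> z = \<one>"
      "tends (\<lambda>n. \<Oplus>k\<in>{..<n}. (\<one> \<ominus> Y t) [^] k) z"
      using neumann[of "\<one> \<ominus> Y t" r] near t Yc by auto
    have "\<one> \<ominus> (\<one> \<ominus> Y t) = Y t" using Yc by (simp add: minus_add_cancel)
    \<comment> \<open>A left inverse agrees with the two-sided Neumann inverse and is therefore the
      sum of that series.\<close>
    then have "Z t = z"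
      using z Z[OF t] Yc[of t] m_assoc[of "Z t" "Y t" z] by simp
    then have "(\<lambda>n. \<tau> ((\<Oplus>k\<in>{..<n}. (\<one> \<ominus> Y t) [^] k) \<otimes> Y' t)) \<longlonglongrightarrow> \<tau> (Z t \<otimes> Y' t)"
      using tends_trace[OF tends_mult_right[OF z(3) Y'c[OF t]]] by simp
    moreover have "\<tau> ((\<Oplus>k\<in>{..<n}. (\<one> \<ominus> Y t) [^] k) \<otimes> Y' t) = (\<Sum>k<n. ?a k t)" for n :: nat
    proof -
      have p: "(\<one> \<ominus> Y t) [^] k \<in> carrier A" for k :: nat using Yc by simp
      have c1: "(\<lambda>k. (\<one> \<ominus> Y t) [^] k) \<in> {..<n} \<rightarrow> carrier A" by (intro Pi_I p)
      have c2: "(\<lambda>k. (\<one> \<ominus> Y t) [^] k \<otimes> Y' t) \<in> {..<n} \<rightarrow> carrier A"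
        by (intro Pi_I m_closed p Y'c[OF t])
      show ?thesis
        unfolding finsum_ldistr[OF finite_lessThan Y'c[OF t] c1] by (rule trace_finsum[OF finite_lessThan c2])
    qed
    ultimately show ?thesis by (simp add: sums_def)
  qed
  \<comment> \<open>A tail bound independent of t is what differentiation under the sum requires; it
    comes from the common radius r < 1.\<close>
  have tail: "cmod ((\<Sum>i<n. ?a i t) - \<tau> (Z t \<otimes> Y' t)) \<le> trace_bd * M / (1 - r) * r ^ n"
    if t: "t \<in> {a..b}" for n t
  proof -
    have "(\<lambda>i. ?a (i + n) t) sums (\<tau> (Z t \<otimes> Y' t) - (\<Sum>i<n. ?a i t))"
      using sums[OF t] by (rule sums_split_initial_segment)
    then have eq: "\<tau> (Z t \<otimes> Y' t) - (\<Sum>i<n. ?a i t) = (\<Sum>i. ?a (i + n) t)" by (simp add: sums_iff)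
    have s: "summable (\<lambda>i. trace_bd * M * r ^ n * r ^ i)"
      using r0 near(2) by (intro summable_mult summable_geometric) auto
    have "cmod (?a (i + n) t) \<le> trace_bd * M * r ^ n * r ^ i" for i
      using abd[OF t, of "i + n"] by (simp add: power_add mult_ac)
    then have "cmod (\<Sum>i. ?a (i + n) t) \<le> (\<Sum>i. trace_bd * M * r ^ n * r ^ i)"
      by (intro norm_suminf_le s)
    also have "\<dots> = trace_bd * M * r ^ n * (1 / (1 - r))"
      using r0 near(2) suminf_geometric[of r] by (subst suminf_mult) auto
    finally show ?thesis
      using norm_minus_commute[of "\<Sum>i<n. ?a i t" "\<tau> (Z t \<otimes> Y' t)"] unfolding eq by simp
  qed
  have fsums: "(\<lambda>n. ?f n t) sums tlog (Y t)" if t: "t \<in> {a..b}" for t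
  proof -
    have "summable (\<lambda>k. \<tau> ((\<one> \<ominus> Y t) [^] Suc k) / of_nat (Suc k))"
      using near(1)[OF t] near(2) Yc by (intro tlog_summable) auto
    then have "(\<lambda>k. - (\<tau> ((\<one> \<ominus> Y t) [^] Suc k) / of_nat (Suc k))) sums tlog (Y t)"
      unfolding tlog_def by (intro sums_minus summable_sums)
    then show ?thesis by simp
  qed
  have "\<exists>g. \<forall>x\<in>{a..b}. (\<lambda>n. ?f n x) sums g x \<and>
      (g has_derivative (\<lambda>h. h *\<^sub>R \<tau> (Z x \<otimes> Y' x))) (at x within {a..b})"
  proof (rule has_derivative_series)
    fix n t assume t: "t \<in> {a..b}"
    have "has_der (\<lambda>t. \<one> \<oplus> scale A (-1) (Y t)) (\<zero> \<oplus> (scale A 0 (Y t) \<oplus> scale A (-1) (Y' t))) t"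
    proof (intro has_der_add has_der_const one_closed)
      have "has_der (\<lambda>t. scale A (-1) \<one> \<otimes> Y t) (\<zero> \<otimes> Y t \<oplus> scale A (-1) \<one> \<otimes> Y' t) t"
        by (intro has_der_mult has_der_const Y t) auto
      then show "has_der (\<lambda>t. scale A (-1) (Y t)) (scale A 0 (Y t) \<oplus> scale A (-1) (Y' t)) t"
        using Yc Y'c[OF t] by (simp add: scale_mult_left)
    qed
    then have "has_der (\<lambda>t. \<one> \<ominus> Y t) (\<ominus> Y' t) t"
      using Yc Y'c[OF t] by (simp add: a_minus_def minus_eq_scale)
    from has_vector_derivative_trace_pow[OF this, of n]
    have "((\<lambda>t. - \<tau> ((\<one> \<ominus> Y t) [^] Suc n) / of_nat (Suc n)) has_vector_derivative
        (- (of_nat (Suc n) * \<tau> ((\<one> \<ominus> Y t) [^] n \<otimes> \<ominus> Y' t)) / of_nat (Suc n))) (at t)"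
      by (intro derivative_intros)
    moreover have "- (of_nat (Suc n) * \<tau> ((\<one> \<ominus> Y t) [^] n \<otimes> \<ominus> Y' t)) / of_nat (Suc n) = ?a n t"
      using Yc Y'c[OF t] by (simp add: r_minus trace_minus del: of_nat_Suc)
    ultimately have "(?f n has_vector_derivative ?a n t) (at t)" by (simp only:)
    then show "(?f n has_derivative (\<lambda>h. h *\<^sub>R ?a n t)) (at t within {a..b})"
      unfolding has_vector_derivative_def by (rule has_derivative_at_withinI)
  next
    fix e :: real assume e: "0 < e"
    have "(\<lambda>n. trace_bd * M / (1 - r) * r ^ n) \<longlonglongrightarrow> trace_bd * M / (1 - r) * 0"
      using r0 near(2) by (intro tendsto_intros LIMSEQ_realpow_zero)
    then have "\<forall>\<^sub>F n in sequentially. trace_bd * M / (1 - r) * r ^ n < e"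
      using e by (intro order_tendstoD(2)) auto
    then show "\<forall>\<^sub>F n in sequentially. \<forall>x\<in>{a..b}. \<forall>h.
        norm ((\<Sum>i<n. h *\<^sub>R ?a i x) - h *\<^sub>R \<tau> (Z x \<otimes> Y' x)) \<le> e * norm h"
    proof eventually_elim
      case (elim n)
      show ?case
      proof (intro ballI allI)
        fix x h assume x: "x \<in> {a..b}"
        have "norm ((\<Sum>i<n. h *\<^sub>R ?a i x) - h *\<^sub>R \<tau> (Z x \<otimes> Y' x))
            = \<bar>h\<bar> * cmod ((\<Sum>i<n. ?a i x) - \<tau> (Z x \<otimes> Y' x))"
          by (simp add: scaleR_sum_right[symmetric] scaleR_diff_right[symmetric])
        also have "\<dots> \<le> \<bar>h\<bar> * e"
          using tail[OF x, of n] elim by (intro mult_left_mono) auto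
        finally show "norm ((\<Sum>i<n. h *\<^sub>R ?a i x) - h *\<^sub>R \<tau> (Z x \<otimes> Y' x)) \<le> e * norm h"
          by (simp add: mult.commute)
      qed
    qed
  qed (use ab fsums[of a] in auto)
  then obtain g where g: "\<And>x. x \<in> {a..b} \<Longrightarrow> (\<lambda>n. ?f n x) sums g x"
    "\<And>x. x \<in> {a..b} \<Longrightarrow> (g has_derivative (\<lambda>h. h *\<^sub>R \<tau> (Z x \<otimes> Y' x))) (at x within {a..b})"
    by blast
  have "g x = tlog (Y x)" if "x \<in> {a..b}" for x
    using g(1)[OF that] fsums[OF that] by (rule sums_unique2)
  moreover have "((\<lambda>t. \<tau> (Z t \<otimes> Y' t)) has_integral (g b - g a)) {a..b}"
    using g(2) by (intro fundamental_theorem_of_calculus ab) (simp add: has_vector_derivative_def)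
  ultimately show ?thesis using ab by simp
qed

text \<open>Along the segment Y from 1 to a, the functions tlog (Y t) and tlog (Y t b) have the same
  derivative, as b cancels under the trace. Their increments from t = 0 to t = 1 are tlog a and tlog
  (a b) - tlog b.\<close>

lemma tlog_mult:
  assumes a: "a \<in> carrier A" "cnorm A (\<one> \<ominus> a) \<le> 1 / 4" and b: "b \<in> carrier A" "cnorm A (\<one> \<ominus> b) \<le> 1 / 4"
  shows "tlog (a \<otimes> b) = tlog a + tlog b"
proof -
  define Y where "Y = (\<lambda>t::real. \<one> \<oplus> scale A (of_real t) (a \<ominus> \<one>))"
  have Yc: "Y t \<in> carrier A" for t using a by (simp add: Y_def)
  have Y1: "\<one> \<ominus> Y t = scale A (of_real t) (\<one> \<ominus> a)" for t
  proof -
    have "\<one> \<ominus> Y t = \<ominus> scale A (of_real t) (a \<ominus> \<one>)"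
      using a by (simp add: Y_def a_minus_def minus_add r_neg2)
    also have "\<dots> = scale A (of_real t) (\<ominus> (a \<ominus> \<one>))" using a by (simp add: scale_minus_right)
    also have "\<ominus> (a \<ominus> \<one>) = \<one> \<ominus> a" using a by (simp add: a_minus_def minus_add a_comm)
    finally show ?thesis .
  qed
  have near: "cnorm A (\<one> \<ominus> Y t) \<le> 1 / 4" if "t \<in> {0..1}" for t
  proof -
    have "cnorm A (\<one> \<ominus> Y t) = \<bar>t\<bar> * cnorm A (\<one> \<ominus> a)"
      unfolding Y1 using a cnorm_scale[of "\<one> \<ominus> a" "of_real t"] by (simp only: norm_of_real minus_closed one_closed)
    also have "\<dots> \<le> 1 * (1 / 4)" using that a cnorm_nonneg by (intro mult_mono) auto
    finally show ?thesis by simp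
  qed
  have "\<exists>z\<in>carrier A. z \<otimes> Y t = \<one>" if "t \<in> {0..1}" for t
    using neumann[of "\<one> \<ominus> Y t" "1 / 4"] near[OF that] Yc[of t] by (auto simp: minus_add_cancel)
  then obtain Z where Z: "\<And>t. t \<in> {0..1} \<Longrightarrow> Z t \<in> carrier A" "\<And>t. t \<in> {0..1} \<Longrightarrow> Z t \<otimes> Y t = \<one>"
    by metis
  obtain c where c: "c \<in> carrier A" "c \<otimes> b = \<one>" "b \<otimes> c = \<one>"
    using neumann[of "\<one> \<ominus> b" "1 / 4"] b by (auto simp: minus_add_cancel)
  have der: "has_der Y (a \<ominus> \<one>) t" for t
  proof -
    have "has_der (\<lambda>t. \<one> \<oplus> scale A (of_real t) (a \<ominus> \<one>)) (\<zero> \<oplus> scale A 1 (a \<ominus> \<one>)) t"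
      using a by (intro has_der_add has_der_const has_der_scale of_real_has_vector_derivative) auto
    then show ?thesis unfolding Y_def using a by (simp add: scale_one)
  qed
  have 1: "((\<lambda>t. \<tau> (Z t \<otimes> (a \<ominus> \<one>))) has_integral (tlog (Y 1) - tlog (Y 0))) {0..1}"
    by (rule tlog_has_integral[OF _ der near _ order_refl Z]) auto
  have der2: "has_der (\<lambda>t. Y t \<otimes> b) ((a \<ominus> \<one>) \<otimes> b) t" for t
    using has_der_mult[OF der has_der_const[OF b(1)], of t] a b Yc by simp
  \<comment> \<open>The norm of b is at most 5 / 4, and 1 / 4 * 5 / 4 + 1 / 4 = 9 / 16 is still
    below 1.\<close>
  have near2: "cnorm A (\<one> \<ominus> Y t \<otimes> b) \<le> 9 / 16" if "t \<in> {0..1}" for t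
  proof -
    have "\<one> \<ominus> Y t \<otimes> b = (\<one> \<ominus> Y t) \<otimes> b \<oplus> (\<one> \<ominus> b)"
      using b Yc[of t] minus_trans[of \<one> b "Y t \<otimes> b"] by (simp add: minus_mult a_comm)
    moreover have "cnorm A b \<le> 5 / 4"
      using cnorm_le_add_diff[of b \<one>] cnorm_minus_commute[of b \<one>] b cnorm_one by simp
    ultimately show ?thesis
      using b Yc[of t] near[OF that] cnorm_triangle[of "(\<one> \<ominus> Y t) \<otimes> b" "\<one> \<ominus> b"]
        cnorm_mult_le[of "\<one> \<ominus> Y t" b "1 / 4" "5 / 4"] by simp
  qed
  have 2: "((\<lambda>t. \<tau> ((c \<otimes> Z t) \<otimes> ((a \<ominus> \<one>) \<otimes> b))) has_integral (tlog (Y 1 \<otimes> b) - tlog (Y 0 \<otimes> b))) {0..1}"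
  proof (rule tlog_has_integral[OF _ der2 near2 _ order_refl])
    show "c \<otimes> Z t \<otimes> (Y t \<otimes> b) = \<one>" if "t \<in> {0..1}" for t
    proof -
      have "c \<otimes> Z t \<otimes> (Y t \<otimes> b) = c \<otimes> (Z t \<otimes> Y t) \<otimes> b"
        using c Z(1)[OF that] Yc[of t] b by (simp add: m_assoc)
      then show ?thesis using Z(2)[OF that] c by simp
    qed
  qed (use c Z in auto)
  have eq: "\<tau> ((c \<otimes> Z t) \<otimes> ((a \<ominus> \<one>) \<otimes> b)) = \<tau> (Z t \<otimes> (a \<ominus> \<one>))" if "t \<in> {0..1}" for t
  proof -
    have "\<tau> ((c \<otimes> Z t) \<otimes> ((a \<ominus> \<one>) \<otimes> b)) = \<tau> (c \<otimes> (Z t \<otimes> (a \<ominus> \<one>) \<otimes> b))"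
      using a b c Z(1)[OF that] by (simp add: m_assoc)
    also have "\<dots> = \<tau> (Z t \<otimes> (a \<ominus> \<one>) \<otimes> b \<otimes> c)"
      using a b c Z(1)[OF that] by (intro trace_commute) auto
    also have "Z t \<otimes> (a \<ominus> \<one>) \<otimes> b \<otimes> c = Z t \<otimes> (a \<ominus> \<one>)"
      using a b c Z(1)[OF that] by (simp add: m_assoc)
    finally show ?thesis .
  qed
  have "((\<lambda>t. \<tau> (Z t \<otimes> (a \<ominus> \<one>))) has_integral (tlog (Y 1 \<otimes> b) - tlog (Y 0 \<otimes> b))) {0..1}"
    using 2 by (rule has_integral_eq[rotated]) (rule eq)
  from has_integral_unique[OF this 1] have "tlog (Y 1 \<otimes> b) - tlog (Y 0 \<otimes> b) = tlog (Y 1) - tlog (Y 0)" .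
  moreover have "Y 0 = \<one>" "Y 1 = a" using a by (simp_all add: Y_def scale_one minus_add_cancel)
  ultimately show ?thesis using b by (simp add: algebra_simps)
qed

end

text \<open>\<open>clog\<close> is a definite description of a limit in the metric topology. The
  partial sums converge in norm, which settles existence; uniqueness is that of limits in a metric
  space, and the bounded trace passes to the limit.\<close>

lemma (in tracial_cstar_algebra) trace_clog:
  assumes u: "u \<in> carrier A" "cnorm A (u \<ominus> \<one>) < 1"
  shows "\<tau> (clog A u) = tracial_banach_algebra.tlog A \<tau> u"
proof -
  interpret B: tracial_banach_algebra A \<tau> by (rule tracial_banach_algebra)
  interpret M: Metric_space "carrier A" "cdist A" by (rule Metric_space_cdist)
  let ?y = "\<one> \<ominus> u"
  have y: "?y \<in> carrier A" "cnorm A ?y < 1" using u B.cnorm_minus_commute[of u \<one>] by auto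
  let ?f = "\<lambda>k. scale A (1 / of_nat (Suc k)) (?y [^] Suc k)"
  have fc: "?f k \<in> carrier A" for k using y by auto
  have "\<exists>l. B.tends (\<lambda>n. \<Oplus>k\<in>{..<n}. ?f k) l \<and> cnorm A l \<le> (\<Sum>k. cnorm A ?y ^ Suc k)"
  proof (rule B.series_converges[OF fc])
    show "cnorm A (?f k) \<le> cnorm A ?y ^ Suc k" for k
    proof -
      have "cnorm A (?f k) = 1 / real (Suc k) * cnorm A (?y [^] Suc k)"
        using y by (subst cnorm_scale) (auto simp: norm_divide simp del: of_nat_Suc)
      also have "\<dots> \<le> 1 * cnorm A ?y ^ Suc k"
        using y B.cnorm_pow[OF y(1), of "Suc k"] cnorm_nonneg by (intro mult_mono) auto
      finally show ?thesis by simp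
    qed
    show "summable (\<lambda>k. cnorm A ?y ^ Suc k)"
      using y cnorm_nonneg[OF y(1)] summable_geometric[of "cnorm A ?y"] by (subst summable_Suc_iff) auto
  qed
  then obtain l where l: "B.tends (\<lambda>n. \<Oplus>k\<in>{..<n}. ?f k) l" by blast
  have re: "(\<Oplus>k\<in>{1..N}. scale A (1 / of_nat k) (?y [^] k)) = (\<Oplus>k\<in>{..<N}. ?f k)" for N :: nat
  proof -
    have im: "{1..N} = Suc ` {..<N}" by (auto simp: image_iff Suc_le_eq gr0_conv_Suc)
    show ?thesis unfolding im using y by (subst finsum_reindex) auto
  qed
  have lc: "l \<in> carrier A" and sc: "\<And>n. (\<Oplus>k\<in>{..<n}. ?f k) \<in> carrier A" using l by (auto simp: B.tends_def)
  let ?s = "\<lambda>N. \<ominus> (\<Oplus>k\<in>{1..N}. scale A (1 / of_nat k) (?y [^] k))"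
  have "\<ominus> (\<Oplus>k\<in>{..<n}. ?f k) \<ominus> (\<ominus> l) = \<ominus> ((\<Oplus>k\<in>{..<n}. ?f k) \<ominus> l)" for n
    using lc sc[of n] by (simp add: a_minus_def minus_add)
  then have cd: "cdist A (?s N) (\<ominus> l) = cnorm A ((\<Oplus>k\<in>{..<N}. ?f k) \<ominus> l)" for N
    unfolding re using lc sc[of N] by (simp add: cdist_def B.cnorm_minus)
  have "?s N \<in> carrier A" for N unfolding re using sc by (rule a_inv_closed)
  then have lim: "limitin M.mtopology ?s (\<ominus> l) sequentially"
    unfolding M.limitin_metric_dist_null cd using l lc by (simp only: B.tends_def a_inv_closed eventually_True simp_thms)
  have "clog A u = \<ominus> l"
    unfolding clog_def
    by (rule the_equality, rule lim) (use lim M.limitin_metric_unique in force)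
  then have "\<tau> (clog A u) = - \<tau> l" using lc by (simp add: B.trace_minus)
  moreover have "(\<lambda>n. \<tau> (\<Oplus>k\<in>{..<n}. ?f k)) \<longlonglongrightarrow> \<tau> l" using l by (rule B.tends_trace)
  moreover have "\<tau> (\<Oplus>k\<in>{..<n}. ?f k) = (\<Sum>k<n. \<tau> (?y [^] Suc k) / of_nat (Suc k))" for n
    using fc by (subst B.trace_finsum) (use y in \<open>auto simp: trace_scale\<close>)
  ultimately show ?thesis by (simp add: B.tlog_def sums_def[symmetric] sums_iff)
qed

section \<open>Trigonometric polynomials with coefficients in an algebra\<close>

lemma has_vector_derivative_cis_mult:
  "((\<lambda>t. cis (of_int m * t)) has_vector_derivative cis (of_int m * x) * (\<i> * of_int m)) (at x)"
proof -
  have "((\<lambda>z. exp (\<i> * of_int m * z)) has_field_derivative exp (\<i> * of_int m * of_real x) * (\<i> * of_int m)) (at (of_real x))"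
    by (auto intro!: derivative_eq_intros)
  from has_vector_derivative_real_field[OF this] show ?thesis
    by (simp add: cis_conv_exp mult_ac)
qed

lemma sum_cis_roots_of_unity:
  fixes k :: int
  assumes "\<bar>k\<bar> < int N"
  shows "(\<Sum>j<N. cis (of_int k * (2 * pi * real j / real N))) = (if k = 0 then of_nat N else 0)"
proof (cases "k = 0")
  case False
  let ?w = "cis (of_int k * (2 * pi / real N))"
  have N: "0 < N" using assms by linarith
  have pow: "cis (of_int k * (2 * pi * real j / real N)) = ?w ^ j" for j
    by (subst Complex.DeMoivre) (rule arg_cong[where f = cis], simp)
  have "?w \<noteq> 1"
  proof
    assume "?w = 1"
    then have "cos (of_int k * (2 * pi / real N)) = 1" by (simp add: complex_eq_iff)
    then obtain n :: int where "of_int k * (2 * pi / real N) = of_int n * 2 * pi"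
      using cos_one_2pi_int by auto
    then have "of_int k = of_int n * real N" using N by (simp add: field_simps)
    then have kn: "k = n * int N" using of_int_eq_iff[where 'a = real, of k "n * int N"] by simp
    then have "n \<noteq> 0" using False by auto
    then have "int N \<le> \<bar>k\<bar>" unfolding kn abs_mult using mult_right_mono[of 1 "\<bar>n\<bar>" "int N"] by simp
    then show False using assms by simp
  qed
  moreover have "?w ^ N = 1"
  proof -
    have "?w ^ N = cis (2 * pi * of_int k)" unfolding Complex.DeMoivre using N by (simp add: field_simps)
    also have "\<dots> = 1" by (intro cis_multiple_2pi) auto
    finally show ?thesis .
  qed
  ultimately show ?thesis
    using False geometric_sum[of ?w N] unfolding pow by simp
qed simp

context involutive_banach_algebra
begin

abbreviation ivl :: "nat \<Rightarrow> int set" where "ivl R \<equiv> {- int R..int R}"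

text \<open>The coefficients c accompany the function, since all later estimates are about
  coefficients. Their vanishing outside the range lets the degree be raised and makes them
  unique.\<close>

definition is_trig :: "nat \<Rightarrow> (real \<Rightarrow> 'a) \<Rightarrow> (int \<Rightarrow> 'a) \<Rightarrow> bool" where
  "is_trig R f c \<longleftrightarrow> (\<forall>m. c m \<in> carrier A) \<and> (\<forall>m. m \<notin> ivl R \<longrightarrow> c m = \<zero>) \<and>
     (\<forall>\<theta>. f \<theta> = (\<Oplus>m\<in>ivl R. scale A (cis (of_int m * \<theta>)) (c m)))"

text \<open>The norm of the Wiener algebra of absolutely convergent Fourier series: it is
  submultiplicative (\<open>is_trig_mult\<close>), dominates the values
  (\<open>is_trig_cnorm_le\<close>) and is unaffected by raising the degree.\<close>

definition wnorm :: "nat \<Rightarrow> (int \<Rightarrow> 'a) \<Rightarrow> real" where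
  "wnorm R c = (\<Sum>m\<in>ivl R. cnorm A (c m))"

definition conv :: "nat \<Rightarrow> (int \<Rightarrow> 'a) \<Rightarrow> (int \<Rightarrow> 'a) \<Rightarrow> int \<Rightarrow> 'a" where
  "conv R c d m = (\<Oplus>t\<in>ivl R. c t \<otimes> d (m - t))"

lemma is_trigD:
  assumes "is_trig R f c"
  shows "c m \<in> carrier A" "m \<notin> ivl R \<Longrightarrow> c m = \<zero>"
    "f \<theta> = (\<Oplus>m\<in>ivl R. scale A (cis (of_int m * \<theta>)) (c m))" "f \<theta> \<in> carrier A"
proof -
  show c: "c m \<in> carrier A" for m using assms by (simp add: is_trig_def)
  show "m \<notin> ivl R \<Longrightarrow> c m = \<zero>" using assms unfolding is_trig_def by blast
  show f: "f \<theta> = (\<Oplus>m\<in>ivl R. scale A (cis (of_int m * \<theta>)) (c m))" using assms unfolding is_trig_def by blast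
  show "f \<theta> \<in> carrier A" unfolding f using c by auto
qed

lemma wnorm_nonneg: "(\<And>m. c m \<in> carrier A) \<Longrightarrow> 0 \<le> wnorm R c"
  unfolding wnorm_def by (intro sum_nonneg cnorm_nonneg) auto

lemma is_trig_mono:
  assumes "is_trig R f c" "R \<le> S" shows "is_trig S f c" "wnorm S c = wnorm R c"
proof -
  note c = is_trigD[OF assms(1)]
  have sub: "ivl R \<subseteq> ivl S" using assms(2) by auto
  have z: "c m = \<zero>" if "m \<in> ivl S - ivl R" for m using c(2)[of m] that by blast
  have z': "c m = \<zero>" if "m \<notin> ivl S" for m using c(2)[of m] that sub by blast
  have "f \<theta> = (\<Oplus>m\<in>ivl S. scale A (cis (of_int m * \<theta>)) (c m))" for \<theta>
    unfolding c(3) by (rule add.finprod_mono_neutral_cong_left[OF _ sub]) (use z c(1) in auto)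
  then show "is_trig S f c" using c z' unfolding is_trig_def by blast
  show "wnorm S c = wnorm R c"
    unfolding wnorm_def by (rule sum.mono_neutral_right[OF _ sub]) (use z in auto)
qed

lemma is_trig_const:
  assumes "a \<in> carrier A"
  shows "is_trig R (\<lambda>_. a) (\<lambda>m. if m = 0 then a else \<zero>)" "wnorm R (\<lambda>m. if m = 0 then a else \<zero>) = cnorm A a"
proof -
  have "is_trig 0 (\<lambda>_. a) (\<lambda>m. if m = 0 then a else \<zero>)" "wnorm 0 (\<lambda>m. if m = 0 then a else \<zero>) = cnorm A a"
    using assms by (auto simp: is_trig_def wnorm_def scale_one)
  then show "is_trig R (\<lambda>_. a) (\<lambda>m. if m = 0 then a else \<zero>)" "wnorm R (\<lambda>m. if m = 0 then a else \<zero>) = cnorm A a"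
    using is_trig_mono[of 0 _ _ R] by auto
qed

lemma is_trig_add:
  assumes "is_trig R f c" "is_trig R g d"
  shows "is_trig R (\<lambda>\<theta>. f \<theta> \<oplus> g \<theta>) (\<lambda>m. c m \<oplus> d m)" "wnorm R (\<lambda>m. c m \<oplus> d m) \<le> wnorm R c + wnorm R d"
proof -
  note c = is_trigD[OF assms(1)] and d = is_trigD[OF assms(2)]
  have "f \<theta> \<oplus> g \<theta> = (\<Oplus>m\<in>ivl R. scale A (cis (of_int m * \<theta>)) (c m \<oplus> d m))" for \<theta>
    unfolding c(3) d(3) using c(1) d(1) by (simp add: scale_add_right Pi_iff)
  then show "is_trig R (\<lambda>\<theta>. f \<theta> \<oplus> g \<theta>) (\<lambda>m. c m \<oplus> d m)"
    unfolding is_trig_def using c(1,2) d(1,2) by auto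
  show "wnorm R (\<lambda>m. c m \<oplus> d m) \<le> wnorm R c + wnorm R d"
    unfolding wnorm_def sum.distrib[symmetric] using c d by (intro sum_mono cnorm_triangle)
qed

lemma is_trig_scale:
  assumes "is_trig R f c"
  shows "is_trig R (\<lambda>\<theta>. scale A a (f \<theta>)) (\<lambda>m. scale A a (c m))" "wnorm R (\<lambda>m. scale A a (c m)) = cmod a * wnorm R c"
proof -
  note c = is_trigD[OF assms(1)]
  have "scale A a (f \<theta>) = (\<Oplus>m\<in>ivl R. scale A (cis (of_int m * \<theta>)) (scale A a (c m)))" for \<theta>
    unfolding c(3) using c(1) by (simp add: scale_finsum Pi_iff scale_scale mult.commute)
  then show "is_trig R (\<lambda>\<theta>. scale A a (f \<theta>)) (\<lambda>m. scale A a (c m))"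
    unfolding is_trig_def using c(1,2) by auto
  show "wnorm R (\<lambda>m. scale A a (c m)) = cmod a * wnorm R c"
    unfolding wnorm_def sum_distrib_left using c by (simp add: cnorm_scale)
qed

lemma is_trig_diff:
  assumes "is_trig R f c" "is_trig R g d"
  shows "is_trig R (\<lambda>\<theta>. f \<theta> \<ominus> g \<theta>) (\<lambda>m. c m \<ominus> d m)" "wnorm R (\<lambda>m. c m \<ominus> d m) \<le> wnorm R c + wnorm R d"
proof -
  note c = is_trigD[OF assms(1)] and d = is_trigD[OF assms(2)]
  show "is_trig R (\<lambda>\<theta>. f \<theta> \<ominus> g \<theta>) (\<lambda>m. c m \<ominus> d m)" "wnorm R (\<lambda>m. c m \<ominus> d m) \<le> wnorm R c + wnorm R d"
    using is_trig_add[OF assms(1) is_trig_scale(1)[OF assms(2), of "-1"]] is_trig_scale(2)[OF assms(2), of "-1"] c d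
    by (simp_all add: a_minus_def minus_eq_scale)
qed

lemma is_trig_finsum:
  assumes "finite S" "\<And>s. s \<in> S \<Longrightarrow> is_trig R (f s) (c s)"
  shows "is_trig R (\<lambda>\<theta>. \<Oplus>s\<in>S. f s \<theta>) (\<lambda>m. \<Oplus>s\<in>S. c s m)"
    "wnorm R (\<lambda>m. \<Oplus>s\<in>S. c s m) \<le> (\<Sum>s\<in>S. wnorm R (c s))"
proof -
  have "is_trig R (\<lambda>\<theta>. \<Oplus>s\<in>S. f s \<theta>) (\<lambda>m. \<Oplus>s\<in>S. c s m) \<and>
    wnorm R (\<lambda>m. \<Oplus>s\<in>S. c s m) \<le> (\<Sum>s\<in>S. wnorm R (c s))"
    using assms
  proof (induction S)
    case empty
    then show ?case using is_trig_const[of \<zero> R] by (simp add: wnorm_def)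
  next
    case (insert s S)
    then have ih: "is_trig R (\<lambda>\<theta>. \<Oplus>s\<in>S. f s \<theta>) (\<lambda>m. \<Oplus>s\<in>S. c s m)"
      "wnorm R (\<lambda>m. \<Oplus>s\<in>S. c s m) \<le> (\<Sum>s\<in>S. wnorm R (c s))" by auto
    have s: "is_trig R (f s) (c s)" using insert.prems by blast
    have e: "(\<Oplus>s\<in>insert s S. f s \<theta>) = f s \<theta> \<oplus> (\<Oplus>s\<in>S. f s \<theta>)" for \<theta>
      using insert.hyps insert.prems by (intro finsum_insert) (auto intro: is_trigD(4)[OF insert.prems])
    have e': "(\<Oplus>s\<in>insert s S. c s m) = c s m \<oplus> (\<Oplus>s\<in>S. c s m)" for m
      using insert.hyps insert.prems by (intro finsum_insert) (auto intro: is_trigD(1)[OF insert.prems])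
    show ?case
      unfolding e e' using is_trig_add[OF s ih(1)] ih(2) insert.hyps by simp
  qed
  then show "is_trig R (\<lambda>\<theta>. \<Oplus>s\<in>S. f s \<theta>) (\<lambda>m. \<Oplus>s\<in>S. c s m)"
    "wnorm R (\<lambda>m. \<Oplus>s\<in>S. c s m) \<le> (\<Sum>s\<in>S. wnorm R (c s))" by blast+
qed

lemma is_trig_scalar:
  assumes "\<And>\<theta>. s \<theta> = (\<Sum>m\<in>ivl R. a m * cis (of_int m * \<theta>))" "\<And>m. m \<notin> ivl R \<Longrightarrow> a m = 0" "x \<in> carrier A"
  shows "is_trig R (\<lambda>\<theta>. scale A (s \<theta>) x) (\<lambda>m. scale A (a m) x)"
    "wnorm R (\<lambda>m. scale A (a m) x) = (\<Sum>m\<in>ivl R. cmod (a m)) * cnorm A x"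
proof -
  have "scale A (s \<theta>) x = (\<Oplus>m\<in>ivl R. scale A (cis (of_int m * \<theta>)) (scale A (a m) x))" for \<theta>
    using assms(3) finsum_scale[of "ivl R" x "\<lambda>m. a m * cis (of_int m * \<theta>)"]
    by (simp add: assms(1) scale_scale mult.commute)
  then show "is_trig R (\<lambda>\<theta>. scale A (s \<theta>) x) (\<lambda>m. scale A (a m) x)"
    unfolding is_trig_def using assms by auto
  show "wnorm R (\<lambda>m. scale A (a m) x) = (\<Sum>m\<in>ivl R. cmod (a m)) * cnorm A x"
    using assms(3) by (simp add: wnorm_def cnorm_scale sum_distrib_right)
qed

lemma is_trig_mult:
  assumes "is_trig R f c" "is_trig S g d"
  shows "is_trig (R + S) (\<lambda>\<theta>. f \<theta> \<otimes> g \<theta>) (conv R c d)" "wnorm (R + S) (conv R c d) \<le> wnorm R c * wnorm S d"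
proof -
  note c = is_trigD[OF assms(1)] and d = is_trigD[OF assms(2)]
  let ?e = "\<lambda>m \<theta>. cis (of_int m * \<theta>)"
  have cc: "conv R c d m \<in> carrier A" for m using c(1) d(1) by (auto simp: conv_def)
  have z: "conv R c d m = \<zero>" if "m \<notin> ivl (R + S)" for m
  proof -
    have "c t \<otimes> d (m - t) = \<zero>" if "t \<in> ivl R" for t
    proof -
      have "m - t \<notin> ivl S" using \<open>m \<notin> _\<close> that by auto
      then show ?thesis using d(2)[of "m - t"] c(1) by simp
    qed
    then show ?thesis unfolding conv_def by (rule add.finprod_one_eqI)
  qed
  \<comment> \<open>The shift by t turns the sum over all frequencies of the product into the sum
    defining g; the remaining indices have coefficient zero.\<close>
  have inner: "(\<Oplus>m\<in>ivl (R + S). scale A (?e m \<theta>) (c t \<otimes> d (m - t)))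
     = scale A (?e t \<theta>) (c t) \<otimes> g \<theta>" if t: "t \<in> ivl R" for t \<theta>
  proof -
    have im: "(\<lambda>s. s + t) ` ivl S = {t - int S..t + int S}" by (auto simp: image_iff intro!: bexI[of _ "_ - t"])
    have "(\<Oplus>m\<in>ivl (R + S). scale A (?e m \<theta>) (c t \<otimes> d (m - t)))
       = (\<Oplus>m\<in>(\<lambda>s. s + t) ` ivl S. scale A (?e m \<theta>) (c t \<otimes> d (m - t)))"
    proof (rule add.finprod_mono_neutral_cong_right)
      show "(\<lambda>s. s + t) ` ivl S \<subseteq> ivl (R + S)" unfolding im using t by auto
      show "scale A (?e i \<theta>) (c t \<otimes> d (i - t)) = \<zero>" if "i \<in> ivl (R + S) - (\<lambda>s. s + t) ` ivl S" for i
      proof -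
        have "i - t \<notin> ivl S" using that unfolding im by auto
        then show ?thesis using d(2)[of "i - t"] c(1) by simp
      qed
    qed (use c(1) d(1) in auto)
    also have "\<dots> = (\<Oplus>s\<in>ivl S. scale A (?e (s + t) \<theta>) (c t \<otimes> d s))"
      using c(1) d(1) by (subst finsum_reindex) auto
    also have "\<dots> = (\<Oplus>s\<in>ivl S. scale A (?e t \<theta>) (c t) \<otimes> scale A (?e s \<theta>) (d s))"
      using c(1) d(1) by (intro finsum_cong' refl) (auto simp: scale_mult_scale cis_mult distrib_right add.commute)
    also have "\<dots> = scale A (?e t \<theta>) (c t) \<otimes> g \<theta>"
      unfolding d(3) using c(1) d(1) by (intro finsum_rdistr[symmetric]) auto
    finally show ?thesis .
  qed
  have "f \<theta> \<otimes> g \<theta> = (\<Oplus>m\<in>ivl (R + S). scale A (?e m \<theta>) (conv R c d m))" for \<theta>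
  proof -
    have "(\<Oplus>m\<in>ivl (R + S). scale A (?e m \<theta>) (conv R c d m))
       = (\<Oplus>m\<in>ivl (R + S). \<Oplus>t\<in>ivl R. scale A (?e m \<theta>) (c t \<otimes> d (m - t)))"
      unfolding conv_def using c(1) d(1) by (intro finsum_cong' refl) (auto simp: scale_finsum Pi_iff)
    also have "\<dots> = (\<Oplus>t\<in>ivl R. \<Oplus>m\<in>ivl (R + S). scale A (?e m \<theta>) (c t \<otimes> d (m - t)))"
      using c(1) d(1) by (intro finsum_swap) auto
    also have "\<dots> = (\<Oplus>t\<in>ivl R. scale A (?e t \<theta>) (c t) \<otimes> g \<theta>)"
      using c(1) d(4) by (intro finsum_cong' refl inner) auto
    also have "\<dots> = f \<theta> \<otimes> g \<theta>"
      unfolding c(3)[of \<theta>] using c(1) d(4) by (intro finsum_ldistr[symmetric]) auto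
    finally show ?thesis by simp
  qed
  then show "is_trig (R + S) (\<lambda>\<theta>. f \<theta> \<otimes> g \<theta>) (conv R c d)"
    unfolding is_trig_def using cc z by blast
  have "wnorm (R + S) (conv R c d) \<le> (\<Sum>m\<in>ivl (R + S). \<Sum>t\<in>ivl R. cnorm A (c t) * cnorm A (d (m - t)))"
    unfolding wnorm_def
  proof (rule sum_mono)
    fix m
    have "cnorm A (conv R c d m) \<le> (\<Sum>t\<in>ivl R. cnorm A (c t \<otimes> d (m - t)))"
      unfolding conv_def using c(1) d(1) by (intro cnorm_finsum) auto
    also have "\<dots> \<le> (\<Sum>t\<in>ivl R. cnorm A (c t) * cnorm A (d (m - t)))"
      using c(1) d(1) by (intro sum_mono cnorm_mult)
    finally show "cnorm A (conv R c d m) \<le> (\<Sum>t\<in>ivl R. cnorm A (c t) * cnorm A (d (m - t)))" .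
  qed
  also have "\<dots> = (\<Sum>t\<in>ivl R. cnorm A (c t) * (\<Sum>m\<in>ivl (R + S). cnorm A (d (m - t))))"
    by (subst sum.swap) (simp add: sum_distrib_left)
  also have "\<dots> \<le> (\<Sum>t\<in>ivl R. cnorm A (c t) * wnorm S d)"
  proof (intro sum_mono mult_left_mono cnorm_nonneg c(1))
    fix t
    have "(\<Sum>m\<in>ivl (R + S). cnorm A (d (m - t))) = (\<Sum>s\<in>(\<lambda>m. m - t) ` ivl (R + S). cnorm A (d s))"
      by (subst sum.reindex) (auto simp: inj_on_def)
    also have "\<dots> = (\<Sum>s\<in>(\<lambda>m. m - t) ` ivl (R + S) \<inter> ivl S. cnorm A (d s))"
      using d(2) by (intro sum.mono_neutral_right) auto
    also have "\<dots> \<le> wnorm S d"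
      unfolding wnorm_def using d(1) by (intro sum_mono2) (auto simp: cnorm_nonneg)
    finally show "(\<Sum>m\<in>ivl (R + S). cnorm A (d (m - t))) \<le> wnorm S d" .
  qed
  also have "\<dots> = wnorm R c * wnorm S d" by (simp add: wnorm_def sum_distrib_right)
  finally show "wnorm (R + S) (conv R c d) \<le> wnorm R c * wnorm S d" .
qed

lemma is_trig_pow:
  assumes "is_trig R f c" "wnorm R c \<le> r"
  shows "\<exists>d. is_trig (n * R) (\<lambda>\<theta>. f \<theta> [^] (n::nat)) d \<and> wnorm (n * R) d \<le> r ^ n"
proof (induction n)
  case 0
  then show ?case using is_trig_const[of \<one> 0] cnorm_one by (intro exI[of _ "\<lambda>m. if m = 0 then \<one> else \<zero>"]) simp
next
  case (Suc n)
  then obtain d where d: "is_trig (n * R) (\<lambda>\<theta>. f \<theta> [^] n) d" "wnorm (n * R) d \<le> r ^ n" by blast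
  have "wnorm (n * R + R) (conv (n * R) d c) \<le> wnorm (n * R) d * wnorm R c"
    by (rule is_trig_mult[OF d(1) assms(1)])
  also have "\<dots> \<le> r ^ n * r"
    using assms d wnorm_nonneg is_trigD(1) order_trans
    by (intro mult_mono) blast+
  finally show ?case
    using is_trig_mult(1)[OF d(1) assms(1)] by (intro exI[of _ "conv (n * R) d c"]) (simp add: add.commute mult.commute)
qed

text \<open>A discrete average replaces the Fourier integral, so that no integration in
  \<open>A\<close> is involved. Two frequencies differ by at most 2 R in absolute value, hence 2 R +
  1 equidistant points separate them exactly.\<close>

lemma is_trig_average:
  assumes "is_trig R f c" "m \<in> ivl R"
  defines "N \<equiv> 2 * R + 1"
  shows "c m = scale A (1 / of_nat N) (\<Oplus>j\<in>{..<N}. scale A (cis (- (of_int m * (2 * pi * real j / real N)))) (f (2 * pi * real j / real N)))"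
proof -
  note c = is_trigD[OF assms(1)]
  let ?x = "\<lambda>j. 2 * pi * real j / real N"
  have cis_diff: "cis (- (of_int m * x)) * cis (of_int t * x) = cis (of_int (t - m) * x)" for t x
    by (simp add: cis_mult left_diff_distrib)
  have "(\<Oplus>j\<in>{..<N}. scale A (cis (- (of_int m * ?x j))) (f (?x j)))
     = (\<Oplus>j\<in>{..<N}. \<Oplus>t\<in>ivl R. scale A (cis (of_int (t - m) * ?x j)) (c t))"
    unfolding c(3) using c(1)
    by (intro finsum_cong' refl) (auto simp: scale_finsum Pi_iff scale_scale cis_diff simp del: of_int_diff times_divide_eq_right)
  also have "\<dots> = (\<Oplus>t\<in>ivl R. \<Oplus>j\<in>{..<N}. scale A (cis (of_int (t - m) * ?x j)) (c t))"
    using c(1) by (intro finsum_swap) auto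
  also have "\<dots> = (\<Oplus>t\<in>ivl R. if m = t then scale A (of_nat N) (c t) else \<zero>)"
  proof (intro finsum_cong' refl)
    fix t assume t: "t \<in> ivl R"
    have "\<bar>t - m\<bar> < int N" using t assms(2) by (auto simp: N_def)
    then show "(\<Oplus>j\<in>{..<N}. scale A (cis (of_int (t - m) * ?x j)) (c t)) = (if m = t then scale A (of_nat N) (c t) else \<zero>)"
      using c(1) finsum_scale[of "{..<N}" "c t" "\<lambda>j. cis (of_int (t - m) * ?x j)"]
      by (subst finsum_scale) (auto simp only: sum_cis_roots_of_unity finite_lessThan, auto)
  qed (use c(1) in auto)
  also have "\<dots> = scale A (of_nat N) (c m)"
    using assms(2) c(1) by (intro finsum_singleton) auto
  finally show ?thesis using c(1) by (simp add: scale_scale scale_one N_def del: of_nat_Suc)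
qed

text \<open>Through this, identities of functions such as unitarity of a path become convolution
  identities of coefficients.\<close>

lemma is_trig_unique:
  assumes "is_trig R f c" "is_trig S f d" shows "c = d"
proof
  fix m
  define T where "T = max R (max S (nat \<bar>m\<bar>))"
  have m: "m \<in> ivl T" by (auto simp: T_def)
  have *: "is_trig T f c" "is_trig T f d"
    using is_trig_mono(1)[OF assms(1), of T] is_trig_mono(1)[OF assms(2), of T] by (simp_all add: T_def)
  show "c m = d m" using is_trig_average[OF *(1) m] is_trig_average[OF *(2) m] by (simp only:)
qed

lemma is_trig_cnorm_le:
  assumes "is_trig R f c" shows "cnorm A (f \<theta>) \<le> wnorm R c"
proof -
  note c = is_trigD[OF assms]
  have "cnorm A (f \<theta>) \<le> (\<Sum>m\<in>ivl R. cnorm A (scale A (cis (of_int m * \<theta>)) (c m)))"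
    unfolding c(3)[of \<theta>] using c(1) by (intro cnorm_finsum) auto
  then show ?thesis using c(1) by (simp add: cnorm_scale wnorm_def)
qed

text \<open>The bound b for the star is 1 for scalars and 2 for the matrices considered
  later.\<close>

lemma is_trig_star:
  assumes "is_trig R f c" "\<And>x. x \<in> carrier A \<Longrightarrow> cnorm A (star A x) \<le> b * cnorm A x"
  shows "is_trig R (\<lambda>\<theta>. star A (f \<theta>)) (\<lambda>m. star A (c (- m)))" "wnorm R (\<lambda>m. star A (c (- m))) \<le> b * wnorm R c"
proof -
  note c = is_trigD[OF assms(1)]
  have im: "uminus ` ivl R = ivl R" by (auto simp: image_iff intro!: bexI[of _ "- _"])
  have "star A (f \<theta>) = (\<Oplus>m\<in>ivl R. scale A (cis (of_int m * \<theta>)) (star A (c (- m))))" for \<theta>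
  proof -
    have "star A (f \<theta>) = (\<Oplus>m\<in>uminus ` ivl R. scale A (cis (- (of_int m * \<theta>))) (star A (c m)))"
      unfolding c(3) im using c(1) by (simp add: star_finsum Pi_iff star_scale cis_cnj)
    also have "\<dots> = (\<Oplus>m\<in>ivl R. scale A (cis (of_int m * \<theta>)) (star A (c (- m))))"
      using c(1) by (subst finsum_reindex) auto
    finally show ?thesis .
  qed
  moreover have "star A (c (- m)) = \<zero>" if "m \<notin> ivl R" for m
    using c(2)[of "- m"] that by auto
  ultimately show "is_trig R (\<lambda>\<theta>. star A (f \<theta>)) (\<lambda>m. star A (c (- m)))"
    unfolding is_trig_def using c(1) by blast
  have "wnorm R (\<lambda>m. star A (c (- m))) \<le> (\<Sum>m\<in>ivl R. b * cnorm A (c (- m)))"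
    unfolding wnorm_def using c(1) assms(2) by (intro sum_mono) auto
  also have "\<dots> = (\<Sum>m\<in>uminus ` ivl R. b * cnorm A (c m))"
    by (subst sum.reindex) auto
  finally show "wnorm R (\<lambda>m. star A (c (- m))) \<le> b * wnorm R c"
    unfolding im wnorm_def by (simp add: sum_distrib_left)
qed

lemma is_trig_has_der:
  assumes "is_trig R f c"
  shows "has_der f (\<Oplus>m\<in>ivl R. scale A (cis (of_int m * \<theta>)) (scale A (\<i> * of_int m) (c m))) \<theta>"
    "is_trig R (\<lambda>\<theta>. \<Oplus>m\<in>ivl R. scale A (cis (of_int m * \<theta>)) (scale A (\<i> * of_int m) (c m))) (\<lambda>m. scale A (\<i> * of_int m) (c m))"
proof -
  note c = is_trigD[OF assms(1)]
  have f: "f = (\<lambda>\<theta>. \<Oplus>m\<in>ivl R. scale A (cis (of_int m * \<theta>)) (c m))" using c(3) by blast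
  note d = has_vector_derivative_cis_mult
  have "has_der f (\<Oplus>m\<in>ivl R. scale A (cis (of_int m * \<theta>) * (\<i> * of_int m)) (c m)) \<theta>"
    unfolding f by (intro has_der_finsum has_der_scale d c(1)) auto
  then show "has_der f (\<Oplus>m\<in>ivl R. scale A (cis (of_int m * \<theta>)) (scale A (\<i> * of_int m) (c m))) \<theta>"
    using c(1) by (simp add: scale_scale)
  have "scale A (\<i> * of_int m) (c m) = \<zero>" if "m \<notin> ivl R" for m using c(2)[OF that] by simp
  then show "is_trig R (\<lambda>\<theta>. \<Oplus>m\<in>ivl R. scale A (cis (of_int m * \<theta>)) (scale A (\<i> * of_int m) (c m))) (\<lambda>m. scale A (\<i> * of_int m) (c m))"
    unfolding is_trig_def using c(1) by blast
qed

end

lemma (in tracial_banach_algebra) is_trig_trace_integral: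
  assumes "is_trig R f c"
  shows "((\<lambda>\<theta>. \<tau> (f \<theta>)) has_integral (2 * pi * \<tau> (c 0))) {0..2*pi}"
proof -
  note c = is_trigD[OF assms(1)]
  have tr: "\<tau> (f \<theta>) = (\<Sum>m\<in>ivl R. cis (of_int m * \<theta>) * \<tau> (c m))" for \<theta>
    unfolding c(3) using c(1) by (simp add: trace_finsum Pi_iff trace_scale)
  have int: "((\<lambda>\<theta>. cis (of_int m * \<theta>)) has_integral (if m = 0 then 2 * pi else 0)) {0..2*pi}" for m :: int
  proof (cases "m = 0")
    case True
    then show ?thesis using has_integral_const_real[of "1::complex" 0 "2*pi"] by (simp add: scaleR_conv_of_real)
  next
    case False
    have "((\<lambda>\<theta>. cis (of_int m * \<theta>)) has_integral (cis (of_int m * (2 * pi)) / (\<i> * of_int m) - cis (of_int m * 0) / (\<i> * of_int m))) {0..2*pi}"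
    proof (rule fundamental_theorem_of_calculus)
      fix t :: real
      have "((\<lambda>t. cis (of_int m * t) / (\<i> * of_int m)) has_vector_derivative cis (of_int m * t)) (at t)"
        using has_vector_derivative_mult_left[OF has_vector_derivative_cis_mult[of m t], of "1 / (\<i> * of_int m)"] False
        by simp
      then show "((\<lambda>t. cis (of_int m * t) / (\<i> * of_int m)) has_vector_derivative cis (of_int m * t)) (at t within {0..2*pi})"
        by (rule has_vector_derivative_at_within)
    qed simp
    moreover have "cis (of_int m * (2 * pi)) = 1"
      using cis_multiple_2pi[of "of_int m"] by (simp add: mult_ac)
    ultimately show ?thesis using False by simp
  qed
  have "((\<lambda>\<theta>. \<Sum>m\<in>ivl R. cis (of_int m * \<theta>) * \<tau> (c m)) has_integral (\<Sum>m\<in>ivl R. (if m = 0 then 2 * pi else 0) * \<tau> (c m))) {0..2*pi}"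
    by (intro has_integral_sum has_integral_mult_left int) auto
  moreover have "(\<Sum>m\<in>ivl R. (if m = 0 then 2 * pi else 0) * \<tau> (c m)) = 2 * pi * \<tau> (c 0)"
    by (subst sum.mono_neutral_right[of _ "{0}"]) auto
  ultimately show ?thesis by (simp only: tr)
qed

section \<open>Inverting an almost unitary trigonometric polynomial\<close>

context involutive_banach_algebra
begin

lemma tends_cnorm:
  assumes "tends x l" shows "(\<lambda>n. cnorm A (x n)) \<longlonglongrightarrow> cnorm A l"
proof -
  have c: "\<And>n. x n \<in> carrier A" "l \<in> carrier A" "(\<lambda>n. cnorm A (x n \<ominus> l)) \<longlonglongrightarrow> 0"
    using assms by (auto simp: tends_def)
  have "norm (cnorm A (x n) - cnorm A l) \<le> cnorm A (x n \<ominus> l)" for n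
    using cnorm_le_add_diff[OF c(1) c(2), of n] cnorm_le_add_diff[OF c(2) c(1), of n]
      cnorm_minus_commute[OF c(1) c(2), of n] by (simp add: abs_le_iff)
  then have "(\<lambda>n. cnorm A (x n) - cnorm A l) \<longlonglongrightarrow> 0"
    by (intro Lim_null_comparison[OF _ c(3)] always_eventually allI)
  then show ?thesis by (simp add: LIM_zero_iff)
qed

text \<open>As F is an arbitrary finite set, this replaces a bound on an infinite sum of norms of
  limits.\<close>

lemma tends_sum_cnorm_le:
  assumes "finite F" "\<And>m. m \<in> F \<Longrightarrow> tends (\<lambda>K. x K m) (l m)" "\<And>K. (\<Sum>m\<in>F. cnorm A (x K m)) \<le> b"
  shows "(\<Sum>m\<in>F. cnorm A (l m)) \<le> b"
proof (rule LIMSEQ_le_const2)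
  show "(\<lambda>K. \<Sum>m\<in>F. cnorm A (x K m)) \<longlonglongrightarrow> (\<Sum>m\<in>F. cnorm A (l m))"
    using assms(2) by (intro tendsto_sum tends_cnorm)
qed (use assms(3) in auto)

lemma sum_coeff_le_wnorm:
  assumes "is_trig R f c" "finite F" shows "(\<Sum>m\<in>F. cnorm A (c m)) \<le> wnorm R c"
proof -
  note c = is_trigD[OF assms(1)]
  have "(\<Sum>m\<in>F. cnorm A (c m)) = (\<Sum>m\<in>F \<inter> ivl R. cnorm A (c m))"
    using c(2) assms(2) by (intro sum.mono_neutral_right) auto
  also have "\<dots> \<le> wnorm R c"
    unfolding wnorm_def using c(1) by (intro sum_mono2) (auto simp: cnorm_nonneg)
  finally show ?thesis .
qed

lemma coeff_le_wnorm: "is_trig R f c \<Longrightarrow> cnorm A (c m) \<le> wnorm R c"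
  using sum_coeff_le_wnorm[of R f c "{m}"] by simp

text \<open>Summation over the second factor keeps the index set fixed while the degree of the first
  factor grows, as needed for the partial sums of an inverse.\<close>

lemma conv_swap:
  assumes "is_trig R f c" "is_trig S g d"
  shows "conv R c d m = (\<Oplus>t\<in>ivl S. c (m - t) \<otimes> d t)"
proof -
  note c = is_trigD[OF assms(1)] and d = is_trigD[OF assms(2)]
  let ?J = "(\<lambda>t. m - t) ` ivl S" and ?h = "\<lambda>t. c t \<otimes> d (m - t)"
  have h: "?h t \<in> carrier A" for t using c(1) d(1) by auto
  have h0: "?h t = \<zero>" if "t \<notin> ivl R \<or> t \<notin> ?J" for t
  proof (cases "t \<in> ivl R")
    case False
    then show ?thesis using c(2)[OF False] d(1) by simp
  next
    case True
    have "m - t \<notin> ivl S"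
    proof
      assume "m - t \<in> ivl S"
      then have "m - (m - t) \<in> ?J" by (rule imageI)
      then show False using that True by simp
    qed
    then show ?thesis using d(2)[of "m - t"] c(1) by simp
  qed
  have "conv R c d m = (\<Oplus>t\<in>ivl R \<inter> ?J. ?h t)"
    unfolding conv_def by (rule add.finprod_mono_neutral_cong_right) (use h h0 in auto)
  also have "\<dots> = (\<Oplus>t\<in>?J. ?h t)"
    by (rule add.finprod_mono_neutral_cong_left) (use h h0 in auto)
  also have "\<dots> = (\<Oplus>t\<in>ivl S. c (m - t) \<otimes> d t)"
    using c(1) d(1) by (subst finsum_reindex) (auto simp: inj_on_def)
  finally show ?thesis .
qed

end

text \<open>The constant 2 is that of 2 x 2 matrices: the star exchanges rows and columns, and a row
  of the adjoint has two entries, each bounded by the norm.\<close>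

locale star_bounded_algebra = tracial_banach_algebra A \<tau>
  for A :: "('a, 'm) cstar_scheme" (structure) and \<tau> :: "'a \<Rightarrow> complex" +
  assumes cnorm_star_le: "x \<in> carrier A \<Longrightarrow> cnorm A (star A x) \<le> 2 * cnorm A x"
begin

text \<open>For almost unitary P the adjoint is almost the inverse: with Y = 1 - star P P, the
  inverse is the sum of the functions Y^k star P, and q collects its coefficients. The inverse is in
  general not a polynomial, so q is an infinite family whose norms are controlled on finite sets.
  The last clause expresses the winding integral of P through p and q.\<close>

lemma wiener_inverse:
  assumes P: "is_trig R P p" "wnorm R p \<le> C"
    and y1: "is_trig S (\<lambda>\<theta>. \<one> \<ominus> star A (P \<theta>) \<otimes> P \<theta>) y" "wnorm S y \<le> \<delta>"
    and y2: "is_trig S (\<lambda>\<theta>. \<one> \<ominus> P \<theta> \<otimes> star A (P \<theta>)) y'" "wnorm S y' \<le> \<delta>"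
    and \<delta>: "\<delta> \<le> 1 / 2"
  shows "\<exists>q. (\<forall>m. q m \<in> carrier A) \<and>
    (\<forall>m. (\<Oplus>t\<in>ivl R. p t \<otimes> q (m - t)) = (if m = 0 then \<one> else \<zero>)) \<and>
    (\<forall>m. (\<Oplus>t\<in>ivl R. q (m - t) \<otimes> p t) = (if m = 0 then \<one> else \<zero>)) \<and>
    (\<forall>F. finite F \<longrightarrow> (\<Sum>m\<in>F. cnorm A (q m)) \<le> 4 * C) \<and>
    (\<forall>F. finite F \<longrightarrow> (\<Sum>m\<in>F. cnorm A (q m \<ominus> star A (p (- m)))) \<le> 4 * C * \<delta>) \<and>
    (\<forall>Z. (\<forall>\<theta>. Z \<theta> \<in> carrier A \<and> Z \<theta> \<otimes> P \<theta> = \<one>) \<longrightarrow>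
      ((\<lambda>\<theta>. \<tau> (Z \<theta> \<otimes> (\<Oplus>m\<in>ivl R. scale A (cis (of_int m * \<theta>)) (scale A (\<i> * of_int m) (p m)))))
        has_integral (2 * pi * (\<Sum>m\<in>ivl R. \<i> * of_int m * \<tau> (p m \<otimes> q (- m))))) {0..2*pi})"
proof -
  note p = is_trigD[OF P(1)]
  define ps where "ps = (\<lambda>m. star A (p (- m)))"
  define Y where "Y = (\<lambda>\<theta>. \<one> \<ominus> star A (P \<theta>) \<otimes> P \<theta>)"
  define Y' where "Y' = (\<lambda>\<theta>. \<one> \<ominus> P \<theta> \<otimes> star A (P \<theta>))"
  have C0: "0 \<le> C" using wnorm_nonneg[of p R] p(1) P(2) by simp
  have \<delta>0: "0 \<le> \<delta>" using wnorm_nonneg[of y S] is_trigD(1)[OF y1(1)] y1(2) by simp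
  have ps: "is_trig R (\<lambda>\<theta>. star A (P \<theta>)) ps" "wnorm R ps \<le> 2 * C"
    using is_trig_star[OF P(1) cnorm_star_le] P(2) unfolding ps_def by fastforce+
  have c: "P \<theta> \<in> carrier A" "star A (P \<theta>) \<in> carrier A" "Y \<theta> \<in> carrier A" "Y' \<theta> \<in> carrier A" for \<theta>
    using p(4) by (auto simp: Y_def Y'_def)
  have "\<exists>d. is_trig (k * S) (\<lambda>\<theta>. Y \<theta> [^] k) d \<and> wnorm (k * S) d \<le> \<delta> ^ k" for k :: nat
    using is_trig_pow[OF y1] unfolding Y_def .
  then obtain yk where yk: "\<And>k. is_trig (k * S) (\<lambda>\<theta>. Y \<theta> [^] k) (yk k)" "\<And>k. wnorm (k * S) (yk k) \<le> \<delta> ^ k"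
    by metis
  have "\<exists>d. is_trig (k * S) (\<lambda>\<theta>. Y' \<theta> [^] k) d \<and> wnorm (k * S) d \<le> \<delta> ^ k" for k :: nat
    using is_trig_pow[OF y2] unfolding Y'_def .
  then obtain yk' where yk': "\<And>k. is_trig (k * S) (\<lambda>\<theta>. Y' \<theta> [^] k) (yk' k)" "\<And>k. wnorm (k * S) (yk' k) \<le> \<delta> ^ k"
    by metis
  \<comment> \<open>The coefficients of Y^k star P; their Wiener norm is at most \<delta>^k times 2
    C, the 2 being that of the star.\<close>
  define ck where "ck = (\<lambda>k. conv (k * S) (yk k) ps)"
  have ck: "is_trig (k * S + R) (\<lambda>\<theta>. Y \<theta> [^] k \<otimes> star A (P \<theta>)) (ck k)" for k
    unfolding ck_def by (rule is_trig_mult(1)[OF yk(1) ps(1)])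
  have ckn: "wnorm (k * S + R) (ck k) \<le> 2 * C * \<delta> ^ k" for k
  proof -
    have "wnorm (k * S + R) (ck k) \<le> wnorm (k * S) (yk k) * wnorm R ps"
      unfolding ck_def by (rule is_trig_mult(2)[OF yk(1) ps(1)])
    also have "\<dots> \<le> \<delta> ^ k * (2 * C)"
      using yk(2)[of k] ps(2) \<delta>0 is_trigD(1)[OF ps(1)] by (intro mult_mono wnorm_nonneg) auto
    finally show ?thesis by (simp add: mult_ac)
  qed
  have ckc: "ck k m \<in> carrier A" for k m by (rule is_trigD(1)[OF ck])
  have ck0: "ck 0 = ps"
  proof -
    have "is_trig (0 * S + R) (\<lambda>\<theta>. star A (P \<theta>)) (ck 0)" using ck[of 0] c by simp
    then show ?thesis using is_trig_unique ps(1) by blast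
  qed
  have sm: "summable (\<lambda>k. 2 * C * \<delta> * \<delta> ^ k)"
    using \<delta> \<delta>0 by (intro summable_mult summable_geometric) auto
  \<comment> \<open>The sum over the terms with k > 0, where 1 / (1 - \<delta>) is at most 2. It
    bounds the distance from q to the coefficients of star P.\<close>
  have smv: "(\<Sum>k<K. 2 * C * \<delta> * \<delta> ^ k) \<le> 4 * C * \<delta>" for K
  proof -
    have "(\<Sum>k<K. 2 * C * \<delta> * \<delta> ^ k) \<le> (\<Sum>k. 2 * C * \<delta> * \<delta> ^ k)"
      using sm \<delta>0 C0 by (intro sum_le_suminf) auto
    also have "\<dots> = 2 * C * \<delta> * (1 / (1 - \<delta>))"
      using \<delta> \<delta>0 suminf_geometric[of \<delta>] by (subst suminf_mult) auto
    also have "\<dots> \<le> 2 * C * \<delta> * 2"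
      using \<delta> \<delta>0 C0 by (intro mult_left_mono) (auto simp: field_simps)
    finally show ?thesis by simp
  qed
  have "\<exists>l. tends (\<lambda>n. \<Oplus>k\<in>{..<n}. ck (Suc k) m) l" for m
  proof -
    have "\<exists>l. tends (\<lambda>n. \<Oplus>k\<in>{..<n}. ck (Suc k) m) l \<and> cnorm A l \<le> (\<Sum>k. 2 * C * \<delta> * \<delta> ^ k)"
    proof (intro series_converges ckc sm)
      show "cnorm A (ck (Suc k) m) \<le> 2 * C * \<delta> * \<delta> ^ k" for k
        using order_trans[OF coeff_le_wnorm[OF ck] ckn, of "Suc k" m] by (simp add: mult_ac)
    qed
    then show ?thesis by blast
  qed
  then obtain d where d: "\<And>m. tends (\<lambda>n. \<Oplus>k\<in>{..<n}. ck (Suc k) m) (d m)" by metis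
  have dc: "d m \<in> carrier A" for m using d[of m] by (simp add: tends_def)
  \<comment> \<open>The term k = 0 is split off since it is the adjoint itself; d is then the
    deviation that has to be small.\<close>
  define q where "q = (\<lambda>m. ps m \<oplus> d m)"
  define Cf where "Cf = (\<lambda>n m. \<Oplus>k\<in>{..<Suc n}. ck k m)"
  define F where "F = (\<lambda>n \<theta>. \<Oplus>k\<in>{..<Suc n}. Y \<theta> [^] k \<otimes> star A (P \<theta>))"
  have psc: "ps m \<in> carrier A" for m by (rule is_trigD(1)[OF ps(1)])
  have qc: "q m \<in> carrier A" for m using psc dc by (simp add: q_def)
  have Cf: "Cf n m = ps m \<oplus> (\<Oplus>k\<in>{..<n}. ck (Suc k) m)" for n m
  proof -
    have "{..<Suc n} = insert 0 (Suc ` {..<n})" using lessThan_Suc_eq_insert_0 by simp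
    then have "Cf n m = ck 0 m \<oplus> (\<Oplus>k\<in>Suc ` {..<n}. ck k m)"
      unfolding Cf_def using ckc by (simp add: Pi_iff)
    then show ?thesis using ckc by (simp add: ck0 finsum_reindex Pi_iff)
  qed
  have Cflim: "tends (\<lambda>n. Cf n m) (q m)" for m
    unfolding Cf q_def by (intro tends_add tends_const d psc)
  have Ftrig: "is_trig (Suc n * S + R) (F n) (Cf n)" for n
    unfolding F_def Cf_def
  proof (intro is_trig_finsum(1))
    fix k assume "k \<in> {..<Suc n}"
    then have "k * S + R \<le> Suc n * S + R" by (intro add_right_mono mult_right_mono) auto
    then show "is_trig (Suc n * S + R) (\<lambda>\<theta>. Y \<theta> [^] k \<otimes> star A (P \<theta>)) (ck k)"
      by (rule is_trig_mono(1)[OF ck])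
  qed simp
  have Fc: "F n \<theta> \<in> carrier A" for n \<theta> by (rule is_trigD(4)[OF Ftrig])
  \<comment> \<open>P intertwines Y and Y', so the series built for a left inverse is also a right
    inverse.\<close>
  have PY: "P \<theta> \<otimes> Y \<theta> [^] k = Y' \<theta> [^] k \<otimes> P \<theta>" for \<theta> and k :: nat
  proof (induction k)
    case 0
    then show ?case using c by simp
  next
    case (Suc k)
    have PY1: "P \<theta> \<otimes> Y \<theta> = Y' \<theta> \<otimes> P \<theta>"
      using c[of \<theta>] by (simp add: Y_def Y'_def minus_mult m_assoc)
    have "P \<theta> \<otimes> Y \<theta> [^] Suc k = (P \<theta> \<otimes> Y \<theta> [^] k) \<otimes> Y \<theta>" using c by (simp add: m_assoc)
    also have "\<dots> = Y' \<theta> [^] k \<otimes> (P \<theta> \<otimes> Y \<theta>)" unfolding Suc using c by (simp add: m_assoc)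
    also have "\<dots> = Y' \<theta> [^] Suc k \<otimes> P \<theta>" unfolding PY1 using c by (simp add: m_assoc)
    finally show ?case .
  qed
  have oneY: "star A (P \<theta>) \<otimes> P \<theta> = \<one> \<ominus> Y \<theta>" "P \<theta> \<otimes> star A (P \<theta>) = \<one> \<ominus> Y' \<theta>" for \<theta>
    using c[of \<theta>] by (simp_all add: Y_def Y'_def minus_add_cancel)
  have FP: "F n \<theta> \<otimes> P \<theta> = \<one> \<ominus> Y \<theta> [^] Suc n" for n \<theta>
  proof -
    have "F n \<theta> \<otimes> P \<theta> = (\<Oplus>k\<in>{..<Suc n}. Y \<theta> [^] k) \<otimes> (star A (P \<theta>) \<otimes> P \<theta>)"
      unfolding F_def using c[of \<theta>]
      by (simp add: finsum_ldistr[symmetric] Pi_iff m_assoc del: finsum_insert add: lessThan_Suc[symmetric])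
    then show ?thesis unfolding oneY using geometric_partial_sum(1)[OF c(3)] by simp
  qed
  have PF: "P \<theta> \<otimes> F n \<theta> = \<one> \<ominus> Y' \<theta> [^] Suc n" for n \<theta>
  proof -
    have "P \<theta> \<otimes> F n \<theta> = (\<Oplus>k\<in>{..<Suc n}. P \<theta> \<otimes> (Y \<theta> [^] k \<otimes> star A (P \<theta>)))"
      unfolding F_def using c[of \<theta>] by (intro finsum_rdistr) auto
    also have "\<dots> = (\<Oplus>k\<in>{..<Suc n}. Y' \<theta> [^] k \<otimes> (P \<theta> \<otimes> star A (P \<theta>)))"
      using c[of \<theta>] by (intro finsum_cong' refl) (auto simp: m_assoc[symmetric] PY)
    also have "\<dots> = (\<Oplus>k\<in>{..<Suc n}. Y' \<theta> [^] k) \<otimes> (P \<theta> \<otimes> star A (P \<theta>))"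
      using c[of \<theta>] by (intro finsum_ldistr[symmetric]) auto
    finally show ?thesis unfolding oneY using geometric_partial_sum(1)[OF c(4)] by simp
  qed
  let ?one = "\<lambda>m::int. if m = 0 then \<one> else \<zero>"
  have pow0: "(\<lambda>n. \<delta> ^ Suc n) \<longlonglongrightarrow> 0"
    using \<delta> \<delta>0 by (intro LIMSEQ_Suc LIMSEQ_realpow_zero) auto
  have lim1: "tends (\<lambda>n. ?one m \<ominus> e n m) (?one m)"
    if e: "\<And>n. is_trig (Suc n * S) (h n) (e n)" "\<And>n. wnorm (Suc n * S) (e n) \<le> \<delta> ^ Suc n" for e h m
  proof (rule tendsI_bound[OF _ _ _ pow0])
    have ec: "e n m \<in> carrier A" for n by (rule is_trigD(1)[OF e(1)])
    then show "\<And>n. ?one m \<ominus> e n m \<in> carrier A" "?one m \<in> carrier A" by auto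
    show "cnorm A (?one m \<ominus> e n m \<ominus> ?one m) \<le> \<delta> ^ Suc n" for n
    proof -
      have "cnorm A (?one m \<ominus> e n m \<ominus> ?one m) = cnorm A (?one m \<ominus> (?one m \<ominus> e n m))"
        using ec by (intro cnorm_minus_commute) auto
      also have "?one m \<ominus> (?one m \<ominus> e n m) = e n m" using ec by (intro minus_add_cancel) auto
      finally show ?thesis using order_trans[OF coeff_le_wnorm[OF e(1)] e(2)] by simp
    qed
  qed
  \<comment> \<open>P times the partial sum \<open>F n\<close> is 1 - Y'^(n+1). Comparing
    coefficients gives a convolution identity with an error of norm at most \<delta>^(n+1), and then
    n tends to infinity.\<close>
  have "(\<Oplus>t\<in>ivl R. p t \<otimes> q (m - t)) = ?one m" for m
  proof -
    have "conv R p (Cf n) = (\<lambda>m. ?one m \<ominus> yk' (Suc n) m)" for n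
    proof (rule is_trig_unique)
      show "is_trig (R + (Suc n * S + R)) (\<lambda>\<theta>. P \<theta> \<otimes> F n \<theta>) (conv R p (Cf n))"
        by (rule is_trig_mult(1)[OF P(1) Ftrig])
      show "is_trig (Suc n * S) (\<lambda>\<theta>. P \<theta> \<otimes> F n \<theta>) (\<lambda>m. ?one m \<ominus> yk' (Suc n) m)"
        unfolding PF by (intro is_trig_diff(1) is_trig_const(1) yk'(1)) auto
    qed
    then have "tends (\<lambda>n. conv R p (Cf n) m) (?one m)"
      using lim1[OF yk'(1) yk'(2), of m] by simp
    moreover have "tends (\<lambda>n. conv R p (Cf n) m) (\<Oplus>t\<in>ivl R. p t \<otimes> q (m - t))"
      unfolding conv_def by (intro tends_finsum tends_mult_left Cflim p(1)) auto
    ultimately show ?thesis using tends_unique by blast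
  qed
  moreover have "(\<Oplus>t\<in>ivl R. q (m - t) \<otimes> p t) = ?one m" for m
  proof -
    have "conv (Suc n * S + R) (Cf n) p = (\<lambda>m. ?one m \<ominus> yk (Suc n) m)" for n
    proof (rule is_trig_unique)
      show "is_trig (Suc n * S + R + R) (\<lambda>\<theta>. F n \<theta> \<otimes> P \<theta>) (conv (Suc n * S + R) (Cf n) p)"
        by (rule is_trig_mult(1)[OF Ftrig P(1)])
      show "is_trig (Suc n * S) (\<lambda>\<theta>. F n \<theta> \<otimes> P \<theta>) (\<lambda>m. ?one m \<ominus> yk (Suc n) m)"
        unfolding FP by (intro is_trig_diff(1) is_trig_const(1) yk(1)) auto
    qed
    then have "(\<Oplus>t\<in>ivl R. Cf n (m - t) \<otimes> p t) = ?one m \<ominus> yk (Suc n) m" for n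
      using conv_swap[OF Ftrig P(1), of n m] by simp
    then have "tends (\<lambda>n. \<Oplus>t\<in>ivl R. Cf n (m - t) \<otimes> p t) (?one m)"
      using lim1[OF yk(1) yk(2), of m] by simp
    moreover have "tends (\<lambda>n. \<Oplus>t\<in>ivl R. Cf n (m - t) \<otimes> p t) (\<Oplus>t\<in>ivl R. q (m - t) \<otimes> p t)"
      by (intro tends_finsum tends_mult_right Cflim p(1)) auto
    ultimately show ?thesis using tends_unique by blast
  qed
  moreover have dsum: "(\<Sum>m\<in>G. cnorm A (d m)) \<le> 4 * C * \<delta>" if "finite G" for G
  proof (rule tends_sum_cnorm_le[OF that d])
    fix K
    have "(\<Sum>m\<in>G. cnorm A (\<Oplus>k\<in>{..<K}. ck (Suc k) m)) \<le> (\<Sum>m\<in>G. \<Sum>k<K. cnorm A (ck (Suc k) m))"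
      using ckc by (intro sum_mono cnorm_finsum) auto
    also have "\<dots> = (\<Sum>k<K. \<Sum>m\<in>G. cnorm A (ck (Suc k) m))" by (rule sum.swap)
    also have "\<dots> \<le> (\<Sum>k<K. 2 * C * \<delta> * \<delta> ^ k)"
    proof (rule sum_mono)
      fix k
      show "(\<Sum>m\<in>G. cnorm A (ck (Suc k) m)) \<le> 2 * C * \<delta> * \<delta> ^ k"
        using order_trans[OF sum_coeff_le_wnorm[OF ck that] ckn, of "Suc k"] by (simp add: mult_ac)
    qed
    finally show "(\<Sum>m\<in>G. cnorm A (\<Oplus>k\<in>{..<K}. ck (Suc k) m)) \<le> 4 * C * \<delta>" using smv[of K] by linarith
  qed
  moreover have "(\<Sum>m\<in>G. cnorm A (q m)) \<le> 4 * C" if "finite G" for G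
  proof -
    have "(\<Sum>m\<in>G. cnorm A (q m)) \<le> (\<Sum>m\<in>G. cnorm A (ps m)) + (\<Sum>m\<in>G. cnorm A (d m))"
      unfolding q_def sum.distrib[symmetric] using psc dc by (intro sum_mono cnorm_triangle)
    also have "\<dots> \<le> 2 * C + 4 * C * (1 / 2)"
      using order_trans[OF sum_coeff_le_wnorm[OF ps(1) that] ps(2)] dsum[OF that] \<delta> C0
      by (intro add_mono order_trans[OF dsum[OF that]] mult_left_mono) auto
    finally show ?thesis by simp
  qed
  moreover have "q m \<ominus> star A (p (- m)) = d m" for m
  proof -
    have "star A (p (- m)) = ps m" by (simp add: ps_def)
    then show ?thesis using psc[of m] dc[of m] by (simp add: q_def minus_add_cancel)
  qed
  moreover have "((\<lambda>\<theta>. \<tau> (Z \<theta> \<otimes> (\<Oplus>m\<in>ivl R. scale A (cis (of_int m * \<theta>)) (scale A (\<i> * of_int m) (p m)))))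
        has_integral (2 * pi * (\<Sum>m\<in>ivl R. \<i> * of_int m * \<tau> (p m \<otimes> q (- m))))) {0..2*pi}"
    if Z: "\<forall>\<theta>. Z \<theta> \<in> carrier A \<and> Z \<theta> \<otimes> P \<theta> = \<one>" for Z
  proof -
    define p' where "p' = (\<lambda>m. scale A (\<i> * of_int m) (p m))"
    define P' where "P' = (\<lambda>\<theta>. \<Oplus>m\<in>ivl R. scale A (cis (of_int m * \<theta>)) (p' m))"
    have P': "is_trig R P' p'" unfolding P'_def p'_def by (rule is_trig_has_der(2)[OF P(1)])
    note pp = is_trigD[OF P']
    have Zc: "Z \<theta> \<in> carrier A" "Z \<theta> \<otimes> P \<theta> = \<one>" for \<theta> using Z by auto
    \<comment> \<open>P has a right inverse because P star P = 1 - Y' is invertible, so the left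
      inverse Z is two-sided. Multiplying F n P = 1 - Y^(n+1) by Z then gives the error of the
      partial sum.\<close>
    have FZ: "Z \<theta> \<ominus> F n \<theta> = Y \<theta> [^] Suc n \<otimes> Z \<theta>" for n \<theta>
    proof -
      have norm: "cnorm A (Y' \<theta>) \<le> \<delta>"
        using order_trans[OF is_trig_cnorm_le[OF y2(1)] y2(2)] unfolding Y'_def .
      obtain z where z: "z \<in> carrier A" "(\<one> \<ominus> Y' \<theta>) \<otimes> z = \<one>"
        using neumann[OF c(4) norm] \<delta> by auto
      have "P \<theta> \<otimes> (star A (P \<theta>) \<otimes> z) = \<one>" using z c[of \<theta>] unfolding oneY[symmetric] by (simp add: m_assoc)
      then have "Z \<theta> = star A (P \<theta>) \<otimes> z"
        using Zc[of \<theta>] c[of \<theta>] z(1) m_assoc[of "Z \<theta>" "P \<theta>" "star A (P \<theta>) \<otimes> z"] by simp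
      then have PZ: "P \<theta> \<otimes> Z \<theta> = \<one>" using \<open>P \<theta> \<otimes> (star A (P \<theta>) \<otimes> z) = \<one>\<close> by simp
      have "(F n \<theta> \<otimes> P \<theta>) \<otimes> Z \<theta> = F n \<theta>" using Fc Zc c PZ by (simp add: m_assoc)
      then have "F n \<theta> = Z \<theta> \<ominus> Y \<theta> [^] Suc n \<otimes> Z \<theta>"
        unfolding FP using Zc c by (simp add: minus_mult)
      then show ?thesis using Zc[of \<theta>] c[of \<theta>] by (simp add: minus_add_cancel)
    qed
    have Ybd: "cnorm A (Y \<theta>) \<le> \<delta>" for \<theta>
      using order_trans[OF is_trig_cnorm_le[OF y1(1)] y1(2)] unfolding Y_def .
    \<comment> \<open>The norm of Z is at most 2 C plus half of itself, since F 0 = star P and the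
      norm of Y is at most 1 / 2.\<close>
    have Zbd: "cnorm A (Z \<theta>) \<le> 4 * C" for \<theta>
    proof -
      have "cnorm A (F 0 \<theta>) \<le> 2 * C"
        using order_trans[OF is_trig_cnorm_le[OF ps(1)] ps(2)] c by (simp add: F_def lessThan_Suc)
      moreover have "cnorm A (Z \<theta>) \<le> cnorm A (F 0 \<theta>) + cnorm A (Y \<theta> \<otimes> Z \<theta>)"
        using cnorm_le_add_diff[OF Zc(1)[of \<theta>] Fc[of 0 \<theta>]] FZ[of \<theta> 0] c by simp
      moreover have "cnorm A (Y \<theta> \<otimes> Z \<theta>) \<le> 1 / 2 * cnorm A (Z \<theta>)"
        using Ybd[of \<theta>] \<delta> c Zc by (intro cnorm_mult_le) auto
      ultimately show ?thesis by simp
    qed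
    have lim: "uniform_limit {0..2*pi} (\<lambda>n \<theta>. \<tau> (F n \<theta> \<otimes> P' \<theta>)) (\<lambda>\<theta>. \<tau> (Z \<theta> \<otimes> P' \<theta>)) sequentially"
    proof (rule uniform_limitI)
      fix e :: real assume "0 < e"
      have "(\<lambda>n. trace_bd * (\<delta> ^ Suc n * (4 * C) * wnorm R p')) \<longlonglongrightarrow> trace_bd * (0 * (4 * C) * wnorm R p')"
        by (intro tendsto_intros pow0)
      then have "\<forall>\<^sub>F n in sequentially. trace_bd * (\<delta> ^ Suc n * (4 * C) * wnorm R p') < e"
        using \<open>0 < e\<close> by (intro order_tendstoD(2)) auto
      then show "\<forall>\<^sub>F n in sequentially. \<forall>\<theta>\<in>{0..2*pi}. dist (\<tau> (F n \<theta> \<otimes> P' \<theta>)) (\<tau> (Z \<theta> \<otimes> P' \<theta>)) < e"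
      proof eventually_elim
        case (elim n)
        show ?case
        proof
          fix \<theta>
          have "\<tau> (Z \<theta> \<otimes> P' \<theta>) - \<tau> (F n \<theta> \<otimes> P' \<theta>) = \<tau> ((Z \<theta> \<ominus> F n \<theta>) \<otimes> P' \<theta>)"
            using Zc Fc pp(4) by (simp add: minus_mult trace_diff)
          also have "cmod \<dots> \<le> trace_bd * (\<delta> ^ Suc n * (4 * C) * wnorm R p')"
            unfolding FZ using Zc c pp(4) Ybd Zbd
            by (intro trace_bd_le cnorm_mult_le cnorm_pow_le is_trig_cnorm_le[OF P']) auto
          finally show "dist (\<tau> (F n \<theta> \<otimes> P' \<theta>)) (\<tau> (Z \<theta> \<otimes> P' \<theta>)) < e"
            using elim by (simp add: dist_norm norm_minus_commute)
        qed
      qed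
    qed
    \<comment> \<open>For the polynomial partial sums the integral is 2 \<pi> times the trace of the
      coefficient at frequency 0; uniform convergence carries this over to Z.\<close>
    have int: "((\<lambda>\<theta>. \<tau> (F n \<theta> \<otimes> P' \<theta>)) has_integral (2 * pi * \<tau> (\<Oplus>t\<in>ivl R. Cf n (0 - t) \<otimes> p' t))) {0..2*pi}" for n
      using is_trig_trace_integral[OF is_trig_mult(1)[OF Ftrig P'], of n] conv_swap[OF Ftrig P', of n 0] by simp
    have cont: "continuous_on {0..2*pi} (\<lambda>\<theta>. \<tau> (F n \<theta> \<otimes> P' \<theta>))" for n
    proof (intro continuous_at_imp_continuous_on ballI)
      fix x
      show "isCont (\<lambda>\<theta>. \<tau> (F n \<theta> \<otimes> P' \<theta>)) x"
        using has_der_trace[OF is_trig_has_der(1)[OF is_trig_mult(1)[OF Ftrig P']]]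
        by (rule has_vector_derivative_continuous)
    qed
    obtain I J where I: "\<And>n. ((\<lambda>\<theta>. \<tau> (F n \<theta> \<otimes> P' \<theta>)) has_integral I n) {0..2*pi}"
      and J: "((\<lambda>\<theta>. \<tau> (Z \<theta> \<otimes> P' \<theta>)) has_integral J) {0..2*pi}" "I \<longlonglongrightarrow> J"
      using uniform_limit_integral[OF lim cont] by auto
    have "I = (\<lambda>n. 2 * pi * \<tau> (\<Oplus>t\<in>ivl R. Cf n (0 - t) \<otimes> p' t))"
      by (rule ext) (rule has_integral_unique[OF I int])
    moreover have "(\<lambda>n. 2 * pi * \<tau> (\<Oplus>t\<in>ivl R. Cf n (0 - t) \<otimes> p' t)) \<longlonglongrightarrow> 2 * pi * \<tau> (\<Oplus>t\<in>ivl R. q (0 - t) \<otimes> p' t)"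
      by (intro tendsto_intros tends_trace tends_finsum tends_mult_right Cflim pp(1)) auto
    ultimately have "I \<longlonglongrightarrow> 2 * pi * \<tau> (\<Oplus>t\<in>ivl R. q (0 - t) \<otimes> p' t)"
      by (simp only:)
    with J(2) have "J = 2 * pi * \<tau> (\<Oplus>t\<in>ivl R. q (0 - t) \<otimes> p' t)"
      by (rule LIMSEQ_unique)
    also have "\<tau> (\<Oplus>t\<in>ivl R. q (0 - t) \<otimes> p' t) = (\<Sum>m\<in>ivl R. \<i> * of_int m * \<tau> (p m \<otimes> q (- m)))"
      unfolding p'_def using qc p(1)
      by (simp add: trace_finsum Pi_iff scale_mult_right trace_scale trace_commute[of "q _"])
    finally show ?thesis using J(1) unfolding P'_def p'_def by simp
  qed
  ultimately show ?thesis using qc by (intro exI[of _ q]) simp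
qed

end

section \<open>Almost self-adjoint idempotents\<close>

text \<open>Kaplansky's formula for the range projection of an idempotent.\<close>

lemma (in tracial_banach_algebra) idempotent_to_projection:
  assumes e: "e \<in> carrier A" "e \<otimes> e = e" and near: "cnorm A (e \<ominus> star A e) \<le> 1 / 2"
  shows "\<exists>p\<in>carrier A. p \<otimes> p = p \<and> star A p = p \<and> \<tau> p = \<tau> e"
proof -
  define f where "f = star A e"
  define d where "d = e \<ominus> f"
  \<comment> \<open>As d is skew-adjoint, z = 1 + star d d. In a C*-algebra this would always be
    invertible; with the row-sum norm, smallness of d and the Neumann series have to do it. The
    element z commutes with e and f and satisfies e z = e f e, whence the projection e f /
    z.\<close>
  define z where "z = \<one> \<ominus> d \<otimes> d"
  have c: "e \<in> carrier A" "f \<in> carrier A" "d \<in> carrier A" "z \<in> carrier A"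
    using e by (auto simp: f_def d_def z_def)
  have ff: "f \<otimes> f = f" using star_mult[of e e] e by (simp add: f_def)
  have "cnorm A (d \<otimes> d) \<le> 1 / 2 * (1 / 2)"
    using c near by (intro cnorm_mult_le) (auto simp: d_def f_def)
  then obtain w where w: "w \<in> carrier A" "w \<otimes> z = \<one>" "z \<otimes> w = \<one>"
    using neumann[of "d \<otimes> d" "1 / 4"] c by (auto simp: z_def)
  have edd: "e \<otimes> (d \<otimes> d) = e \<ominus> e \<otimes> f \<otimes> e"
  proof -
    have "e \<otimes> (d \<otimes> d) = (e \<ominus> e \<otimes> f) \<otimes> d"
      using c e(2) by (simp add: m_assoc[symmetric]) (simp add: d_def minus_mult)
    also have "\<dots> = (e \<ominus> e \<otimes> f \<otimes> e) \<ominus> (e \<otimes> f \<ominus> e \<otimes> f)"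
      using c e(2) ff by (simp add: d_def minus_mult m_assoc)
    finally show ?thesis using c by (simp add: a_minus_def r_neg)
  qed
  have dde: "(d \<otimes> d) \<otimes> e = e \<ominus> e \<otimes> f \<otimes> e"
  proof -
    have "(d \<otimes> d) \<otimes> e = d \<otimes> (e \<ominus> f \<otimes> e)"
      using c e(2) by (simp add: m_assoc) (simp add: d_def minus_mult)
    also have "\<dots> = (e \<ominus> f \<otimes> e) \<ominus> (e \<otimes> f \<otimes> e \<ominus> f \<otimes> e)"
      using c e(2) ff m_assoc[of f f e] m_assoc[of e f e] by (simp add: d_def minus_mult)
    also have "\<dots> = (e \<ominus> f \<otimes> e) \<oplus> (f \<otimes> e \<ominus> e \<otimes> f \<otimes> e)"
      using c by (simp add: a_minus_def minus_add a_comm)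
    finally show ?thesis using c by (simp add: minus_trans)
  qed
  have ez: "e \<otimes> z = e \<otimes> f \<otimes> e" "z \<otimes> e = e \<otimes> f \<otimes> e"
    using c edd dde by (simp_all add: z_def minus_mult minus_add_cancel)
  have sd: "star A (d \<otimes> d) = d \<otimes> d"
  proof -
    have "star A d = f \<ominus> e" using e by (simp add: d_def f_def star_diff star_star)
    then have "star A d = \<ominus> d" using c by (simp add: d_def a_minus_def minus_add a_comm)
    then show ?thesis using c by (simp add: star_mult l_minus r_minus)
  qed
  then have sz: "star A z = z" using c by (simp add: z_def star_diff)
  have sw: "star A w = w"
  proof -
    have "star A w \<otimes> z = \<one>" using star_mult[of z w] c w sz by simp
    then have "star A w \<otimes> z \<otimes> w = w" using w by simp
    then show ?thesis using w c m_assoc[of "star A w" z w] by simp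
  qed
  have fz: "f \<otimes> z = z \<otimes> f"
    using star_mult[of z e] star_mult[of e z] ez c sz by (simp add: f_def)
  have comm: "x \<otimes> w = w \<otimes> x" if "x \<in> carrier A" "x \<otimes> z = z \<otimes> x" for x
  proof -
    have "w \<otimes> x = w \<otimes> (x \<otimes> (z \<otimes> w))" using that(1) w by simp
    also have "\<dots> = w \<otimes> (x \<otimes> z) \<otimes> w" using that(1) w(1) c by (simp add: m_assoc)
    also have "\<dots> = (w \<otimes> z) \<otimes> (x \<otimes> w)" unfolding that(2) using that(1) w(1) c by (simp add: m_assoc)
    finally show ?thesis using that(1) w by simp
  qed
  have ew: "e \<otimes> w = w \<otimes> e" and fw: "f \<otimes> w = w \<otimes> f"
    using comm[OF c(1)] comm[OF c(2)] ez fz by simp_all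
  define p where "p = e \<otimes> f \<otimes> w"
  have pc: "p \<in> carrier A" using c w by (simp add: p_def)
  have pe: "p \<otimes> e = e"
  proof -
    have "p \<otimes> e = e \<otimes> f \<otimes> (w \<otimes> e)" using c w by (simp add: p_def m_assoc)
    also have "\<dots> = (e \<otimes> f \<otimes> e) \<otimes> w" unfolding ew[symmetric] using c w by (simp add: m_assoc)
    also have "\<dots> = e \<otimes> (z \<otimes> w)" unfolding ez(1)[symmetric] using c w by (simp add: m_assoc)
    finally show ?thesis using w c by simp
  qed
  have ep: "e \<otimes> p = p" using c w e(2) by (simp add: p_def m_assoc[symmetric])
  have "p \<otimes> p = p \<otimes> e \<otimes> (f \<otimes> w)" using c w pc by (simp add: p_def m_assoc)
  then have "p \<otimes> p = p" unfolding pe using c w by (simp add: p_def m_assoc)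
  moreover have "star A p = p"
  proof -
    have "star A p = w \<otimes> (e \<otimes> f)"
      using e c w sw by (simp add: p_def f_def star_mult star_star)
    also have "\<dots> = e \<otimes> (w \<otimes> f)" using ew c w by (simp add: m_assoc[symmetric])
    also have "\<dots> = p" unfolding fw[symmetric] using c w by (simp add: p_def m_assoc)
    finally show ?thesis .
  qed
  moreover have "\<tau> p = \<tau> e" using trace_commute[OF pc c(1)] pe ep by simp
  ultimately show ?thesis using pc by blast
qed

section \<open>Toeplitz idempotents\<close>

text \<open>On the left, a t is counted once for every i < t.\<close>

lemma sum_tail_weights:
  fixes a :: "nat \<Rightarrow> complex"
  shows "(\<Sum>i<D. (\<Sum>t\<le>D. a t) - (\<Sum>t\<le>i. a t)) = (\<Sum>t\<le>D. of_nat t * a t)"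
proof (induction D)
  case (Suc D)
  have "(\<Sum>i<Suc D. (\<Sum>t\<le>Suc D. a t) - (\<Sum>t\<le>i. a t))
      = (\<Sum>i<Suc D. a (Suc D) + ((\<Sum>t\<le>D. a t) - (\<Sum>t\<le>i. a t)))"
    by (intro sum.cong) auto
  also have "\<dots> = of_nat (Suc D) * a (Suc D) + (\<Sum>i<D. (\<Sum>t\<le>D. a t) - (\<Sum>t\<le>i. a t))"
    unfolding sum.distrib by simp
  finally show ?case using Suc by simp
qed simp

context star_bounded_algebra
begin

text \<open>Let T(p) be the infinite Toeplitz matrix with entries p (i - j), for i, j in the natural
  numbers. As p has no negative frequencies, T(q) T(p) = 1, so E = 1 - T(p) T(q) is an idempotent
  whose kernel is the range of T(p). Since p has degree at most D, the rows of E from D on vanish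
  and its leading D x D block remains. The trace of that block is the winding number, as in the
  index theorem for Toeplitz operators. Only entries are handled, no operators.\<close>

lemma toeplitz_projection:
  fixes p q :: "int \<Rightarrow> 'a" and D :: nat
  assumes p: "\<And>m. p m \<in> carrier A" and p0: "\<And>m. m < 0 \<or> int D < m \<Longrightarrow> p m = \<zero>"
    and q: "\<And>m. q m \<in> carrier A"
    and pq: "\<And>m. (\<Oplus>t\<in>{..D}. p (int t) \<otimes> q (m - int t)) = (if m = 0 then \<one> else \<zero>)"
    and qp: "\<And>m. (\<Oplus>t\<in>{..D}. q (m - int t) \<otimes> p (int t)) = (if m = 0 then \<one> else \<zero>)"
    and psum: "\<And>F. finite F \<Longrightarrow> (\<Sum>m\<in>F. cnorm A (p m)) \<le> C"
    and qsum: "\<And>F. finite F \<Longrightarrow> (\<Sum>m\<in>F. cnorm A (q m)) \<le> K"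
    and near: "\<And>F. finite F \<Longrightarrow> (\<Sum>m\<in>F. cnorm A (q m \<ominus> star A (p (- m)))) \<le> \<eta>"
    and small: "3 * C * \<eta> \<le> 1 / 2"
  shows "\<exists>x\<in>carrier (Mat D A). x \<otimes>\<^bsub>Mat D A\<^esub> x = x \<and> star (Mat D A) x = x \<and>
    mat_trace D \<tau> x = (\<Sum>t\<le>D. of_nat t * \<tau> (p (int t) \<otimes> q (- int t)))"
proof -
  \<comment> \<open>\<open>T i j l\<close> is the l-th term of the entry (i, j) of T(p) T(q); for l
    > i it vanishes because p then has a negative argument, so that \<open>f\<close> is a finite
    sum.\<close>
  define T where "T = (\<lambda>i j l. p (int i - int l) \<otimes> q (int l - int j))"
  define f where "f = (\<lambda>i j. \<Oplus>l\<in>{..i}. T i j l)"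
  define E where "E = (\<lambda>i j::nat. (if i = j then \<one> else \<zero>) \<ominus> f i j)"
  have Tc: "T i j l \<in> carrier A" for i j l using p q by (simp add: T_def)
  have fc: "f i j \<in> carrier A" for i j using Tc by (auto simp: f_def)
  have Ec: "E i j \<in> carrier A" for i j using fc by (simp add: E_def)
  have C0: "0 \<le> C" and K0: "0 \<le> K" and \<eta>0: "0 \<le> \<eta>"
    using psum[of "{}"] qsum[of "{}"] near[of "{}"] by auto
  have psum1: "(\<Sum>l\<in>S. cnorm A (p (int i - int l))) \<le> C" if "finite S" for S i
  proof -
    have "(\<Sum>l\<in>S. cnorm A (p (int i - int l))) = (\<Sum>m\<in>(\<lambda>l. int i - int l) ` S. cnorm A (p m))"
      by (subst sum.reindex) (auto simp: inj_on_def)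
    then show ?thesis using psum[of "(\<lambda>l. int i - int l) ` S"] that by simp
  qed
  have psum2: "(\<Sum>j\<in>S. cnorm A (p (int j - int l))) \<le> C" if "finite S" for S l
  proof -
    have "(\<Sum>j\<in>S. cnorm A (p (int j - int l))) = (\<Sum>m\<in>(\<lambda>j. int j - int l) ` S. cnorm A (p m))"
      by (subst sum.reindex) (auto simp: inj_on_def)
    then show ?thesis using psum[of "(\<lambda>j. int j - int l) ` S"] that by simp
  qed
  have fext: "f i j = (\<Oplus>l\<in>{..<N}. T i j l)" if "i < N" for i j N
    unfolding f_def
  proof (rule add.finprod_mono_neutral_cong_left)
    show "T i j l = \<zero>" if "l \<in> {..<N} - {..i}" for l
      using that p0[of "int i - int l"] q by (simp add: T_def)
  qed (use that Tc in auto)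
  \<comment> \<open>For i at least D, starting the sum at l = 0 cuts off no term of the convolution
    of p and q, so the entry is that of the identity.\<close>
  have Ezero: "E i j = \<zero>" if "D \<le> i" for i j
  proof -
    have "f i j = (\<Oplus>l\<in>{i - D..i}. T i j l)"
      unfolding f_def
    proof (rule add.finprod_mono_neutral_cong_right)
      show "T i j l = \<zero>" if "l \<in> {..i} - {i - D..i}" for l
      proof -
        have "int D < int i - int l" using that \<open>D \<le> i\<close> by auto
        then show ?thesis using p0[of "int i - int l"] q by (simp add: T_def)
      qed
    qed (use Tc in auto)
    also have "{i - D..i} = (\<lambda>t. i - t) ` {..D}"
    proof (intro equalityI subsetI)
      fix l assume "l \<in> {i - D..i}"
      then have "l = i - (i - l)" "i - l \<in> {..D}" by auto
      then show "l \<in> (\<lambda>t. i - t) ` {..D}" by (rule image_eqI)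
    qed auto
    also have "(\<Oplus>l\<in>(\<lambda>t. i - t) ` {..D}. T i j l) = (\<Oplus>t\<in>{..D}. T i j (i - t))"
      using that Tc by (subst finsum_reindex) (auto simp: inj_on_def)
    also have "\<dots> = (\<Oplus>t\<in>{..D}. p (int t) \<otimes> q ((int i - int j) - int t))"
      using that p q by (intro finsum_cong' refl) (auto simp: T_def of_nat_diff algebra_simps)
    also have "\<dots> = (if i = j then \<one> else \<zero>)" unfolding pq by simp
    finally show ?thesis by (simp add: E_def)
  qed
  \<comment> \<open>This is E T(p) = 0. The cut-off J leaves room for all D + 1 entries of column k
    of T(p).\<close>
  have Ep: "(\<Oplus>j\<in>{..<J}. E i j \<otimes> p (int j - int k)) = \<zero>" if J: "k + D < J" for i k J
  proof -
    have inner: "(\<Oplus>j\<in>{..<J}. q (m - int j) \<otimes> p (int j - int k)) = (if m = int k then \<one> else \<zero>)" for m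
    proof -
      have "(\<Oplus>j\<in>{..<J}. q (m - int j) \<otimes> p (int j - int k)) = (\<Oplus>j\<in>(\<lambda>t. t + k) ` {..D}. q (m - int j) \<otimes> p (int j - int k))"
      proof (rule add.finprod_mono_neutral_cong_right)
        show "q (m - int j) \<otimes> p (int j - int k) = \<zero>" if "j \<in> {..<J} - (\<lambda>t. t + k) ` {..D}" for j
        proof -
          have "int j - int k < 0 \<or> int D < int j - int k"
          proof (rule ccontr)
            assume "\<not> ?thesis"
            then have "j = (j - k) + k" "j - k \<in> {..D}" by auto
            then show False using that by blast
          qed
          then show ?thesis using p0[of "int j - int k"] q by simp
        qed
      qed (use J p q in auto)
      also have "\<dots> = (\<Oplus>t\<in>{..D}. q ((m - int k) - int t) \<otimes> p (int t))"
        using p q by (subst finsum_reindex) (auto simp: algebra_simps)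
      finally show ?thesis unfolding qp by simp
    qed
    have 1: "(\<Oplus>j\<in>{..<J}. (if i = j then \<one> else \<zero>) \<otimes> p (int j - int k)) = p (int i - int k)"
    proof -
      have "(\<Oplus>j\<in>{..<J}. (if i = j then \<one> else \<zero>) \<otimes> p (int j - int k)) = (\<Oplus>j\<in>{..<J}. if i = j then p (int j - int k) else \<zero>)"
        using p by (intro finsum_cong' refl) auto
      also have "\<dots> = p (int i - int k)"
      proof (cases "i < J")
        case True
        then show ?thesis using p by (intro finsum_singleton) auto
      next
        case False
        then have "p (int i - int k) = \<zero>" using J by (intro p0) auto
        moreover have "(\<Oplus>j\<in>{..<J}. if i = j then p (int j - int k) else \<zero>) = \<zero>"
          using False by (intro add.finprod_one_eqI) auto
        ultimately show ?thesis by simp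
      qed
      finally show ?thesis .
    qed
    have "(\<Oplus>j\<in>{..<J}. f i j \<otimes> p (int j - int k)) = (\<Oplus>j\<in>{..<J}. \<Oplus>l\<in>{..i}. p (int i - int l) \<otimes> (q (int l - int j) \<otimes> p (int j - int k)))"
      unfolding f_def T_def using p q by (intro finsum_cong' refl) (auto simp: finsum_ldistr Pi_iff m_assoc)
    also have "\<dots> = (\<Oplus>l\<in>{..i}. \<Oplus>j\<in>{..<J}. p (int i - int l) \<otimes> (q (int l - int j) \<otimes> p (int j - int k)))"
      using p q by (intro finsum_swap) auto
    also have "\<dots> = (\<Oplus>l\<in>{..i}. if k = l then p (int i - int l) else \<zero>)"
    proof (intro finsum_cong' refl)
      fix l
      have "(\<Oplus>j\<in>{..<J}. p (int i - int l) \<otimes> (q (int l - int j) \<otimes> p (int j - int k)))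
          = p (int i - int l) \<otimes> (\<Oplus>j\<in>{..<J}. q (int l - int j) \<otimes> p (int j - int k))"
        using p q by (intro finsum_rdistr[symmetric]) auto
      then show "(\<Oplus>j\<in>{..<J}. p (int i - int l) \<otimes> (q (int l - int j) \<otimes> p (int j - int k)))
          = (if k = l then p (int i - int l) else \<zero>)"
        unfolding inner using p by auto
    qed (use p in auto)
    also have "\<dots> = p (int i - int k)"
    proof (cases "k \<le> i")
      case True
      then show ?thesis using p by (intro finsum_singleton) auto
    next
      case False
      then have "p (int i - int k) = \<zero>" by (intro p0) auto
      moreover have "(\<Oplus>l\<in>{..i}. if k = l then p (int i - int l) else \<zero>) = \<zero>"
        using False by (intro add.finprod_one_eqI) auto
      ultimately show ?thesis by simp
    qed
    finally have 2: "(\<Oplus>j\<in>{..<J}. f i j \<otimes> p (int j - int k)) = p (int i - int k)" .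
    have "(\<Oplus>j\<in>{..<J}. E i j \<otimes> p (int j - int k))
       = (\<Oplus>j\<in>{..<J}. (if i = j then \<one> else \<zero>) \<otimes> p (int j - int k) \<ominus> f i j \<otimes> p (int j - int k))"
      unfolding E_def using p fc by (intro finsum_cong' refl) (auto simp: minus_mult)
    also have "\<dots> = (\<Oplus>j\<in>{..<J}. (if i = j then \<one> else \<zero>) \<otimes> p (int j - int k)) \<ominus> (\<Oplus>j\<in>{..<J}. f i j \<otimes> p (int j - int k))"
      using p fc by (intro finsum_diff) auto
    finally show ?thesis unfolding 1 2 using p by simp
  qed
  have qb: "cnorm A (q m) \<le> K" for m using qsum[of "{m}"] by simp
  have fb: "cnorm A (f i j) \<le> C * K" for i j
  proof -
    have "cnorm A (f i j) \<le> (\<Sum>l\<in>{..i}. cnorm A (T i j l))"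
      unfolding f_def using Tc by (intro cnorm_finsum) auto
    also have "\<dots> \<le> (\<Sum>l\<in>{..i}. cnorm A (p (int i - int l)) * K)"
      unfolding T_def using p q qb by (intro sum_mono cnorm_mult_le) auto
    also have "\<dots> \<le> C * K"
      unfolding sum_distrib_right[symmetric] using psum1 K0 by (intro mult_right_mono) auto
    finally show ?thesis .
  qed
  have Eb: "cnorm A (E i j) \<le> 1 + C * K" for i j
  proof -
    have "cnorm A (E i j) \<le> cnorm A (if i = j then \<one> else \<zero>) + cnorm A (f i j)"
      unfolding E_def using fc by (intro cnorm_diff_triangle) auto
    also have "\<dots> \<le> 1 + C * K" using cnorm_one fb by (intro add_mono) auto
    finally show ?thesis .
  qed
  have EE: "(\<Oplus>j\<in>{..<D}. E i j \<otimes> E j k) = E i k" for i k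
  proof -
    define r where "r = (\<lambda>l. cnorm A (q (int l - int k)))"
    have r0: "0 \<le> r l" for l using q by (simp add: r_def cnorm_nonneg)
    have rs: "summable r"
    proof (rule summableI_nonneg_bounded[OF r0])
      fix n
      have "(\<Sum>l<n. r l) = (\<Sum>m\<in>(\<lambda>l. int l - int k) ` {..<n}. cnorm A (q m))"
        unfolding r_def by (subst sum.reindex) (auto simp: inj_on_def)
      then show "(\<Sum>l<n. r l) \<le> K" using qsum by simp
    qed
    \<comment> \<open>E E = E - (E T(p)) T(q), but the infinite sums cannot be interchanged freely.
      Cut off at J = n + D, the factor E T(p) vanishes except in the last D columns, and these are
      multiplied by a tail of the summable norms of q. Letting n grow removes the error.\<close>
    have le: "cnorm A ((\<Oplus>j\<in>{..<D}. E i j \<otimes> E j k) \<ominus> E i k) \<le> (1 + C * K) * C * (\<Sum>l\<in>{n..<n + D}. r l)"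
      if n: "k < n" for n
    proof -
      define J where "J = n + D"
      define g where "g = (\<lambda>l. \<Oplus>j\<in>{..<J}. E i j \<otimes> p (int j - int l))"
      have gc: "g l \<in> carrier A" for l using Ec p by (auto simp: g_def)
      have gb: "cnorm A (g l) \<le> (1 + C * K) * C" for l
      proof -
        have "cnorm A (g l) \<le> (\<Sum>j<J. cnorm A (E i j \<otimes> p (int j - int l)))"
          unfolding g_def using Ec p by (intro cnorm_finsum) auto
        also have "\<dots> \<le> (\<Sum>j<J. (1 + C * K) * cnorm A (p (int j - int l)))"
          using Ec p Eb by (intro sum_mono cnorm_mult_le) auto
        also have "\<dots> \<le> (1 + C * K) * C"
          unfolding sum_distrib_left[symmetric] using psum2 C0 K0 by (intro mult_left_mono) auto
        finally show ?thesis .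
      qed
      have g0: "g l = \<zero>" if "l \<notin> {n..<n + D}" "l < J" for l
        unfolding g_def using that by (intro Ep) (auto simp: J_def)
      have "(\<Oplus>j\<in>{..<D}. E i j \<otimes> E j k) = (\<Oplus>j\<in>{..<J}. E i j \<otimes> E j k)"
        by (rule add.finprod_mono_neutral_cong_left) (use Ec Ezero in \<open>auto simp: J_def\<close>)
      also have "\<dots> = (\<Oplus>j\<in>{..<J}. E i j \<otimes> (if j = k then \<one> else \<zero>) \<ominus> E i j \<otimes> f j k)"
        using Ec fc by (intro finsum_cong' refl) (auto simp: E_def[of] minus_mult)
      also have "\<dots> = (\<Oplus>j\<in>{..<J}. E i j \<otimes> (if j = k then \<one> else \<zero>)) \<ominus> (\<Oplus>j\<in>{..<J}. E i j \<otimes> f j k)"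
        using Ec fc by (intro finsum_diff) auto
      also have "(\<Oplus>j\<in>{..<J}. E i j \<otimes> (if j = k then \<one> else \<zero>)) = E i k"
      proof -
        have "(\<Oplus>j\<in>{..<J}. E i j \<otimes> (if j = k then \<one> else \<zero>)) = (\<Oplus>j\<in>{..<J}. if k = j then E i j else \<zero>)"
          using Ec by (intro finsum_cong' refl) auto
        also have "\<dots> = E i k" using Ec n by (intro finsum_singleton) (auto simp: J_def)
        finally show ?thesis .
      qed
      also have "(\<Oplus>j\<in>{..<J}. E i j \<otimes> f j k) = (\<Oplus>l\<in>{..<J}. g l \<otimes> q (int l - int k))"
      proof -
        have "(\<Oplus>j\<in>{..<J}. E i j \<otimes> f j k) = (\<Oplus>j\<in>{..<J}. \<Oplus>l\<in>{..<J}. E i j \<otimes> p (int j - int l) \<otimes> q (int l - int k))"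
        proof (intro finsum_cong' refl)
          fix j assume j: "j \<in> {..<J}"
          have "f j k = (\<Oplus>l\<in>{..<J}. T j k l)" using j by (intro fext) auto
          then have "E i j \<otimes> f j k = (\<Oplus>l\<in>{..<J}. E i j \<otimes> T j k l)"
            using Ec Tc by (simp add: finsum_rdistr Pi_iff)
          then show "E i j \<otimes> f j k = (\<Oplus>l\<in>{..<J}. E i j \<otimes> p (int j - int l) \<otimes> q (int l - int k))"
            using Ec p q by (simp add: T_def m_assoc)
        qed (use Ec p q in auto)
        also have "\<dots> = (\<Oplus>l\<in>{..<J}. \<Oplus>j\<in>{..<J}. E i j \<otimes> p (int j - int l) \<otimes> q (int l - int k))"
          using Ec p q by (intro finsum_swap) auto
        also have "\<dots> = (\<Oplus>l\<in>{..<J}. g l \<otimes> q (int l - int k))"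
          unfolding g_def using Ec p q by (intro finsum_cong' refl) (auto simp: finsum_ldistr Pi_iff)
        finally show ?thesis .
      qed
      also have "(\<Oplus>l\<in>{..<J}. g l \<otimes> q (int l - int k)) = (\<Oplus>l\<in>{n..<n + D}. g l \<otimes> q (int l - int k))"
        by (rule add.finprod_mono_neutral_cong_right) (use gc q g0 in \<open>auto simp: J_def\<close>)
      finally have "(\<Oplus>j\<in>{..<D}. E i j \<otimes> E j k) \<ominus> E i k = \<ominus> (\<Oplus>l\<in>{n..<n + D}. g l \<otimes> q (int l - int k))"
        using Ec gc q by (simp add: a_minus_def a_comm[of "E i k"] a_assoc r_neg Pi_iff)
      then have "cnorm A ((\<Oplus>j\<in>{..<D}. E i j \<otimes> E j k) \<ominus> E i k) = cnorm A (\<Oplus>l\<in>{n..<n + D}. g l \<otimes> q (int l - int k))"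
        using gc q by (simp add: Pi_iff)
      also have "\<dots> \<le> (\<Sum>l\<in>{n..<n + D}. cnorm A (g l \<otimes> q (int l - int k)))"
        using gc q by (intro cnorm_finsum) auto
      also have "\<dots> \<le> (\<Sum>l\<in>{n..<n + D}. (1 + C * K) * C * r l)"
        unfolding r_def using gc q gb by (intro sum_mono cnorm_mult_le) auto
      finally show ?thesis by (simp only: sum_distrib_left)
    qed
    have "(\<lambda>n. (\<Sum>l<n + D. r l) - (\<Sum>l<n. r l)) \<longlonglongrightarrow> suminf r - suminf r"
      using summable_LIMSEQ[OF rs] by (intro tendsto_diff LIMSEQ_ignore_initial_segment)
    moreover have "(\<Sum>l<n + D. r l) - (\<Sum>l<n. r l) = (\<Sum>l\<in>{n..<n + D}. r l)" for n
      using sum_diff_nat_ivl[of 0 n "n + D" r] by (simp add: atLeast0LessThan)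
    ultimately have "(\<lambda>n. \<Sum>l\<in>{n..<n + D}. r l) \<longlonglongrightarrow> 0" by simp
    then have "(\<lambda>n. (1 + C * K) * C * (\<Sum>l\<in>{n..<n + D}. r l)) \<longlonglongrightarrow> (1 + C * K) * C * 0"
      by (intro tendsto_intros)
    then have "cnorm A ((\<Oplus>j\<in>{..<D}. E i j \<otimes> E j k) \<ominus> E i k) \<le> (1 + C * K) * C * 0"
      using le by (intro LIMSEQ_le_const) (auto intro!: exI[of _ "Suc k"])
    then have "(\<Oplus>j\<in>{..<D}. E i j \<otimes> E j k) \<ominus> E i k = \<zero>"
      using cnorm_nonneg[of "(\<Oplus>j\<in>{..<D}. E i j \<otimes> E j k) \<ominus> E i k"]
        cnorm_eq_0[of "(\<Oplus>j\<in>{..<D}. E i j \<otimes> E j k) \<ominus> E i k"] Ec by (simp add: Pi_iff)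
    then show ?thesis using Ec by (simp add: minus_eq_zero_iff Pi_iff)
  qed
  define r where "r = (\<lambda>m. q m \<ominus> star A (p (- m)))"
  \<comment> \<open>H below is 1 - T(p) T(p)' with the adjoint T(p)' and is exactly self-adjoint; G
    is what replacing q by the adjoint coefficients costs. So E - star E is controlled by G
    alone.\<close>
  define G where "G = (\<lambda>i j. \<Oplus>l\<in>{..i}. p (int i - int l) \<otimes> r (int l - int j))"
  define H where "H = (\<lambda>i j::nat. (if i = j then \<one> else \<zero>) \<ominus> (\<Oplus>l\<in>{..i}. p (int i - int l) \<otimes> star A (p (int j - int l))))"
  have rc: "r m \<in> carrier A" for m using p q by (simp add: r_def)
  have Gc: "G i j \<in> carrier A" for i j using p rc by (auto simp: G_def)
  have Hc: "H i j \<in> carrier A" for i j using p by (auto simp: H_def)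
  have EH: "E i j = H i j \<ominus> G i j" for i j
  proof -
    have s: "(\<Oplus>l\<in>{..i}. p (int i - int l) \<otimes> star A (p (int j - int l))) \<in> carrier A" using p by auto
    have "f i j = (\<Oplus>l\<in>{..i}. p (int i - int l) \<otimes> star A (p (int j - int l)) \<oplus> p (int i - int l) \<otimes> r (int l - int j))"
      unfolding f_def T_def using p q
      by (intro finsum_cong' refl) (auto simp: r_def r_distr[symmetric] minus_add_cancel)
    also have "\<dots> = (\<Oplus>l\<in>{..i}. p (int i - int l) \<otimes> star A (p (int j - int l))) \<oplus> G i j"
      unfolding G_def using p rc by (intro finsum_addf) auto
    finally show ?thesis
      using Gc s by (simp add: E_def H_def a_minus_def minus_add a_assoc)
  qed
  have Hstar: "star A (H j i) = H i j" for i j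
  proof -
    have "star A (\<Oplus>l\<in>{..j}. p (int j - int l) \<otimes> star A (p (int i - int l))) = (\<Oplus>l\<in>{..j}. p (int i - int l) \<otimes> star A (p (int j - int l)))"
      using p by (simp add: star_finsum Pi_iff star_mult star_star)
    also have "\<dots> = (\<Oplus>l\<in>{..i}. p (int i - int l) \<otimes> star A (p (int j - int l)))"
    proof -
      let ?h = "\<lambda>l. p (int i - int l) \<otimes> star A (p (int j - int l))"
      have h: "?h l = \<zero>" if "i < l \<or> j < l" for l
        using that p0[of "int i - int l"] p0[of "int j - int l"] p by auto
      have "(\<Oplus>l\<in>{..j}. ?h l) = (\<Oplus>l\<in>{..min i j}. ?h l)"
        by (rule add.finprod_mono_neutral_cong_right) (use p h in auto)
      also have "\<dots> = (\<Oplus>l\<in>{..i}. ?h l)"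
        by (rule add.finprod_mono_neutral_cong_left) (use p h in auto)
      finally show ?thesis .
    qed
    finally show ?thesis using p unfolding H_def by (subst star_diff) auto
  qed
  have Ediff: "cnorm A (E i j \<ominus> star A (E j i)) \<le> 2 * cnorm A (G j i) + cnorm A (G i j)" for i j
  proof -
    have "E i j \<ominus> star A (E j i) = (H i j \<ominus> G i j) \<ominus> (H i j \<ominus> star A (G j i))"
      unfolding EH using Hc Gc by (simp add: star_diff Hstar)
    also have "\<dots> = (H i j \<ominus> H i j) \<ominus> (G i j \<ominus> star A (G j i))"
      using Hc Gc by (simp add: a_minus_def minus_add a_ac)
    also have "\<dots> = \<ominus> (G i j \<ominus> star A (G j i))" using Hc Gc by (simp add: a_minus_def r_neg)
    finally have "cnorm A (E i j \<ominus> star A (E j i)) \<le> cnorm A (G i j) + cnorm A (star A (G j i))"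
      using Gc cnorm_diff_triangle by simp
    then show ?thesis using cnorm_star_le[OF Gc, of j i] by simp
  qed
  have Gn: "cnorm A (G i j) \<le> (\<Sum>l<D. cnorm A (p (int i - int l)) * cnorm A (r (int l - int j)))" if "i < D" for i j
  proof -
    have "cnorm A (G i j) \<le> (\<Sum>l\<in>{..i}. cnorm A (p (int i - int l) \<otimes> r (int l - int j)))"
      unfolding G_def using p rc by (intro cnorm_finsum) auto
    also have "\<dots> \<le> (\<Sum>l\<in>{..i}. cnorm A (p (int i - int l)) * cnorm A (r (int l - int j)))"
      using p rc by (intro sum_mono cnorm_mult)
    also have "\<dots> \<le> (\<Sum>l<D. cnorm A (p (int i - int l)) * cnorm A (r (int l - int j)))"
      using that p rc by (intro sum_mono2) (auto simp: cnorm_nonneg)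
    finally show ?thesis .
  qed
  have rsum1: "(\<Sum>j\<in>S. cnorm A (r (int l - int j))) \<le> \<eta>" if "finite S" for S l
  proof -
    have "(\<Sum>j\<in>S. cnorm A (r (int l - int j))) = (\<Sum>m\<in>(\<lambda>j. int l - int j) ` S. cnorm A (r m))"
      by (subst sum.reindex) (auto simp: inj_on_def)
    then show ?thesis using near[of "(\<lambda>j. int l - int j) ` S"] that by (simp add: r_def)
  qed
  have rsum2: "(\<Sum>l\<in>S. cnorm A (r (int l - int j))) \<le> \<eta>" if "finite S" for S j
  proof -
    have "(\<Sum>l\<in>S. cnorm A (r (int l - int j))) = (\<Sum>m\<in>(\<lambda>l. int l - int j) ` S. cnorm A (r m))"
      by (subst sum.reindex) (auto simp: inj_on_def)
    then show ?thesis using near[of "(\<lambda>l. int l - int j) ` S"] that by (simp add: r_def)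
  qed
  have Grow: "(\<Sum>j<D. cnorm A (G i j)) \<le> C * \<eta>" if "i < D" for i
  proof -
    have "(\<Sum>j<D. cnorm A (G i j)) \<le> (\<Sum>j<D. \<Sum>l<D. cnorm A (p (int i - int l)) * cnorm A (r (int l - int j)))"
      using that by (intro sum_mono Gn)
    also have "\<dots> = (\<Sum>l<D. cnorm A (p (int i - int l)) * (\<Sum>j<D. cnorm A (r (int l - int j))))"
      by (subst sum.swap) (simp add: sum_distrib_left)
    also have "\<dots> \<le> (\<Sum>l<D. cnorm A (p (int i - int l)) * \<eta>)"
      using p rsum1 by (intro sum_mono mult_left_mono cnorm_nonneg) auto
    also have "\<dots> \<le> C * \<eta>"
      unfolding sum_distrib_right[symmetric] using psum1 \<eta>0 by (intro mult_right_mono) auto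
    finally show ?thesis .
  qed
  \<comment> \<open>In a row of E - star E the adjoint part contributes a column of G, with the
    factor 2 of the star. Together with the row of G this gives the 3 C \<eta> of
    \<open>small\<close>.\<close>
  have Gcol: "(\<Sum>j<D. cnorm A (G j i)) \<le> C * \<eta>" for i
  proof -
    have "(\<Sum>j<D. cnorm A (G j i)) \<le> (\<Sum>j<D. \<Sum>l<D. cnorm A (p (int j - int l)) * cnorm A (r (int l - int i)))"
      by (intro sum_mono Gn) auto
    also have "\<dots> = (\<Sum>l<D. (\<Sum>j<D. cnorm A (p (int j - int l))) * cnorm A (r (int l - int i)))"
      by (subst sum.swap) (simp add: sum_distrib_right)
    also have "\<dots> \<le> (\<Sum>l<D. C * cnorm A (r (int l - int i)))"
      using rc psum2 by (intro sum_mono mult_right_mono cnorm_nonneg) auto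
    also have "\<dots> \<le> C * \<eta>"
      unfolding sum_distrib_left[symmetric] using rsum2 C0 by (intro mult_left_mono) auto
    finally show ?thesis .
  qed
  interpret M: tracial_banach_algebra "Mat D A" "mat_trace D \<tau>" by (rule Mat_tracial_banach_algebra)
  \<comment> \<open>The rows of E beyond D vanish, so cutting off the columns as well keeps the
    idempotent and the whole diagonal.\<close>
  define e where "e = (\<lambda>i j. if i < D \<and> j < D then E i j else \<zero>)"
  have em: "e \<in> matrices A D D" using Ec by (intro matricesI) (auto simp: e_def)
  have ee: "matrix_prod A D e e = e"
  proof (intro ext)
    fix i j
    show "matrix_prod A D e e i j = e i j"
    proof (cases "i < D \<and> j < D")
      case True
      then have "matrix_prod A D e e i j = (\<Oplus>t\<in>{..<D}. E i t \<otimes> E t j)"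
        unfolding matrix_prod_def using Ec by (intro finsum_cong' refl) (auto simp: e_def)
      then show ?thesis using True by (simp add: EE e_def)
    next
      case False
      then show ?thesis
        using matrices_outside[OF matrix_prod_closed[OF em em] False] matrices_outside[OF em False] by simp
    qed
  qed
  have "mat_norm D A (e \<ominus>\<^bsub>Mat D A\<^esub> matrix_star A e) \<le> 1 / 2"
    unfolding Mat_minus[OF em matrix_star_closed[OF em]] mat_norm_le_iff
  proof (intro conjI allI impI)
    fix i assume i: "i < D"
    have "(\<Sum>j<D. cnorm A (e i j \<ominus> matrix_star A e i j)) \<le> (\<Sum>j<D. 2 * cnorm A (G j i) + cnorm A (G i j))"
      using i Ediff by (intro sum_mono) (auto simp: e_def matrix_star_def)
    also have "\<dots> \<le> 2 * (C * \<eta>) + C * \<eta>"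
      unfolding sum.distrib sum_distrib_left[symmetric] using Gcol Grow[OF i] by (intro add_mono mult_left_mono) auto
    finally show "(\<Sum>j<D. cnorm A (e i j \<ominus> matrix_star A e i j)) \<le> 1 / 2" using small by simp
  qed simp
  then have "\<exists>x\<in>carrier (Mat D A). x \<otimes>\<^bsub>Mat D A\<^esub> x = x \<and> star (Mat D A) x = x \<and> mat_trace D \<tau> x = mat_trace D \<tau> e"
    using em ee by (intro M.idempotent_to_projection) simp_all
  moreover have "mat_trace D \<tau> e = (\<Sum>t\<le>D. of_nat t * \<tau> (p (int t) \<otimes> q (- int t)))"
  proof -
    define a where "a = (\<lambda>t. \<tau> (p (int t) \<otimes> q (- int t)))"
    have "\<tau> \<one> = (\<Sum>t\<le>D. a t)"
      using arg_cong[OF pq[of 0], of \<tau>] p q by (simp add: trace_finsum Pi_iff a_def)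
    moreover have "\<tau> (f i i) = (\<Sum>t\<le>i. a t)" for i
    proof -
      have "\<tau> (f i i) = (\<Sum>l\<le>i. \<tau> (T i i l))"
        unfolding f_def using Tc by (intro trace_finsum) auto
      also have "\<dots> = (\<Sum>l\<le>i. a (i - l))"
        by (intro sum.cong refl) (auto simp: T_def a_def of_nat_diff)
      also have "\<dots> = (\<Sum>t\<le>i. a t)"
        by (rule sum.reindex_bij_witness[of _ "\<lambda>t. i - t" "\<lambda>t. i - t"]) auto
      finally show ?thesis .
    qed
    ultimately have "\<tau> (E i i) = (\<Sum>t\<le>D. a t) - (\<Sum>t\<le>i. a t)" for i
      using fc by (simp add: E_def trace_diff)
    then have "mat_trace D \<tau> e = (\<Sum>i<D. (\<Sum>t\<le>D. a t) - (\<Sum>t\<le>i. a t))"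
      by (simp add: mat_trace_def e_def)
    then show ?thesis unfolding sum_tail_weights a_def .
  qed
  ultimately show ?thesis by simp
qed

end

section \<open>Scalar trigonometric approximation\<close>

text \<open>The scalars as an algebra of the same kind, so that scalar trigonometric polynomials
  inherit the lemmas on \<open>is_trig\<close>.\<close>

definition cplx :: "complex cstar" where
  "cplx = \<lparr>carrier = UNIV, mult = (*), one = 1, zero = 0, add = (+), scale = (*), star = cnj, cnorm = cmod\<rparr>"

lemma cplx_simps [simp]:
  "carrier cplx = UNIV" "mult cplx = (*)" "one cplx = 1" "zero cplx = 0" "add cplx = (+)"
  "scale cplx = (*)" "star cplx = cnj" "cnorm cplx = cmod"
  by (simp_all add: cplx_def)

lemma cplx_ring: "ring cplx"
proof (rule ringI)
  show "abelian_group cplx"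
  proof (rule abelian_groupI)
    fix x assume "x \<in> carrier cplx"
    show "\<exists>y\<in>carrier cplx. y \<oplus>\<^bsub>cplx\<^esub> x = \<zero>\<^bsub>cplx\<^esub>" by (intro bexI[of _ "- x"]) auto
  qed auto
  show "monoid cplx" by (rule monoidI) auto
qed (auto simp: algebra_simps)

lemma cplx_minus [simp]: "x \<ominus>\<^bsub>cplx\<^esub> y = x - y"
proof -
  interpret ring cplx by (rule cplx_ring)
  have "\<ominus>\<^bsub>cplx\<^esub> y = - y" by (rule minus_equality) auto
  then show ?thesis by (simp add: a_minus_def)
qed

lemma cplx_tracial: "tracial_banach_algebra cplx (\<lambda>x. x)"
proof (intro tracial_banach_algebra.intro involutive_banach_algebra.intro cplx_ring
    involutive_banach_algebra_axioms.intro tracial_banach_algebra_axioms.intro)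
  fix f :: "nat \<Rightarrow> complex"
  assume "\<And>e. 0 < e \<Longrightarrow> \<exists>M. \<forall>m\<ge>M. \<forall>n\<ge>M. cnorm cplx (f m \<ominus>\<^bsub>cplx\<^esub> f n) < e"
  then have "Cauchy f" by (simp add: Cauchy_iff)
  then obtain l where "f \<longlonglongrightarrow> l" using Cauchy_convergent convergent_def by blast
  then have "(\<lambda>n. f n - l) \<longlonglongrightarrow> 0" by (simp add: LIM_zero_iff)
  then have "(\<lambda>n. cmod (f n - l)) \<longlonglongrightarrow> 0" by (rule tendsto_norm_zero)
  then show "\<exists>l\<in>carrier cplx. (\<lambda>n. cnorm cplx (f n \<ominus>\<^bsub>cplx\<^esub> l)) \<longlonglongrightarrow> 0" by auto
next
  show "\<exists>T. \<forall>x\<in>carrier cplx. cmod x \<le> T * cnorm cplx x" by (intro exI[of _ 1]) auto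
qed (auto simp: algebra_simps norm_mult norm_triangle_ineq)

interpretation cplx: tracial_banach_algebra cplx "\<lambda>x. x"
  by (rule cplx_tracial)

lemma finsum_cplx [simp]: "finite S \<Longrightarrow> finsum cplx f S = sum f S"
  by (induction S rule: finite_induct) (simp_all add: Pi_iff)

definition strig :: "nat \<Rightarrow> (real \<Rightarrow> complex) \<Rightarrow> (int \<Rightarrow> complex) \<Rightarrow> bool" where
  "strig R f c \<longleftrightarrow> (\<forall>m. m \<notin> {- int R..int R} \<longrightarrow> c m = 0) \<and>
     (\<forall>\<theta>. f \<theta> = (\<Sum>m\<in>{- int R..int R}. c m * cis (of_int m * \<theta>)))"

lemma is_trig_cplx: "cplx.is_trig R f c \<longleftrightarrow> strig R f c"
  by (auto simp: cplx.is_trig_def strig_def mult.commute)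

lemma strig_mono: "strig R f c \<Longrightarrow> R \<le> S \<Longrightarrow> strig S f c"
  using cplx.is_trig_mono(1) by (simp add: is_trig_cplx)

lemma strig_const: "strig R (\<lambda>_. a) (\<lambda>m. if m = 0 then a else 0)"
  using cplx.is_trig_const(1)[of a R] unfolding is_trig_cplx cplx_simps by simp

lemma strig_add: "strig R f c \<Longrightarrow> strig R g d \<Longrightarrow> strig R (\<lambda>\<theta>. f \<theta> + g \<theta>) (\<lambda>m. c m + d m)"
  using cplx.is_trig_add(1)[of R f c g d] by (simp add: is_trig_cplx)

lemma strig_diff: "strig R f c \<Longrightarrow> strig R g d \<Longrightarrow> strig R (\<lambda>\<theta>. f \<theta> - g \<theta>) (\<lambda>m. c m - d m)"
  using cplx.is_trig_diff(1)[of R f c g d] by (simp add: is_trig_cplx)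

lemma strig_cmult: "strig R f c \<Longrightarrow> strig R (\<lambda>\<theta>. a * f \<theta>) (\<lambda>m. a * c m)"
  using cplx.is_trig_scale(1)[of R f c a] by (simp add: is_trig_cplx)

lemma strig_mult:
  assumes "strig R f c" "strig S g d" shows "\<exists>e. strig (R + S) (\<lambda>\<theta>. f \<theta> * g \<theta>) e"
  using cplx.is_trig_mult(1)[of R f c S g d] assms by (auto simp: is_trig_cplx)

lemma strig_cnj:
  assumes "strig R f c" shows "\<exists>e. strig R (\<lambda>\<theta>. cnj (f \<theta>)) e"
  using cplx.is_trig_star(1)[of R f c 1] assms by (auto simp: is_trig_cplx)

lemma strig_deriv:
  assumes "strig R f c"
  obtains f' where "strig R f' (\<lambda>m. \<i> * of_int m * c m)" "\<And>\<theta>. (f has_vector_derivative f' \<theta>) (at \<theta>)"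
proof -
  have f: "cplx.is_trig R f c" using assms by (simp add: is_trig_cplx)
  show ?thesis
  proof (rule that)
    show "strig R (\<lambda>\<theta>. \<Sum>m\<in>{- int R..int R}. cis (of_int m * \<theta>) * (\<i> * of_int m * c m)) (\<lambda>m. \<i> * of_int m * c m)"
      using cplx.is_trig_has_der(2)[OF f] by (simp add: is_trig_cplx)
    show "(f has_vector_derivative (\<Sum>m\<in>{- int R..int R}. cis (of_int m * \<theta>) * (\<i> * of_int m * c m))) (at \<theta>)" for \<theta>
      using cplx.has_der_trace[OF cplx.is_trig_has_der(1)[OF f]] by simp
  qed
qed

lemma strig_integral:
  fixes f :: "real \<Rightarrow> complex" and c :: "int \<Rightarrow> complex"
  shows "strig R f c \<Longrightarrow> (f has_integral (2 * complex_of_real pi * c 0)) {0..2*pi}"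
  using cplx.is_trig_trace_integral[of R f c] by (simp add: is_trig_cplx)

lemma strig_coeff_le:
  assumes "strig R f c" "\<And>\<theta>. \<theta> \<in> {0..2*pi} \<Longrightarrow> cmod (f \<theta>) \<le> b" shows "cmod (c m) \<le> b"
proof (cases "m \<in> {- int R..int R}")
  case True
  let ?N = "2 * R + 1"
  define N where "N = ?N"
  have "c m = 1 / of_nat ?N * (\<Sum>j<?N. cis (- (of_int m * (2 * pi * real j / real ?N))) * f (2 * pi * real j / real ?N))"
    using cplx.is_trig_average[OF assms(1)[folded is_trig_cplx] True]
    unfolding cplx_simps finsum_cplx[OF finite_lessThan] .
  then have c: "c m = 1 / of_nat N * (\<Sum>j<N. cis (- (of_int m * (2 * pi * real j / real N))) * f (2 * pi * real j / real N))"
    unfolding N_def .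
  have N: "0 < N" by (simp add: N_def)
  have "cmod (\<Sum>j<N. cis (- (of_int m * (2 * pi * real j / real N))) * f (2 * pi * real j / real N)) \<le> (\<Sum>j<N. b)"
  proof (rule order_trans[OF norm_sum], rule sum_mono)
    fix j assume j: "j \<in> {..<N}"
    have "real j / real N \<le> 1" using j N by (simp add: divide_le_eq)
    then have "2 * pi * (real j / real N) \<le> 2 * pi * 1" by (rule mult_left_mono) simp
    then have "2 * pi * real j / real N \<in> {0..2*pi}" by simp
    then show "cmod (cis (- (of_int m * (2 * pi * real j / real N))) * f (2 * pi * real j / real N)) \<le> b"
      using assms(2) by (simp add: norm_mult)
  qed
  then have "cmod (c m) \<le> (\<Sum>j<N. b) / real N"
    unfolding c norm_mult norm_divide norm_one norm_of_nat using N by (simp add: field_simps)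
  also have "\<dots> = b" using N by simp
  finally show ?thesis .
next
  case False
  then show ?thesis using assms norm_ge_zero[of "f 0"] order_trans[OF norm_ge_zero assms(2), of 0] by (auto simp: strig_def)
qed

lemma sum_inverse_squares: "(\<Sum>m = 1..n. 1 / (real m)\<^sup>2) \<le> 2"
proof -
  have "(\<Sum>m = 1..n. 1 / (real m)\<^sup>2) \<le> 2 - 1 / real (max 1 n)"
  proof (induction n)
    case (Suc n)
    show ?case
    proof (cases "n = 0")
      case False
      have "(\<Sum>m = 1..Suc n. 1 / (real m)\<^sup>2) \<le> 2 - 1 / real n + 1 / (real (Suc n))\<^sup>2"
        using Suc False by (simp add: max_def)
      also have "\<dots> \<le> 2 - 1 / real (Suc n)"
      proof -
        have "1 / (real (Suc n))\<^sup>2 \<le> 1 / (real n * real (Suc n))"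
          using False by (intro divide_left_mono) (auto simp: power2_eq_square)
        also have "\<dots> = 1 / real n - 1 / real (Suc n)" using False by (simp add: field_simps)
        finally show ?thesis by simp
      qed
      finally show ?thesis by simp
    qed simp
  qed simp
  then show ?thesis using divide_nonneg_nonneg[of 1 "real (max 1 n)"] by linarith
qed

text \<open>The coefficients of f'' are - m^2 c m, so c m is at most b / m^2; the frequency 0 counts
  1 and each sign 2, by \<open>sum_inverse_squares\<close>. This is how closeness with two
  derivatives becomes closeness in the Wiener norm.\<close>

lemma strig_sum_coeff_le:
  assumes f: "strig R f c" and f1: "\<And>\<theta>. (f has_vector_derivative f1 \<theta>) (at \<theta>)"
    and f2: "\<And>\<theta>. (f1 has_vector_derivative f2 \<theta>) (at \<theta>)"
    and b: "\<And>\<theta>. \<theta> \<in> {0..2*pi} \<Longrightarrow> cmod (f \<theta>) \<le> b" "\<And>\<theta>. \<theta> \<in> {0..2*pi} \<Longrightarrow> cmod (f2 \<theta>) \<le> b"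
  shows "(\<Sum>m\<in>{- int R..int R}. cmod (c m)) \<le> 5 * b"
proof -
  obtain g where g: "strig R g (\<lambda>m. \<i> * of_int m * c m)" "\<And>\<theta>. (f has_vector_derivative g \<theta>) (at \<theta>)"
    using strig_deriv[OF f] by blast
  have "g = f1" using vector_derivative_unique_at[OF g(2) f1] by blast
  obtain h where h: "strig R h (\<lambda>m. \<i> * of_int m * (\<i> * of_int m * c m))" "\<And>\<theta>. (g has_vector_derivative h \<theta>) (at \<theta>)"
    using strig_deriv[OF g(1)] by blast
  have "h = f2" using vector_derivative_unique_at[OF h(2)] f2 unfolding \<open>g = f1\<close> by blast
  have b0: "0 \<le> b" using order_trans[OF norm_ge_zero b(1), of 0] by simp
  have c2: "cmod (c m) * (of_int m)\<^sup>2 \<le> b" for m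
  proof -
    have "cmod (\<i> * of_int m * (\<i> * of_int m * c m)) \<le> b"
      using h(1) b(2) unfolding \<open>h = f2\<close> by (rule strig_coeff_le)
    then show ?thesis by (simp add: norm_mult power2_eq_square mult_ac flip: abs_mult)
  qed
  have c0: "cmod (c 0) \<le> b" using f b(1) by (rule strig_coeff_le)
  have split: "{- int R..int R} = {0} \<union> (int ` {1..R} \<union> (\<lambda>m. - int m) ` {1..R})"
  proof (intro equalityI subsetI)
    fix m assume m: "m \<in> {- int R..int R}"
    consider "m = 0" | "m > 0" | "m < 0" by linarith
    then show "m \<in> {0} \<union> (int ` {1..R} \<union> (\<lambda>m. - int m) ` {1..R})"
    proof cases
      case 2
      then have "m = int (nat m)" "nat m \<in> {1..R}" using m by auto
      then show ?thesis by blast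
    next
      case 3
      then have "m = - int (nat (- m))" "nat (- m) \<in> {1..R}" using m by auto
      then show ?thesis by blast
    qed simp
  qed auto
  have "(\<Sum>m\<in>{- int R..int R}. cmod (c m)) = cmod (c 0) + ((\<Sum>m\<in>int ` {1..R}. cmod (c m)) + (\<Sum>m\<in>(\<lambda>m. - int m) ` {1..R}. cmod (c m)))"
    unfolding split by (subst sum.union_disjoint; auto)+
  also have "(\<Sum>m\<in>int ` {1..R}. cmod (c m)) = (\<Sum>m = 1..R. cmod (c (int m)))"
    by (subst sum.reindex) auto
  also have "(\<Sum>m\<in>(\<lambda>m. - int m) ` {1..R}. cmod (c m)) = (\<Sum>m = 1..R. cmod (c (- int m)))"
    by (subst sum.reindex) (auto simp: inj_on_def)
  also have "cmod (c 0) + ((\<Sum>m = 1..R. cmod (c (int m))) + (\<Sum>m = 1..R. cmod (c (- int m))))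
      \<le> b + ((\<Sum>m = 1..R. b * (1 / (real m)\<^sup>2)) + (\<Sum>m = 1..R. b * (1 / (real m)\<^sup>2)))"
  proof (intro add_mono c0 sum_mono)
    fix m assume "m \<in> {1..R}"
    then show "cmod (c (int m)) \<le> b * (1 / (real m)\<^sup>2)" "cmod (c (- int m)) \<le> b * (1 / (real m)\<^sup>2)"
      using c2[of "int m"] c2[of "- int m"] by (simp_all add: field_simps)
  qed
  also have "\<dots> \<le> b + (b * 2 + b * 2)"
    unfolding sum_distrib_left[symmetric] using b0 sum_inverse_squares by (intro add_mono mult_left_mono order_refl) auto
  finally show ?thesis by simp
qed

lemma real_polynomial_strig:
  fixes r :: "complex \<Rightarrow> real"
  assumes "real_polynomial_function r" shows "\<exists>R c. strig R (\<lambda>\<theta>. of_real (r (cis \<theta>))) c"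
  using assms
proof induction
  case (linear f)
  interpret bounded_linear f by fact
  define c where "c = (\<lambda>m::int. if m = 1 then (of_real (f 1) - \<i> * of_real (f \<i>)) / 2
     else if m = -1 then (of_real (f 1) + \<i> * of_real (f \<i>)) / 2 else 0)"
  have "of_real (f (cis \<theta>)) = (\<Sum>m\<in>{- int 1..int 1}. c m * cis (of_int m * \<theta>))" for \<theta>
  proof -
    have "cis \<theta> = cos \<theta> *\<^sub>R 1 + sin \<theta> *\<^sub>R \<i>" by (simp add: complex_eq_iff)
    then have "f (cis \<theta>) = cos \<theta> * f 1 + sin \<theta> * f \<i>" by (simp only: add scaleR) simp
    moreover have "{- int 1..int 1} = {-1, 0, 1}" by auto
    ultimately show ?thesis by (simp add: c_def complex_eq_iff field_simps)
  qed
  then have "strig 1 (\<lambda>\<theta>. of_real (f (cis \<theta>))) c" unfolding strig_def by (auto simp: c_def)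
  then show ?case by blast
next
  case (const a)
  show ?case using strig_const[of 0 "of_real a"] by blast
next
  case (add f g)
  then obtain R c S d where "strig R (\<lambda>\<theta>. of_real (f (cis \<theta>))) c" "strig S (\<lambda>\<theta>. of_real (g (cis \<theta>))) d" by blast
  then have "strig (max R S) (\<lambda>\<theta>. of_real (f (cis \<theta>))) c" "strig (max R S) (\<lambda>\<theta>. of_real (g (cis \<theta>))) d"
    using strig_mono by fastforce+
  from strig_add[OF this] show ?case by auto
next
  case (mult f g)
  then show ?case using strig_mult by fastforce
qed

lemma trig_weierstrass:
  fixes h :: "real \<Rightarrow> complex"
  assumes h: "continuous_on {0..2*pi} h" "h 0 = h (2*pi)" and e: "0 < e"
  obtains R f c where "strig R f c" "\<And>\<theta>. \<theta> \<in> {0..2*pi} \<Longrightarrow> cmod (f \<theta> - h \<theta>) \<le> e"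
proof -
  define p where "p = (\<lambda>t. h (2 * pi * t))"
  have "continuous_on {0..1} p"
    unfolding p_def by (intro continuous_on_compose2[OF h(1)] continuous_intros) (auto simp: field_simps)
  \<comment> \<open>The constant homotopy: the lemma on circle maps, applied to it, supplies the
    continuity of h composed with \<open>Arg2pi\<close> across the branch cut.\<close>
  then have "homotopic_loops UNIV p p"
    using h(2) by (simp add: homotopic_loops_refl path_def p_def pathstart_def pathfinish_def)
  from homotopic_loops_imp_homotopic_circlemaps[OF this]
  have "continuous_on (sphere 0 1) (p \<circ> (\<lambda>z. Arg2pi z / (2 * pi)))"
    using homotopic_with_imp_continuous by blast
  then have "continuous_on (sphere 0 1) (\<lambda>z. h (Arg2pi z))" by (simp add: p_def o_def)
  from Stone_Weierstrass_polynomial_function[OF compact_sphere this e]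
  obtain g :: "complex \<Rightarrow> complex" where g: "polynomial_function g" "\<And>x. x \<in> sphere 0 1 \<Longrightarrow> cmod (h (Arg2pi x) - g x) < e"
    by blast
  have rp: "real_polynomial_function (Re \<circ> g)" "real_polynomial_function (Im \<circ> g)"
    using g(1) bounded_linear_Re bounded_linear_Im unfolding polynomial_function_def by blast+
  obtain R c S d where 1: "strig R (\<lambda>\<theta>. of_real (Re (g (cis \<theta>)))) c" "strig S (\<lambda>\<theta>. of_real (Im (g (cis \<theta>)))) d"
    using real_polynomial_strig[OF rp(1)] real_polynomial_strig[OF rp(2)] unfolding comp_def by blast
  have "strig (max R S) (\<lambda>\<theta>. of_real (Re (g (cis \<theta>)))) c" "strig (max R S) (\<lambda>\<theta>. \<i> * of_real (Im (g (cis \<theta>)))) (\<lambda>m. \<i> * d m)"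
    using strig_mono[OF 1(1)] strig_mono[OF strig_cmult[OF 1(2)]] by auto
  from strig_add[OF this] have s: "strig (max R S) (\<lambda>\<theta>. g (cis \<theta>)) (\<lambda>m. c m + \<i> * d m)"
    by (simp flip: complex_eq)
  have "cmod (g (cis \<theta>) - h \<theta>) \<le> e" if "\<theta> \<in> {0..2*pi}" for \<theta>
  proof (cases "\<theta> = 2 * pi")
    case True
    have "Arg2pi 1 = 0" by (rule Arg2pi_unique[of 1]) auto
    then show ?thesis using g(2)[of 1] True h(2) by (simp add: norm_minus_commute)
  next
    case False
    then have "Arg2pi (cis \<theta>) = \<theta>" using that by (intro Arg2pi_unique[of 1]) (auto simp: cis_conv_exp)
    then show ?thesis using g(2)[of "cis \<theta>"] by (simp add: norm_minus_commute)
  qed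
  then show ?thesis using s that by blast
qed

text \<open>A trigonometric polynomial has a periodic primitive only if its mean c 0 vanishes. Here
  \<psi> has mean 0, as the derivative of a function with equal end values, so c 0 is at most e and
  subtracting it doubles the error. Over the interval, of length at most 7, this integrates to 14
  e.\<close>

lemma strig_antiderivative:
  assumes \<phi>: "\<And>\<theta>. (\<phi> has_vector_derivative \<psi> \<theta>) (at \<theta>)" "\<phi> 0 = \<phi> (2*pi)"
    and f: "strig R f c" and close: "\<And>\<theta>. \<theta> \<in> {0..2*pi} \<Longrightarrow> cmod (f \<theta> - \<psi> \<theta>) \<le> e"
  obtains F d where "strig R F d" "\<And>\<theta>. (F has_vector_derivative f \<theta> - c 0) (at \<theta>)" "cmod (c 0) \<le> e"
    "\<And>\<theta>. \<theta> \<in> {0..2*pi} \<Longrightarrow> cmod (F \<theta> - \<phi> \<theta>) \<le> 14 * e"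
proof -
  have int\<psi>: "(\<psi> has_integral 0) {0..2*pi}"
    using fundamental_theorem_of_calculus[of 0 "2*pi" \<phi> \<psi>] \<phi> by (auto intro: has_vector_derivative_at_within)
  have c0: "cmod (c 0) \<le> e"
  proof -
    have "((\<lambda>\<theta>. f \<theta> - \<psi> \<theta>) has_integral (2 * complex_of_real pi * c 0 - 0)) {0..2*pi}"
      by (intro has_integral_diff strig_integral[OF f] int\<psi>)
    then have "cmod (2 * complex_of_real pi * c 0 - 0) \<le> e * measure lborel {0..2*pi}"
      using close order_trans[OF norm_ge_zero close, of 0] by (intro has_integral_bound_real[where S = "{}"]) auto
    then have "2 * pi * cmod (c 0) \<le> 2 * pi * e" by (simp add: norm_mult)
    then show ?thesis by simp
  qed
  have e0: "0 \<le> e" using c0 norm_ge_zero order_trans by blast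
  define d where "d = (\<lambda>m::int. if m = 0 then 0 else c m / (\<i> * of_int m))"
  have d0: "m \<notin> {- int R..int R} \<Longrightarrow> d m = 0" for m using f by (auto simp: d_def strig_def)
  define F0 where "F0 = (\<lambda>\<theta>. \<Sum>m\<in>{- int R..int R}. d m * cis (of_int m * \<theta>))"
  have F0: "strig R F0 d" using d0 by (auto simp: strig_def F0_def)
  \<comment> \<open>The constant of integration that makes F and \<phi> agree at 0.\<close>
  define k where "k = \<phi> 0 - F0 0"
  define F where "F = (\<lambda>\<theta>. F0 \<theta> + k)"
  have F: "strig R F (\<lambda>m. d m + (if m = 0 then k else 0))"
    unfolding F_def by (intro strig_add F0 strig_const)
  obtain F' where F': "strig R F' (\<lambda>m. \<i> * of_int m * d m)" "\<And>\<theta>. (F0 has_vector_derivative F' \<theta>) (at \<theta>)"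
    using strig_deriv[OF F0] by blast
  have "F' \<theta> = f \<theta> - c 0" for \<theta>
  proof -
    have "strig R (\<lambda>\<theta>. f \<theta> - c 0) (\<lambda>m. c m - (if m = 0 then c 0 else 0))"
      by (intro strig_diff f strig_const)
    moreover have "(\<lambda>m. \<i> * of_int m * d m) = (\<lambda>m. c m - (if m = 0 then c 0 else 0))"
      by (auto simp: d_def)
    ultimately show ?thesis using F'(1) by (simp add: strig_def)
  qed
  then have dF: "(F has_vector_derivative f \<theta> - c 0) (at \<theta>)" for \<theta>
    using F'(2)[of \<theta>] unfolding F_def by (auto intro!: derivative_eq_intros)
  have "cmod (F \<theta> - \<phi> \<theta>) \<le> 14 * e" if t: "\<theta> \<in> {0..2*pi}" for \<theta>
  proof -
    have "((\<lambda>t. f t - c 0 - \<psi> t) has_integral ((F \<theta> - \<phi> \<theta>) - (F 0 - \<phi> 0))) {0..\<theta>}"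
      using t by (intro fundamental_theorem_of_calculus has_vector_derivative_diff has_vector_derivative_at_within[OF dF]
          has_vector_derivative_at_within[OF \<phi>(1)]) auto
    moreover have "F 0 - \<phi> 0 = 0" by (simp add: F_def k_def)
    moreover have "cmod (f t - c 0 - \<psi> t) \<le> 2 * e" if "t \<in> {0..\<theta>}" for t
      using close[of t] c0 that t norm_triangle_ineq4[of "f t - \<psi> t" "c 0"] by (simp add: algebra_simps)
    ultimately have "cmod (F \<theta> - \<phi> \<theta>) \<le> 2 * e * measure lborel {0..\<theta>}"
      using e0 by (intro has_integral_bound_real[where S = "{}" and f = "\<lambda>t. f t - c 0 - \<psi> t"]) auto
    also have "\<dots> \<le> 2 * e * 7" using t e0 pi_less_4 pi_approx by (intro mult_left_mono) auto
    finally show ?thesis by simp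
  qed
  then show ?thesis using that F dF c0 by blast
qed

definition C2 :: "(real \<Rightarrow> complex) \<Rightarrow> (real \<Rightarrow> complex) \<Rightarrow> (real \<Rightarrow> complex) \<Rightarrow> bool" where
  "C2 f f1 f2 \<longleftrightarrow> (\<forall>\<theta>. (f has_vector_derivative f1 \<theta>) (at \<theta>) \<and> (f1 has_vector_derivative f2 \<theta>) (at \<theta>))"

text \<open>Approximating the second derivative and integrating twice gives the errors 2 \<eta>, 28
  \<eta> and 196 \<eta>; the choice \<eta> = e / 400 covers all of them. Approximating \<phi> itself
  would say nothing about its derivatives.\<close>

lemma C2_approx:
  assumes C2: "C2 \<phi> \<phi>1 \<phi>2" and cont: "continuous_on {0..2*pi} \<phi>2"
    and per: "\<phi> 0 = \<phi> (2*pi)" "\<phi>1 0 = \<phi>1 (2*pi)" "\<phi>2 0 = \<phi>2 (2*pi)" and e: "0 < e"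
  obtains R f c f1 f2 where "strig R f c" "C2 f f1 f2"
    "\<And>\<theta>. \<theta> \<in> {0..2*pi} \<Longrightarrow> cmod (f \<theta> - \<phi> \<theta>) \<le> e"
    "\<And>\<theta>. \<theta> \<in> {0..2*pi} \<Longrightarrow> cmod (f1 \<theta> - \<phi>1 \<theta>) \<le> e"
    "\<And>\<theta>. \<theta> \<in> {0..2*pi} \<Longrightarrow> cmod (f2 \<theta> - \<phi>2 \<theta>) \<le> e"
proof -
  define \<eta> where "\<eta> = e / 400"
  have \<eta>: "0 < \<eta>" using e by (simp add: \<eta>_def)
  obtain R h a where h: "strig R h a" "\<And>\<theta>. \<theta> \<in> {0..2*pi} \<Longrightarrow> cmod (h \<theta> - \<phi>2 \<theta>) \<le> \<eta>"
    using trig_weierstrass[OF cont per(3) \<eta>] by blast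
  have d1: "(\<phi>1 has_vector_derivative \<phi>2 \<theta>) (at \<theta>)" and d0: "(\<phi> has_vector_derivative \<phi>1 \<theta>) (at \<theta>)" for \<theta>
    using C2 by (auto simp: C2_def)
  obtain F d where F: "strig R F d" "\<And>\<theta>. (F has_vector_derivative h \<theta> - a 0) (at \<theta>)" "cmod (a 0) \<le> \<eta>"
    "\<And>\<theta>. \<theta> \<in> {0..2*pi} \<Longrightarrow> cmod (F \<theta> - \<phi>1 \<theta>) \<le> 14 * \<eta>"
    using strig_antiderivative[OF d1 per(2) h] by blast
  obtain G b where G: "strig R G b" "\<And>\<theta>. (G has_vector_derivative F \<theta> - d 0) (at \<theta>)" "cmod (d 0) \<le> 14 * \<eta>"
    "\<And>\<theta>. \<theta> \<in> {0..2*pi} \<Longrightarrow> cmod (G \<theta> - \<phi> \<theta>) \<le> 14 * (14 * \<eta>)"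
    using strig_antiderivative[OF d0 per(1) F(1,4)] by blast
  show ?thesis
  proof (rule that[OF G(1)])
    show "C2 G (\<lambda>\<theta>. F \<theta> - d 0) (\<lambda>\<theta>. h \<theta> - a 0)"
      unfolding C2_def using G(2) F(2) by (auto intro!: derivative_eq_intros)
    fix \<theta> assume t: "\<theta> \<in> {0..2*pi}"
    show "cmod (G \<theta> - \<phi> \<theta>) \<le> e" using G(4)[OF t] \<eta> by (simp add: \<eta>_def)
    show "cmod (F \<theta> - d 0 - \<phi>1 \<theta>) \<le> e"
      using F(4)[OF t] G(3) norm_triangle_ineq4[of "F \<theta> - \<phi>1 \<theta>" "d 0"] e by (simp add: \<eta>_def algebra_simps)
    show "cmod (h \<theta> - a 0 - \<phi>2 \<theta>) \<le> e"
      using h(2)[OF t] F(3) norm_triangle_ineq4[of "h \<theta> - \<phi>2 \<theta>" "a 0"] e by (simp add: \<eta>_def algebra_simps)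
  qed
qed

lemma C2_const: "C2 (\<lambda>_. a) (\<lambda>_. 0) (\<lambda>_. 0)"
  by (simp add: C2_def)

lemma C2_add: "C2 f f1 f2 \<Longrightarrow> C2 g g1 g2 \<Longrightarrow> C2 (\<lambda>t. f t + g t) (\<lambda>t. f1 t + g1 t) (\<lambda>t. f2 t + g2 t)"
  by (auto simp: C2_def intro!: has_vector_derivative_add)

lemma C2_diff: "C2 f f1 f2 \<Longrightarrow> C2 g g1 g2 \<Longrightarrow> C2 (\<lambda>t. f t - g t) (\<lambda>t. f1 t - g1 t) (\<lambda>t. f2 t - g2 t)"
  by (auto simp: C2_def intro!: has_vector_derivative_diff)

lemma C2_mult:
  assumes "C2 f f1 f2" "C2 g g1 g2"
  shows "C2 (\<lambda>t. f t * g t) (\<lambda>t. f t * g1 t + f1 t * g t) (\<lambda>t. f t * g2 t + 2 * f1 t * g1 t + f2 t * g t)"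
  unfolding C2_def
proof (intro allI conjI)
  fix t
  note d = assms[unfolded C2_def, rule_format, of t]
  show "((\<lambda>t. f t * g t) has_vector_derivative f t * g1 t + f1 t * g t) (at t)"
    using d by (intro has_vector_derivative_mult) auto
  have "((\<lambda>t. f t * g1 t + f1 t * g t) has_vector_derivative (f t * g2 t + f1 t * g1 t) + (f1 t * g1 t + f2 t * g t)) (at t)"
    using d by (intro has_vector_derivative_add has_vector_derivative_mult) auto
  then show "((\<lambda>t. f t * g1 t + f1 t * g t) has_vector_derivative f t * g2 t + 2 * f1 t * g1 t + f2 t * g t) (at t)"
    by (simp add: algebra_simps)
qed

lemma C2_cmult: "C2 f f1 f2 \<Longrightarrow> C2 (\<lambda>t. a * f t) (\<lambda>t. a * f1 t) (\<lambda>t. a * f2 t)"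
  using C2_mult[OF C2_const[of a], of f f1 f2] by simp

lemma C2_cnj: "C2 f f1 f2 \<Longrightarrow> C2 (\<lambda>t. cnj (f t)) (\<lambda>t. cnj (f1 t)) (\<lambda>t. cnj (f2 t))"
  unfolding C2_def by (auto intro!: bounded_linear.has_vector_derivative[OF bounded_linear_cnj])

lemma C2_unique:
  assumes "C2 f f1 f2" "C2 f g1 g2" shows "f1 = g1" "f2 = g2"
proof -
  show eq: "f1 = g1" using assms vector_derivative_unique_at unfolding C2_def by blast
  show "f2 = g2" using assms vector_derivative_unique_at unfolding C2_def eq by blast
qed

lemma C2_continuous: "C2 f f1 f2 \<Longrightarrow> continuous_on S f" "C2 f f1 f2 \<Longrightarrow> continuous_on S f1"
  unfolding C2_def
  by (auto intro!: continuous_at_imp_continuous_on has_vector_derivative_continuous)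

text \<open>
  The reparametrisation \<open>s\<close> maps \<open>[0, 2\<pi>]\<close> onto \<open>[0, \<pi>/2]\<close> and has vanishing first and second
  derivatives at both ends. Hence a smooth function of \<open>s\<close> becomes a periodic \<open>C\<^sup>2\<close> function as
  soon as its values at the ends are matched by subtracting a multiple of \<open>ramp\<close>.
\<close>

definition ramp :: "real \<Rightarrow> complex" where "ramp t = of_real ((t - sin t) / (2 * pi))"
definition ramp1 :: "real \<Rightarrow> complex" where "ramp1 t = of_real ((1 - cos t) / (2 * pi))"
definition ramp2 :: "real \<Rightarrow> complex" where "ramp2 t = of_real (sin t / (2 * pi))"
definition spin :: "int \<Rightarrow> real \<Rightarrow> complex" where "spin l t = cis (of_int l * ((t - sin t) / 4))"
definition turn :: "int \<Rightarrow> complex" where "turn l = cis (of_int l * (pi / 2))"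
definition spin1 :: "int \<Rightarrow> real \<Rightarrow> complex" where "spin1 l t = \<i> * of_int l * of_real (pi / 2) * ramp1 t * spin l t"
definition spin2 :: "int \<Rightarrow> real \<Rightarrow> complex" where
  "spin2 l t = \<i> * of_int l * of_real (pi / 2) * (ramp2 t * spin l t + ramp1 t * spin1 l t)"

lemma ramp_C2: "C2 ramp ramp1 ramp2"
  unfolding C2_def ramp_def ramp1_def ramp2_def
  by (auto intro!: derivative_eq_intros has_vector_derivative_of_real
      simp: has_real_derivative_iff_has_vector_derivative[symmetric])

lemma spin_C2: "C2 (spin l) (spin1 l) (spin2 l)"
proof -
  have s: "(spin l has_vector_derivative spin1 l t) (at t)" for t
  proof -
    have "((\<lambda>t. \<i> * of_int l * of_real ((t - sin t) / 4)) has_vector_derivative \<i> * of_int l * of_real ((1 - cos t) / 4)) (at t)"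
      by (intro has_vector_derivative_mult_right has_vector_derivative_of_real)
        (auto intro!: derivative_eq_intros simp: has_real_derivative_iff_has_vector_derivative[symmetric])
    from field_vector_diff_chain_at[OF this, of exp]
    have "((\<lambda>t. exp (\<i> * of_int l * of_real ((t - sin t) / 4))) has_vector_derivative
       \<i> * of_int l * of_real ((1 - cos t) / 4) * exp (\<i> * of_int l * of_real ((t - sin t) / 4))) (at t)"
      by (simp add: DERIV_exp o_def)
    then show ?thesis
      by (simp add: spin_def[abs_def] spin1_def ramp1_def cis_conv_exp mult_ac)
  qed
  moreover have "(spin1 l has_vector_derivative spin2 l t) (at t)" for t
  proof -
    have "(ramp1 has_vector_derivative ramp2 t) (at t)" using ramp_C2 by (simp add: C2_def)
    from has_vector_derivative_mult_right[OF has_vector_derivative_mult[OF this s], of "\<i> * of_int l * of_real (pi / 2)"]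
    show ?thesis by (simp add: spin1_def[abs_def] spin2_def algebra_simps)
  qed
  ultimately show ?thesis by (simp add: C2_def)
qed

lemma ramp_ends [simp]:
  "ramp 0 = 0" "ramp (2*pi) = 1" "ramp1 0 = 0" "ramp1 (2*pi) = 0" "ramp2 0 = 0" "ramp2 (2*pi) = 0"
  by (simp_all add: ramp_def ramp1_def ramp2_def)

lemma spin_ends [simp]:
  "spin l 0 = 1" "spin l (2*pi) = turn l" "spin1 l 0 = 0" "spin1 l (2*pi) = 0" "spin2 l 0 = 0" "spin2 l (2*pi) = 0"
  by (simp_all add: spin_def turn_def spin1_def spin2_def)

lemma continuous_ramp2: "continuous_on S ramp2"
  unfolding ramp2_def by (intro continuous_intros) auto

lemma continuous_spin2: "continuous_on S (spin2 l)"
  unfolding spin2_def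
  by (intro continuous_intros continuous_ramp2 C2_continuous[OF spin_C2] C2_continuous[OF ramp_C2])

lemma spin_simps: "spin 0 t = 1" "spin (k + l) t = spin k t * spin l t" "spin (- l) t = cnj (spin l t)"
  by (simp_all add: spin_def cis_mult cis_cnj distrib_right add_divide_distrib)

lemma turn_simps: "turn 0 = 1" "turn (k + l) = turn k * turn l" "turn (- l) = cnj (turn l)" "turn l * cnj (turn l) = 1" "cmod (turn l) = 1"
  by (simp_all add: turn_def cis_mult cis_cnj distrib_right add_divide_distrib)

lemma cnj_ramp: "cnj (ramp t) = ramp t" "cnj (ramp1 t) = ramp1 t" "cnj (ramp2 t) = ramp2 t"
  by (simp_all add: ramp_def ramp1_def ramp2_def)

lemma cmod_ramp_le: "t \<in> {0..2*pi} \<Longrightarrow> cmod (ramp t) \<le> 1"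
proof -
  assume t: "t \<in> {0..2*pi}"
  have "0 \<le> t - sin t" using t sin_x_le_x[of t] by simp
  moreover have "t - sin t \<le> 2 * pi"
    using t sin_x_le_x[of "2 * pi - t"] by (simp add: sin_diff)
  ultimately show ?thesis by (simp only: ramp_def norm_of_real) simp
qed

text \<open>The function cis (l s) made periodic. If W is a sum of cis (l s) c l with W 0 = 1 and W
  (\<pi> / 2) = U, then replacing cis (l s) by \<open>wave l\<close> yields W - (U - 1)
  \<open>ramp\<close>, which returns to 1.\<close>

definition wave :: "int \<Rightarrow> real \<Rightarrow> complex" where "wave l t = spin l t - (turn l - 1) * ramp t"

text \<open>A member that is constantly 1 is kept exactly. This concerns \<open>wave 0\<close>: it
  multiplies the coefficient sums that unitarity makes equal to 1, where an error would not be
  damped by anything. A common degree exists because I is finite.\<close>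

lemma C2_family_approx:
  fixes n :: nat and F F1 F2 :: "int \<Rightarrow> real \<Rightarrow> complex"
  assumes C2: "\<And>l. C2 (F l) (F1 l) (F2 l)" and cont: "\<And>l. continuous_on {0..2*pi} (F2 l)"
    and per: "\<And>l. F l 0 = F l (2*pi)" "\<And>l. F1 l 0 = F1 l (2*pi)" "\<And>l. F2 l 0 = F2 l (2*pi)" and e: "0 < e"
    and I: "finite I"
  obtains R f c f1 f2 where "\<And>l. l \<in> I \<Longrightarrow> strig R (f l) (c l)" "\<And>l. C2 (f l) (f1 l) (f2 l)"
    "\<And>l t. t \<in> {0..2*pi} \<Longrightarrow> cmod (f l t - F l t) \<le> e \<and> cmod (f1 l t - F1 l t) \<le> e \<and> cmod (f2 l t - F2 l t) \<le> e"
    "\<And>l. F l = (\<lambda>_. 1) \<Longrightarrow> f l = (\<lambda>_. 1)"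
proof -
  have "\<exists>R f c f1 f2. strig R f c \<and> C2 f f1 f2 \<and>
    (\<forall>t\<in>{0..2*pi}. cmod (f t - F l t) \<le> e \<and> cmod (f1 t - F1 l t) \<le> e \<and> cmod (f2 t - F2 l t) \<le> e)
    \<and> (F l = (\<lambda>_. 1) \<longrightarrow> f = (\<lambda>_. 1))" for l
  proof (cases "F l = (\<lambda>_. 1)")
    case True
    have "F1 l = (\<lambda>_. 0)" "F2 l = (\<lambda>_. 0)"
      using C2_unique[of "\<lambda>_. 1" "F1 l" "F2 l" "\<lambda>_. 0" "\<lambda>_. 0"] C2[of l] C2_const[of 1] True by auto
    then show ?thesis
      using True C2[of l] strig_const[of 0 1] e
      by (intro exI[of _ "0::nat"] exI[of _ "F l"] exI[of _ "\<lambda>m. if m = 0 then 1 else 0"] exI[of _ "F1 l"] exI[of _ "F2 l"]) auto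
  next
    case False
    obtain R f c f1 f2 where "strig R f c" "C2 f f1 f2"
      "\<And>\<theta>. \<theta> \<in> {0..2*pi} \<Longrightarrow> cmod (f \<theta> - F l \<theta>) \<le> e"
      "\<And>\<theta>. \<theta> \<in> {0..2*pi} \<Longrightarrow> cmod (f1 \<theta> - F1 l \<theta>) \<le> e"
      "\<And>\<theta>. \<theta> \<in> {0..2*pi} \<Longrightarrow> cmod (f2 \<theta> - F2 l \<theta>) \<le> e"
      using C2_approx[OF C2[of l] cont[of l] per(1)[of l] per(2)[of l] per(3)[of l] e] by blast
    then show ?thesis using False by blast
  qed
  then have ex: "\<forall>l. \<exists>x. strig (fst x) (fst (snd x)) (fst (snd (snd x))) \<and>
    C2 (fst (snd x)) (fst (snd (snd (snd x)))) (snd (snd (snd (snd x)))) \<and>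
    (\<forall>t\<in>{0..2*pi}. cmod (fst (snd x) t - F l t) \<le> e \<and> cmod (fst (snd (snd (snd x))) t - F1 l t) \<le> e
      \<and> cmod (snd (snd (snd (snd x))) t - F2 l t) \<le> e)
    \<and> (F l = (\<lambda>_. 1) \<longrightarrow> fst (snd x) = (\<lambda>_. 1))"
    unfolding split_paired_Ex fst_conv snd_conv by blast
  obtain X where X: "\<forall>l. strig (fst (X l)) (fst (snd (X l))) (fst (snd (snd (X l)))) \<and>
    C2 (fst (snd (X l))) (fst (snd (snd (snd (X l))))) (snd (snd (snd (snd (X l))))) \<and>
    (\<forall>t\<in>{0..2*pi}. cmod (fst (snd (X l)) t - F l t) \<le> e \<and> cmod (fst (snd (snd (snd (X l)))) t - F1 l t) \<le> e
      \<and> cmod (snd (snd (snd (snd (X l)))) t - F2 l t) \<le> e)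
    \<and> (F l = (\<lambda>_. 1) \<longrightarrow> fst (snd (X l)) = (\<lambda>_. 1))"
    using choice[OF ex] by blast
  define R where "R l = fst (X l)" for l
  define f where "f l = fst (snd (X l))" for l
  define c where "c l = fst (snd (snd (X l)))" for l
  define f1 where "f1 l = fst (snd (snd (snd (X l))))" for l
  define f2 where "f2 l = snd (snd (snd (snd (X l))))" for l
  have *: "\<And>l. strig (R l) (f l) (c l)" "\<And>l. C2 (f l) (f1 l) (f2 l)"
    "\<And>l t. t \<in> {0..2*pi} \<Longrightarrow> cmod (f l t - F l t) \<le> e \<and> cmod (f1 l t - F1 l t) \<le> e \<and> cmod (f2 l t - F2 l t) \<le> e"
    "\<And>l. F l = (\<lambda>_. 1) \<Longrightarrow> f l = (\<lambda>_. 1)"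
    using X unfolding R_def f_def c_def f1_def f2_def by blast+
  have "strig (Max (insert 0 (R ` I))) (f l) (c l)" if "l \<in> I" for l
    using that I by (intro strig_mono[OF *(1)] Max_ge) auto
  then show ?thesis using that[of _ f c f1 f2] *(2-4) by blast
qed

lemma product_close:
  fixes a b a' b' :: complex
  assumes "cmod (a - a') \<le> e" "cmod (b - b') \<le> e" "cmod a' \<le> B" "cmod b' \<le> B" "e \<le> 1"
  shows "cmod (a * b - a' * b') \<le> e * (2 * B + 1)"
proof -
  have "a * b - a' * b' = a * (b - b') + (a - a') * b'" by (simp add: algebra_simps)
  then have "cmod (a * b - a' * b') \<le> cmod a * cmod (b - b') + cmod (a - a') * cmod b'"
    by (metis norm_mult norm_triangle_ineq)
  also have "cmod a \<le> B + 1" using norm_triangle_sub[of a a'] assms by linarith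
  then have "cmod a * cmod (b - b') + cmod (a - a') * cmod b' \<le> (B + 1) * e + e * B"
    using assms norm_ge_zero order_trans by (intro add_mono mult_mono) (auto intro: order_trans[OF norm_ge_zero])
  finally show ?thesis by (simp add: algebra_simps)
qed

text \<open>All scalar data of the loop, for paths of degree n and before any algebra is given. M is
  independent of \<eta>, whereas R and the size of g and h may grow as \<eta> shrinks. The long
  bracket is the product of two waves expanded: it is an identity for the exact functions
  \<open>wave\<close>, \<open>psi\<close>, \<open>chi\<close> (\<open>rel\<close>). Its arrangement
  puts factors \<open>turn\<close> - 1 in front of g and h; summed against the coefficients of a
  path they produce its end minus its start, which is small.\<close>

lemma scalar_approximation:
  fixes n :: nat
  shows "\<exists>M\<ge>1. \<forall>\<eta>>0. \<exists>R f cf g cg h ch.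
    (\<forall>l. \<bar>l\<bar> \<le> 2 * int n \<longrightarrow> strig R (f l) (cf l) \<and> (\<Sum>m\<in>{- int R..int R}. cmod (cf l m)) \<le> M) \<and>
    f 0 = (\<lambda>_. 1) \<and>
    (\<forall>l. \<bar>l\<bar> \<le> int n \<longrightarrow> strig R (g l) (cg l)) \<and> strig R h ch \<and>
    (\<forall>l t. t \<in> {0..2*pi} \<longrightarrow> cmod (f l t - wave l t) \<le> \<eta>) \<and>
    (\<forall>j k. \<bar>j\<bar> \<le> int n \<longrightarrow> \<bar>k\<bar> \<le> int n \<longrightarrow>
      (\<exists>b. strig (R + R) (\<lambda>t. cnj (f j t) * f k t - (f (k - j) t - (turn k - 1) * g (- j) t
           - (turn (- j) - 1) * g k t + (turn (- j) - 1) * (turn k - 1) * h t)) b \<and>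
         (\<Sum>m\<in>{- int (R + R)..int (R + R)}. cmod (b m)) \<le> \<eta>))"
proof -
  define wave1 where "wave1 = (\<lambda>l t. spin1 l t - (turn l - 1) * ramp1 t)"
  define wave2 where "wave2 = (\<lambda>l t. spin2 l t - (turn l - 1) * ramp2 t)"
  have wave: "C2 (wave l) (wave1 l) (wave2 l)" for l
    unfolding wave_def wave1_def wave2_def by (intro C2_diff C2_cmult spin_C2 ramp_C2)
  \<comment> \<open>The mixed terms \<open>ramp\<close> * \<open>spin\<close> and
    \<open>ramp\<close>^2 of the product are not periodic. Subtracting multiples of
    \<open>ramp\<close> makes them vanish at both ends, and in \<open>rel\<close> these subtractions
    cancel against the one in \<open>wave (k - j)\<close>.\<close>
  define psi where "psi = (\<lambda>l t. ramp t * (spin l t - turn l))"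
  define psi1 where "psi1 = (\<lambda>l t. ramp t * (spin1 l t - 0) + ramp1 t * (spin l t - turn l))"
  define psi2 where "psi2 = (\<lambda>l t. ramp t * (spin2 l t - 0) + 2 * ramp1 t * (spin1 l t - 0) + ramp2 t * (spin l t - turn l))"
  have psi: "C2 (psi l) (psi1 l) (psi2 l)" for l
    unfolding psi_def psi1_def psi2_def by (intro C2_mult C2_diff C2_const spin_C2 ramp_C2)
  define chi where "chi = (\<lambda>t. ramp t * ramp t - ramp t)"
  define chi1 where "chi1 = (\<lambda>t. (ramp t * ramp1 t + ramp1 t * ramp t) - ramp1 t)"
  define chi2 where "chi2 = (\<lambda>t. (ramp t * ramp2 t + 2 * ramp1 t * ramp1 t + ramp2 t * ramp t) - ramp2 t)"
  have chi: "C2 chi chi1 chi2"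
    unfolding chi_def chi1_def chi2_def by (intro C2_mult C2_diff ramp_C2)
  note cont = continuous_intros continuous_ramp2 continuous_spin2 C2_continuous[OF spin_C2] C2_continuous[OF ramp_C2]
  have cw: "continuous_on {0..2*pi} (wave2 l)" and cp: "continuous_on {0..2*pi} (psi2 l)"
    and cc: "continuous_on {0..2*pi} chi2" for l
    unfolding wave2_def psi2_def chi2_def by (intro cont)+
  have pw: "wave l 0 = wave l (2*pi)" "wave1 l 0 = wave1 l (2*pi)" "wave2 l 0 = wave2 l (2*pi)" for l
    by (simp_all add: wave_def wave1_def wave2_def)
  have pp: "psi l 0 = psi l (2*pi)" "psi1 l 0 = psi1 l (2*pi)" "psi2 l 0 = psi2 l (2*pi)" for l
    by (simp_all add: psi_def psi1_def psi2_def)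
  have pc: "chi 0 = chi (2*pi)" "chi1 0 = chi1 (2*pi)" "chi2 0 = chi2 (2*pi)"
    by (simp_all add: chi_def chi1_def chi2_def)
  have rel: "cnj (wave j t) * wave k t - (wave (k - j) t - (turn k - 1) * psi (- j) t
      - (turn (- j) - 1) * psi k t + (turn (- j) - 1) * (turn k - 1) * chi t) = 0" for j k t
  proof -
    have "wave (k - j) t = spin k t * cnj (spin j t) - (turn k * cnj (turn j) - 1) * ramp t"
      using spin_simps(2)[of k "- j" t] spin_simps(3)[of j t] turn_simps(2)[of k "- j"] turn_simps(3)[of j] by (simp add: wave_def)
    then show ?thesis
      by (simp add: wave_def psi_def chi_def spin_simps turn_simps cnj_ramp) (simp add: algebra_simps)
  qed
  define I where "I = {- (2 * int n)..2 * int n}"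
  have "\<exists>b. \<forall>t\<in>{0..2*pi}. cmod (wave l t) \<le> b \<and> cmod (wave1 l t) \<le> b \<and> cmod (wave2 l t) \<le> b" for l
  proof -
    have "\<exists>b. \<forall>t\<in>{0..2*pi}. cmod (u t) \<le> b" if "continuous_on {0..2*pi} u" for u :: "real \<Rightarrow> complex"
      using compact_continuous_image[OF that compact_Icc] compact_imp_bounded bounded_iff by (metis imageI)
    from this[OF C2_continuous(1)[OF wave]] this[OF C2_continuous(2)[OF wave]] this[OF cw]
    obtain b1 b2 b3 where "\<forall>t\<in>{0..2*pi}. cmod (wave l t) \<le> b1" "\<forall>t\<in>{0..2*pi}. cmod (wave1 l t) \<le> b2"
      "\<forall>t\<in>{0..2*pi}. cmod (wave2 l t) \<le> b3" by blast
    then show ?thesis by (intro exI[of _ "max b1 (max b2 b3)"]) (auto simp: le_max_iff_disj)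
  qed
  then obtain b where b: "\<And>l t. t \<in> {0..2*pi} \<Longrightarrow> cmod (wave l t) \<le> b l \<and> cmod (wave1 l t) \<le> b l \<and> cmod (wave2 l t) \<le> b l"
    by metis
  have b0: "0 \<le> b l" for l using b[of 0 l] order_trans[OF norm_ge_zero, of "wave l 0" "b l"] by simp
  define B where "B = (\<Sum>l\<in>I. b l)"
  have B: "cmod (wave l t) \<le> B" "cmod (wave1 l t) \<le> B" "cmod (wave2 l t) \<le> B" if "l \<in> I" "t \<in> {0..2*pi}" for l t
  proof -
    have "b l \<le> B" unfolding B_def using that b0 by (intro member_le_sum) (auto simp: I_def)
    then show "cmod (wave l t) \<le> B" "cmod (wave1 l t) \<le> B" "cmod (wave2 l t) \<le> B" using b[OF that(2), of l] by auto
  qed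
  have B0: "0 \<le> B" unfolding B_def by (intro sum_nonneg b0)
  show ?thesis
  \<comment> \<open>The approximants and their second derivatives stay below B + 1, as e is at most
    1; the 5 is that of \<open>strig_sum_coeff_le\<close>.\<close>
  proof (intro exI[of _ "5 * (B + 1)"] conjI allI impI)
    show "1 \<le> 5 * (B + 1)" using B0 by simp
    fix \<eta> :: real assume \<eta>: "0 < \<eta>"
    \<comment> \<open>The second derivative of a product has the weights 1, 2, 1, and each product
      is off by e (2 B + 1); the linear bracket is off by 9 e. So 8 B + 13 = 4 (2 B + 1) + 9, and
      the 5 is again that of \<open>strig_sum_coeff_le\<close>.\<close>
    define e where "e = min 1 (\<eta> / (5 * (8 * B + 13)))"
    have e: "0 < e" "e \<le> 1" using \<eta> B0 by (auto simp: e_def)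
    have e\<eta>: "5 * (e * (8 * B + 13)) \<le> \<eta>"
    proof -
      have "e * (5 * (8 * B + 13)) \<le> \<eta> / (5 * (8 * B + 13)) * (5 * (8 * B + 13))"
        using B0 by (intro mult_right_mono) (auto simp: e_def)
      also have "\<dots> = \<eta>" using B0 by simp
      finally show ?thesis by (simp add: algebra_simps)
    qed
    have e\<eta>': "e \<le> \<eta>"
    proof -
      have "e * 1 \<le> e * (5 * (8 * B + 13))" using e B0 by (intro mult_left_mono) auto
      then show ?thesis using e\<eta> by (simp add: algebra_simps)
    qed
    have finI: "finite I" by (simp add: I_def)
    obtain R1 f cf f1 f2 where f: "\<And>l. l \<in> I \<Longrightarrow> strig R1 (f l) (cf l)" "\<And>l. C2 (f l) (f1 l) (f2 l)"
      "\<And>l t. t \<in> {0..2*pi} \<Longrightarrow> cmod (f l t - wave l t) \<le> e \<and> cmod (f1 l t - wave1 l t) \<le> e \<and> cmod (f2 l t - wave2 l t) \<le> e"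
      "\<And>l. wave l = (\<lambda>_. 1) \<Longrightarrow> f l = (\<lambda>_. 1)"
      by (rule C2_family_approx[OF wave cw pw e(1) finI], rule that; assumption?; blast?)
    obtain R2 g cg g1 g2 where g: "\<And>l. l \<in> I \<Longrightarrow> strig R2 (g l) (cg l)" "\<And>l. C2 (g l) (g1 l) (g2 l)"
      "\<And>l t. t \<in> {0..2*pi} \<Longrightarrow> cmod (g l t - psi l t) \<le> e \<and> cmod (g1 l t - psi1 l t) \<le> e \<and> cmod (g2 l t - psi2 l t) \<le> e"
      by (rule C2_family_approx[OF psi cp pp e(1) finI], rule that; assumption?; blast?)
    obtain R3 h ch h1 h2 where h: "strig R3 h ch" "C2 h h1 h2"
      "\<And>t. t \<in> {0..2*pi} \<Longrightarrow> cmod (h t - chi t) \<le> e"  "\<And>t. t \<in> {0..2*pi} \<Longrightarrow> cmod (h1 t - chi1 t) \<le> e"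
      "\<And>t. t \<in> {0..2*pi} \<Longrightarrow> cmod (h2 t - chi2 t) \<le> e"
      using C2_approx[OF chi cc pc e(1)] by blast
    define R where "R = max R1 (max R2 R3)"
    have fR: "strig R (f l) (cf l)" if "l \<in> I" for l by (rule strig_mono[OF f(1)[OF that]]) (simp add: R_def)
    have gR: "strig R (g l) (cg l)" if "l \<in> I" for l by (rule strig_mono[OF g(1)[OF that]]) (simp add: R_def)
    have hR: "strig R h ch" by (rule strig_mono[OF h(1)]) (simp add: R_def)
    have fB: "cmod (f l t) \<le> B + 1" "cmod (f2 l t) \<le> B + 1" if "l \<in> I" "t \<in> {0..2*pi}" for l t
      using norm_triangle_sub[of "f l t" "wave l t"] norm_triangle_sub[of "f2 l t" "wave2 l t"]
        f(3)[OF that(2), of l] B[OF that] e by linarith+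
    have err: "\<exists>b. strig (R + R) (\<lambda>t. cnj (f j t) * f k t - (f (k - j) t - (turn k - 1) * g (- j) t
           - (turn (- j) - 1) * g k t + (turn (- j) - 1) * (turn k - 1) * h t)) b \<and>
         (\<Sum>m\<in>{- int (R + R)..int (R + R)}. cmod (b m)) \<le> \<eta>" if jk: "\<bar>j\<bar> \<le> int n" "\<bar>k\<bar> \<le> int n" for j k
    proof -
      have I: "j \<in> I" "k \<in> I" "k - j \<in> I" "- j \<in> I" using jk by (auto simp: I_def)
      let ?\<alpha> = "turn k - 1" and ?\<beta> = "turn (- j) - 1"
      have \<alpha>: "cmod ?\<alpha> \<le> 2" "cmod ?\<beta> \<le> 2"
        using norm_triangle_ineq4[of "turn k" 1] norm_triangle_ineq4[of "turn (- j)" 1] turn_simps(5)[of k] turn_simps(5)[of "- j"] by auto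
      have \<alpha>\<beta>: "cmod (?\<beta> * ?\<alpha>) \<le> 4" using mult_mono[OF \<alpha>(2,1)] by (simp add: norm_mult)
      let ?r = "\<lambda>t. cnj (f j t) * f k t - (f (k - j) t - ?\<alpha> * g (- j) t - ?\<beta> * g k t + ?\<beta> * ?\<alpha> * h t)"
      obtain c1 where c1: "strig R (\<lambda>t. cnj (f j t)) c1" using strig_cnj[OF fR[OF I(1)]] by blast
      obtain c2 where c2: "strig (R + R) (\<lambda>t. cnj (f j t) * f k t) c2" using strig_mult[OF c1 fR[OF I(2)]] by blast
      have "strig R (\<lambda>t. f (k - j) t - ?\<alpha> * g (- j) t - ?\<beta> * g k t + ?\<beta> * ?\<alpha> * h t)
        (\<lambda>m. cf (k - j) m - ?\<alpha> * cg (- j) m - ?\<beta> * cg k m + ?\<beta> * ?\<alpha> * ch m)"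
        by (intro strig_add strig_diff strig_cmult fR gR hR I)
      then have "strig (R + R) (\<lambda>t. f (k - j) t - ?\<alpha> * g (- j) t - ?\<beta> * g k t + ?\<beta> * ?\<alpha> * h t)
        (\<lambda>m. cf (k - j) m - ?\<alpha> * cg (- j) m - ?\<beta> * cg k m + ?\<beta> * ?\<alpha> * ch m)" by (rule strig_mono) simp
      from strig_diff[OF c2 this] obtain b where b: "strig (R + R) ?r b" by blast
      \<comment> \<open>One formula for the second derivative of the bracket, evaluated at the
        approximants in \<open>r2\<close> and at the exact functions in \<open>\<rho>2\<close>,
        where it gives 0.\<close>
      define D where "D = (\<lambda>(a0::complex) a1 a2 b0 b1 b2 c2 d2 e2 h2. (a0 * b2 + 2 * a1 * b1 + a2 * b0) - (c2 - ?\<alpha> * d2 - ?\<beta> * e2 + ?\<beta> * ?\<alpha> * h2))"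
      define r1 where "r1 = (\<lambda>t. (cnj (f j t) * f1 k t + cnj (f1 j t) * f k t) - (f1 (k - j) t - ?\<alpha> * g1 (- j) t - ?\<beta> * g1 k t + ?\<beta> * ?\<alpha> * h1 t))"
      define r2 where "r2 = (\<lambda>t. D (cnj (f j t)) (cnj (f1 j t)) (cnj (f2 j t)) (f k t) (f1 k t) (f2 k t) (f2 (k - j) t) (g2 (- j) t) (g2 k t) (h2 t))"
      have r: "C2 ?r r1 r2"
        unfolding r1_def r2_def D_def by (intro C2_diff C2_add C2_cmult C2_mult C2_cnj f(2) g(2) h(2))
      define \<rho>1 where "\<rho>1 = (\<lambda>t. (cnj (wave j t) * wave1 k t + cnj (wave1 j t) * wave k t) - (wave1 (k - j) t - ?\<alpha> * psi1 (- j) t - ?\<beta> * psi1 k t + ?\<beta> * ?\<alpha> * chi1 t))"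
      define \<rho>2 where "\<rho>2 = (\<lambda>t. D (cnj (wave j t)) (cnj (wave1 j t)) (cnj (wave2 j t)) (wave k t) (wave1 k t) (wave2 k t) (wave2 (k - j) t) (psi2 (- j) t) (psi2 k t) (chi2 t))"
      have "C2 (\<lambda>t. cnj (wave j t) * wave k t - (wave (k - j) t - ?\<alpha> * psi (- j) t - ?\<beta> * psi k t + ?\<beta> * ?\<alpha> * chi t)) \<rho>1 \<rho>2"
        unfolding \<rho>1_def \<rho>2_def D_def by (intro C2_diff C2_add C2_cmult C2_mult C2_cnj wave psi chi)
      then have "C2 (\<lambda>_. 0) \<rho>1 \<rho>2" unfolding rel .
      then have \<rho>2: "\<rho>2 = (\<lambda>_. 0)" using C2_unique(2)[OF _ C2_const] by blast
      \<comment> \<open>9 = 1 + 2 + 2 + 4, because \<open>turn\<close> - 1 has modulus at most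
        2.\<close>
      have lin: "cmod ((c - ?\<alpha> * d - ?\<beta> * d' + ?\<beta> * ?\<alpha> * d'') - (c' - ?\<alpha> * x - ?\<beta> * x' + ?\<beta> * ?\<alpha> * x'')) \<le> 9 * e"
        if "cmod (c - c') \<le> e" "cmod (d - x) \<le> e" "cmod (d' - x') \<le> e" "cmod (d'' - x'') \<le> e" for c c' d d' d'' x x' x''
      proof -
        have "(c - ?\<alpha> * d - ?\<beta> * d' + ?\<beta> * ?\<alpha> * d'') - (c' - ?\<alpha> * x - ?\<beta> * x' + ?\<beta> * ?\<alpha> * x'')
          = (c - c') - ?\<alpha> * (d - x) - ?\<beta> * (d' - x') + ?\<beta> * ?\<alpha> * (d'' - x'')" by (simp add: algebra_simps)
        also have "cmod \<dots> \<le> cmod (c - c') + cmod (?\<alpha> * (d - x)) + cmod (?\<beta> * (d' - x')) + cmod (?\<beta> * ?\<alpha> * (d'' - x''))"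
          by (intro order_trans[OF norm_triangle_ineq] add_mono order_trans[OF norm_triangle_ineq4] order_refl)
        also have "\<dots> \<le> e + 2 * e + 2 * e + 4 * e"
          using \<alpha> \<alpha>\<beta> that e unfolding norm_mult[of _ "_ - _"] by (intro add_mono mult_mono) auto
        finally show ?thesis by simp
      qed
      have small: "cmod (?r t) \<le> e * (8 * B + 13)" "cmod (r2 t) \<le> e * (8 * B + 13)" if t: "t \<in> {0..2*pi}" for t
      proof -
        note fc = f(3)[OF t] and gc = g(3)[OF t]
        have cj: "cmod (cnj x - cnj y) = cmod (x - y)" for x y
          by (metis complex_cnj_diff complex_mod_cnj)
        note pr = product_close[OF _ _ _ _ e(2), of _ _ _ _ B]
        have 1: "cmod (cnj (f j t) * f k t - cnj (wave j t) * wave k t) \<le> e * (2 * B + 1)"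
          by (rule pr) (use fc B[OF I(1) t] B[OF I(2) t] cj in auto)
        have 2: "cmod (cnj (f j t) * f2 k t - cnj (wave j t) * wave2 k t) \<le> e * (2 * B + 1)"
          by (rule pr) (use fc B[OF I(1) t] B[OF I(2) t] cj in auto)
        have 3: "cmod (cnj (f1 j t) * f1 k t - cnj (wave1 j t) * wave1 k t) \<le> e * (2 * B + 1)"
          by (rule pr) (use fc B[OF I(1) t] B[OF I(2) t] cj in auto)
        have 4: "cmod (cnj (f2 j t) * f k t - cnj (wave2 j t) * wave k t) \<le> e * (2 * B + 1)"
          by (rule pr) (use fc B[OF I(1) t] B[OF I(2) t] cj in auto)
        let ?L = "\<lambda>c d d' d''. c - ?\<alpha> * d - ?\<beta> * d' + ?\<beta> * ?\<alpha> * d''"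
        have 5: "cmod (?L (f (k - j) t) (g (- j) t) (g k t) (h t) - ?L (wave (k - j) t) (psi (- j) t) (psi k t) (chi t)) \<le> 9 * e"
          by (rule lin) (use fc gc h(3)[OF t] in auto)
        have 6: "cmod (?L (f2 (k - j) t) (g2 (- j) t) (g2 k t) (h2 t) - ?L (wave2 (k - j) t) (psi2 (- j) t) (psi2 k t) (chi2 t)) \<le> 9 * e"
          by (rule lin) (use fc gc h(5)[OF t] in auto)
        have "?r t = (cnj (f j t) * f k t - cnj (wave j t) * wave k t)
           - (?L (f (k - j) t) (g (- j) t) (g k t) (h t) - ?L (wave (k - j) t) (psi (- j) t) (psi k t) (chi t))"
          using rel[of j t k] by (simp add: algebra_simps)
        note req = this
        have "cmod (?r t) \<le> e * (2 * B + 1) + 9 * e"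
          by (subst req) (rule order_trans[OF norm_triangle_ineq4 add_mono[OF 1 5]])
        also have "\<dots> \<le> e * (8 * B + 13)" using e B0 by (simp add: algebra_simps)
        finally show "cmod (?r t) \<le> e * (8 * B + 13)" .
        have "r2 t = (cnj (f j t) * f2 k t - cnj (wave j t) * wave2 k t) + 2 * (cnj (f1 j t) * f1 k t - cnj (wave1 j t) * wave1 k t)
           + (cnj (f2 j t) * f k t - cnj (wave2 j t) * wave k t)
           - (?L (f2 (k - j) t) (g2 (- j) t) (g2 k t) (h2 t) - ?L (wave2 (k - j) t) (psi2 (- j) t) (psi2 k t) (chi2 t))"
          using fun_cong[OF \<rho>2, of t] by (simp add: r2_def \<rho>2_def D_def algebra_simps)
        also have "cmod \<dots> \<le> e * (2 * B + 1) + 2 * (e * (2 * B + 1)) + e * (2 * B + 1) + 9 * e"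
        proof -
          have 3: "cmod (2 * (cnj (f1 j t) * f1 k t - cnj (wave1 j t) * wave1 k t)) \<le> 2 * (e * (2 * B + 1))"
            using 3 unfolding norm_mult[of 2] by simp
          show ?thesis
            by (rule order_trans[OF norm_triangle_ineq4 add_mono[OF order_trans[OF norm_triangle_ineq
                  add_mono[OF order_trans[OF norm_triangle_ineq add_mono[OF 2 3]] 4]] 6]])
        qed
        also have "\<dots> = e * (8 * B + 13)" by (simp add: algebra_simps)
        finally show "cmod (r2 t) \<le> e * (8 * B + 13)" .
      qed
      have "(\<Sum>m\<in>{- int (R + R)..int (R + R)}. cmod (b m)) \<le> 5 * (e * (8 * B + 13))"
        using r small by (intro strig_sum_coeff_le[OF b, of r1 r2]) (auto simp: C2_def)
      then show ?thesis using b e\<eta> by (intro exI[of _ b]) auto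
    qed
    have "wave 0 = (\<lambda>_. 1)" by (simp add: wave_def spin_simps turn_simps fun_eq_iff)
    then have f0: "f 0 = (\<lambda>_. 1)" by (rule f(4))
    have fM: "(\<Sum>m\<in>{- int R..int R}. cmod (cf l m)) \<le> 5 * (B + 1)" if "l \<in> I" for l
      using fB[OF that] f(2)[of l] by (intro strig_sum_coeff_le[OF fR[OF that], of "f1 l" "f2 l"]) (auto simp: C2_def)
    show "\<exists>R f cf g cg h ch.
    (\<forall>l. \<bar>l\<bar> \<le> 2 * int n \<longrightarrow> strig R (f l) (cf l) \<and> (\<Sum>m\<in>{- int R..int R}. cmod (cf l m)) \<le> 5 * (B + 1)) \<and>
    f 0 = (\<lambda>_. 1) \<and>
    (\<forall>l. \<bar>l\<bar> \<le> int n \<longrightarrow> strig R (g l) (cg l)) \<and> strig R h ch \<and>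
    (\<forall>l t. t \<in> {0..2*pi} \<longrightarrow> cmod (f l t - wave l t) \<le> \<eta>) \<and>
    (\<forall>j k. \<bar>j\<bar> \<le> int n \<longrightarrow> \<bar>k\<bar> \<le> int n \<longrightarrow>
      (\<exists>b. strig (R + R) (\<lambda>t. cnj (f j t) * f k t - (f (k - j) t - (turn k - 1) * g (- j) t
           - (turn (- j) - 1) * g k t + (turn (- j) - 1) * (turn k - 1) * h t)) b \<and>
         (\<Sum>m\<in>{- int (R + R)..int (R + R)}. cmod (b m)) \<le> \<eta>))"
    proof (rule exI[of _ R], rule exI[of _ f], rule exI[of _ cf], rule exI[of _ g], rule exI[of _ cg],
        rule exI[of _ h], rule exI[of _ ch], intro conjI allI impI)
      have "l \<in> I" if "\<bar>l\<bar> \<le> 2 * int n" for l using that by (auto simp: I_def)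
      then show "strig R (f l) (cf l)" "(\<Sum>m\<in>{- int R..int R}. cmod (cf l m)) \<le> 5 * (B + 1)" if "\<bar>l\<bar> \<le> 2 * int n" for l
        using that fR[of l] fM[of l] by blast+
      show "strig R (g l) (cg l)" if "\<bar>l\<bar> \<le> int n" for l using that by (intro gR) (auto simp: I_def)
      show "cmod (f l t - wave l t) \<le> \<eta>" if "t \<in> {0..2*pi}" for l t using f(3)[OF that, of l] e\<eta>' by linarith
      show "f 0 = (\<lambda>_. 1)" by (rule f0)
      show "strig R h ch" by (rule hR)
    qed (rule err)
  qed
qed

section \<open>Closing up a path of unitaries\<close>

context involutive_banach_algebra
begin

lemma strig_is_trig:
  assumes "strig R s a" "x \<in> carrier A"
  shows "is_trig R (\<lambda>\<theta>. scale A (s \<theta>) x) (\<lambda>m. scale A (a m) x)"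
    "wnorm R (\<lambda>m. scale A (a m) x) = (\<Sum>m\<in>{- int R..int R}. cmod (a m)) * cnorm A x"
  using is_trig_scalar[where s = s and R = R and a = a and x = x] assms by (auto simp: strig_def)

lemma double_sum_linear:
  assumes "\<And>j k. T j k \<in> carrier A" "finite J"
  shows "(\<Oplus>j\<in>J. \<Oplus>k\<in>J. scale A (\<phi> j k + \<psi> j k) (T j k))
      = (\<Oplus>j\<in>J. \<Oplus>k\<in>J. scale A (\<phi> j k) (T j k)) \<oplus> (\<Oplus>j\<in>J. \<Oplus>k\<in>J. scale A (\<psi> j k) (T j k))"
    "(\<Oplus>j\<in>J. \<Oplus>k\<in>J. scale A (z * \<phi> j k) (T j k)) = scale A z (\<Oplus>j\<in>J. \<Oplus>k\<in>J. scale A (\<phi> j k) (T j k))"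
proof -
  have "(\<Oplus>j\<in>J. \<Oplus>k\<in>J. scale A (\<phi> j k + \<psi> j k) (T j k))
      = (\<Oplus>j\<in>J. (\<Oplus>k\<in>J. scale A (\<phi> j k) (T j k)) \<oplus> (\<Oplus>k\<in>J. scale A (\<psi> j k) (T j k)))"
    using assms by (intro finsum_cong' refl) (auto simp: scale_add_left intro!: finsum_addf)
  also have "\<dots> = (\<Oplus>j\<in>J. \<Oplus>k\<in>J. scale A (\<phi> j k) (T j k)) \<oplus> (\<Oplus>j\<in>J. \<Oplus>k\<in>J. scale A (\<psi> j k) (T j k))"
    using assms by (intro finsum_addf) auto
  finally show "(\<Oplus>j\<in>J. \<Oplus>k\<in>J. scale A (\<phi> j k + \<psi> j k) (T j k))
      = (\<Oplus>j\<in>J. \<Oplus>k\<in>J. scale A (\<phi> j k) (T j k)) \<oplus> (\<Oplus>j\<in>J. \<Oplus>k\<in>J. scale A (\<psi> j k) (T j k))" .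
  show "(\<Oplus>j\<in>J. \<Oplus>k\<in>J. scale A (z * \<phi> j k) (T j k)) = scale A z (\<Oplus>j\<in>J. \<Oplus>k\<in>J. scale A (\<phi> j k) (T j k))"
    using assms by (simp add: scale_finsum Pi_iff scale_scale)
qed

text \<open>
  The defect \<open>1 - P\<^sup>* P\<close> (and likewise \<open>1 - P P\<^sup>*\<close>) of the approximating loop, with
  \<open>T j k = c\<^sub>j\<^sup>* c\<^sub>k\<close>.
\<close>

lemma defect_trig:
  fixes n R :: nat and T :: "int \<Rightarrow> int \<Rightarrow> 'a"
  assumes f: "\<And>l. \<bar>l\<bar> \<le> 2 * int n \<Longrightarrow> strig R (f l) (cf l)" and f0: "f 0 = (\<lambda>_. 1)"
    and g: "\<And>l. \<bar>l\<bar> \<le> int n \<Longrightarrow> strig R (g l) (cg l)" "\<And>l. \<bar>l\<bar> \<le> int n \<Longrightarrow> (\<Sum>m\<in>{- int R..int R}. cmod (cg l m)) \<le> L"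
    and h: "strig R h ch" "(\<Sum>m\<in>{- int R..int R}. cmod (ch m)) \<le> L"
    and r: "\<And>j k. \<bar>j\<bar> \<le> int n \<Longrightarrow> \<bar>k\<bar> \<le> int n \<Longrightarrow>
      (\<exists>b. strig (R + R) (\<lambda>t. cnj (f j t) * f k t - (f (k - j) t - (turn k - 1) * g (- j) t
           - (turn (- j) - 1) * g k t + (turn (- j) - 1) * (turn k - 1) * h t)) b \<and>
         (\<Sum>m\<in>{- int (R + R)..int (R + R)}. cmod (b m)) \<le> \<eta>)"
    and T: "\<And>j k. T j k \<in> carrier A" "\<And>j k. k \<notin> ivl n \<Longrightarrow> T j k = \<zero>"
    and T1: "\<And>l. (\<Oplus>j\<in>ivl n. T j (j + l)) = (if l = 0 then \<one> else \<zero>)"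
    and a: "\<And>j. (\<Oplus>k\<in>ivl n. scale A (turn k - 1) (T j k)) = a j"
    and b: "\<And>k. (\<Oplus>j\<in>ivl n. scale A (turn (- j) - 1) (T j k)) = b k"
    and w: "(\<Oplus>j\<in>ivl n. scale A (turn (- j) - 1) (a j)) = w"
  shows "\<exists>y. is_trig (R + R) (\<lambda>t. \<one> \<ominus> (\<Oplus>j\<in>ivl n. \<Oplus>k\<in>ivl n. scale A (cnj (f j t) * f k t) (T j k))) y \<and>
    wnorm (R + R) y \<le> \<eta> * (\<Sum>j\<in>ivl n. \<Sum>k\<in>ivl n. cnorm A (T j k)) + L * (\<Sum>j\<in>ivl n. cnorm A (a j))
      + L * (\<Sum>k\<in>ivl n. cnorm A (b k)) + L * cnorm A w"
proof -
  define \<rho> where "\<rho> = (\<lambda>j k t. cnj (f j t) * f k t - (f (k - j) t - (turn k - 1) * g (- j) t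
           - (turn (- j) - 1) * g k t + (turn (- j) - 1) * (turn k - 1) * h t))"
  define cr where "cr = (\<lambda>(j, k). SOME c. strig (R + R) (\<rho> j k) c \<and> (\<Sum>m\<in>{- int (R + R)..int (R + R)}. cmod (c m)) \<le> \<eta>)"
  have cr: "strig (R + R) (\<rho> j k) (cr (j, k))" "(\<Sum>m\<in>{- int (R + R)..int (R + R)}. cmod (cr (j, k) m)) \<le> \<eta>"
    if "j \<in> ivl n" "k \<in> ivl n" for j k
  proof -
    have "\<bar>j\<bar> \<le> int n" "\<bar>k\<bar> \<le> int n" using that by auto
    from someI_ex[OF r[OF this, folded \<rho>_def]] show "strig (R + R) (\<rho> j k) (cr (j, k))"
      "(\<Sum>m\<in>{- int (R + R)..int (R + R)}. cmod (cr (j, k) m)) \<le> \<eta>"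
      unfolding cr_def \<rho>_def by auto
  qed
  have ac: "a j \<in> carrier A" and bc: "b k \<in> carrier A" for j k using T(1) unfolding a[symmetric] b[symmetric] by auto
  have wc: "w \<in> carrier A" unfolding w[symmetric] using ac by auto
  let ?SS = "\<lambda>\<phi>. \<Oplus>j\<in>ivl n. \<Oplus>k\<in>ivl n. scale A (\<phi> j k) (T j k)"
  have SSc: "?SS \<phi> \<in> carrier A" for \<phi> using T(1) by auto
  note lin = double_sum_linear[OF T(1) finite_atLeastAtMost_int]
  \<comment> \<open>Grouping by l = k - j, unitarity in the form \<open>T1\<close> leaves l = 0
    only, where f is exactly 1. So the main term contributes no error, however large the other f l
    are.\<close>
  have S1: "?SS (\<lambda>j k. f (k - j) t) = \<one>" for t
  proof -
    have in1: "(\<Oplus>k\<in>ivl n. scale A (f (k - j) t) (T j k)) = (\<Oplus>l\<in>ivl (2 * n). scale A (f l t) (T j (j + l)))" if j: "j \<in> ivl n" for j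
    proof -
      have "(\<Oplus>l\<in>ivl (2 * n). scale A (f l t) (T j (j + l))) = (\<Oplus>l\<in>(\<lambda>k. k - j) ` ivl n. scale A (f l t) (T j (j + l)))"
      proof (rule add.finprod_mono_neutral_cong_right)
        show "(\<lambda>k. k - j) ` ivl n \<subseteq> ivl (2 * n)" using j by auto
        show "scale A (f l t) (T j (j + l)) = \<zero>" if "l \<in> ivl (2 * n) - (\<lambda>k. k - j) ` ivl n" for l
        proof -
          have "j + l \<notin> ivl n"
          proof
            assume "j + l \<in> ivl n"
            then have "(j + l) - j \<in> (\<lambda>k. k - j) ` ivl n" by (rule imageI)
            then show False using that by simp
          qed
          then show ?thesis using T(2) by simp
        qed
      qed (use T(1) in auto)
      also have "\<dots> = (\<Oplus>k\<in>ivl n. scale A (f (k - j) t) (T j k))"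
        using T(1) by (subst finsum_reindex) (auto simp: inj_on_def)
      finally show ?thesis by simp
    qed
    have "?SS (\<lambda>j k. f (k - j) t) = (\<Oplus>j\<in>ivl n. \<Oplus>l\<in>ivl (2 * n). scale A (f l t) (T j (j + l)))"
      by (rule finsum_cong'[OF refl _ in1]) (use T(1) in auto)
    also have "\<dots> = (\<Oplus>l\<in>ivl (2 * n). \<Oplus>j\<in>ivl n. scale A (f l t) (T j (j + l)))"
      using T(1) by (intro finsum_swap) auto
    also have "\<dots> = (\<Oplus>l\<in>ivl (2 * n). if 0 = l then \<one> else \<zero>)"
    proof (intro finsum_cong' refl)
      fix l
      have "(\<Oplus>j\<in>ivl n. scale A (f l t) (T j (j + l))) = scale A (f l t) (\<Oplus>j\<in>ivl n. T j (j + l))"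
        using T(1) by (intro scale_finsum[symmetric]) auto
      then show "(\<Oplus>j\<in>ivl n. scale A (f l t) (T j (j + l))) = (if 0 = l then \<one> else \<zero>)"
        unfolding T1 using f0 by (auto simp: scale_one)
    qed auto
    also have "\<dots> = \<one>" by (rule finsum_singleton) auto
    finally show ?thesis .
  qed
  \<comment> \<open>In this and the next two sums the factors \<open>turn\<close> - 1 are absorbed
    into a, b and w. In the application these contain U - 1, so the uncontrolled bound L is always
    met by something small.\<close>
  have S2: "?SS (\<lambda>j k. (turn k - 1) * g (- j) t) = (\<Oplus>j\<in>ivl n. scale A (g (- j) t) (a j))" for t
    using T(1) ac unfolding a[symmetric]
    by (intro finsum_cong' refl) (auto simp: scale_finsum Pi_iff scale_scale mult.commute)
  have S3: "?SS (\<lambda>j k. (turn (- j) - 1) * g k t) = (\<Oplus>k\<in>ivl n. scale A (g k t) (b k))" for t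
  proof -
    have "?SS (\<lambda>j k. (turn (- j) - 1) * g k t) = (\<Oplus>k\<in>ivl n. \<Oplus>j\<in>ivl n. scale A ((turn (- j) - 1) * g k t) (T j k))"
      using T(1) by (intro finsum_swap) auto
    also have "\<dots> = (\<Oplus>k\<in>ivl n. scale A (g k t) (b k))"
      using T(1) bc unfolding b[symmetric]
      by (intro finsum_cong' refl) (auto simp: scale_finsum Pi_iff scale_scale mult.commute)
    finally show ?thesis .
  qed
  have S4: "?SS (\<lambda>j k. (turn (- j) - 1) * (turn k - 1) * h t) = scale A (h t) w" for t
  proof -
    have "?SS (\<lambda>j k. (turn (- j) - 1) * (turn k - 1) * h t) = (\<Oplus>j\<in>ivl n. scale A (h t) (scale A (turn (- j) - 1) (a j)))"
      using T(1) ac unfolding a[symmetric]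
      by (intro finsum_cong' refl) (auto simp: scale_finsum Pi_iff scale_scale mult_ac)
    also have "\<dots> = scale A (h t) w" unfolding w[symmetric] using ac by (intro scale_finsum[symmetric]) auto
    finally show ?thesis .
  qed
  define G1 where "G1 = (\<lambda>t. \<Oplus>j\<in>ivl n. scale A (g (- j) t) (a j))"
  define G2 where "G2 = (\<lambda>t. \<Oplus>k\<in>ivl n. scale A (g k t) (b k))"
  define E where "E = (\<lambda>t. ?SS (\<lambda>j k. \<rho> j k t))"
  have c: "G1 t \<in> carrier A" "G2 t \<in> carrier A" "E t \<in> carrier A" for t
    unfolding G1_def G2_def E_def using ac bc SSc by auto
  have eq: "\<one> \<ominus> ?SS (\<lambda>j k. cnj (f j t) * f k t) = ((G1 t \<oplus> G2 t) \<ominus> scale A (h t) w) \<ominus> E t" for t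
  proof -
    have "?SS (\<lambda>j k. cnj (f j t) * f k t)
       = ?SS (\<lambda>j k. (\<rho> j k t + f (k - j) t) + ((- 1) * ((turn k - 1) * g (- j) t)
           + ((- 1) * ((turn (- j) - 1) * g k t) + (turn (- j) - 1) * (turn k - 1) * h t)))"
      by (intro finsum_cong' refl) (use T(1) in \<open>auto simp: \<rho>_def algebra_simps\<close>)
    also have "\<dots> = (E t \<oplus> \<one>) \<oplus> (scale A (- 1) (G1 t) \<oplus> (scale A (- 1) (G2 t) \<oplus> scale A (h t) w))"
      unfolding lin S1 S2 S3 S4 E_def G1_def G2_def by (rule refl)
    finally have e: "?SS (\<lambda>j k. cnj (f j t) * f k t) = \<dots>" .
    let ?v = "E t \<oplus> (scale A (- 1) (G1 t) \<oplus> (scale A (- 1) (G2 t) \<oplus> scale A (h t) w))"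
    have "(E t \<oplus> \<one>) \<oplus> (scale A (- 1) (G1 t) \<oplus> (scale A (- 1) (G2 t) \<oplus> scale A (h t) w)) = \<one> \<oplus> ?v"
      using c[of t] wc by (simp add: a_ac)
    moreover have "\<one> \<ominus> (\<one> \<oplus> ?v) = \<ominus> ?v"
      using c[of t] wc by (simp add: a_minus_def minus_add r_neg2)
    ultimately show ?thesis
      unfolding e using c[of t] wc
      by (simp add: minus_eq_scale[symmetric] a_minus_def minus_add a_ac)
  qed
  have tE: "is_trig (R + R) E (\<lambda>m. \<Oplus>j\<in>ivl n. \<Oplus>k\<in>ivl n. scale A (cr (j, k) m) (T j k))"
    "wnorm (R + R) (\<lambda>m. \<Oplus>j\<in>ivl n. \<Oplus>k\<in>ivl n. scale A (cr (j, k) m) (T j k)) \<le> \<eta> * (\<Sum>j\<in>ivl n. \<Sum>k\<in>ivl n. cnorm A (T j k))"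
  proof -
    have inner: "is_trig (R + R) (\<lambda>t. \<Oplus>k\<in>ivl n. scale A (\<rho> j k t) (T j k)) (\<lambda>m. \<Oplus>k\<in>ivl n. scale A (cr (j, k) m) (T j k))"
      "wnorm (R + R) (\<lambda>m. \<Oplus>k\<in>ivl n. scale A (cr (j, k) m) (T j k)) \<le> (\<Sum>k\<in>ivl n. \<eta> * cnorm A (T j k))" if j: "j \<in> ivl n" for j
    proof -
      show "is_trig (R + R) (\<lambda>t. \<Oplus>k\<in>ivl n. scale A (\<rho> j k t) (T j k)) (\<lambda>m. \<Oplus>k\<in>ivl n. scale A (cr (j, k) m) (T j k))"
        by (intro is_trig_finsum(1) strig_is_trig(1) cr(1) j T(1)) auto
      have "wnorm (R + R) (\<lambda>m. \<Oplus>k\<in>ivl n. scale A (cr (j, k) m) (T j k)) \<le> (\<Sum>k\<in>ivl n. wnorm (R + R) (\<lambda>m. scale A (cr (j, k) m) (T j k)))"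
        by (rule is_trig_finsum(2)[OF _ strig_is_trig(1)[OF cr(1)[OF j] T(1)]]) auto
      also have "\<dots> \<le> (\<Sum>k\<in>ivl n. \<eta> * cnorm A (T j k))"
        using strig_is_trig(2)[OF cr(1)[OF j] T(1)] cr(2)[OF j] T(1) cnorm_nonneg
        by (intro sum_mono) (auto intro!: mult_right_mono)
      finally show "wnorm (R + R) (\<lambda>m. \<Oplus>k\<in>ivl n. scale A (cr (j, k) m) (T j k)) \<le> (\<Sum>k\<in>ivl n. \<eta> * cnorm A (T j k))" .
    qed
    show "is_trig (R + R) E (\<lambda>m. \<Oplus>j\<in>ivl n. \<Oplus>k\<in>ivl n. scale A (cr (j, k) m) (T j k))"
      unfolding E_def by (intro is_trig_finsum(1) inner(1)) auto
    have "wnorm (R + R) (\<lambda>m. \<Oplus>j\<in>ivl n. \<Oplus>k\<in>ivl n. scale A (cr (j, k) m) (T j k))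
      \<le> (\<Sum>j\<in>ivl n. wnorm (R + R) (\<lambda>m. \<Oplus>k\<in>ivl n. scale A (cr (j, k) m) (T j k)))"
      by (rule is_trig_finsum(2)[OF _ inner(1)]) auto
    also have "\<dots> \<le> (\<Sum>j\<in>ivl n. \<Sum>k\<in>ivl n. \<eta> * cnorm A (T j k))" by (intro sum_mono inner(2))
    finally show "wnorm (R + R) (\<lambda>m. \<Oplus>j\<in>ivl n. \<Oplus>k\<in>ivl n. scale A (cr (j, k) m) (T j k)) \<le> \<eta> * (\<Sum>j\<in>ivl n. \<Sum>k\<in>ivl n. cnorm A (T j k))"
      by (simp add: sum_distrib_left)
  qed
  have tG: "is_trig R (\<lambda>t. \<Oplus>j\<in>ivl n. scale A (g (\<sigma> j) t) (x j)) (\<lambda>m. \<Oplus>j\<in>ivl n. scale A (cg (\<sigma> j) m) (x j))"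
    "wnorm R (\<lambda>m. \<Oplus>j\<in>ivl n. scale A (cg (\<sigma> j) m) (x j)) \<le> L * (\<Sum>j\<in>ivl n. cnorm A (x j))"
    if x: "\<And>j. x j \<in> carrier A" and \<sigma>: "\<And>j. j \<in> ivl n \<Longrightarrow> \<bar>\<sigma> j\<bar> \<le> int n" for x and \<sigma> :: "int \<Rightarrow> int"
  proof -
    note s = strig_is_trig[OF g(1)[OF \<sigma>] x]
    show "is_trig R (\<lambda>t. \<Oplus>j\<in>ivl n. scale A (g (\<sigma> j) t) (x j)) (\<lambda>m. \<Oplus>j\<in>ivl n. scale A (cg (\<sigma> j) m) (x j))"
      by (intro is_trig_finsum(1) s(1)) auto
    have "wnorm R (\<lambda>m. \<Oplus>j\<in>ivl n. scale A (cg (\<sigma> j) m) (x j)) \<le> (\<Sum>j\<in>ivl n. wnorm R (\<lambda>m. scale A (cg (\<sigma> j) m) (x j)))"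
      by (rule is_trig_finsum(2)[OF _ s(1)]) auto
    also have "\<dots> \<le> (\<Sum>j\<in>ivl n. L * cnorm A (x j))"
      using s(2) g(2)[OF \<sigma>] x cnorm_nonneg by (intro sum_mono) (auto intro!: mult_right_mono)
    finally show "wnorm R (\<lambda>m. \<Oplus>j\<in>ivl n. scale A (cg (\<sigma> j) m) (x j)) \<le> L * (\<Sum>j\<in>ivl n. cnorm A (x j))"
      by (simp add: sum_distrib_left)
  qed
  have neg: "\<And>j. j \<in> ivl n \<Longrightarrow> \<bar>- j\<bar> \<le> int n" and pos: "\<And>j. j \<in> ivl n \<Longrightarrow> \<bar>j\<bar> \<le> int n" by auto
  note t1 = tG[where x = a and \<sigma> = uminus, OF ac neg, folded G1_def]
  note t2 = tG[where x = b and \<sigma> = "\<lambda>k. k", OF bc pos, folded G2_def]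
  note th = strig_is_trig[OF h(1) wc]
  obtain c1 where c1: "is_trig R G1 c1" "wnorm R c1 \<le> L * (\<Sum>j\<in>ivl n. cnorm A (a j))" using t1 by blast
  obtain c2 where c2: "is_trig R G2 c2" "wnorm R c2 \<le> L * (\<Sum>k\<in>ivl n. cnorm A (b k))" using t2 by blast
  obtain c3 where c3: "is_trig R (\<lambda>t. scale A (h t) w) c3" "wnorm R c3 \<le> L * cnorm A w"
    using th mult_right_mono[OF h(2) cnorm_nonneg[OF wc]] by auto
  obtain c4 where c4: "is_trig (R + R) E c4" "wnorm (R + R) c4 \<le> \<eta> * (\<Sum>j\<in>ivl n. \<Sum>k\<in>ivl n. cnorm A (T j k))"
    using tE by blast
  note d1 = is_trig_add[OF c1(1) c2(1)]
  note d2 = is_trig_diff[OF d1(1) c3(1)]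
  note d3 = is_trig_mono[OF d2(1), of "R + R"]
  note d4 = is_trig_diff[OF d3(1) c4(1)]
  show ?thesis
    unfolding eq using d4 d3(2) d2(2) d1(2) c1(2) c2(2) c3(2) c4(2)
    by (intro exI[of _ "\<lambda>m. (c1 m \<oplus> c2 m \<ominus> c3 m) \<ominus> c4 m"]) auto
qed

lemma finsum_shift:
  assumes "\<And>s. F s \<in> carrier A"
  shows "(\<Oplus>t\<in>{..2 * R}. F (int t - int R)) = (\<Oplus>s\<in>ivl R. F s)"
proof -
  have "ivl R = (\<lambda>t. int t - int R) ` {..2 * R}"
  proof (intro equalityI subsetI)
    fix s assume "s \<in> ivl R"
    then have "s = int (nat (s + int R)) - int R" "nat (s + int R) \<in> {..2 * R}" by auto
    then show "s \<in> (\<lambda>t. int t - int R) ` {..2 * R}" by blast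
  qed auto
  then show ?thesis using assms by (simp add: finsum_reindex inj_on_def Pi_iff)
qed

end

lemma sum_shift:
  fixes F :: "int \<Rightarrow> complex"
  shows "(\<Sum>t\<le>2 * R. F (int t - int R)) = (\<Sum>s\<in>{- int R..int R}. F s)"
  using cplx.finsum_shift[of F R] by simp

context star_bounded_algebra
begin

lemma cnorm_finsum_scale:
  assumes "finite S" "\<And>s. s \<in> S \<Longrightarrow> x s \<in> carrier A" "\<And>s. s \<in> S \<Longrightarrow> cmod (a s) \<le> e"
  shows "cnorm A (\<Oplus>s\<in>S. scale A (a s) (x s)) \<le> e * (\<Sum>s\<in>S. cnorm A (x s))"
proof -
  have "cnorm A (\<Oplus>s\<in>S. scale A (a s) (x s)) \<le> (\<Sum>s\<in>S. cnorm A (scale A (a s) (x s)))"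
    using assms by (intro cnorm_finsum) auto
  also have "\<dots> \<le> (\<Sum>s\<in>S. e * cnorm A (x s))"
    using assms by (intro sum_mono) (simp add: cnorm_scale mult_right_mono cnorm_nonneg)
  finally show ?thesis by (simp add: sum_distrib_left)
qed

text \<open>In the logarithmic derivative of V P the flat factor V has trace 0, so only that of P
  remains; and V P stays near 1, where tlog is defined. In the application V is the adjoint of the
  path that P follows, and T is that path.\<close>

lemma winding_has_integral:
  assumes ab: "a \<le> b" and V: "\<And>t. has_der V (V' t) t" and P: "\<And>t. has_der P (P' t) t"
    and T: "\<And>t. T t \<in> carrier A" "\<And>t. T t \<otimes> V t = \<one>" and flat: "\<And>t. \<tau> (T t \<otimes> V' t) = 0"
    and Z: "\<And>t. Z t \<in> carrier A" "\<And>t. Z t \<otimes> P t = \<one>" "\<And>t. P t \<otimes> Z t = \<one>"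
    and near: "\<And>t. t \<in> {a..b} \<Longrightarrow> cnorm A (\<one> \<ominus> V t \<otimes> P t) \<le> r" "r < 1"
    and bd: "\<And>t. cnorm A (V t) \<le> M" "\<And>t. cnorm A (V' t) \<le> M" "\<And>t. cnorm A (P t) \<le> M" "\<And>t. cnorm A (P' t) \<le> M"
  shows "((\<lambda>t. \<tau> (Z t \<otimes> P' t)) has_integral (tlog (V b \<otimes> P b) - tlog (V a \<otimes> P a))) {a..b}"
proof -
  have c: "V t \<in> carrier A" "V' t \<in> carrier A" "P t \<in> carrier A" "P' t \<in> carrier A" for t
    using has_der_closed[OF V[of t]] has_der_closed[OF P[of t]] by auto
  have eq: "\<tau> ((Z t \<otimes> T t) \<otimes> (V' t \<otimes> P t \<oplus> V t \<otimes> P' t)) = \<tau> (Z t \<otimes> P' t)" for t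
  proof -
    have "\<tau> ((Z t \<otimes> T t) \<otimes> (V' t \<otimes> P t \<oplus> V t \<otimes> P' t))
      = \<tau> (Z t \<otimes> (T t \<otimes> V' t \<otimes> P t)) + \<tau> (Z t \<otimes> (T t \<otimes> V t \<otimes> P' t))"
      using c T(1) Z(1) by (simp add: r_distr trace_add m_assoc)
    also have "\<tau> (Z t \<otimes> (T t \<otimes> V' t \<otimes> P t)) = \<tau> ((T t \<otimes> V' t \<otimes> P t) \<otimes> Z t)"
      using c T(1) Z(1) by (intro trace_commute) auto
    also have "(T t \<otimes> V' t \<otimes> P t) \<otimes> Z t = (T t \<otimes> V' t) \<otimes> (P t \<otimes> Z t)"
      using c T(1) Z(1) by (intro m_assoc) auto
    also have "\<tau> \<dots> = 0" using c T(1) by (simp add: Z(3) flat)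
    finally show ?thesis using c by (simp add: T(2))
  qed
  have "((\<lambda>t. \<tau> ((Z t \<otimes> T t) \<otimes> (V' t \<otimes> P t \<oplus> V t \<otimes> P' t))) has_integral (tlog (V b \<otimes> P b) - tlog (V a \<otimes> P a))) {a..b}"
  proof (rule tlog_has_integral[OF ab _ near])
    show "has_der (\<lambda>t. V t \<otimes> P t) (V' t \<otimes> P t \<oplus> V t \<otimes> P' t) t" for t by (rule has_der_mult[OF V P])
    show "cnorm A (V' t \<otimes> P t \<oplus> V t \<otimes> P' t) \<le> M * M + M * M" for t
      using c bd by (intro order_trans[OF cnorm_triangle] add_mono cnorm_mult_le) auto
    show "Z t \<otimes> T t \<in> carrier A" for t using Z(1) T(1) by simp
    show "Z t \<otimes> T t \<otimes> (V t \<otimes> P t) = \<one>" for t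
    proof -
      have "Z t \<otimes> T t \<otimes> (V t \<otimes> P t) = Z t \<otimes> (T t \<otimes> V t \<otimes> P t)" using c T(1) Z(1) by (simp add: m_assoc)
      then show ?thesis using c by (simp add: T(2) Z(2))
    qed
  qed
  then show ?thesis unfolding eq .
qed

text \<open>Condition \<open>c1\<close> keeps P so close to the path W that the adjoint of W times P
  stays within 1 / 4 of 1. Condition \<open>c2\<close> makes the Toeplitz idempotent of P satisfy
  the smallness of \<open>toeplitz_projection\<close>. The summand with \<tau> \<one> comes from
  shifting the frequencies of P by R to make them nonnegative.\<close>

lemma loop_projection:
  fixes n R :: nat and K M L \<eta> \<epsilon> :: real
  assumes f: "\<And>l. \<bar>l\<bar> \<le> 2 * int n \<Longrightarrow> strig R (f l) (cf l)" "\<And>l. \<bar>l\<bar> \<le> 2 * int n \<Longrightarrow> (\<Sum>m\<in>{- int R..int R}. cmod (cf l m)) \<le> M"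
    and f0: "f 0 = (\<lambda>_. 1)"
    and g: "\<And>l. \<bar>l\<bar> \<le> int n \<Longrightarrow> strig R (g l) (cg l)" "\<And>l. \<bar>l\<bar> \<le> int n \<Longrightarrow> (\<Sum>m\<in>{- int R..int R}. cmod (cg l m)) \<le> L"
    and h: "strig R h ch" "(\<Sum>m\<in>{- int R..int R}. cmod (ch m)) \<le> L"
    and close: "\<And>l t. t \<in> {0..2*pi} \<Longrightarrow> cmod (f l t - wave l t) \<le> \<eta>"
    and r: "\<And>j k. \<bar>j\<bar> \<le> int n \<Longrightarrow> \<bar>k\<bar> \<le> int n \<Longrightarrow>
      (\<exists>b. strig (R + R) (\<lambda>t. cnj (f j t) * f k t - (f (k - j) t - (turn k - 1) * g (- j) t
           - (turn (- j) - 1) * g k t + (turn (- j) - 1) * (turn k - 1) * h t)) b \<and>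
         (\<Sum>m\<in>{- int (R + R)..int (R + R)}. cmod (b m)) \<le> \<eta>)"
    and W: "is_trig n W c" "wnorm n c \<le> K" "\<And>s. star A (W s) \<otimes> W s = \<one>" "\<And>s. W s \<otimes> star A (W s) = \<one>"
    and W0: "W 0 = \<one>" and WU: "W (pi / 2) = U" and U: "cnorm A (\<one> \<ominus> U) \<le> \<epsilon>"
    and flat: "\<And>s. \<tau> (star A (\<Oplus>m\<in>ivl n. scale A (cis (of_int m * s)) (scale A (\<i> * of_int m) (c m))) \<otimes> W s) = 0"
    and K: "1 \<le> K" "1 \<le> M" "0 \<le> L" "0 \<le> \<eta>"
    and c1: "2 * K * (\<eta> * K + \<epsilon>) \<le> 1 / 4" and c2: "24 * (M * K)\<^sup>2 * (2 * K\<^sup>2 * \<eta> + 6 * L * K * \<epsilon>) \<le> 1"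
  shows "\<exists>D x. x \<in> carrier (Mat D A) \<and> x \<otimes>\<^bsub>Mat D A\<^esub> x = x \<and> star (Mat D A) x = x \<and>
    mat_trace D \<tau> x = of_nat R * \<tau> \<one> - tlog U / (2 * of_real pi * \<i>)"
proof -
  note c = is_trigD[OF W(1)]
  have Wc: "W s \<in> carrier A" for s by (rule c(4))
  have Uc: "U \<in> carrier A" using Wc unfolding WU[symmetric] by simp
  have Kc: "(\<Sum>j\<in>ivl n. cnorm A (c j)) \<le> K" using W(2) by (simp add: wnorm_def)
  have \<epsilon>0: "0 \<le> \<epsilon>" using U cnorm_nonneg[of "\<one> \<ominus> U"] Uc by simp
  \<comment> \<open>The star may double the distance to 1, and \<open>tlog_mult\<close> is applied
    to star U within 1 / 4.\<close>
  have \<epsilon>1: "\<epsilon> \<le> 1 / 8"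
  proof -
    have "1 * \<epsilon> \<le> K * (\<eta> * K + \<epsilon>)" using K \<epsilon>0 by (intro mult_mono) auto
    then show ?thesis using c1 by simp
  qed
  \<comment> \<open>The bound for both defects of P: 2 K^2 \<eta> from the errors of the scalar
    products, and 2 L K \<epsilon> for each of the three terms containing U - 1. The factors 2 are
    those of the star.\<close>
  define \<delta> where "\<delta> = 2 * K\<^sup>2 * \<eta> + 6 * L * K * \<epsilon>"
  have \<delta>0: "0 \<le> \<delta>" unfolding \<delta>_def using K \<epsilon>0 by simp
  have MK: "1 \<le> M * K" using mult_mono[of 1 M 1 K] K by simp
  \<comment> \<open>The condition 3 C \<eta> \<le> 1 / 2 of \<open>toeplitz_projection\<close> for C
    = M K and for the bound 4 M K \<delta> that \<open>wiener_inverse\<close> supplies.\<close>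
  have \<delta>12: "12 * (M * K) * ((M * K) * \<delta>) \<le> 1 / 2" using c2 by (simp add: \<delta>_def power2_eq_square mult_ac)
  have \<delta>1: "\<delta> \<le> 1 / 2"
  proof -
    have "\<delta> \<le> M * K * \<delta>" using mult_right_mono[OF MK \<delta>0] by simp
    moreover have "M * K * \<delta> \<le> M * K * (M * K * \<delta>)" using mult_right_mono[OF MK, of "M * K * \<delta>"] MK \<delta>0 by simp
    ultimately show ?thesis using \<delta>12 \<delta>0 unfolding mult.assoc[of 12] by linarith
  qed
  define V where "V = U \<ominus> \<one>"
  have V: "V \<in> carrier A" "cnorm A V \<le> \<epsilon>" using Uc U cnorm_minus_commute[of U \<one>] by (auto simp: V_def)
  have Vs: "cnorm A (star A V) \<le> 2 * \<epsilon>" using cnorm_star_le[OF V(1)] V(2) by simp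
  have Vsum: "(\<Oplus>k\<in>ivl n. scale A (turn k - 1) (c k)) = V"
  proof -
    have "(\<Oplus>k\<in>ivl n. scale A (turn k - 1) (c k)) = (\<Oplus>k\<in>ivl n. scale A (cis (of_int k * (pi / 2))) (c k) \<ominus> scale A (cis (of_int k * 0)) (c k))"
      using c(1) by (intro finsum_cong' refl) (auto simp: scale_diff_left turn_def)
    also have "\<dots> = W (pi / 2) \<ominus> W 0" unfolding c(3) using c(1) by (intro finsum_diff) auto
    finally show ?thesis by (simp add: V_def W0 WU)
  qed
  define cs where "cs = (\<lambda>m. star A (c m))"
  have csc: "cs m \<in> carrier A" "cnorm A (cs m) \<le> 2 * cnorm A (c m)" for m
    using c(1) cnorm_star_le by (auto simp: cs_def)
  have cs0: "cs m = \<zero>" if "m \<notin> ivl n" for m using c(2)[OF that] by (simp add: cs_def)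
  have Vsum': "(\<Oplus>j\<in>ivl n. scale A (turn (- j) - 1) (cs j)) = star A V"
    unfolding Vsum[symmetric] cs_def using c(1)
    by (simp add: star_finsum Pi_iff star_scale turn_simps)
  have Ks: "(\<Sum>j\<in>ivl n. cnorm A (cs j)) \<le> 2 * K"
  proof -
    have "(\<Sum>j\<in>ivl n. cnorm A (cs j)) \<le> (\<Sum>j\<in>ivl n. 2 * cnorm A (c j))" using csc by (intro sum_mono)
    then show ?thesis using Kc by (simp add: sum_distrib_left[symmetric])
  qed
  \<comment> \<open>With the exact \<open>wave\<close> in place of f this would be the
    reparametrised path minus \<open>ramp\<close> times V, the closed-up path.\<close>
  define P where "P = (\<lambda>t. \<Oplus>j\<in>ivl n. scale A (f j t) (c j))"
  define p where "p = (\<lambda>m. \<Oplus>j\<in>ivl n. scale A (cf j m) (c j))"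
  have jn: "\<bar>j\<bar> \<le> 2 * int n" "\<bar>j\<bar> \<le> int n" if "j \<in> ivl n" for j using that by auto
  have P: "is_trig R P p" unfolding P_def p_def by (intro is_trig_finsum(1) strig_is_trig(1) f(1) jn c(1)) auto
  note pp = is_trigD[OF P]
  have pK: "wnorm R p \<le> M * K"
  proof -
    have "wnorm R p \<le> (\<Sum>j\<in>ivl n. wnorm R (\<lambda>m. scale A (cf j m) (c j)))"
      unfolding p_def by (rule is_trig_finsum(2)[OF _ strig_is_trig(1)[OF f(1)[OF jn(1)] c(1)]]) auto
    also have "\<dots> \<le> (\<Sum>j\<in>ivl n. M * cnorm A (c j))"
      using strig_is_trig(2)[OF f(1)[OF jn(1)] c(1)] f(2)[OF jn(1)] c(1) cnorm_nonneg by (intro sum_mono) (auto intro!: mult_right_mono)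
    also have "\<dots> \<le> M * K" unfolding sum_distrib_left[symmetric] using Kc K by (intro mult_left_mono) auto
    finally show ?thesis .
  qed
  have Pc: "P t \<in> carrier A" for t by (rule pp(4))
  have Pstar: "star A (P t) = (\<Oplus>j\<in>ivl n. scale A (cnj (f j t)) (cs j))" for t
    unfolding P_def cs_def using c(1) by (simp add: star_finsum Pi_iff star_scale)
  have PP1: "star A (P t) \<otimes> P t = (\<Oplus>j\<in>ivl n. \<Oplus>k\<in>ivl n. scale A (cnj (f j t) * f k t) (cs j \<otimes> c k))" for t
  proof -
    have "star A (P t) \<otimes> P t = (\<Oplus>j\<in>ivl n. scale A (cnj (f j t)) (cs j) \<otimes> P t)"
      unfolding Pstar using csc Pc by (intro finsum_ldistr) auto
    also have "\<dots> = (\<Oplus>j\<in>ivl n. \<Oplus>k\<in>ivl n. scale A (cnj (f j t) * f k t) (cs j \<otimes> c k))"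
    proof (rule finsum_cong'[OF refl])
      fix j
      have "scale A (cnj (f j t)) (cs j) \<otimes> P t = (\<Oplus>k\<in>ivl n. scale A (cnj (f j t)) (cs j) \<otimes> scale A (f k t) (c k))"
        unfolding P_def using csc c(1) by (intro finsum_rdistr) auto
      then show "scale A (cnj (f j t)) (cs j) \<otimes> P t = (\<Oplus>k\<in>ivl n. scale A (cnj (f j t) * f k t) (cs j \<otimes> c k))"
        using csc c(1) by (simp add: scale_mult_scale)
    qed (use csc c(1) in auto)
    finally show ?thesis .
  qed
  have PP2: "P t \<otimes> star A (P t) = (\<Oplus>j\<in>ivl n. \<Oplus>k\<in>ivl n. scale A (cnj (f j t) * f k t) (c k \<otimes> cs j))" for t
  proof -
    have "P t \<otimes> star A (P t) = (\<Oplus>j\<in>ivl n. P t \<otimes> scale A (cnj (f j t)) (cs j))"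
      unfolding Pstar using csc Pc by (intro finsum_rdistr) auto
    also have "\<dots> = (\<Oplus>j\<in>ivl n. \<Oplus>k\<in>ivl n. scale A (cnj (f j t) * f k t) (c k \<otimes> cs j))"
    proof (rule finsum_cong'[OF refl])
      fix j
      have "P t \<otimes> scale A (cnj (f j t)) (cs j) = (\<Oplus>k\<in>ivl n. scale A (f k t) (c k) \<otimes> scale A (cnj (f j t)) (cs j))"
        unfolding P_def using csc c(1) by (intro finsum_ldistr) auto
      then show "P t \<otimes> scale A (cnj (f j t)) (cs j) = (\<Oplus>k\<in>ivl n. scale A (cnj (f j t) * f k t) (c k \<otimes> cs j))"
        using csc c(1) by (simp add: scale_mult_scale mult.commute)
    qed (use csc c(1) in auto)
    finally show ?thesis .
  qed
  have csW: "is_trig n (\<lambda>s. star A (W s)) (\<lambda>m. cs (- m))"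
    unfolding cs_def by (rule is_trig_star(1)[OF W(1) cnorm_star_le])
  have im: "uminus ` ivl n = ivl n" by (auto simp: image_iff intro!: bexI[of _ "- _"])
  \<comment> \<open>The coefficients of the constant function star W W.\<close>
  have T1: "(\<Oplus>j\<in>ivl n. cs j \<otimes> c (j + l)) = (if l = 0 then \<one> else \<zero>)" for l
  proof -
    have "conv n (\<lambda>m. cs (- m)) c = (\<lambda>m. if m = 0 then \<one> else \<zero>)"
    proof (rule is_trig_unique)
      show "is_trig (n + n) (\<lambda>s. star A (W s) \<otimes> W s) (conv n (\<lambda>m. cs (- m)) c)" by (rule is_trig_mult(1)[OF csW W(1)])
      show "is_trig 0 (\<lambda>s. star A (W s) \<otimes> W s) (\<lambda>m. if m = 0 then \<one> else \<zero>)" unfolding W(3) by (rule is_trig_const(1)) simp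
    qed
    from fun_cong[OF this, of l] have "(\<Oplus>t\<in>ivl n. cs (- t) \<otimes> c (l - t)) = (if l = 0 then \<one> else \<zero>)" by (simp add: conv_def)
    moreover have "(\<Oplus>j\<in>uminus ` ivl n. cs j \<otimes> c (j + l)) = (\<Oplus>t\<in>ivl n. cs (- t) \<otimes> c (l - t))"
      using csc c(1) by (subst finsum_reindex) auto
    ultimately show ?thesis unfolding im by simp
  qed
  have T2: "(\<Oplus>j\<in>ivl n. c (j + l) \<otimes> cs j) = (if l = 0 then \<one> else \<zero>)" for l
  proof -
    have "conv n c (\<lambda>m. cs (- m)) = (\<lambda>m. if m = 0 then \<one> else \<zero>)"
    proof (rule is_trig_unique)
      show "is_trig (n + n) (\<lambda>s. W s \<otimes> star A (W s)) (conv n c (\<lambda>m. cs (- m)))" by (rule is_trig_mult(1)[OF W(1) csW])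
      show "is_trig 0 (\<lambda>s. W s \<otimes> star A (W s)) (\<lambda>m. if m = 0 then \<one> else \<zero>)" unfolding W(4) by (rule is_trig_const(1)) simp
    qed
    from fun_cong[OF this, of l] have "(\<Oplus>t\<in>ivl n. c (l - t) \<otimes> cs (- t)) = (if l = 0 then \<one> else \<zero>)" by (simp add: conv_swap[OF W(1) csW])
    moreover have "(\<Oplus>j\<in>uminus ` ivl n. c (j + l) \<otimes> cs j) = (\<Oplus>t\<in>ivl n. c (l - t) \<otimes> cs (- t))"
      using csc c(1) by (subst finsum_reindex) auto
    ultimately show ?thesis unfolding im by simp
  qed
  have bound: "\<eta> * (\<Sum>j\<in>ivl n. \<Sum>k\<in>ivl n. cnorm A (T j k)) + L * (\<Sum>j\<in>ivl n. cnorm A (a j))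
      + L * (\<Sum>k\<in>ivl n. cnorm A (b k)) + L * cnorm A w \<le> \<delta>"
    if "\<And>j k. cnorm A (T j k) \<le> cnorm A (cs j) * cnorm A (c k)" "\<And>j. cnorm A (a j) \<le> cnorm A (cs j) * \<epsilon>"
      "\<And>k. cnorm A (b k) \<le> (2 * \<epsilon>) * cnorm A (c k)" "cnorm A w \<le> 2 * \<epsilon> * \<epsilon>" for T :: "int \<Rightarrow> int \<Rightarrow> 'a" and a b w
  proof -
    have "(\<Sum>j\<in>ivl n. \<Sum>k\<in>ivl n. cnorm A (T j k)) \<le> (\<Sum>j\<in>ivl n. cnorm A (cs j)) * (\<Sum>k\<in>ivl n. cnorm A (c k))"
      unfolding sum_product using that(1) by (intro sum_mono)
    also have "\<dots> \<le> 2 * K * K" using Ks Kc K csc(1) c(1) by (intro mult_mono sum_nonneg cnorm_nonneg) auto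
    finally have 1: "\<eta> * (\<Sum>j\<in>ivl n. \<Sum>k\<in>ivl n. cnorm A (T j k)) \<le> \<eta> * (2 * K * K)" using K by (intro mult_left_mono)
    have "(\<Sum>j\<in>ivl n. cnorm A (a j)) \<le> (\<Sum>j\<in>ivl n. cnorm A (cs j)) * \<epsilon>"
      unfolding sum_distrib_right using that(2) by (intro sum_mono)
    also have "\<dots> \<le> 2 * K * \<epsilon>" using Ks \<epsilon>0 by (intro mult_right_mono) auto
    finally have 2: "L * (\<Sum>j\<in>ivl n. cnorm A (a j)) \<le> L * (2 * K * \<epsilon>)" using K by (intro mult_left_mono)
    have "(\<Sum>k\<in>ivl n. cnorm A (b k)) \<le> (2 * \<epsilon>) * (\<Sum>k\<in>ivl n. cnorm A (c k))"
      unfolding sum_distrib_left using that(3) by (intro sum_mono)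
    also have "\<dots> \<le> (2 * \<epsilon>) * K" using Kc \<epsilon>0 by (intro mult_left_mono) auto
    finally have 3: "L * (\<Sum>k\<in>ivl n. cnorm A (b k)) \<le> L * (2 * \<epsilon> * K)" using K by (intro mult_left_mono)
    have "2 * \<epsilon> * \<epsilon> \<le> 2 * \<epsilon> * K" using \<epsilon>0 \<epsilon>1 K by (intro mult_left_mono) auto
    then have 4: "L * cnorm A w \<le> L * (2 * \<epsilon> * K)" using that(4) K by (intro mult_left_mono) auto
    show ?thesis using 1 2 3 4 by (simp add: \<delta>_def power2_eq_square algebra_simps)
  qed
  have "\<exists>y. is_trig (R + R) (\<lambda>t. \<one> \<ominus> star A (P t) \<otimes> P t) y \<and> wnorm (R + R) y \<le> \<delta>"
  proof -
    have a: "(\<Oplus>k\<in>ivl n. scale A (turn k - 1) (cs j \<otimes> c k)) = cs j \<otimes> V" for j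
      unfolding Vsum[symmetric] using csc c(1) by (subst finsum_rdistr) (auto simp: scale_mult_right)
    have b: "(\<Oplus>j\<in>ivl n. scale A (turn (- j) - 1) (cs j \<otimes> c k)) = star A V \<otimes> c k" for k
      unfolding Vsum'[symmetric] using csc c(1) by (subst finsum_ldistr) (auto simp: scale_mult_left)
    have w: "(\<Oplus>j\<in>ivl n. scale A (turn (- j) - 1) (cs j \<otimes> V)) = star A V \<otimes> V"
      unfolding Vsum'[symmetric] using csc V by (subst finsum_ldistr) (auto simp: scale_mult_left)
    have Tz: "cs j \<otimes> c k = \<zero>" if "k \<notin> ivl n" for j k using c(2)[OF that] csc by simp
    have Tc: "cs j \<otimes> c k \<in> carrier A" for j k using csc c(1) by simp
    obtain y where y: "is_trig (R + R) (\<lambda>t. \<one> \<ominus> (\<Oplus>j\<in>ivl n. \<Oplus>k\<in>ivl n. scale A (cnj (f j t) * f k t) (cs j \<otimes> c k))) y"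
      "wnorm (R + R) y \<le> \<eta> * (\<Sum>j\<in>ivl n. \<Sum>k\<in>ivl n. cnorm A (cs j \<otimes> c k)) + L * (\<Sum>j\<in>ivl n. cnorm A (cs j \<otimes> V))
      + L * (\<Sum>k\<in>ivl n. cnorm A (star A V \<otimes> c k)) + L * cnorm A (star A V \<otimes> V)"
      using defect_trig[OF f(1) f0 g h r Tc Tz T1 a b w] by blast
    have "wnorm (R + R) y \<le> \<delta>"
    proof (rule order_trans[OF y(2) bound])
      show "cnorm A (cs j \<otimes> c k) \<le> cnorm A (cs j) * cnorm A (c k)" for j k using csc c(1) by (intro cnorm_mult) auto
      show "cnorm A (cs j \<otimes> V) \<le> cnorm A (cs j) * \<epsilon>" for j using csc V by (intro cnorm_mult_le) auto
      show "cnorm A (star A V \<otimes> c k) \<le> (2 * \<epsilon>) * cnorm A (c k)" for k using c(1) V Vs by (intro cnorm_mult_le) auto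
      show "cnorm A (star A V \<otimes> V) \<le> 2 * \<epsilon> * \<epsilon>" using V Vs by (intro cnorm_mult_le) auto
    qed
    then show ?thesis using y(1) unfolding PP1 by blast
  qed
  then obtain y where y: "is_trig (R + R) (\<lambda>t. \<one> \<ominus> star A (P t) \<otimes> P t) y" "wnorm (R + R) y \<le> \<delta>" by blast
  have "\<exists>y. is_trig (R + R) (\<lambda>t. \<one> \<ominus> P t \<otimes> star A (P t)) y \<and> wnorm (R + R) y \<le> \<delta>"
  proof -
    have a: "(\<Oplus>k\<in>ivl n. scale A (turn k - 1) (c k \<otimes> cs j)) = V \<otimes> cs j" for j
      unfolding Vsum[symmetric] using csc c(1) by (subst finsum_ldistr) (auto simp: scale_mult_left)
    have b: "(\<Oplus>j\<in>ivl n. scale A (turn (- j) - 1) (c k \<otimes> cs j)) = c k \<otimes> star A V" for k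
      unfolding Vsum'[symmetric] using csc c(1) by (subst finsum_rdistr) (auto simp: scale_mult_right)
    have w: "(\<Oplus>j\<in>ivl n. scale A (turn (- j) - 1) (V \<otimes> cs j)) = V \<otimes> star A V"
      unfolding Vsum'[symmetric] using csc V by (subst finsum_rdistr) (auto simp: scale_mult_right)
    have Tz: "c k \<otimes> cs j = \<zero>" if "k \<notin> ivl n" for j k using c(2)[OF that] csc by simp
    have Tc: "c k \<otimes> cs j \<in> carrier A" for j k using csc c(1) by simp
    obtain y where y: "is_trig (R + R) (\<lambda>t. \<one> \<ominus> (\<Oplus>j\<in>ivl n. \<Oplus>k\<in>ivl n. scale A (cnj (f j t) * f k t) (c k \<otimes> cs j))) y"
      "wnorm (R + R) y \<le> \<eta> * (\<Sum>j\<in>ivl n. \<Sum>k\<in>ivl n. cnorm A (c k \<otimes> cs j)) + L * (\<Sum>j\<in>ivl n. cnorm A (V \<otimes> cs j))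
      + L * (\<Sum>k\<in>ivl n. cnorm A (c k \<otimes> star A V)) + L * cnorm A (V \<otimes> star A V)"
      using defect_trig[where T = "\<lambda>j k. c k \<otimes> cs j", OF f(1) f0 g h r Tc Tz T2 a b w] by blast
    have "wnorm (R + R) y \<le> \<delta>"
    proof (rule order_trans[OF y(2) bound])
      show "cnorm A (c k \<otimes> cs j) \<le> cnorm A (cs j) * cnorm A (c k)" for j k
        using csc c(1) cnorm_mult[of "c k" "cs j"] by (simp add: mult.commute)
      show "cnorm A (V \<otimes> cs j) \<le> cnorm A (cs j) * \<epsilon>" for j
        using csc V cnorm_mult_le[of V "cs j" \<epsilon> "cnorm A (cs j)"] by (simp add: mult.commute)
      show "cnorm A (c k \<otimes> star A V) \<le> (2 * \<epsilon>) * cnorm A (c k)" for k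
        using c(1) V Vs cnorm_mult_le[of "c k" "star A V" "cnorm A (c k)" "2 * \<epsilon>"] by (simp add: mult.commute)
      show "cnorm A (V \<otimes> star A V) \<le> 2 * \<epsilon> * \<epsilon>"
        using V Vs cnorm_mult_le[of V "star A V" \<epsilon> "2 * \<epsilon>"] by (simp add: mult_ac)
    qed
    then show ?thesis using y(1) unfolding PP2 by blast
  qed
  then obtain y' where y': "is_trig (R + R) (\<lambda>t. \<one> \<ominus> P t \<otimes> star A (P t)) y'" "wnorm (R + R) y' \<le> \<delta>" by blast
  obtain q where q: "\<And>m. q m \<in> carrier A"
    "\<And>m. (\<Oplus>t\<in>ivl R. p t \<otimes> q (m - t)) = (if m = 0 then \<one> else \<zero>)"
    "\<And>m. (\<Oplus>t\<in>ivl R. q (m - t) \<otimes> p t) = (if m = 0 then \<one> else \<zero>)"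
    "\<And>F. finite F \<Longrightarrow> (\<Sum>m\<in>F. cnorm A (q m)) \<le> 4 * (M * K)"
    "\<And>F. finite F \<Longrightarrow> (\<Sum>m\<in>F. cnorm A (q m \<ominus> star A (p (- m)))) \<le> 4 * (M * K) * \<delta>"
    "\<And>Z. (\<And>\<theta>. Z \<theta> \<in> carrier A \<and> Z \<theta> \<otimes> P \<theta> = \<one>) \<Longrightarrow>
      ((\<lambda>\<theta>. \<tau> (Z \<theta> \<otimes> (\<Oplus>m\<in>ivl R. scale A (cis (of_int m * \<theta>)) (scale A (\<i> * of_int m) (p m)))))
        has_integral (2 * pi * (\<Sum>m\<in>ivl R. \<i> * of_int m * \<tau> (p m \<otimes> q (- m))))) {0..2*pi}"
    using wiener_inverse[OF P pK y y' \<delta>1] by auto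
  define S where "S = (\<Sum>m\<in>ivl R. of_int m * \<tau> (p m \<otimes> q (- m)))"
  \<comment> \<open>Neumann series for star P P and for P star P give a left and a right inverse of
    P, and these coincide.\<close>
  have "\<exists>Zt\<in>carrier A. Zt \<otimes> P t = \<one> \<and> P t \<otimes> Zt = \<one>" for t
  proof -
    have "cnorm A (\<one> \<ominus> star A (P t) \<otimes> P t) \<le> \<delta>" "cnorm A (\<one> \<ominus> P t \<otimes> star A (P t)) \<le> \<delta>"
      using is_trig_cnorm_le[OF y(1), of t] y(2) is_trig_cnorm_le[OF y'(1), of t] y'(2) by auto
    then obtain z z' where z: "z \<in> carrier A" "z \<otimes> (\<one> \<ominus> (\<one> \<ominus> star A (P t) \<otimes> P t)) = \<one>"
      and z': "z' \<in> carrier A" "(\<one> \<ominus> (\<one> \<ominus> P t \<otimes> star A (P t))) \<otimes> z' = \<one>"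
      using neumann[of "\<one> \<ominus> star A (P t) \<otimes> P t" \<delta>] neumann[of "\<one> \<ominus> P t \<otimes> star A (P t)" \<delta>] Pc[of t] \<delta>1 by auto
    have l: "(z \<otimes> star A (P t)) \<otimes> P t = \<one>" using z Pc[of t] by (simp add: minus_add_cancel m_assoc)
    have r': "P t \<otimes> (star A (P t) \<otimes> z') = \<one>" using z' Pc[of t] by (simp add: minus_add_cancel m_assoc)
    have "z \<otimes> star A (P t) = (z \<otimes> star A (P t)) \<otimes> (P t \<otimes> (star A (P t) \<otimes> z'))" using r' z(1) Pc[of t] by simp
    also have "\<dots> = ((z \<otimes> star A (P t)) \<otimes> P t) \<otimes> (star A (P t) \<otimes> z')" using z(1) z'(1) Pc[of t] by (simp add: m_assoc)
    also have "\<dots> = star A (P t) \<otimes> z'" unfolding l using z'(1) Pc[of t] by simp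
    finally show ?thesis using l r' z(1) z'(1) Pc[of t] by (intro bexI[of _ "z \<otimes> star A (P t)"]) auto
  qed
  then obtain Z where Z: "\<And>t. Z t \<in> carrier A" "\<And>t. Z t \<otimes> P t = \<one>" "\<And>t. P t \<otimes> Z t = \<one>" by metis
  define Wd where "Wd = (\<lambda>s. \<Oplus>m\<in>ivl n. scale A (cis (of_int m * s)) (scale A (\<i> * of_int m) (c m)))"
  define P' where "P' = (\<lambda>t. \<Oplus>m\<in>ivl R. scale A (cis (of_int m * t)) (scale A (\<i> * of_int m) (p m)))"
  define st where "st = (\<lambda>t::real. (t - sin t) / 4)"
  define X where "X = (\<lambda>t. star A (W (st t)))"
  define X' where "X' = (\<lambda>t. \<Oplus>m\<in>ivl n. scale A (spin1 (- m) t) (cs m))"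
  have Xeq: "X t = (\<Oplus>m\<in>ivl n. scale A (spin (- m) t) (cs m))" for t
    unfolding X_def c(3) cs_def st_def using c(1)
    by (simp add: star_finsum Pi_iff star_scale spin_def cis_cnj)
  have Xder: "has_der X (X' t) t" for t
  proof -
    have "(spin (- m) has_vector_derivative spin1 (- m) t) (at t)" for m using spin_C2[of "- m"] by (simp add: C2_def)
    then have "has_der (\<lambda>t. \<Oplus>m\<in>ivl n. scale A (spin (- m) t) (cs m)) (X' t) t"
      unfolding X'_def by (intro has_der_finsum has_der_scale csc) auto
    then show ?thesis unfolding Xeq[symmetric] by simp
  qed
  have Wdc: "Wd s \<in> carrier A" for s unfolding Wd_def using c(1) by auto
  \<comment> \<open>The chain rule: (\<pi> / 2) \<open>ramp1\<close> is the derivative of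
    \<open>st\<close>. It passes the flatness of W on to X.\<close>
  have X'eq: "X' t = scale A (of_real (pi / 2) * ramp1 t) (star A (Wd (st t)))" for t
  proof -
    have "star A (Wd (st t)) = (\<Oplus>m\<in>ivl n. scale A (cnj (cis (of_int m * st t)) * cnj (\<i> * of_int m)) (cs m))"
      unfolding Wd_def cs_def using c(1) by (simp add: star_finsum Pi_iff star_scale scale_scale)
    then have "scale A (of_real (pi / 2) * ramp1 t) (star A (Wd (st t)))
      = (\<Oplus>m\<in>ivl n. scale A (of_real (pi / 2) * ramp1 t) (scale A (cnj (cis (of_int m * st t)) * cnj (\<i> * of_int m)) (cs m)))"
      using csc by (simp only:) (intro scale_finsum, auto)
    also have "\<dots> = X' t" unfolding X'_def
    proof (rule finsum_cong'[OF refl])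
      fix m
      have "of_real (pi / 2) * ramp1 t * (cnj (cis (of_int m * st t)) * cnj (\<i> * of_int m)) = spin1 (- m) t"
        by (simp add: spin1_def spin_def st_def cis_cnj)
      then show "scale A (of_real (pi / 2) * ramp1 t) (scale A (cnj (cis (of_int m * st t)) * cnj (\<i> * of_int m)) (cs m)) = scale A (spin1 (- m) t) (cs m)"
        using csc by (simp only: scale_scale)
    qed (use csc in auto)
    finally show ?thesis by simp
  qed
  have flat': "\<tau> (W (st t) \<otimes> X' t) = 0" for t
  proof -
    have "\<tau> (W (st t) \<otimes> X' t) = (of_real (pi / 2) * ramp1 t) * \<tau> (W (st t) \<otimes> star A (Wd (st t)))"
      unfolding X'eq using Wc Wdc by (simp add: scale_mult_right trace_scale)
    also have "\<tau> (W (st t) \<otimes> star A (Wd (st t))) = \<tau> (star A (Wd (st t)) \<otimes> W (st t))" using Wc Wdc by (intro trace_commute) auto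
    also have "\<dots> = 0" using flat[of "st t"] unfolding Wd_def .
    finally show ?thesis by simp
  qed
  \<comment> \<open>P minus the path is the approximation error minus \<open>ramp\<close> times V,
    hence at most \<eta> K + \<epsilon>; multiplying by X, of norm at most 2 K, gives the left side
    of \<open>c1\<close>.\<close>
  have near: "cnorm A (\<one> \<ominus> X t \<otimes> P t) \<le> 1 / 4" if t: "t \<in> {0..2*pi}" for t
  proof -
    have "P t \<ominus> W (st t) = (\<Oplus>j\<in>ivl n. scale A (f j t) (c j) \<ominus> scale A (cis (of_int j * st t)) (c j))"
      unfolding P_def c(3) using c(1) by (intro finsum_diff[symmetric]) auto
    also have "\<dots> = (\<Oplus>j\<in>ivl n. scale A (f j t - wave j t) (c j) \<ominus> scale A (ramp t) (scale A (turn j - 1) (c j)))"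
      using c(1) by (intro finsum_cong' refl) (auto simp: scale_scale scale_diff_left[symmetric] wave_def spin_def st_def algebra_simps)
    also have "\<dots> = (\<Oplus>j\<in>ivl n. scale A (f j t - wave j t) (c j)) \<ominus> (\<Oplus>j\<in>ivl n. scale A (ramp t) (scale A (turn j - 1) (c j)))"
      using c(1) by (intro finsum_diff) auto
    also have "(\<Oplus>j\<in>ivl n. scale A (ramp t) (scale A (turn j - 1) (c j))) = scale A (ramp t) V"
      unfolding Vsum[symmetric] using c(1) by (intro scale_finsum[symmetric]) auto
    finally have e: "P t \<ominus> W (st t) = (\<Oplus>j\<in>ivl n. scale A (f j t - wave j t) (c j)) \<ominus> scale A (ramp t) V" .
    have "cnorm A (\<Oplus>j\<in>ivl n. scale A (f j t - wave j t) (c j)) \<le> \<eta> * (\<Sum>j\<in>ivl n. cnorm A (c j))"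
      using close[OF t] c(1) by (intro cnorm_finsum_scale) auto
    also have "\<dots> \<le> \<eta> * K" using Kc K by (intro mult_left_mono) auto
    finally have n1: "cnorm A (\<Oplus>j\<in>ivl n. scale A (f j t - wave j t) (c j)) \<le> \<eta> * K" .
    have "cnorm A (scale A (ramp t) V) \<le> 1 * \<epsilon>"
      using V cmod_ramp_le[OF t] cnorm_nonneg[OF V(1)] unfolding cnorm_scale[OF V(1)] by (intro mult_mono) auto
    then have d: "cnorm A (P t \<ominus> W (st t)) \<le> \<eta> * K + \<epsilon>"
      unfolding e using n1 c(1) V(1) by (intro order_trans[OF cnorm_diff_triangle]) auto
    have "cnorm A (W (st t)) \<le> K" using is_trig_cnorm_le[OF W(1)] W(2) order_trans by blast
    then have "cnorm A (X t) \<le> 2 * K" unfolding X_def using cnorm_star_le[OF Wc, of "st t"] by simp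
    then have "cnorm A (X t \<otimes> (P t \<ominus> W (st t))) \<le> 2 * K * (\<eta> * K + \<epsilon>)"
      using d Pc Wc by (intro cnorm_mult_le) (auto simp: X_def)
    moreover have "X t \<otimes> (P t \<ominus> W (st t)) = X t \<otimes> P t \<ominus> \<one>"
      unfolding X_def W(3)[of "st t", symmetric] using Pc Wc by (intro minus_mult) auto
    moreover have "cnorm A (\<one> \<ominus> X t \<otimes> P t) = cnorm A (X t \<otimes> P t \<ominus> \<one>)"
      using Pc Wc by (intro cnorm_minus_commute) (auto simp: X_def)
    ultimately show ?thesis using c1 by simp
  qed
  have int: "((\<lambda>t. \<tau> (Z t \<otimes> P' t)) has_integral (tlog (X (2 * pi) \<otimes> P (2 * pi)) - tlog (X 0 \<otimes> P 0))) {0..2 * pi}"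
  proof -
    define B where "B = real n * (pi / 2)"
    have s1: "cmod (spin1 (- m) t) \<le> B" if "m \<in> ivl n" for m t
    proof -
      have "\<bar>1 - cos t\<bar> \<le> 2 * pi" using cos_ge_minus_one[of t] cos_le_one[of t] pi_gt3 by linarith
      then have "cmod (ramp1 t) \<le> 1" unfolding ramp1_def norm_of_real by simp
      then have "\<bar>real_of_int m\<bar> * (pi / 2) * cmod (ramp1 t) \<le> real n * (pi / 2) * 1"
        using that by (intro mult_mono) auto
      then show ?thesis by (simp add: spin1_def spin_def norm_mult B_def)
    qed
    \<comment> \<open>Some common bound for the two curves and their derivatives; its size does not
      enter the result.\<close>
    define M0 where "M0 = 1 * (2 * K) + B * (2 * K) + wnorm R p + wnorm R (\<lambda>m. scale A (\<i> * of_int m) (p m))"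
    have B0: "0 \<le> B" by (simp add: B_def)
    have BK: "0 \<le> B * (2 * K)" using B0 K by simp
    have w0: "0 \<le> wnorm R p" "0 \<le> wnorm R (\<lambda>m. scale A (\<i> * of_int m) (p m))"
      using pp(1) by (auto intro!: wnorm_nonneg)
    have x0: "cnorm A (X t) \<le> 1 * (\<Sum>m\<in>ivl n. cnorm A (cs m))" for t
      unfolding Xeq using csc by (intro cnorm_finsum_scale) (auto simp: spin_def)
    have x1: "cnorm A (X t) \<le> M0" for t
      using x0[of t] Ks w0 BK unfolding M0_def by linarith
    have "cnorm A (X' t) \<le> B * (\<Sum>m\<in>ivl n. cnorm A (cs m))" for t
      unfolding X'_def using csc s1 by (intro cnorm_finsum_scale) auto
    moreover have "B * (\<Sum>m\<in>ivl n. cnorm A (cs m)) \<le> M0"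
      using mult_left_mono[OF Ks B0] w0 K by (simp add: M0_def)
    ultimately have x2: "cnorm A (X' t) \<le> M0" for t using order_trans by blast
    have x3: "cnorm A (P t) \<le> M0" for t
      using is_trig_cnorm_le[OF P, of t] w0 BK K by (simp add: M0_def)
    have x4: "cnorm A (P' t) \<le> M0" for t
      using is_trig_cnorm_le[OF is_trig_has_der(2)[OF P], of t] w0 BK K by (simp add: M0_def P'_def)
    show ?thesis
    proof (rule winding_has_integral[where T = "\<lambda>t. W (st t)", OF _ Xder _ _ _ flat' Z near _ x1 x2 x3 x4])
      show "has_der P (P' t) t" for t unfolding P'_def by (rule is_trig_has_der(1)[OF P])
      show "W (st t) \<otimes> X t = \<one>" for t unfolding X_def by (rule W(4))
    qed (auto simp: Wc)
  qed
  \<comment> \<open>P is a loop, but P 0 is only near 1. It occurs at both ends and cancels by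
    \<open>tlog_mult\<close>, leaving the logarithm of star U.\<close>
  have ends: "X 0 \<otimes> P 0 = P 0" "X (2 * pi) \<otimes> P (2 * pi) = star A U \<otimes> P 0"
  proof -
    have "st 0 = 0" "st (2 * pi) = pi / 2" by (simp_all add: st_def)
    then have "X 0 = \<one>" "X (2 * pi) = star A U" by (simp_all only: X_def W0 WU star_one)
    moreover have "P (2 * pi) = P 0"
      unfolding pp(3) using cis_multiple_2pi by (simp add: mult.commute)
    ultimately show "X 0 \<otimes> P 0 = P 0" "X (2 * pi) \<otimes> P (2 * pi) = star A U \<otimes> P 0" using Pc by simp_all
  qed
  have sU: "cnorm A (\<one> \<ominus> star A U) \<le> 1 / 4"
  proof -
    have "cnorm A (star A (\<one> \<ominus> U)) \<le> 2 * cnorm A (\<one> \<ominus> U)" using Uc by (intro cnorm_star_le) auto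
    then show ?thesis using U \<epsilon>1 Uc by (simp add: star_diff)
  qed
  have "tlog (star A U \<otimes> P 0) = tlog (star A U) + tlog (P 0)"
    using near[of 0] ends(1) sU Uc Pc by (intro tlog_mult) auto
  moreover have "tlog (star A U \<otimes> U) = tlog (star A U) + tlog U"
    using sU Uc U \<epsilon>1 by (intro tlog_mult) auto
  moreover have "star A U \<otimes> U = \<one>" using W(3) WU by metis
  ultimately have logU: "tlog (star A U \<otimes> P 0) - tlog (P 0) = - tlog U" by (simp add: add_eq_0_iff)
  have "2 * pi * (\<Sum>m\<in>ivl R. \<i> * of_int m * \<tau> (p m \<otimes> q (- m))) = - tlog U"
  proof (rule has_integral_unique)
    show "((\<lambda>t. \<tau> (Z t \<otimes> P' t)) has_integral (2 * pi * (\<Sum>m\<in>ivl R. \<i> * of_int m * \<tau> (p m \<otimes> q (- m))))) {0..2*pi}"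
      unfolding P'_def using Z by (intro q(6)) auto
    show "((\<lambda>t. \<tau> (Z t \<otimes> P' t)) has_integral (- tlog U)) {0..2*pi}"
      using int unfolding ends logU .
  qed
  then have winding: "2 * pi * \<i> * S = - tlog U"
    by (simp add: S_def sum_distrib_left mult_ac)
  \<comment> \<open>Shifting all frequencies by R amounts to multiplying P by cis (R t). This makes
    P analytic of degree 2 R and adds R times the trace of 1 to its winding number.\<close>
  have "\<exists>x\<in>carrier (Mat (2 * R) A). x \<otimes>\<^bsub>Mat (2 * R) A\<^esub> x = x \<and> star (Mat (2 * R) A) x = x \<and>
    mat_trace (2 * R) \<tau> x = (\<Sum>t\<le>2 * R. of_nat t * \<tau> (p (int t - int R) \<otimes> q (- int t + int R)))"
  proof (rule toeplitz_projection[where p = "\<lambda>m. p (m - int R)" and q = "\<lambda>m. q (m + int R)" and C = "M * K" and K = "4 * (M * K)" and \<eta> = "4 * (M * K) * \<delta>"])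
    show "p (m - int R) = \<zero>" if "m < 0 \<or> int (2 * R) < m" for m using that by (intro pp(2)) auto
    show "(\<Oplus>t\<in>{..2 * R}. p (int t - int R) \<otimes> q (m - int t + int R)) = (if m = 0 then \<one> else \<zero>)" for m
      using finsum_shift[of "\<lambda>s. p s \<otimes> q (m - s)" R] q(2)[of m] pp(1) q(1) by (simp add: algebra_simps)
    show "(\<Oplus>t\<in>{..2 * R}. q (m - int t + int R) \<otimes> p (int t - int R)) = (if m = 0 then \<one> else \<zero>)" for m
      using finsum_shift[of "\<lambda>s. q (m - s) \<otimes> p s" R] q(3)[of m] pp(1) q(1) by (simp add: algebra_simps)
    show "3 * (M * K) * (4 * (M * K) * \<delta>) \<le> 1 / 2" using \<delta>12 by (simp add: mult_ac)
    fix F :: "int set" assume F: "finite F"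
    have "(\<Sum>m\<in>F. cnorm A (p (m - int R))) = (\<Sum>m\<in>(\<lambda>m. m - int R) ` F. cnorm A (p m))"
      by (subst sum.reindex) (auto simp: inj_on_def)
    then show "(\<Sum>m\<in>F. cnorm A (p (m - int R))) \<le> M * K"
      using order_trans[OF sum_coeff_le_wnorm[OF P, of "(\<lambda>m. m - int R) ` F"] pK] F by simp
    have "(\<Sum>m\<in>F. cnorm A (q (m + int R))) = (\<Sum>m\<in>(\<lambda>m. m + int R) ` F. cnorm A (q m))"
      by (subst sum.reindex) (auto simp: inj_on_def)
    then show "(\<Sum>m\<in>F. cnorm A (q (m + int R))) \<le> 4 * (M * K)"
      using q(4)[of "(\<lambda>m. m + int R) ` F"] F by simp
    have "(\<Sum>m\<in>F. cnorm A (q (m + int R) \<ominus> star A (p (- m - int R)))) = (\<Sum>m\<in>(\<lambda>m. m + int R) ` F. cnorm A (q m \<ominus> star A (p (- m))))"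
      by (subst sum.reindex) (auto simp: inj_on_def)
    then show "(\<Sum>m\<in>F. cnorm A (q (m + int R) \<ominus> star A (p (- m - int R)))) \<le> 4 * (M * K) * \<delta>"
      using q(5)[of "(\<lambda>m. m + int R) ` F"] F by simp
  qed (use pp(1) q(1) in auto)
  then obtain x where x: "x \<in> carrier (Mat (2 * R) A)" "x \<otimes>\<^bsub>Mat (2 * R) A\<^esub> x = x" "star (Mat (2 * R) A) x = x"
    "mat_trace (2 * R) \<tau> x = (\<Sum>t\<le>2 * R. of_nat t * \<tau> (p (int t - int R) \<otimes> q (- int t + int R)))" by blast
  have "(\<Sum>t\<le>2 * R. of_nat t * \<tau> (p (int t - int R) \<otimes> q (- int t + int R))) = (\<Sum>s\<in>ivl R. of_int (s + int R) * \<tau> (p s \<otimes> q (- s)))"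
    using sum_shift[of "\<lambda>s. of_int (s + int R) * \<tau> (p s \<otimes> q (- s))" R] by simp
  also have "\<dots> = S + of_nat R * (\<Sum>s\<in>ivl R. \<tau> (p s \<otimes> q (- s)))"
    by (simp add: S_def distrib_right sum.distrib sum_distrib_left)
  also have "(\<Sum>s\<in>ivl R. \<tau> (p s \<otimes> q (- s))) = \<tau> \<one>"
    using arg_cong[OF q(2)[of 0], of \<tau>] pp(1) q(1) by (simp add: trace_finsum Pi_iff)
  finally have "mat_trace (2 * R) \<tau> x = of_nat R * \<tau> \<one> + S" unfolding x(4) by (simp add: add.commute)
  moreover have "S = - tlog U / (2 * of_real pi * \<i>)" using winding by (simp add: field_simps)
  ultimately show ?thesis using x by (intro exI[of _ "2 * R"] exI[of _ x]) simp
qed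

end

section \<open>Unitary trigonometric paths with traceless logarithmic derivative\<close>

context star_bounded_algebra
begin

lemma has_der_star:
  assumes "has_der f f' t" shows "has_der (\<lambda>t. star A (f t)) (star A f') t"
proof (rule has_derI_bound)
  note c = has_der_closed[OF assms]
  show "\<And>s. star A (f s) \<in> carrier A" "star A f' \<in> carrier A" using c by auto
  show "cnorm A ((star A (f y) \<ominus> star A (f t)) \<ominus> scale A (of_real (y - t)) (star A f')) / \<bar>y - t\<bar>
    \<le> 2 * (cnorm A ((f y \<ominus> f t) \<ominus> scale A (of_real (y - t)) f') / \<bar>y - t\<bar>)" for y
  proof -
    have "(star A (f y) \<ominus> star A (f t)) \<ominus> scale A (of_real (y - t)) (star A f') = star A ((f y \<ominus> f t) \<ominus> scale A (of_real (y - t)) f')"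
      using c by (simp add: star_diff star_scale)
    then show ?thesis
      using cnorm_star_le[of "(f y \<ominus> f t) \<ominus> scale A (of_real (y - t)) f'"] c by (simp add: divide_right_mono)
  qed
  show "((\<lambda>y. 2 * (cnorm A ((f y \<ominus> f t) \<ominus> scale A (of_real (y - t)) f') / \<bar>y - t\<bar>)) \<longlongrightarrow> 0) (at t)"
    using assms unfolding has_der_def by (intro tendsto_mult_right_zero) auto
qed

text \<open>Uniqueness of the derivative under the trace is enough, since flatness speaks of traces
  only.\<close>

lemma has_der_trace_unique:
  assumes "has_der f d t" "has_der f d' t" "x \<in> carrier A" shows "\<tau> (x \<otimes> d) = \<tau> (x \<otimes> d')"
proof -
  have "((\<lambda>t. \<tau> (x \<otimes> f t)) has_vector_derivative \<tau> (x \<otimes> d)) (at t)" if "has_der f d t" for d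
    using has_der_trace[OF has_der_mult[OF has_der_const[OF assms(3)] that]] has_der_closed[OF that] assms(3) by simp
  from vector_derivative_unique_at[OF this[OF assms(1)] this[OF assms(2)]] show ?thesis .
qed

text \<open>These paths have period 2 \<pi>, but only the quarter from 0 to \<pi> / 2 is of
  interest, which leads from 1 to the element under study. Some derivative d is asked for instead of
  the one given by the coefficients, so that the product rule applies without computing a
  convolution.\<close>

definition flat_loop :: "nat \<Rightarrow> real \<Rightarrow> (real \<Rightarrow> 'a) \<Rightarrow> bool" where
  "flat_loop N K F \<longleftrightarrow> (\<exists>c. is_trig N F c \<and> wnorm N c \<le> K) \<and>
     (\<forall>s. star A (F s) \<otimes> F s = \<one> \<and> F s \<otimes> star A (F s) = \<one>) \<and>
     (\<forall>s. \<exists>d. has_der F d s \<and> \<tau> (star A (F s) \<otimes> d) = 0)"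

lemma flat_loop_const:
  assumes "u \<in> carrier A" "star A u \<otimes> u = \<one>" "u \<otimes> star A u = \<one>" "cnorm A u \<le> K"
  shows "flat_loop 0 K (\<lambda>_. u)"
  unfolding flat_loop_def using assms is_trig_const[OF assms(1), of 0] has_der_const[OF assms(1)]
  by (metis r_null star_closed trace_zero)

text \<open>Under the trace the logarithmic derivative of a product is the sum of those of the
  factors.\<close>

lemma flat_loop_mult:
  assumes F: "flat_loop N K F" and G: "flat_loop S L G" and KL: "0 \<le> K"
  shows "flat_loop (N + S) (K * L) (\<lambda>s. F s \<otimes> G s)"
proof -
  obtain c where c: "is_trig N F c" "wnorm N c \<le> K" using F unfolding flat_loop_def by blast
  obtain d where d: "is_trig S G d" "wnorm S d \<le> L" using G unfolding flat_loop_def by blast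
  have Fu: "star A (F s) \<otimes> F s = \<one>" "F s \<otimes> star A (F s) = \<one>" and Gu: "star A (G s) \<otimes> G s = \<one>" "G s \<otimes> star A (G s) = \<one>" for s
    using F G unfolding flat_loop_def by auto
  note cl [simp] = is_trigD(4)[OF c(1)] is_trigD(4)[OF d(1)]
  have "wnorm N c * wnorm S d \<le> K * L"
    using c d KL is_trigD(1)[OF d(1)] by (intro mult_mono wnorm_nonneg) auto
  then have 1: "is_trig (N + S) (\<lambda>s. F s \<otimes> G s) (conv N c d)" "wnorm (N + S) (conv N c d) \<le> K * L"
    using is_trig_mult[OF c(1) d(1)] by auto
  have 2: "star A (F s \<otimes> G s) \<otimes> (F s \<otimes> G s) = \<one>" for s
  proof -
    have "star A (F s \<otimes> G s) \<otimes> (F s \<otimes> G s) = star A (G s) \<otimes> ((star A (F s) \<otimes> F s) \<otimes> G s)"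
      by (simp add: star_mult m_assoc)
    then show ?thesis by (simp add: Fu Gu)
  qed
  have 3: "(F s \<otimes> G s) \<otimes> star A (F s \<otimes> G s) = \<one>" for s
  proof -
    have "(F s \<otimes> G s) \<otimes> star A (F s \<otimes> G s) = F s \<otimes> ((G s \<otimes> star A (G s)) \<otimes> star A (F s))"
      by (simp add: star_mult m_assoc)
    then show ?thesis by (simp add: Fu Gu)
  qed
  have 4: "\<exists>e. has_der (\<lambda>s. F s \<otimes> G s) e s \<and> \<tau> (star A (F s \<otimes> G s) \<otimes> e) = 0" for s
  proof -
    obtain f g where f: "has_der F f s" "\<tau> (star A (F s) \<otimes> f) = 0" and g: "has_der G g s" "\<tau> (star A (G s) \<otimes> g) = 0"
      using F G unfolding flat_loop_def by metis
    have fg: "f \<in> carrier A" "g \<in> carrier A" using has_der_closed f(1) g(1) by blast+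
    have "\<tau> (star A (F s \<otimes> G s) \<otimes> (f \<otimes> G s \<oplus> F s \<otimes> g))
      = \<tau> (star A (G s) \<otimes> (star A (F s) \<otimes> f \<otimes> G s)) + \<tau> (star A (G s) \<otimes> ((star A (F s) \<otimes> F s) \<otimes> g))"
      using fg by (simp add: star_mult r_distr m_assoc trace_add)
    also have "\<tau> (star A (G s) \<otimes> (star A (F s) \<otimes> f \<otimes> G s)) = \<tau> (star A (F s) \<otimes> f \<otimes> G s \<otimes> star A (G s))"
      using fg by (intro trace_commute) auto
    also have "star A (F s) \<otimes> f \<otimes> G s \<otimes> star A (G s) = star A (F s) \<otimes> f \<otimes> (G s \<otimes> star A (G s))"
      using fg by (intro m_assoc) auto
    finally have "\<tau> (star A (F s \<otimes> G s) \<otimes> (f \<otimes> G s \<oplus> F s \<otimes> g)) = 0" using f(2) g(2) fg by (simp add: Fu Gu)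
    then show ?thesis using has_der_mult[OF f(1) g(1)] by blast
  qed
  show ?thesis unfolding flat_loop_def using 1 2 3 4 by blast
qed

lemma is_trig_cos_sin:
  assumes "x \<in> carrier A"
  shows "\<exists>c. is_trig 1 (\<lambda>s. scale A (of_real (cos s)) x) c \<and> wnorm 1 c = cnorm A x"
    "\<exists>c. is_trig 1 (\<lambda>s. scale A (of_real (sin s)) x) c \<and> wnorm 1 c = cnorm A x"
proof -
  have I: "{- int 1..int 1} = {- 1, 0, 1}" by auto
  define a :: "int \<Rightarrow> complex" where "a m = (if \<bar>m\<bar> = 1 then 1 / 2 else 0)" for m
  define b :: "int \<Rightarrow> complex" where "b m = (if \<bar>m\<bar> = 1 then - \<i> * of_int m / 2 else 0)" for m
  have 1: "complex_of_real (cos s) = (\<Sum>m\<in>ivl 1. a m * cis (of_int m * s))" for s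
    unfolding I by (simp add: a_def complex_eq_iff)
  have 2: "complex_of_real (sin s) = (\<Sum>m\<in>ivl 1. b m * cis (of_int m * s))" for s
    unfolding I by (simp add: b_def complex_eq_iff)
  have s: "(\<Sum>m\<in>ivl 1. cmod (a m)) = 1" "(\<Sum>m\<in>ivl 1. cmod (b m)) = 1"
    unfolding I by (simp_all add: a_def b_def norm_mult norm_divide)
  have z: "\<And>m. m \<notin> ivl 1 \<Longrightarrow> a m = 0" "\<And>m. m \<notin> ivl 1 \<Longrightarrow> b m = 0" by (auto simp: a_def b_def)
  show "\<exists>c. is_trig 1 (\<lambda>s. scale A (of_real (cos s)) x) c \<and> wnorm 1 c = cnorm A x"
    using is_trig_scalar[OF 1 z(1) assms] s(1) by auto
  show "\<exists>c. is_trig 1 (\<lambda>s. scale A (of_real (sin s)) x) c \<and> wnorm 1 c = cnorm A x"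
    using is_trig_scalar[OF 2 z(2) assms] s(2) by auto
qed

text \<open>As J squares to -1, this is the one-parameter group exp (s J), whose logarithmic
  derivative is J, of trace 0. The cosine and the sine term each have Wiener norm at most 1, whence
  the bound 2.\<close>

lemma flat_loop_rotation:
  assumes J: "J \<in> carrier A" "star A J = \<ominus> J" "J \<otimes> J = \<ominus> \<one>" "\<tau> J = 0" "cnorm A J \<le> 1"
  shows "flat_loop 1 2 (\<lambda>s. scale A (of_real (cos s)) \<one> \<oplus> scale A (of_real (sin s)) J)"
proof -
  define r where "r = (\<lambda>s. scale A (of_real (cos s)) \<one> \<oplus> scale A (of_real (sin s)) J)"
  have lin: "(scale A a \<one> \<oplus> scale A b J) \<otimes> (scale A c \<one> \<oplus> scale A d J)
      = scale A (a * c - b * d) \<one> \<oplus> scale A (a * d + b * c) J" for a b c d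
  proof -
    have "(scale A a \<one> \<oplus> scale A b J) \<otimes> (scale A c \<one> \<oplus> scale A d J)
      = (scale A (a * c) \<one> \<oplus> scale A (b * d) (\<ominus> \<one>)) \<oplus> (scale A (a * d) J \<oplus> scale A (b * c) J)"
      using J(1) by (simp add: l_distr r_distr scale_mult_scale J(3) a_ac)
    also have "scale A (b * d) (\<ominus> \<one>) = scale A (- (b * d)) \<one>" by (simp add: minus_eq_scale scale_scale)
    finally show ?thesis using J(1) scale_add_left[of \<one> "a * c" "- (b * d)"] by (simp add: scale_add_left)
  qed
  have rs: "star A (r s) = scale A (of_real (cos s)) \<one> \<oplus> scale A (of_real (- sin s)) J" for s
    unfolding r_def using J(1) by (simp add: star_add star_scale J(2) minus_eq_scale scale_scale)
  have rc: "r s \<in> carrier A" for s using J(1) by (simp add: r_def)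
  obtain c where c: "is_trig 1 (\<lambda>s. scale A (of_real (cos s)) \<one>) c" "wnorm 1 c = cnorm A \<one>"
    using is_trig_cos_sin(1)[OF one_closed] by blast
  obtain d where d: "is_trig 1 (\<lambda>s. scale A (of_real (sin s)) J) d" "wnorm 1 d = cnorm A J"
    using is_trig_cos_sin(2)[OF J(1)] by blast
  have 1: "\<exists>c. is_trig 1 r c \<and> wnorm 1 c \<le> 2"
    unfolding r_def using is_trig_add[OF c(1) d(1)] c(2) d(2) J(5) cnorm_one
    by (intro exI[of _ "\<lambda>m. c m \<oplus> d m"]) auto
  have sc: "cos s * cos s + sin s * sin s = 1" for s :: real
    using sin_cos_squared_add2[of s] by (simp add: power2_eq_square)
  have sc': "complex_of_real (cos s) * complex_of_real (cos s) + complex_of_real (sin s) * complex_of_real (sin s) = 1" for s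
    using sc[of s] by (metis of_real_1 of_real_add of_real_mult)
  have 2: "star A (r s) \<otimes> r s = \<one>" "r s \<otimes> star A (r s) = \<one>" for s
    unfolding rs unfolding r_def lin using J(1) sc'[of s] by (simp_all add: scale_one mult.commute)
  have 3: "has_der r (scale A (of_real (- sin s)) \<one> \<oplus> scale A (of_real (cos s)) J) s" for s
  proof -
    have "((\<lambda>x. complex_of_real (cos x)) has_vector_derivative of_real (- sin s)) (at s)"
      "((\<lambda>x. complex_of_real (sin x)) has_vector_derivative of_real (cos s)) (at s)"
      by (auto intro!: has_vector_derivative_of_real derivative_eq_intros simp: has_real_derivative_iff_has_vector_derivative[symmetric])
    then show ?thesis unfolding r_def using J(1) by (intro has_der_add has_der_scale) auto
  qed
  have 4: "\<tau> (star A (r s) \<otimes> (scale A (of_real (- sin s)) \<one> \<oplus> scale A (of_real (cos s)) J)) = 0" for s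
    unfolding rs lin using J(1) by (simp add: trace_add trace_scale J(4) mult.commute)
  have "flat_loop 1 2 r" unfolding flat_loop_def using 1 2 3 4 by blast
  then show ?thesis unfolding r_def .
qed

text \<open>Flatness in the form that \<open>loop_projection\<close> uses: differentiating star F F
  = 1 moves the derivative to the adjoint factor, and uniqueness under the trace replaces d by the
  derivative given by the coefficients.\<close>

lemma flat_loop_coefficients:
  assumes "flat_loop N K F"
  obtains c where "is_trig N F c" "wnorm N c \<le> K"
    "\<And>s. \<tau> (star A (\<Oplus>m\<in>ivl N. scale A (cis (of_int m * s)) (scale A (\<i> * of_int m) (c m))) \<otimes> F s) = 0"
proof -
  obtain c where c: "is_trig N F c" "wnorm N c \<le> K" using assms unfolding flat_loop_def by blast
  note Fc [simp] = is_trigD(4)[OF c(1)]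
  have "\<tau> (star A (\<Oplus>m\<in>ivl N. scale A (cis (of_int m * s)) (scale A (\<i> * of_int m) (c m))) \<otimes> F s) = 0" for s
  proof -
    define e where "e = (\<Oplus>m\<in>ivl N. scale A (cis (of_int m * s)) (scale A (\<i> * of_int m) (c m)))"
    have e: "has_der F e s" unfolding e_def by (rule is_trig_has_der(1)[OF c(1)])
    have ec: "e \<in> carrier A" using has_der_closed(2)[OF e] .
    obtain d where d: "has_der F d s" "\<tau> (star A (F s) \<otimes> d) = 0" using assms unfolding flat_loop_def by blast
    have 0: "\<tau> (star A (F s) \<otimes> e) = 0" using has_der_trace_unique[OF e d(1), of "star A (F s)"] d(2) by simp
    have "has_der (\<lambda>s. star A (F s) \<otimes> F s) (star A e \<otimes> F s \<oplus> star A (F s) \<otimes> e) s"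
      by (rule has_der_mult[OF has_der_star[OF e] e])
    moreover have "(\<lambda>s. star A (F s) \<otimes> F s) = (\<lambda>_. \<one>)" using assms unfolding flat_loop_def by auto
    ultimately have "has_der (\<lambda>_. \<one>) (star A e \<otimes> F s \<oplus> star A (F s) \<otimes> e) s" by simp
    from has_der_trace_unique[OF this has_der_const[OF one_closed] one_closed]
    have "\<tau> (star A e \<otimes> F s) + \<tau> (star A (F s) \<otimes> e) = 0" using ec by (simp add: trace_add)
    then show ?thesis unfolding e_def[symmetric] 0 by simp
  qed
  then show ?thesis using that c by blast
qed

end

section \<open>Rotations of 2 x 2 matrices and paths to products of commutators\<close>

context unital_cstar_algebra
begin

definition diag2 :: "'a \<Rightarrow> 'a \<Rightarrow> nat \<Rightarrow> nat \<Rightarrow> 'a" where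
  "diag2 a b = (\<lambda>i j. if i = 0 \<and> j = 0 then a else if i = 1 \<and> j = 1 then b else \<zero>)"

text \<open>The rotation by a right angle; conjugation by it exchanges the two diagonal
  entries.\<close>

definition quarter :: "nat \<Rightarrow> nat \<Rightarrow> 'a" where
  "quarter = (\<lambda>i j. if i = 0 \<and> j = 1 then \<ominus> \<one> else if i = 1 \<and> j = 0 then \<one> else \<zero>)"

lemma matrix_prod_2:
  assumes "\<And>i j. x i j \<in> carrier A" "\<And>i j. y i j \<in> carrier A"
  shows "matrix_prod A 2 x y = (\<lambda>i j. x i 0 \<otimes> y 0 j \<oplus> x i 1 \<otimes> y 1 j)"
proof (intro ext)
  fix i j
  have "{..<2::nat} = insert 0 {1}" by auto
  then show "matrix_prod A 2 x y i j = x i 0 \<otimes> y 0 j \<oplus> x i 1 \<otimes> y 1 j"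
    using assms by (simp add: matrix_prod_def)
qed

lemma diag2_closed: "\<lbrakk>a \<in> carrier A; b \<in> carrier A\<rbrakk> \<Longrightarrow> diag2 a b \<in> matrices A 2 2"
  by (auto simp: matrices_def diag2_def)

lemma quarter_closed: "quarter \<in> matrices A 2 2"
  by (auto simp: matrices_def quarter_def)

lemma diag2_prod:
  assumes "a \<in> carrier A" "b \<in> carrier A" "c \<in> carrier A" "d \<in> carrier A"
  shows "matrix_prod A 2 (diag2 a b) (diag2 c d) = diag2 (a \<otimes> c) (b \<otimes> d)"
  using assms by (subst matrix_prod_2) (auto simp: diag2_def fun_eq_iff)

lemma quarter_prod:
  assumes "a \<in> carrier A" "b \<in> carrier A"
  shows "matrix_prod A 2 (matrix_prod A 2 quarter (diag2 a b)) (\<lambda>i j. \<ominus> quarter i j) = diag2 b a"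
    "matrix_prod A 2 quarter quarter = (\<lambda>i j. \<ominus> diag2 \<one> \<one> i j)"
proof -
  have "matrix_prod A 2 quarter (diag2 a b) = (\<lambda>i j. if i = 0 \<and> j = 1 then \<ominus> b else if i = 1 \<and> j = 0 then a else \<zero>)"
    using assms by (subst matrix_prod_2) (auto simp: diag2_def quarter_def fun_eq_iff l_minus)
  then show "matrix_prod A 2 (matrix_prod A 2 quarter (diag2 a b)) (\<lambda>i j. \<ominus> quarter i j) = diag2 b a"
    using assms by (simp only:) (subst matrix_prod_2, auto simp: diag2_def quarter_def fun_eq_iff l_minus r_minus)
  show "matrix_prod A 2 quarter quarter = (\<lambda>i j. \<ominus> diag2 \<one> \<one> i j)"
    by (subst matrix_prod_2) (auto simp: diag2_def quarter_def fun_eq_iff l_minus r_minus)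
qed

lemma diag2_star: "matrix_star A (diag2 a b) = diag2 (star A a) (star A b)"
proof -
  interpret I: involutive_banach_algebra A by (rule involutive_banach_algebra)
  show ?thesis by (auto simp: matrix_star_def diag2_def fun_eq_iff)
qed

lemma quarter_star: "matrix_star A quarter = (\<lambda>i j. \<ominus> quarter i j)"
proof -
  interpret I: involutive_banach_algebra A by (rule involutive_banach_algebra)
  show ?thesis by (auto simp: matrix_star_def quarter_def fun_eq_iff I.star_minus)
qed

lemma mat_norm_2_le:
  "mat_norm 2 A x \<le> r \<longleftrightarrow> 0 \<le> r \<and> cnorm A (x 0 0) + cnorm A (x 0 1) \<le> r \<and> cnorm A (x 1 0) + cnorm A (x 1 1) \<le> r"
proof -
  have "{..<2::nat} = {0, 1}" by auto
  moreover have "(\<forall>i<2::nat. P i) \<longleftrightarrow> P 0 \<and> P 1" for P by (auto simp: less_2_cases_iff)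
  ultimately show ?thesis unfolding mat_norm_le_iff by simp
qed

end

context involutive_banach_algebra
begin

lemma Mat_uminus:
  assumes "x \<in> matrices A k k" shows "\<ominus>\<^bsub>Mat k A\<^esub> x = (\<lambda>i j. \<ominus> x i j)"
proof -
  interpret B: involutive_banach_algebra "Mat k A" by (rule Mat_involutive_banach_algebra)
  show ?thesis using B.minus_eq_scale[of x] assms by (simp add: minus_eq_scale matrices_entry)
qed

lemma Mat_finsum:
  assumes "finite S" "\<And>s. s \<in> S \<Longrightarrow> f s \<in> matrices A k k"
  shows "(\<Oplus>\<^bsub>Mat k A\<^esub>s\<in>S. f s) i j = (\<Oplus>s\<in>S. f s i j)"
proof -
  interpret B: involutive_banach_algebra "Mat k A" by (rule Mat_involutive_banach_algebra)
  show ?thesis using assms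
  proof (induction S)
    case (insert s S)
    then have "f s \<in> carrier (Mat k A)" "f \<in> S \<rightarrow> carrier (Mat k A)" by auto
    moreover have "f t i j \<in> carrier A" if "t \<in> insert s S" for t by (rule matrices_entry[OF insert.prems[OF that]])
    ultimately show ?case using insert by (simp add: Pi_iff)
  qed simp
qed

lemma finsum_pairs:
  assumes "\<And>t r. f t r \<in> carrier A"
  shows "(\<Oplus>s\<in>{..<2 * D::nat}. f (s div 2) (s mod 2)) = (\<Oplus>t\<in>{..<D}. \<Oplus>r\<in>{..<2::nat}. f t r)"
proof (induction D)
  case (Suc D)
  have "{..<2 * Suc D} = insert (2 * D + 1) (insert (2 * D) {..<2 * D})" "{..<2::nat} = insert 1 {0}" by auto
  then show ?case using Suc assms by (simp add: lessThan_Suc a_ac)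
qed simp

end

lemma sum_pairs:
  fixes f :: "nat \<Rightarrow> nat \<Rightarrow> complex"
  shows "(\<Sum>s<2 * D. f (s div 2) (s mod 2)) = (\<Sum>t<D. \<Sum>r<2. f t r)"
proof (induction D)
  case (Suc D)
  have "{..<2 * Suc D} = insert (2 * D + 1) (insert (2 * D) {..<2 * D})" "{..<2::nat} = insert 1 {0}" by auto
  then show ?case using Suc by (simp add: lessThan_Suc)
qed simp

primrec cword :: "('a, 'm) cstar_scheme \<Rightarrow> ('a \<times> 'a) list \<Rightarrow> 'a" where
  "cword A [] = \<one>\<^bsub>A\<^esub>"
| "cword A (w # ws) = (fst w \<otimes>\<^bsub>A\<^esub> snd w \<otimes>\<^bsub>A\<^esub> star A (fst w) \<otimes>\<^bsub>A\<^esub> star A (snd w)) \<otimes>\<^bsub>A\<^esub> cword A ws"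

context tracial_cstar_algebra
begin

lemma Mat2_star_bounded: "star_bounded_algebra (Mat 2 A) (mat_trace 2 \<tau>)"
proof -
  interpret T: tracial_banach_algebra A \<tau> by (rule tracial_banach_algebra)
  interpret B: tracial_banach_algebra "Mat 2 A" "mat_trace 2 \<tau>" by (rule T.Mat_tracial_banach_algebra)
  show ?thesis
  proof unfold_locales
    fix x assume "x \<in> carrier (Mat 2 A)"
    then have x: "x \<in> matrices A 2 2" by simp
    have e: "cnorm A (star A (x i j)) \<le> mat_norm 2 A x" for i j
      using T.cnorm_entry_le[OF x, of i j] cnorm_star[OF matrices_entry[OF x, of i j]] by simp
    then have "mat_norm 2 A (matrix_star A x) \<le> 2 * mat_norm 2 A x"
      unfolding mat_norm_2_le matrix_star_def using mat_norm_nonneg[of 2 A x]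
        e[of 0 0] e[of 0 1] e[of 1 0] e[of 1 1] by (intro conjI; linarith)
    then show "cnorm (Mat 2 A) (star (Mat 2 A) x) \<le> 2 * cnorm (Mat 2 A) x" by simp
  qed
qed

lemma Mat2_one: "\<one>\<^bsub>Mat 2 A\<^esub> = diag2 \<one> \<one>"
  by (auto simp: diag2_def fun_eq_iff)

lemma one_minus_diag2:
  assumes "u \<in> carrier A" shows "\<one>\<^bsub>Mat 2 A\<^esub> \<ominus>\<^bsub>Mat 2 A\<^esub> diag2 u \<one> = diag2 (\<one> \<ominus> u) \<zero>"
proof -
  interpret T: tracial_banach_algebra A \<tau> by (rule tracial_banach_algebra)
  show ?thesis
    unfolding Mat2_one T.Mat_minus[OF diag2_closed[OF one_closed one_closed] diag2_closed[OF assms one_closed]]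
    using assms by (auto simp: diag2_def fun_eq_iff)
qed

lemma tlog_diag2:
  assumes u: "u \<in> carrier A"
  shows "tracial_banach_algebra.tlog (Mat 2 A) (mat_trace 2 \<tau>) (diag2 u \<one>) = tracial_banach_algebra.tlog A \<tau> u"
proof -
  interpret T: tracial_banach_algebra A \<tau> by (rule tracial_banach_algebra)
  interpret B: star_bounded_algebra "Mat 2 A" "mat_trace 2 \<tau>" by (rule Mat2_star_bounded)
  have c: "\<one> \<ominus> u \<in> carrier A" using u by simp
  have "diag2 (\<one> \<ominus> u) \<zero> [^]\<^bsub>Mat 2 A\<^esub> Suc k = diag2 ((\<one> \<ominus> u) [^] Suc k) \<zero>" for k :: nat
  proof (induction k)
    case 0
    show ?case using c diag2_closed[OF c zero_closed] B.l_one[of "diag2 (\<one> \<ominus> u) \<zero>"] by (simp del: Mat_simps(3))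
  next
    case (Suc k)
    have "diag2 (\<one> \<ominus> u) \<zero> [^]\<^bsub>Mat 2 A\<^esub> Suc (Suc k) = matrix_prod A 2 (diag2 ((\<one> \<ominus> u) [^] Suc k) \<zero>) (diag2 (\<one> \<ominus> u) \<zero>)"
      using Suc by simp
    also have "\<dots> = diag2 ((\<one> \<ominus> u) [^] Suc k \<otimes> (\<one> \<ominus> u)) (\<zero> \<otimes> \<zero>)"
      using c by (intro diag2_prod) auto
    finally show ?case by simp
  qed
  moreover have "{..<2::nat} = {0, 1}" by auto
  then have "mat_trace 2 \<tau> (diag2 a \<zero>) = \<tau> a" for a by (simp add: mat_trace_def diag2_def)
  ultimately show ?thesis unfolding B.tlog_def T.tlog_def one_minus_diag2[OF u] by simp
qed

text \<open>Write x', y' for the adjoints. The matrix of the commutator is diag(x, x') diag(y, 1)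
  diag(x', x) diag(y', 1). The first factor is reached from 1 by diag(x, 1) r(s) diag(x', 1) r(-s)
  with the rotation r, which is 1 at s = 0 and diag(x, 1) diag(1, x') at s = \<pi> / 2; the third is
  treated likewise. The factors with y stay constant and cancel at s = 0. Each commutator thus costs
  four rotations of degree 1 and norm at most 2: degree 4 and norm 16.\<close>

lemma commutator_loop:
  assumes "set ws \<subseteq> unitaries A \<times> unitaries A"
  shows "\<exists>F. star_bounded_algebra.flat_loop (Mat 2 A) (mat_trace 2 \<tau>) (4 * length ws) (16 ^ length ws) F \<and>
    F 0 = \<one>\<^bsub>Mat 2 A\<^esub> \<and> F (pi / 2) = diag2 (cword A ws) \<one> \<and> cword A ws \<in> carrier A"
  using assms
proof (induction ws)
  interpret T: tracial_banach_algebra A \<tau> by (rule tracial_banach_algebra)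
  interpret B: star_bounded_algebra "Mat 2 A" "mat_trace 2 \<tau>" by (rule Mat2_star_bounded)
  case Nil
  have "B.flat_loop 0 1 (\<lambda>_. \<one>\<^bsub>Mat 2 A\<^esub>)"
    by (rule B.flat_loop_const) (simp_all only: B.star_one B.one_closed B.l_one B.cnorm_one)
  then show ?case by (intro exI[of _ "\<lambda>_. \<one>\<^bsub>Mat 2 A\<^esub>"]) (simp add: Mat2_one del: Mat_simps)
next
  interpret T: tracial_banach_algebra A \<tau> by (rule tracial_banach_algebra)
  interpret B: star_bounded_algebra "Mat 2 A" "mat_trace 2 \<tau>" by (rule Mat2_star_bounded)
  case (Cons w ws)
  obtain x y where w: "w = (x, y)" by (cases w)
  obtain F where F: "B.flat_loop (4 * length ws) (16 ^ length ws) F" "F 0 = \<one>\<^bsub>Mat 2 A\<^esub>"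
    "F (pi / 2) = diag2 (cword A ws) \<one>" and wc: "cword A ws \<in> carrier A" using Cons by auto
  have x: "x \<in> carrier A" "star A x \<otimes> x = \<one>" "x \<otimes> star A x = \<one>"
    and y: "y \<in> carrier A" "star A y \<otimes> y = \<one>" "y \<otimes> star A y = \<one>"
    using Cons.prems by (auto simp: w unitaries_def)
  have norm_u: "cnorm A u \<le> 1" if "u \<in> carrier A" "star A u \<otimes> u = \<one>" for u
  proof -
    have "(cnorm A u)\<^sup>2 \<le> 1\<^sup>2" using cstar_identity[OF that(1)] that(2) cnorm_one_le by simp
    then show ?thesis by (rule power2_le_imp_le) simp
  qed
  have ul: "B.flat_loop 0 1 (\<lambda>_. diag2 u \<one>)" if u: "u \<in> carrier A" "star A u \<otimes> u = \<one>" "u \<otimes> star A u = \<one>" for u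
  proof (rule B.flat_loop_const)
    show "diag2 u \<one> \<in> carrier (Mat 2 A)" using u by (simp add: diag2_closed)
    show "star (Mat 2 A) (diag2 u \<one>) \<otimes>\<^bsub>Mat 2 A\<^esub> diag2 u \<one> = \<one>\<^bsub>Mat 2 A\<^esub>"
      "diag2 u \<one> \<otimes>\<^bsub>Mat 2 A\<^esub> star (Mat 2 A) (diag2 u \<one>) = \<one>\<^bsub>Mat 2 A\<^esub>"
      unfolding Mat2_one using u by (simp_all add: diag2_star diag2_prod)
    have "mat_norm 2 A (diag2 u \<one>) \<le> 1"
      unfolding mat_norm_2_le using norm_u[OF u(1,2)] cnorm_one_le by (simp add: diag2_def)
    then show "cnorm (Mat 2 A) (diag2 u \<one>) \<le> 1" by simp
  qed
  have xs: "star A x \<in> carrier A" "star A (star A x) \<otimes> star A x = \<one>" "star A x \<otimes> star A (star A x) = \<one>"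
    and ys: "star A y \<in> carrier A" "star A (star A y) \<otimes> star A y = \<one>" "star A y \<otimes> star A (star A y) = \<one>"
    using x y by (simp_all add: star_star)
  \<comment> \<open>The adjoint of \<open>quarter\<close> and also its inverse; with it the path r
    runs through the inverse rotations.\<close>
  define J' where "J' = (\<lambda>i j. \<ominus> quarter i j)"
  define r where "r = (\<lambda>J s. scale (Mat 2 A) (of_real (cos s)) \<one>\<^bsub>Mat 2 A\<^esub> \<oplus>\<^bsub>Mat 2 A\<^esub> scale (Mat 2 A) (of_real (sin s)) J)"
  have Jc: "quarter \<in> carrier (Mat 2 A)" using quarter_closed by simp
  have J'eq: "J' = \<ominus>\<^bsub>Mat 2 A\<^esub> quarter" unfolding J'_def using T.Mat_uminus[OF quarter_closed] by simp
  have J'c: "J' \<in> carrier (Mat 2 A)" unfolding J'eq by (rule B.a_inv_closed[OF Jc])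
  have two: "{..<2::nat} = {0, 1}" by auto
  have Jn: "cnorm (Mat 2 A) quarter \<le> 1"
  proof -
    have "mat_norm 2 A quarter \<le> 1" unfolding mat_norm_2_le using cnorm_one_le by (simp add: quarter_def)
    then show ?thesis by simp
  qed
  have Js: "star (Mat 2 A) quarter = \<ominus>\<^bsub>Mat 2 A\<^esub> quarter"
    unfolding J'eq[symmetric] J'_def using quarter_star by simp
  have JJ: "quarter \<otimes>\<^bsub>Mat 2 A\<^esub> quarter = \<ominus>\<^bsub>Mat 2 A\<^esub> \<one>\<^bsub>Mat 2 A\<^esub>"
    unfolding Mat2_one using quarter_prod(2)[of \<one> \<one>] T.Mat_uminus[OF diag2_closed[OF one_closed one_closed]] by simp
  have Jt: "mat_trace 2 \<tau> quarter = 0" by (simp add: mat_trace_def two quarter_def)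
  have rl: "B.flat_loop 1 2 (r quarter)"
    unfolding r_def by (rule B.flat_loop_rotation[OF Jc Js JJ Jt Jn])
  have rl': "B.flat_loop 1 2 (r J')"
    unfolding r_def J'eq
  proof (rule B.flat_loop_rotation)
    show "star (Mat 2 A) (\<ominus>\<^bsub>Mat 2 A\<^esub> quarter) = \<ominus>\<^bsub>Mat 2 A\<^esub> (\<ominus>\<^bsub>Mat 2 A\<^esub> quarter)" using B.star_minus[OF Jc] Js by simp
    show "(\<ominus>\<^bsub>Mat 2 A\<^esub> quarter) \<otimes>\<^bsub>Mat 2 A\<^esub> (\<ominus>\<^bsub>Mat 2 A\<^esub> quarter) = \<ominus>\<^bsub>Mat 2 A\<^esub> \<one>\<^bsub>Mat 2 A\<^esub>"
      using Jc JJ B.l_minus[OF Jc B.a_inv_closed[OF Jc]] B.r_minus[OF Jc Jc] B.minus_minus[OF B.m_closed[OF Jc Jc]] by simp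
    show "mat_trace 2 \<tau> (\<ominus>\<^bsub>Mat 2 A\<^esub> quarter) = 0" using B.trace_minus[OF Jc] Jt by simp
    show "cnorm (Mat 2 A) (\<ominus>\<^bsub>Mat 2 A\<^esub> quarter) \<le> 1" using B.cnorm_minus[OF Jc] Jn by simp
  qed (rule B.a_inv_closed[OF Jc])
  have r0: "r J 0 = \<one>\<^bsub>Mat 2 A\<^esub>" and r1: "r J (pi / 2) = J" if "J \<in> carrier (Mat 2 A)" for J
    unfolding r_def using that B.one_closed by (simp_all add: B.scale_one del: Mat_simps)
  define X where "X = (\<lambda>s. ((diag2 x \<one> \<otimes>\<^bsub>Mat 2 A\<^esub> r quarter s) \<otimes>\<^bsub>Mat 2 A\<^esub> diag2 (star A x) \<one>) \<otimes>\<^bsub>Mat 2 A\<^esub> r J' s)"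
  define Y where "Y = (\<lambda>s. ((r quarter s \<otimes>\<^bsub>Mat 2 A\<^esub> diag2 x \<one>) \<otimes>\<^bsub>Mat 2 A\<^esub> r J' s) \<otimes>\<^bsub>Mat 2 A\<^esub> diag2 (star A x) \<one>)"
  define G where "G = (\<lambda>s. (((X s \<otimes>\<^bsub>Mat 2 A\<^esub> diag2 y \<one>) \<otimes>\<^bsub>Mat 2 A\<^esub> Y s) \<otimes>\<^bsub>Mat 2 A\<^esub> diag2 (star A y) \<one>) \<otimes>\<^bsub>Mat 2 A\<^esub> F s)"
  have X: "B.flat_loop (0 + 1 + 0 + 1) (1 * 2 * 1 * 2) X"
    unfolding X_def by (intro B.flat_loop_mult ul x xs rl rl') auto
  have Y: "B.flat_loop (1 + 0 + 1 + 0) (2 * 1 * 2 * 1) Y"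
    unfolding Y_def by (intro B.flat_loop_mult ul x xs rl rl') auto
  have e: "(((0 + 1 + 0 + 1) + 0 + (1 + 0 + 1 + 0) + 0) + 4 * length ws) = 4 * length (w # ws)"
    "(((1 * 2 * 1 * 2) * 1 * (2 * 1 * 2 * 1) * 1) * 16 ^ length ws) = (16 ^ length (w # ws) :: real)" by simp_all
  have "B.flat_loop (((0 + 1 + 0 + 1) + 0 + (1 + 0 + 1 + 0) + 0) + 4 * length ws)
      (((1 * 2 * 1 * 2) * 1 * (2 * 1 * 2 * 1) * 1) * 16 ^ length ws) G"
    unfolding G_def by (intro B.flat_loop_mult ul y ys X Y F(1)) auto
  then have G: "B.flat_loop (4 * length (w # ws)) (16 ^ length (w # ws)) G" unfolding e .
  have dc: "diag2 a b \<in> carrier (Mat 2 A)" if "a \<in> carrier A" "b \<in> carrier A" for a b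
    using diag2_closed[OF that] by simp
  have dp: "diag2 a b \<otimes>\<^bsub>Mat 2 A\<^esub> diag2 c d = diag2 (a \<otimes> c) (b \<otimes> d)"
    if "a \<in> carrier A" "b \<in> carrier A" "c \<in> carrier A" "d \<in> carrier A" for a b c d
    using diag2_prod[OF that] by simp
  have JdJ: "quarter \<otimes>\<^bsub>Mat 2 A\<^esub> diag2 a b \<otimes>\<^bsub>Mat 2 A\<^esub> J' = diag2 b a" if "a \<in> carrier A" "b \<in> carrier A" for a b
    using quarter_prod(1)[OF that] by (simp add: J'_def)
  have one: "diag2 \<one> \<one> \<otimes>\<^bsub>Mat 2 A\<^esub> z = z" "z \<otimes>\<^bsub>Mat 2 A\<^esub> diag2 \<one> \<one> = z" if "z \<in> carrier (Mat 2 A)" for z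
    using B.l_one[OF that] B.r_one[OF that] by (simp_all only: Mat2_one)
  have dx: "diag2 x \<one> \<in> carrier (Mat 2 A)" "diag2 (star A x) \<one> \<in> carrier (Mat 2 A)"
    "diag2 y \<one> \<in> carrier (Mat 2 A)" "diag2 (star A y) \<one> \<in> carrier (Mat 2 A)" using x xs y ys by (auto intro: dc simp del: Mat_simps)
  have "G 0 = \<one>\<^bsub>Mat 2 A\<^esub>"
    unfolding G_def X_def Y_def r0[OF Jc] r0[OF J'c] F(2) unfolding Mat2_one
    using x xs y ys by (simp add: one dp dc dx del: Mat_simps)
  moreover have "G (pi / 2) = diag2 (cword A (w # ws)) \<one>"
  proof -
    have "X (pi / 2) = diag2 x \<one> \<otimes>\<^bsub>Mat 2 A\<^esub> (quarter \<otimes>\<^bsub>Mat 2 A\<^esub> diag2 (star A x) \<one> \<otimes>\<^bsub>Mat 2 A\<^esub> J')"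
      unfolding X_def r1[OF Jc] r1[OF J'c] using dx Jc J'c by (simp add: B.m_assoc del: Mat_simps)
    then have X1: "X (pi / 2) = diag2 x (star A x)" using x xs by (simp add: JdJ dp del: Mat_simps)
    have Y1: "Y (pi / 2) = diag2 (star A x) x"
      unfolding Y_def r1[OF Jc] r1[OF J'c] using x xs by (simp add: JdJ dp del: Mat_simps)
    show ?thesis unfolding G_def X1 Y1 F(3) using x xs y ys wc by (simp add: dp w del: Mat_simps)
  qed
  moreover have "cword A (w # ws) \<in> carrier A" using x xs y ys wc by (simp add: w)
  ultimately show ?case using G by blast
qed

text \<open>The group K_0 is formed from matrices over A itself, so a D x D matrix of 2 x 2 blocks
  is read as a matrix of size 2 D, the index i standing for the pair (i div 2, i mod 2). Norms are
  no longer involved.\<close>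

lemma flatten_projection:
  assumes x: "x \<in> carrier (Mat D (Mat 2 A))" "x \<otimes>\<^bsub>Mat D (Mat 2 A)\<^esub> x = x" "star (Mat D (Mat 2 A)) x = x"
  shows "\<exists>p\<in>projections A. matrix_trace \<tau> p = mat_trace D (mat_trace 2 \<tau>) x"
proof -
  interpret T: tracial_banach_algebra A \<tau> by (rule tracial_banach_algebra)
  interpret B: star_bounded_algebra "Mat 2 A" "mat_trace 2 \<tau>" by (rule Mat2_star_bounded)
  define p where "p = (\<lambda>i j. x (i div 2) (j div 2) (i mod 2) (j mod 2))"
  have xm: "x i j \<in> matrices A 2 2" for i j using x(1) by (simp add: matrices_def[of "Mat 2 A"])
  have xc: "x i j a b \<in> carrier A" for i j a b using xm by (rule matrices_entry)
  have x0: "x i j a b = \<zero>" if "\<not> (i < D \<and> j < D)" for i j a b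
    using x(1) that by (auto simp: matrices_def[of "Mat 2 A"])
  have 1: "p \<in> matrices A (2 * D) (2 * D)"
  proof (rule matricesI)
    show "p i j = \<zero>" if "\<not> (i < 2 * D \<and> j < 2 * D)" for i j
    proof -
      have "\<not> (i div 2 < D \<and> j div 2 < D)" using that by auto
      then show ?thesis unfolding p_def by (rule x0)
    qed
  qed (simp add: p_def xc)
  have 2: "matrix_prod A (2 * D) p p = p"
  proof (intro ext)
    fix i j
    have sq: "x k l a b = (\<Oplus>t\<in>{..<D}. \<Oplus>r\<in>{..<2}. x k t a r \<otimes> x t l r b)" for k l a b
    proof -
      have "x k l a b = matrix_prod (Mat 2 A) D x x k l a b" using x(2) by simp
      also have "\<dots> = (\<Oplus>t\<in>{..<D}. matrix_prod A 2 (x k t) (x t l) a b)"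
        using xm T.matrix_prod_closed by (simp add: matrix_prod_def[of "Mat 2 A"]) (intro T.Mat_finsum, auto)
      finally show ?thesis by (simp add: matrix_prod_def)
    qed
    have "matrix_prod A (2 * D) p p i j
      = (\<Oplus>s\<in>{..<2 * D}. x (i div 2) (s div 2) (i mod 2) (s mod 2) \<otimes> x (s div 2) (j div 2) (s mod 2) (j mod 2))"
      by (simp add: matrix_prod_def p_def)
    also have "\<dots> = (\<Oplus>t\<in>{..<D}. \<Oplus>r\<in>{..<2}. x (i div 2) t (i mod 2) r \<otimes> x t (j div 2) r (j mod 2))"
      using xc by (intro T.finsum_pairs[of "\<lambda>t r. x (i div 2) t (i mod 2) r \<otimes> x t (j div 2) r (j mod 2)"]) auto
    also have "\<dots> = p i j" unfolding p_def by (rule sq[symmetric])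
    finally show "matrix_prod A (2 * D) p p i j = p i j" .
  qed
  have "star A (x j i b a) = x i j a b" for i j a b
    using x(3) by (simp add: matrix_star_def fun_eq_iff)
  then have 3: "matrix_star A p = p" by (simp add: matrix_star_def p_def)
  have "matrix_trace \<tau> (2 * D, p) = mat_trace D (mat_trace 2 \<tau>) x"
    using sum_pairs[of "\<lambda>t r. \<tau> (x t t r r)" D] by (simp add: p_def mat_trace_def)
  then show ?thesis using 1 2 3 by (intro bexI[of _ "(2 * D, p)"]) (auto simp: projections_def)
qed

lemma scaled_trace_one_in_K0_trace: "of_nat k * \<tau> \<one> \<in> K0_trace \<tau> ` carrier (K0 A)"
proof -
  interpret T: tracial_banach_algebra A \<tau> by (rule tracial_banach_algebra)
  interpret M: involutive_banach_algebra "Mat k A" by (rule T.Mat_involutive_banach_algebra)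
  have "(k, \<one>\<^bsub>Mat k A\<^esub>) \<in> projections A"
    using M.one_closed M.l_one[OF M.one_closed] M.star_one by (simp add: projections_def)
  moreover have "(0, \<lambda>_ _. \<zero>) \<in> projections A"
    by (auto simp: projections_def matrices_def matrix_prod_def matrix_star_def star_zero)
  ultimately have "matrix_trace \<tau> (k, \<one>\<^bsub>Mat k A\<^esub>) - matrix_trace \<tau> (0, \<lambda>_ _. \<zero>) \<in> K0_trace \<tau> ` carrier (K0 A)"
    by (rule K0_trace_imageI)
  then show ?thesis by simp
qed

lemma projection_trace_in_K0_trace:
  assumes "p \<in> projections A" shows "matrix_trace \<tau> p \<in> K0_trace \<tau> ` carrier (K0 A)"
proof -
  have "(0, \<lambda>_ _. \<zero>) \<in> projections A"
    by (auto simp: projections_def matrices_def matrix_prod_def matrix_star_def star_zero)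
  from K0_trace_imageI[OF assms this] show ?thesis by simp
qed

end

text \<open>The bound \<epsilon> precedes the algebra in the statement. The choices are made in the
  order M, \<eta>, R, N, \<epsilon>. The size N of the coefficients of g and h is known only after
  the degree R, but in \<open>c2\<close> it multiplies \<epsilon> alone, and \<epsilon> comes
  last.\<close>

theorem commutator_log_trace:
  fixes L :: nat
  shows "\<exists>\<epsilon>>0. \<forall>(A :: ('a, 'm) cstar_scheme) \<tau> ws. tracial_cstar_algebra A \<tau> \<longrightarrow> length ws = L \<longrightarrow>
    set ws \<subseteq> unitaries A \<times> unitaries A \<longrightarrow> cnorm A (\<one>\<^bsub>A\<^esub> \<ominus>\<^bsub>A\<^esub> cword A ws) \<le> \<epsilon> \<longrightarrow>
    tracial_banach_algebra.tlog A \<tau> (cword A ws) / (2 * of_real pi * \<i>) \<in> K0_trace \<tau> ` carrier (K0 A)"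
proof -
  define n where "n = 4 * L"
  define K :: real where "K = 16 ^ L"
  have K1: "1 \<le> K" by (simp add: K_def)
  obtain M where M: "1 \<le> M" and appr: "\<forall>\<eta>>0. \<exists>R f cf g cg h ch.
    (\<forall>l. \<bar>l\<bar> \<le> 2 * int n \<longrightarrow> strig R (f l) (cf l) \<and> (\<Sum>m\<in>{- int R..int R}. cmod (cf l m)) \<le> M) \<and>
    f 0 = (\<lambda>_. 1) \<and>
    (\<forall>l. \<bar>l\<bar> \<le> int n \<longrightarrow> strig R (g l) (cg l)) \<and> strig R h ch \<and>
    (\<forall>l t. t \<in> {0..2*pi} \<longrightarrow> cmod (f l t - wave l t) \<le> \<eta>) \<and>
    (\<forall>j k. \<bar>j\<bar> \<le> int n \<longrightarrow> \<bar>k\<bar> \<le> int n \<longrightarrow>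
      (\<exists>b. strig (R + R) (\<lambda>t. cnj (f j t) * f k t - (f (k - j) t - (turn k - 1) * g (- j) t
           - (turn (- j) - 1) * g k t + (turn (- j) - 1) * (turn k - 1) * h t)) b \<and>
         (\<Sum>m\<in>{- int (R + R)..int (R + R)}. cmod (b m)) \<le> \<eta>))"
    using scalar_approximation[of n] by (elim exE conjE) (rule that; assumption)
  \<comment> \<open>Chosen so that 24 (M K)^2 * 2 K^2 \<eta> = 1 / 2, half of what \<open>c2\<close>
    allows.\<close>
  define \<eta> where "\<eta> = 1 / (96 * M\<^sup>2 * K ^ 4)"
  have \<eta>: "0 < \<eta>" using M K1 by (simp add: \<eta>_def)
  obtain R f cf g cg h ch where raw:
    "\<forall>l. \<bar>l\<bar> \<le> 2 * int n \<longrightarrow> strig R (f l) (cf l) \<and> (\<Sum>m\<in>{- int R..int R}. cmod (cf l m)) \<le> M"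
    "f 0 = (\<lambda>_. 1)" "\<forall>l. \<bar>l\<bar> \<le> int n \<longrightarrow> strig R (g l) (cg l)" "strig R h ch"
    "\<forall>l t. t \<in> {0..2*pi} \<longrightarrow> cmod (f l t - wave l t) \<le> \<eta>"
    "\<forall>j k. \<bar>j\<bar> \<le> int n \<longrightarrow> \<bar>k\<bar> \<le> int n \<longrightarrow>
      (\<exists>b. strig (R + R) (\<lambda>t. cnj (f j t) * f k t - (f (k - j) t - (turn k - 1) * g (- j) t
           - (turn (- j) - 1) * g k t + (turn (- j) - 1) * (turn k - 1) * h t)) b \<and>
         (\<Sum>m\<in>{- int (R + R)..int (R + R)}. cmod (b m)) \<le> \<eta>)"
    using appr[THEN spec, THEN mp, OF \<eta>] by (elim exE conjE) (rule that; assumption)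
  have f: "\<And>l. \<bar>l\<bar> \<le> 2 * int n \<Longrightarrow> strig R (f l) (cf l)" "\<And>l. \<bar>l\<bar> \<le> 2 * int n \<Longrightarrow> (\<Sum>m\<in>{- int R..int R}. cmod (cf l m)) \<le> M"
    using raw(1) by auto
  note f0 = raw(2) and g = raw(3)[rule_format] and h = raw(4) and close = raw(5)[rule_format] and r = raw(6)[rule_format]
  \<comment> \<open>A common bound for the coefficient sums of g and h, for which
    \<open>scalar_approximation\<close> gives no estimate. Being a finite sum of scalars it depends
    on \<open>L\<close> only.\<close>
  define N where "N = (\<Sum>l\<in>{- int n..int n}. \<Sum>m\<in>{- int R..int R}. cmod (cg l m)) + (\<Sum>m\<in>{- int R..int R}. cmod (ch m))"
  have N0: "0 \<le> N" unfolding N_def by (intro add_nonneg_nonneg sum_nonneg) auto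
  have gN: "(\<Sum>m\<in>{- int R..int R}. cmod (cg l m)) \<le> N" if "\<bar>l\<bar> \<le> int n" for l
  proof -
    have "(\<Sum>m\<in>{- int R..int R}. cmod (cg l m)) \<le> (\<Sum>l\<in>{- int n..int n}. \<Sum>m\<in>{- int R..int R}. cmod (cg l m))"
      using that by (intro member_le_sum) (auto intro: sum_nonneg)
    moreover have "0 \<le> (\<Sum>m\<in>{- int R..int R}. cmod (ch m))" by (intro sum_nonneg) auto
    ultimately show ?thesis unfolding N_def by linarith
  qed
  have hN: "(\<Sum>m\<in>{- int R..int R}. cmod (ch m)) \<le> N"
    unfolding N_def by (simp add: sum_nonneg)
  \<comment> \<open>With 288 = 2 * 24 * 6 the second half of \<open>c2\<close> becomes N / (2 (N +
    1)). The N + 1 covers N = 0.\<close>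
  define \<epsilon> where "\<epsilon> = 1 / (288 * M\<^sup>2 * K ^ 3 * (N + 1))"
  have \<epsilon>: "0 < \<epsilon>" using M K1 N0 by (simp add: \<epsilon>_def)
  have K0: "0 < K" "0 < M" "0 < N + 1" using K1 M N0 by auto
  have pw: "1 \<le> M\<^sup>2" "1 \<le> K\<^sup>2" "1 \<le> M\<^sup>2 * K\<^sup>2" "1 \<le> M\<^sup>2 * K\<^sup>2 * (N + 1)"
  proof -
    show *: "1 \<le> M\<^sup>2" "1 \<le> K\<^sup>2" using M K1 by (simp_all add: one_le_power)
    show **: "1 \<le> M\<^sup>2 * K\<^sup>2" using mult_mono[OF *] by simp
    show "1 \<le> M\<^sup>2 * K\<^sup>2 * (N + 1)" using mult_mono[OF **, of 1 "N + 1"] N0 by simp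
  qed
  have e1: "K * (\<eta> * K) = 1 / (96 * (M\<^sup>2 * K\<^sup>2))" unfolding \<eta>_def using K0 by (simp add: power2_eq_square power4_eq_xxxx)
  have e2: "K * \<epsilon> = 1 / (288 * (M\<^sup>2 * K\<^sup>2 * (N + 1)))" unfolding \<epsilon>_def using K0 by (simp add: power2_eq_square power3_eq_cube)
  have c1: "2 * K * (\<eta> * K + \<epsilon>) \<le> 1 / 4"
  proof -
    have "K * (\<eta> * K) \<le> 1 / 96" "K * \<epsilon> \<le> 1 / 288" unfolding e1 e2 using pw by (simp_all add: divide_simps)
    then show ?thesis by (simp add: algebra_simps)
  qed
  have c2: "24 * (M * K)\<^sup>2 * (2 * K\<^sup>2 * \<eta> + 6 * N * K * \<epsilon>) \<le> 1"
  proof -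
    have "24 * (M * K)\<^sup>2 * (2 * K\<^sup>2 * \<eta>) = 1 / 2"
      unfolding \<eta>_def using K0 by (simp add: power2_eq_square power4_eq_xxxx)
    moreover have "24 * (M * K)\<^sup>2 * (6 * N * K * \<epsilon>) \<le> 1 / 2"
    proof -
      have "M\<^sup>2 * K\<^sup>2 * (K * \<epsilon>) = 1 / (288 * (N + 1))" unfolding e2 using K0 by simp
      moreover have "24 * (M * K)\<^sup>2 * (6 * N * K * \<epsilon>) = 144 * N * (M\<^sup>2 * K\<^sup>2 * (K * \<epsilon>))"
        by (simp add: power_mult_distrib mult_ac)
      ultimately have "24 * (M * K)\<^sup>2 * (6 * N * K * \<epsilon>) = 144 * N * (1 / (288 * (N + 1)))" by simp
      also have "\<dots> \<le> 1 / 2" using N0 by (simp add: divide_simps)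
      finally show ?thesis .
    qed
    ultimately show ?thesis unfolding distrib_left by linarith
  qed
  show ?thesis
  proof (intro exI[of _ \<epsilon>] conjI allI impI)
    fix A :: "('a, 'm) cstar_scheme" and \<tau> ws
    assume "tracial_cstar_algebra A \<tau>" and ws: "length ws = L" "set ws \<subseteq> unitaries A \<times> unitaries A"
      and small: "cnorm A (\<one>\<^bsub>A\<^esub> \<ominus>\<^bsub>A\<^esub> cword A ws) \<le> \<epsilon>"
    then interpret tracial_cstar_algebra A \<tau> by simp
    interpret T: tracial_banach_algebra A \<tau> by (rule tracial_banach_algebra)
    interpret B: star_bounded_algebra "Mat 2 A" "mat_trace 2 \<tau>" by (rule Mat2_star_bounded)
    obtain W where W: "B.flat_loop n K W" "W 0 = \<one>\<^bsub>Mat 2 A\<^esub>" "W (pi / 2) = diag2 (cword A ws) \<one>\<^bsub>A\<^esub>"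
      and wc: "cword A ws \<in> carrier A"
      using commutator_loop[OF ws(2)] unfolding n_def K_def ws(1) by blast
    obtain c where c: "B.is_trig n W c" "B.wnorm n c \<le> K"
      "\<And>s. mat_trace 2 \<tau> (star (Mat 2 A) (\<Oplus>\<^bsub>Mat 2 A\<^esub>m\<in>B.ivl n. scale (Mat 2 A) (cis (of_int m * s)) (scale (Mat 2 A) (\<i> * of_int m) (c m))) \<otimes>\<^bsub>Mat 2 A\<^esub> W s) = 0"
      using B.flat_loop_coefficients[OF W(1)] by blast
    have Wu: "star (Mat 2 A) (W s) \<otimes>\<^bsub>Mat 2 A\<^esub> W s = \<one>\<^bsub>Mat 2 A\<^esub>" "W s \<otimes>\<^bsub>Mat 2 A\<^esub> star (Mat 2 A) (W s) = \<one>\<^bsub>Mat 2 A\<^esub>" for s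
      using W(1) unfolding B.flat_loop_def by auto
    have "mat_norm 2 A (diag2 (\<one>\<^bsub>A\<^esub> \<ominus>\<^bsub>A\<^esub> cword A ws) \<zero>\<^bsub>A\<^esub>) \<le> \<epsilon>"
      unfolding mat_norm_2_le using small \<epsilon> by (simp add: diag2_def T.cnorm_zero)
    then have U: "cnorm (Mat 2 A) (\<one>\<^bsub>Mat 2 A\<^esub> \<ominus>\<^bsub>Mat 2 A\<^esub> diag2 (cword A ws) \<one>\<^bsub>A\<^esub>) \<le> \<epsilon>"
      unfolding one_minus_diag2[OF wc] by simp
    obtain D x where x: "x \<in> carrier (Mat D (Mat 2 A))" "x \<otimes>\<^bsub>Mat D (Mat 2 A)\<^esub> x = x" "star (Mat D (Mat 2 A)) x = x"
      "mat_trace D (mat_trace 2 \<tau>) x = of_nat R * mat_trace 2 \<tau> \<one>\<^bsub>Mat 2 A\<^esub>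
        - B.tlog (diag2 (cword A ws) \<one>\<^bsub>A\<^esub>) / (2 * of_real pi * \<i>)"
      using B.loop_projection[OF f f0 g gN h hN close r c(1,2) Wu W(2,3) U c(3) K1 M N0 less_imp_le[OF \<eta>] c1 c2] by blast
    obtain p where p: "p \<in> projections A" "matrix_trace \<tau> p = mat_trace D (mat_trace 2 \<tau>) x"
      using flatten_projection[OF x(1-3)] by blast
    have "{..<2::nat} = {0, 1}" by auto
    then have "mat_trace 2 \<tau> \<one>\<^bsub>Mat 2 A\<^esub> = 2 * \<tau> \<one>\<^bsub>A\<^esub>" by (simp add: mat_trace_def)
    \<comment> \<open>The unit of the 2 x 2 matrices has trace 2 \<tau> \<one>, so the value is the
      trace of the identity matrix of size 2 R minus the trace of the projection p.\<close>
    then have "tracial_banach_algebra.tlog A \<tau> (cword A ws) / (2 * of_real pi * \<i>) = of_nat (2 * R) * \<tau> \<one>\<^bsub>A\<^esub> - matrix_trace \<tau> p"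
      using x(4) p(2) tlog_diag2[OF wc] by simp
    then show "tracial_banach_algebra.tlog A \<tau> (cword A ws) / (2 * of_real pi * \<i>) \<in> K0_trace \<tau> ` carrier (K0 A)"
      using K0_trace_image_diff[OF scaled_trace_one_in_K0_trace projection_trace_in_K0_trace[OF p(1)]] by metis
  qed (rule \<epsilon>)
qed

section \<open>Extending homomorphisms into divisible groups\<close>

lemma (in group) subgroup_normal_cyclic:
  assumes S: "S \<lhd> G" and z: "z \<in> carrier G"
  shows "subgroup {s \<otimes> z [^] (k::int) |s k. s \<in> S} G"
proof -
  have sub: "subgroup S G" using S by (rule normal_imp_subgroup)
  note Sc = subgroup.mem_carrier[OF sub]
  have conj: "x \<otimes> s \<otimes> inv x \<in> S" if "x \<in> carrier G" "s \<in> S" for x s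
    using S that normal_inv_iff by blast
  show ?thesis
  proof (rule subgroupI)
    show "{s \<otimes> z [^] (k::int) |s k. s \<in> S} \<subseteq> carrier G" using Sc z by auto
    show "{s \<otimes> z [^] (k::int) |s k. s \<in> S} \<noteq> {}" using subgroup.one_closed[OF sub] by blast
  next
    fix a assume "a \<in> {s \<otimes> z [^] (k::int) |s k. s \<in> S}"
    then obtain s and k :: int where s: "s \<in> S" and a: "a = s \<otimes> z [^] k" by blast
    let ?w = "z [^] (- k)"
    have w: "?w \<in> carrier G" "inv (z [^] k) = ?w" using z by (auto simp: int_pow_neg)
    have "inv a = ?w \<otimes> inv s" using s Sc[OF s] z by (simp add: a inv_mult_group w(2))
    also have "\<dots> = (?w \<otimes> inv s \<otimes> inv ?w) \<otimes> ?w" using w(1) Sc[OF s] by (simp add: m_assoc)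
    finally show "inv a \<in> {s \<otimes> z [^] (k::int) |s k. s \<in> S}"
      using conj[OF w(1) subgroup.m_inv_closed[OF sub s]] by blast
    fix b assume "b \<in> {s \<otimes> z [^] (k::int) |s k. s \<in> S}"
    then obtain t and l :: int where t: "t \<in> S" and b: "b = t \<otimes> z [^] l" by blast
    have zk: "z [^] k \<in> carrier G" "z [^] l \<in> carrier G" using z by auto
    have "a \<otimes> b = (s \<otimes> (z [^] k \<otimes> t \<otimes> inv (z [^] k))) \<otimes> (z [^] k \<otimes> z [^] l)"
    proof -
      have "inv (z [^] k) \<otimes> (z [^] k \<otimes> z [^] l) = z [^] l" using zk by (simp add: m_assoc[symmetric])
      then show ?thesis using Sc[OF s] Sc[OF t] zk by (simp add: a b m_assoc)
    qed
    also have "z [^] k \<otimes> z [^] l = z [^] (k + l)" using z by (simp add: int_pow_mult)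
    finally show "a \<otimes> b \<in> {s \<otimes> z [^] (k::int) |s k. s \<in> S}"
      using subgroup.m_closed[OF sub s conj[OF zk(1) t]] by blast
  qed
qed

lemma (in group) cyclic_period:
  assumes I: "\<And>k l :: int. k \<in> I \<Longrightarrow> l \<in> I \<Longrightarrow> k - l \<in> I" and 0: "0 \<in> I"
  obtains d where "0 \<le> d" "d \<in> I" "\<And>k. k \<in> I \<Longrightarrow> d dvd k"
proof (cases "\<exists>k\<in>I. k \<noteq> 0")
  case True
  have neg: "- k \<in> I" if "k \<in> I" for k using I[OF 0 that] by simp
  have add: "k + l \<in> I" if "k \<in> I" "l \<in> I" for k l using I[OF that(1) neg[OF that(2)]] by simp
  have "\<exists>n::nat. 0 < n \<and> int n \<in> I"
  proof -
    obtain k where k: "k \<in> I" "k \<noteq> 0" using True by blast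
    then have "int (nat \<bar>k\<bar>) \<in> I" "0 < nat \<bar>k\<bar>" using neg[OF k(1)] by (auto simp: abs_if)
    then show ?thesis by blast
  qed
  define n where "n = (LEAST n::nat. 0 < n \<and> int n \<in> I)"
  have n: "0 < n" "int n \<in> I" using LeastI_ex[OF \<open>\<exists>n::nat. 0 < n \<and> int n \<in> I\<close>] by (auto simp: n_def)
  have least: "n \<le> m" if "0 < m" "int m \<in> I" for m
    unfolding n_def using that by (intro Least_le) auto
  have mult: "int n * q \<in> I" for q
  proof (induction q rule: int_induct[where k = 0])
    case (step1 i)
    then show ?case using add[OF step1(2) n(2)] by (simp add: algebra_simps)
  next
    case (step2 i)
    then show ?case using I[OF step2(2) n(2)] by (simp add: algebra_simps)
  qed (simp add: 0)
  have "int n dvd k" if k: "k \<in> I" for k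
  proof -
    have "k mod int n = k - int n * (k div int n)" by (simp add: minus_mult_div_eq_mod)
    then have "k mod int n \<in> I" using I[OF k mult] by simp
    moreover have "0 \<le> k mod int n" "k mod int n < int n" using n(1) by auto
    ultimately have "k mod int n = 0"
      using least[of "nat (k mod int n)"] by (cases "k mod int n = 0") auto
    then show ?thesis by (simp add: dvd_eq_mod_eq_0)
  qed
  then show ?thesis using that[of "int n"] n by simp
next
  case False
  then show ?thesis using that[of 0] 0 by auto
qed

text \<open>S is read as a homomorphism on its domain with values determined up to K; a relation
  spares forming the quotient of M and choosing representatives. Since commutators are related to 1,
  S is normal, and adjoining (e, d) means multiplying S by the powers of that pair. Consistency has
  to be ensured only at e^k0, where k0 generates the exponents for which the power of e is in the
  domain; divisibility provides d.\<close>

lemma extend_relation_step: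
  fixes E :: "('e, 'u) monoid_scheme" and M :: "('v, 'w) monoid_scheme"
  assumes E: "group E" and M: "comm_group M"
    and divisible: "\<And>x k. x \<in> carrier M \<Longrightarrow> 0 < k \<Longrightarrow> \<exists>y\<in>carrier M. y [^]\<^bsub>M\<^esub> (k::int) = x"
    and S: "subgroup S (E \<times>\<times> M)" and K: "\<And>x. (\<one>\<^bsub>E\<^esub>, x) \<in> S \<Longrightarrow> x \<in> K"
    and comm: "\<And>a b. a \<in> carrier E \<Longrightarrow> b \<in> carrier E \<Longrightarrow>
      (a \<otimes>\<^bsub>E\<^esub> b \<otimes>\<^bsub>E\<^esub> inv\<^bsub>E\<^esub> a \<otimes>\<^bsub>E\<^esub> inv\<^bsub>E\<^esub> b, \<one>\<^bsub>M\<^esub>) \<in> S"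
    and e: "e \<in> carrier E"
  shows "\<exists>T. subgroup T (E \<times>\<times> M) \<and> S \<subseteq> T \<and> (\<forall>x. (\<one>\<^bsub>E\<^esub>, x) \<in> T \<longrightarrow> x \<in> K) \<and> (\<exists>d. (e, d) \<in> T)"
proof -
  interpret E: group E by fact
  interpret M: comm_group M by fact
  interpret G: group "E \<times>\<times> M" by (rule DirProd_group[OF E M.is_group])
  have Sc: "s \<in> carrier E \<times> carrier M" if "s \<in> S" for s using subgroup.mem_carrier[OF S that] by simp
  \<comment> \<open>Conjugation changes the first component by a commutator, which S relates to 1,
    and does not change the second.\<close>
  have normal: "S \<lhd> (E \<times>\<times> M)"
    unfolding G.normal_inv_iff
  proof (intro conjI ballI S)
    fix z s assume z: "z \<in> carrier (E \<times>\<times> M)" and s: "s \<in> S"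
    obtain a x b y where zs: "z = (a, x)" "s = (b, y)" by (metis surj_pair)
    have c: "a \<in> carrier E" "x \<in> carrier M" "b \<in> carrier E" "y \<in> carrier M" using z Sc[OF s] by (auto simp: zs)
    have "z \<otimes>\<^bsub>E \<times>\<times> M\<^esub> s \<otimes>\<^bsub>E \<times>\<times> M\<^esub> inv\<^bsub>E \<times>\<times> M\<^esub> z
      = (a \<otimes>\<^bsub>E\<^esub> b \<otimes>\<^bsub>E\<^esub> inv\<^bsub>E\<^esub> a, x \<otimes>\<^bsub>M\<^esub> y \<otimes>\<^bsub>M\<^esub> inv\<^bsub>M\<^esub> x)"
      using c by (simp add: zs inv_DirProd E.is_group M.is_group)
    also have "a \<otimes>\<^bsub>E\<^esub> b \<otimes>\<^bsub>E\<^esub> inv\<^bsub>E\<^esub> a = (a \<otimes>\<^bsub>E\<^esub> b \<otimes>\<^bsub>E\<^esub> inv\<^bsub>E\<^esub> a \<otimes>\<^bsub>E\<^esub> inv\<^bsub>E\<^esub> b) \<otimes>\<^bsub>E\<^esub> b"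
      using c by (simp add: E.m_assoc)
    also have "x \<otimes>\<^bsub>M\<^esub> y \<otimes>\<^bsub>M\<^esub> inv\<^bsub>M\<^esub> x = \<one>\<^bsub>M\<^esub> \<otimes>\<^bsub>M\<^esub> y"
    proof -
      have "x \<otimes>\<^bsub>M\<^esub> y \<otimes>\<^bsub>M\<^esub> inv\<^bsub>M\<^esub> x = y \<otimes>\<^bsub>M\<^esub> (x \<otimes>\<^bsub>M\<^esub> inv\<^bsub>M\<^esub> x)"
        using c by (simp add: M.m_comm[of x y] M.m_assoc)
      then show ?thesis using c by simp
    qed
    finally show "z \<otimes>\<^bsub>E \<times>\<times> M\<^esub> s \<otimes>\<^bsub>E \<times>\<times> M\<^esub> inv\<^bsub>E \<times>\<times> M\<^esub> z \<in> S"
      using subgroup.m_closed[OF S comm[OF c(1,3)] s] by (simp add: zs)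
  qed
  define I where "I = {k::int. \<exists>m. (e [^]\<^bsub>E\<^esub> k, m) \<in> S}"
  have Idiff: "k - l \<in> I" if kl: "k \<in> I" "l \<in> I" for k l
  proof -
    obtain m m' where m: "(e [^]\<^bsub>E\<^esub> k, m) \<in> S" "(e [^]\<^bsub>E\<^esub> l, m') \<in> S" using kl by (auto simp: I_def)
    from subgroup.m_closed[OF S m(1) subgroup.m_inv_closed[OF S m(2)]]
    show ?thesis using Sc[OF m(2)] e by (auto simp: I_def E.int_pow_diff inv_DirProd E.is_group M.is_group)
  qed
  have "0 \<in> I" using subgroup.one_closed[OF S] by (auto simp: I_def)
  then obtain k0 where k0: "0 \<le> k0" "k0 \<in> I" "\<And>k. k \<in> I \<Longrightarrow> k0 dvd k" using E.cyclic_period[of I] Idiff by blast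
  \<comment> \<open>For k0 = 0 the only power of e with an exponent in I is the 0-th, and every d is
    consistent.\<close>
  obtain d where d: "d \<in> carrier M" "(e [^]\<^bsub>E\<^esub> k0, d [^]\<^bsub>M\<^esub> k0) \<in> S"
  proof (cases "k0 = 0")
    case True
    then show ?thesis using that[of "\<one>\<^bsub>M\<^esub>"] subgroup.one_closed[OF S] by simp
  next
    case False
    obtain m where m: "(e [^]\<^bsub>E\<^esub> k0, m) \<in> S" using k0(2) by (auto simp: I_def)
    obtain d where "d \<in> carrier M" "d [^]\<^bsub>M\<^esub> k0 = m" using divisible[of m k0] Sc[OF m] k0(1) False by auto
    then show ?thesis using that m by blast
  qed
  define z where "z = (e, d)"
  have z: "z \<in> carrier (E \<times>\<times> M)" using e d(1) by (simp add: z_def)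
  have zpow: "z [^]\<^bsub>E \<times>\<times> M\<^esub> (k::int) = (e [^]\<^bsub>E\<^esub> k, d [^]\<^bsub>M\<^esub> k)" for k
  proof -
    have n: "z [^]\<^bsub>E \<times>\<times> M\<^esub> (n::nat) = (e [^]\<^bsub>E\<^esub> n, d [^]\<^bsub>M\<^esub> n)" for n by (induction n) (simp_all add: z_def)
    show ?thesis
    proof (cases k rule: int_cases2)
      case (nonneg n)
      then show ?thesis by (simp add: int_pow_int n)
    next
      case (nonpos m)
      have "z [^]\<^bsub>E \<times>\<times> M\<^esub> k = inv\<^bsub>E \<times>\<times> M\<^esub> (z [^]\<^bsub>E \<times>\<times> M\<^esub> m)"
        using z unfolding nonpos by (simp only: G.int_pow_neg int_pow_int)
      then show ?thesis
        using e d(1) unfolding n by (simp add: nonpos E.int_pow_neg M.int_pow_neg int_pow_int inv_DirProd[OF E M.is_group])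
    qed
  qed
  define T where "T = {s \<otimes>\<^bsub>E \<times>\<times> M\<^esub> z [^]\<^bsub>E \<times>\<times> M\<^esub> (k::int) |s k. s \<in> S}"
  have 1: "subgroup T (E \<times>\<times> M)" unfolding T_def by (rule G.subgroup_normal_cyclic[OF normal z])
  have 2: "S \<subseteq> T"
  proof
    fix s assume s: "s \<in> S"
    then have "s = s \<otimes>\<^bsub>E \<times>\<times> M\<^esub> z [^]\<^bsub>E \<times>\<times> M\<^esub> (0::int)" using subgroup.mem_carrier[OF S s] z by simp
    then show "s \<in> T" unfolding T_def using s by blast
  qed
  have "z = \<one>\<^bsub>E \<times>\<times> M\<^esub> \<otimes>\<^bsub>E \<times>\<times> M\<^esub> z [^]\<^bsub>E \<times>\<times> M\<^esub> (1::int)" using z by (simp add: G.int_pow_1 del: one_DirProd)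
  then have 3: "(e, d) \<in> T" unfolding T_def z_def[symmetric] using subgroup.one_closed[OF S] by blast
  \<comment> \<open>If (1, x) is s times the k-th power of z, then the k-th power of e lies in the
    domain. So k0 divides k, that power of z already lies in S, and nothing new is related to
    1.\<close>
  have 4: "x \<in> K" if "(\<one>\<^bsub>E\<^esub>, x) \<in> T" for x
  proof -
    obtain s and k :: int where s: "s \<in> S" "(\<one>\<^bsub>E\<^esub>, x) = s \<otimes>\<^bsub>E \<times>\<times> M\<^esub> z [^]\<^bsub>E \<times>\<times> M\<^esub> k"
      using \<open>(\<one>\<^bsub>E\<^esub>, x) \<in> T\<close> unfolding T_def by blast
    obtain a m where am: "s = (a, m)" by (cases s)
    have ac: "a \<in> carrier E" "m \<in> carrier M" using Sc[OF s(1)] by (auto simp: am)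
    have "a \<otimes>\<^bsub>E\<^esub> e [^]\<^bsub>E\<^esub> k = \<one>\<^bsub>E\<^esub>" using s(2) by (simp add: am zpow)
    then have "a = e [^]\<^bsub>E\<^esub> (- k)" using ac e E.inv_equality[of a "e [^]\<^bsub>E\<^esub> k"] by (simp add: E.int_pow_neg)
    then have "- k \<in> I" using s(1) by (auto simp: I_def am)
    then have "k0 dvd k" using k0(3)[of "- k"] by simp
    then obtain q where q: "k = k0 * q" by (rule dvdE)
    have "z [^]\<^bsub>E \<times>\<times> M\<^esub> k0 \<in> S" using d(2) by (simp add: zpow)
    then have "(z [^]\<^bsub>E \<times>\<times> M\<^esub> k0) [^]\<^bsub>E \<times>\<times> M\<^esub> q \<in> S" using G.subgroup_int_pow_closed[OF S] by blast
    then have "z [^]\<^bsub>E \<times>\<times> M\<^esub> k \<in> S" using z by (simp add: q G.int_pow_pow)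
    then have "(\<one>\<^bsub>E\<^esub>, x) \<in> S" using subgroup.m_closed[OF S s(1)] s(2) by simp
    then show ?thesis by (rule K)
  qed
  show ?thesis using 1 2 3 4 by blast
qed

text \<open>Zorn's lemma: each condition on S tests finitely many pairs at a time, so unions of
  chains inherit it, and the one-step extension shows that a maximal S is defined
  everywhere.\<close>

lemma extend_relation:
  fixes E :: "('e, 'u) monoid_scheme" and M :: "('v, 'w) monoid_scheme"
  assumes E: "group E" and M: "comm_group M"
    and divisible: "\<And>x k. x \<in> carrier M \<Longrightarrow> 0 < k \<Longrightarrow> \<exists>y\<in>carrier M. y [^]\<^bsub>M\<^esub> (k::int) = x"
    and S0: "subgroup S0 (E \<times>\<times> M)" and K: "\<And>x. (\<one>\<^bsub>E\<^esub>, x) \<in> S0 \<Longrightarrow> x \<in> K"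
    and comm: "\<And>a b. a \<in> carrier E \<Longrightarrow> b \<in> carrier E \<Longrightarrow>
      (a \<otimes>\<^bsub>E\<^esub> b \<otimes>\<^bsub>E\<^esub> inv\<^bsub>E\<^esub> a \<otimes>\<^bsub>E\<^esub> inv\<^bsub>E\<^esub> b, \<one>\<^bsub>M\<^esub>) \<in> S0"
  shows "\<exists>S. subgroup S (E \<times>\<times> M) \<and> S0 \<subseteq> S \<and> (\<forall>x. (\<one>\<^bsub>E\<^esub>, x) \<in> S \<longrightarrow> x \<in> K) \<and>
    (\<forall>e\<in>carrier E. \<exists>d. (e, d) \<in> S)"
proof -
  interpret E: group E by fact
  interpret M: comm_group M by fact
  interpret G: group "E \<times>\<times> M" by (rule DirProd_group[OF E M.is_group])
  let ?A = "{S. subgroup S (E \<times>\<times> M) \<and> S0 \<subseteq> S \<and> (\<forall>x. (\<one>\<^bsub>E\<^esub>, x) \<in> S \<longrightarrow> x \<in> K)}"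
  have "\<exists>S\<in>?A. \<forall>X\<in>?A. S \<subseteq> X \<longrightarrow> X = S"
  proof (rule subset_Zorn_nonempty)
    have "S0 \<in> ?A" using S0 K by blast
    then show "?A \<noteq> {}" by blast
    fix C assume C: "C \<noteq> {}" "subset.chain ?A C"
    have CA: "C \<subseteq> ?A" and chain: "\<And>X Y. X \<in> C \<Longrightarrow> Y \<in> C \<Longrightarrow> X \<subseteq> Y \<or> Y \<subseteq> X"
      using C(2) by (auto simp: subset_chain_def)
    have Csub: "subgroup X (E \<times>\<times> M)" if "X \<in> C" for X using CA that by blast
    obtain X0 where X0: "X0 \<in> C" using C(1) by blast
    have "subgroup (\<Union>C) (E \<times>\<times> M)"
    proof (rule G.subgroupI)
      show "\<Union>C \<subseteq> carrier (E \<times>\<times> M)" using Csub subgroup.subset by blast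
      show "\<Union>C \<noteq> {}" using subgroup.one_closed[OF Csub[OF X0]] X0 by blast
      show "inv\<^bsub>E \<times>\<times> M\<^esub> a \<in> \<Union>C" if a: "a \<in> \<Union>C" for a
      proof -
        obtain X where X: "X \<in> C" "a \<in> X" using a by blast
        then show ?thesis using subgroup.m_inv_closed[OF Csub[OF X(1)] X(2)] by blast
      qed
      show "a \<otimes>\<^bsub>E \<times>\<times> M\<^esub> b \<in> \<Union>C" if ab: "a \<in> \<Union>C" "b \<in> \<Union>C" for a b
      proof -
        obtain X Y where "X \<in> C" "a \<in> X" "Y \<in> C" "b \<in> Y" using ab by blast
        then obtain Z where Z: "Z \<in> C" "a \<in> Z" "b \<in> Z" using chain by blast
        then show ?thesis using subgroup.m_closed[OF Csub[OF Z(1)] Z(2,3)] by blast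
      qed
    qed
    moreover have "S0 \<subseteq> \<Union>C" using CA X0 by blast
    moreover have "\<forall>x. (\<one>\<^bsub>E\<^esub>, x) \<in> \<Union>C \<longrightarrow> x \<in> K" using CA by blast
    ultimately show "\<Union>C \<in> ?A" by blast
  qed
  then obtain S where S': "S \<in> ?A" and max: "\<forall>X\<in>?A. S \<subseteq> X \<longrightarrow> X = S" by (rule bexE) (rule that)
  have S: "subgroup S (E \<times>\<times> M)" "S0 \<subseteq> S" "\<And>x. (\<one>\<^bsub>E\<^esub>, x) \<in> S \<Longrightarrow> x \<in> K" using S' by auto
  have "\<exists>d. (e, d) \<in> S" if e: "e \<in> carrier E" for e
  proof -
    have cm: "(a \<otimes>\<^bsub>E\<^esub> b \<otimes>\<^bsub>E\<^esub> inv\<^bsub>E\<^esub> a \<otimes>\<^bsub>E\<^esub> inv\<^bsub>E\<^esub> b, \<one>\<^bsub>M\<^esub>) \<in> S"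
      if "a \<in> carrier E" "b \<in> carrier E" for a b
      using comm[OF that] S(2) by blast
    obtain T where T: "subgroup T (E \<times>\<times> M)" "S \<subseteq> T" "\<And>x. (\<one>\<^bsub>E\<^esub>, x) \<in> T \<Longrightarrow> x \<in> K" "\<exists>d. (e, d) \<in> T"
      using extend_relation_step[OF E M divisible S(1,3) cm e] by auto
    have "T \<in> ?A" using T(1,3) order_trans[OF S(2) T(2)] by simp
    then have "T = S" using max T(2) by simp
    then show ?thesis using T(4) by simp
  qed
  then show ?thesis using S by blast
qed

section \<open>Products of commutators in a group\<close>

text \<open>Explicit lists instead of the subgroup generated by commutators: the length of the list
  is the number L on which the bound in \<open>commutator_log_trace\<close> depends.\<close>

primrec comm_prod :: "('g, 'm) monoid_scheme \<Rightarrow> ('g \<times> 'g) list \<Rightarrow> 'g" where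
  "comm_prod G [] = \<one>\<^bsub>G\<^esub>"
| "comm_prod G (w # ws) =
     (fst w \<otimes>\<^bsub>G\<^esub> snd w \<otimes>\<^bsub>G\<^esub> inv\<^bsub>G\<^esub> fst w \<otimes>\<^bsub>G\<^esub> inv\<^bsub>G\<^esub> snd w) \<otimes>\<^bsub>G\<^esub> comm_prod G ws"

context group
begin

lemma comm_prod_closed: "set ws \<subseteq> carrier G \<times> carrier G \<Longrightarrow> comm_prod G ws \<in> carrier G"
  by (induction ws) auto

lemma comm_prod_append:
  "\<lbrakk>set ws \<subseteq> carrier G \<times> carrier G; set vs \<subseteq> carrier G \<times> carrier G\<rbrakk> \<Longrightarrow>
    comm_prod G (ws @ vs) = comm_prod G ws \<otimes> comm_prod G vs"
  by (induction ws) (auto simp: m_assoc comm_prod_closed)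

definition comm_prods :: "'a set" where
  "comm_prods = comm_prod G ` {ws. set ws \<subseteq> carrier G \<times> carrier G}"

lemma comm_prods_closed: "c \<in> comm_prods \<Longrightarrow> c \<in> carrier G"
  unfolding comm_prods_def using comm_prod_closed by auto

lemma comm_prods_one: "\<one> \<in> comm_prods"
  unfolding comm_prods_def by (rule image_eqI[of _ _ "[]"]) auto

lemma comm_prods_mult:
  assumes "c \<in> comm_prods" "d \<in> comm_prods" shows "c \<otimes> d \<in> comm_prods"
proof -
  obtain ws vs where "set ws \<subseteq> carrier G \<times> carrier G" "c = comm_prod G ws" "set vs \<subseteq> carrier G \<times> carrier G" "d = comm_prod G vs"
    using assms by (auto simp: comm_prods_def)
  then show ?thesis
    unfolding comm_prods_def by (intro image_eqI[of _ _ "ws @ vs"]) (auto simp: comm_prod_append)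
qed

lemma commutator_in_comm_prods:
  assumes "a \<in> carrier G" "b \<in> carrier G" shows "a \<otimes> b \<otimes> inv a \<otimes> inv b \<in> comm_prods"
  unfolding comm_prods_def using assms by (intro image_eqI[of _ _ "[(a, b)]"]) auto

lemma comm_prods_inv:
  assumes "c \<in> comm_prods" shows "inv c \<in> comm_prods"
proof -
  have "inv (comm_prod G ws) \<in> comm_prods" if "set ws \<subseteq> carrier G \<times> carrier G" for ws
    using that
  proof (induction ws)
    case Nil
    then show ?case by (simp add: comm_prods_one)
  next
    case (Cons w ws)
    obtain a b where w: "w = (a, b)" by (cases w)
    have ab: "a \<in> carrier G" "b \<in> carrier G" using Cons.prems by (auto simp: w)
    have "inv (comm_prod G (w # ws)) = inv (comm_prod G ws) \<otimes> (b \<otimes> a \<otimes> inv b \<otimes> inv a)"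
      using ab comm_prod_closed[of ws] Cons.prems by (simp add: w inv_mult_group m_assoc)
    then show ?case
      using comm_prods_mult[OF Cons.IH commutator_in_comm_prods[OF ab(2,1)]] Cons.prems by simp
  qed
  then show ?thesis using assms by (auto simp: comm_prods_def)
qed

lemma comm_prods_conj:
  assumes g: "g \<in> carrier G" and c: "c \<in> comm_prods" shows "g \<otimes> c \<otimes> inv g \<in> comm_prods"
proof -
  have cc: "c \<in> carrier G" by (rule comm_prods_closed[OF c])
  have "g \<otimes> c \<otimes> inv g = (g \<otimes> c \<otimes> inv g \<otimes> inv c) \<otimes> c" using g cc by (simp add: m_assoc)
  then show ?thesis using comm_prods_mult[OF commutator_in_comm_prods[OF g cc] c] by simp
qed

end

section \<open>Classes in second cohomology\<close>

text \<open>Representatives of a class differ by coboundaries, which the homomorphism maps to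
  coboundaries. So all cosets in the union that defines \<open>H2_map\<close> are the same.\<close>

lemma H2_map_class:
  assumes \<Gamma>: "group \<Gamma>" and M: "comm_group M" and N: "comm_group N" and f: "f \<in> hom M N"
    and \<omega>: "\<omega> \<in> carrier (Z2 \<Gamma> M)"
  shows "H2_map \<Gamma> N f (H2_class \<Gamma> M \<omega>) = H2_class \<Gamma> N (\<lambda>x\<in>carrier \<Gamma> \<times> carrier \<Gamma>. f (\<omega> x))"
    "(\<lambda>x\<in>carrier \<Gamma> \<times> carrier \<Gamma>. f (\<omega> x)) \<in> carrier (Z2 \<Gamma> N)"
proof -
  interpret \<Gamma>: group \<Gamma> by fact
  interpret M: comm_group M by fact
  interpret N: comm_group N by fact
  interpret f: group_hom M N f by unfold_locales (rule f)
  interpret ZM: comm_group "Z2 \<Gamma> M" by (rule Z2_comm_group[OF \<Gamma> M])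
  interpret ZN: comm_group "Z2 \<Gamma> N" by (rule Z2_comm_group[OF \<Gamma> N])
  let ?f = "\<lambda>\<omega>. \<lambda>x\<in>carrier \<Gamma> \<times> carrier \<Gamma>. f (\<omega> x)"
  have wc: "w x \<in> carrier M" if "w \<in> carrier (Z2 \<Gamma> M)" "x \<in> carrier \<Gamma> \<times> carrier \<Gamma>" for w x
    using that by (auto simp: Z2_def)
  have fZ: "?f w \<in> carrier (Z2 \<Gamma> N)" if w: "w \<in> carrier (Z2 \<Gamma> M)" for w
  proof -
    have "f (w (b, c)) \<otimes>\<^bsub>N\<^esub> inv\<^bsub>N\<^esub> f (w (a \<otimes>\<^bsub>\<Gamma>\<^esub> b, c)) \<otimes>\<^bsub>N\<^esub> f (w (a, b \<otimes>\<^bsub>\<Gamma>\<^esub> c)) \<otimes>\<^bsub>N\<^esub> inv\<^bsub>N\<^esub> f (w (a, b)) = \<one>\<^bsub>N\<^esub>"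
      if abc: "a \<in> carrier \<Gamma>" "b \<in> carrier \<Gamma>" "c \<in> carrier \<Gamma>" for a b c
    proof -
      have c: "w (b, c) \<in> carrier M" "w (a \<otimes>\<^bsub>\<Gamma>\<^esub> b, c) \<in> carrier M" "w (a, b \<otimes>\<^bsub>\<Gamma>\<^esub> c) \<in> carrier M" "w (a, b) \<in> carrier M"
        using abc by (auto intro!: wc[OF w])
      have "w (b, c) \<otimes>\<^bsub>M\<^esub> inv\<^bsub>M\<^esub> w (a \<otimes>\<^bsub>\<Gamma>\<^esub> b, c) \<otimes>\<^bsub>M\<^esub> w (a, b \<otimes>\<^bsub>\<Gamma>\<^esub> c) \<otimes>\<^bsub>M\<^esub> inv\<^bsub>M\<^esub> w (a, b) = \<one>\<^bsub>M\<^esub>"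
        using w abc by (auto simp: Z2_def)
      from arg_cong[OF this, of f] show ?thesis using c by simp
    qed
    then show ?thesis using wc[OF w] by (auto simp: Z2_def)
  qed
  show "?f \<omega> \<in> carrier (Z2 \<Gamma> N)" by (rule fZ[OF \<omega>])
  have "H2_class \<Gamma> N (?f w) = H2_class \<Gamma> N (?f \<omega>)" if "w \<in> H2_class \<Gamma> M \<omega>" for w
  proof -
    obtain \<delta> where \<delta>: "\<delta> \<in> carrier \<Gamma> \<rightarrow> carrier M" and w: "w = coboundary \<Gamma> M \<delta> \<otimes>\<^bsub>Z2 \<Gamma> M\<^esub> \<omega>"
    proof -
      obtain \<beta> where "\<beta> \<in> B2 \<Gamma> M" "w = \<beta> \<otimes>\<^bsub>Z2 \<Gamma> M\<^esub> \<omega>"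
        using \<open>w \<in> H2_class \<Gamma> M \<omega>\<close> unfolding H2_class_def r_coset_def by blast
      then show ?thesis using that unfolding B2_def by blast
    qed
    have "?f w = coboundary \<Gamma> N (\<lambda>a. f (\<delta> a)) \<otimes>\<^bsub>Z2 \<Gamma> N\<^esub> ?f \<omega>"
    proof
      fix x
      show "?f w x = (coboundary \<Gamma> N (\<lambda>a. f (\<delta> a)) \<otimes>\<^bsub>Z2 \<Gamma> N\<^esub> ?f \<omega>) x"
      proof (cases "x \<in> carrier \<Gamma> \<times> carrier \<Gamma>")
        case True
        then obtain a b where x: "x = (a, b)" "a \<in> carrier \<Gamma>" "b \<in> carrier \<Gamma>" by auto
        then have "\<delta> a \<in> carrier M" "\<delta> b \<in> carrier M" "\<delta> (a \<otimes>\<^bsub>\<Gamma>\<^esub> b) \<in> carrier M" "\<omega> x \<in> carrier M"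
          using \<delta> wc[OF \<omega> True] by auto
        then show ?thesis using x by (simp add: w Z2_def coboundary_def)
      qed (simp add: Z2_def)
    qed
    moreover have "coboundary \<Gamma> N (\<lambda>a. f (\<delta> a)) \<in> B2 \<Gamma> N" unfolding B2_def by (rule imageI) (use \<delta> f.hom_closed in \<open>auto simp: Pi_iff\<close>)
    ultimately have "?f w \<in> B2 \<Gamma> N #>\<^bsub>Z2 \<Gamma> N\<^esub> ?f \<omega>" by (auto simp: r_coset_def)
    then show ?thesis
      unfolding H2_class_def using ZN.repr_independence[OF _ fZ[OF \<omega>] B2_subgroup[OF \<Gamma> N]] by simp
  qed
  moreover have "\<omega> \<in> H2_class \<Gamma> M \<omega>"
    unfolding H2_class_def by (rule ZM.rcos_self[OF \<omega> B2_subgroup[OF \<Gamma> M]])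
  ultimately show "H2_map \<Gamma> N f (H2_class \<Gamma> M \<omega>) = H2_class \<Gamma> N (?f \<omega>)"
    unfolding H2_map_def by blast
qed

context unital_cstar_algebra
begin

lemma unitaries_closed: "u \<in> unitaries A \<Longrightarrow> u \<in> carrier A"
  by (simp add: unitaries_def)

lemma unitaries_mult:
  assumes "u \<in> unitaries A" "v \<in> unitaries A" shows "u \<otimes> v \<in> unitaries A"
proof -
  have c: "u \<in> carrier A" "v \<in> carrier A" "star A u \<otimes> u = \<one>" "u \<otimes> star A u = \<one>" "star A v \<otimes> v = \<one>" "v \<otimes> star A v = \<one>"
    using assms by (auto simp: unitaries_def)
  have "star A (u \<otimes> v) \<otimes> (u \<otimes> v) = star A v \<otimes> ((star A u \<otimes> u) \<otimes> v)"
    "(u \<otimes> v) \<otimes> star A (u \<otimes> v) = u \<otimes> ((v \<otimes> star A v) \<otimes> star A u)"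
    using c(1,2) by (simp_all add: star_mult m_assoc)
  then show ?thesis using c by (simp add: unitaries_def)
qed

lemma unitaries_star: "u \<in> unitaries A \<Longrightarrow> star A u \<in> unitaries A"
  by (simp add: unitaries_def star_star)

lemma unitaries_one: "\<one> \<in> unitaries A"
  by (simp add: unitaries_def star_one_eq)

lemma unitaries_inv: "u \<in> unitaries A \<Longrightarrow> inv u = star A u"
  using inv_unique'[of u "star A u"] by (simp add: unitaries_def)

lemma unitaries_norm:
  assumes "u \<in> unitaries A" shows "cnorm A u \<le> 1"
proof -
  have "(cnorm A u)\<^sup>2 \<le> 1\<^sup>2"
    using cstar_identity[of u] assms cnorm_one_le by (simp add: unitaries_def)
  then show ?thesis by (rule power2_le_imp_le) simp
qed

text \<open>Multiplication by a unitary does not increase the norm, because the C*-identity bounds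
  the norm of a unitary by 1.\<close>

lemma unitaries_deviation:
  assumes u: "u \<in> unitaries A" and v: "v \<in> unitaries A"
  shows "cnorm A (\<one> \<ominus> u \<otimes> v) \<le> cnorm A (\<one> \<ominus> u) + cnorm A (\<one> \<ominus> v)"
    "cnorm A (\<one> \<ominus> star A u) \<le> cnorm A (\<one> \<ominus> u)"
    "cnorm A (\<one> \<ominus> v \<otimes> u \<otimes> star A v) \<le> cnorm A (\<one> \<ominus> u)"
    "x \<in> carrier A \<Longrightarrow> cnorm A (\<one> \<ominus> x \<otimes> star A u) \<le> cnorm A (x \<ominus> u)"
proof -
  interpret I: involutive_banach_algebra A by (rule involutive_banach_algebra)
  note c = unitaries_closed[OF u] unitaries_closed[OF v]
  have v1: "v \<otimes> star A v = \<one>" and u1: "u \<otimes> star A u = \<one>" using u v by (auto simp: unitaries_def)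
  have "\<one> \<ominus> u \<otimes> v = (\<one> \<ominus> u) \<oplus> (u \<ominus> u \<otimes> v)" using c by (simp add: I.minus_trans)
  also have "u \<ominus> u \<otimes> v = u \<otimes> (\<one> \<ominus> v)" using c by (simp add: I.minus_mult)
  finally have "cnorm A (\<one> \<ominus> u \<otimes> v) \<le> cnorm A (\<one> \<ominus> u) + cnorm A (u \<otimes> (\<one> \<ominus> v))" using c by (simp add: cnorm_triangle)
  moreover have "cnorm A (u \<otimes> (\<one> \<ominus> v)) \<le> 1 * cnorm A (\<one> \<ominus> v)" using c unitaries_norm[OF u] by (intro I.cnorm_mult_le) auto
  ultimately show "cnorm A (\<one> \<ominus> u \<otimes> v) \<le> cnorm A (\<one> \<ominus> u) + cnorm A (\<one> \<ominus> v)" by simp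
  show "cnorm A (\<one> \<ominus> star A u) \<le> cnorm A (\<one> \<ominus> u)"
    using cnorm_star[of "\<one> \<ominus> u"] c by (simp add: I.star_diff)
  have "\<one> \<ominus> v \<otimes> u \<otimes> star A v = v \<otimes> (\<one> \<ominus> u) \<otimes> star A v" using c by (simp add: I.minus_mult v1)
  moreover have "cnorm A (v \<otimes> (\<one> \<ominus> u) \<otimes> star A v) \<le> (1 * cnorm A (\<one> \<ominus> u)) * 1"
    using c unitaries_norm[OF v] unitaries_norm[OF unitaries_star[OF v]] by (intro I.cnorm_mult_le) auto
  ultimately show "cnorm A (\<one> \<ominus> v \<otimes> u \<otimes> star A v) \<le> cnorm A (\<one> \<ominus> u)" by simp
  show "cnorm A (\<one> \<ominus> x \<otimes> star A u) \<le> cnorm A (x \<ominus> u)" if x: "x \<in> carrier A"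
  proof -
    have "\<one> \<ominus> x \<otimes> star A u = (u \<ominus> x) \<otimes> star A u" using c x by (simp add: I.minus_mult u1)
    moreover have "cnorm A ((u \<ominus> x) \<otimes> star A u) \<le> cnorm A (u \<ominus> x) * 1"
      using c x unitaries_norm[OF unitaries_star[OF u]] by (intro I.cnorm_mult_le) auto
    ultimately show ?thesis using I.cnorm_minus_commute[of u x] c x by simp
  qed
qed

end

lemma (in group) mult_inv_cancel:
  assumes "x \<in> carrier G" "y \<in> carrier G" shows "x \<otimes> (inv x \<otimes> y) = y" "inv x \<otimes> (x \<otimes> y) = y"
  using assms by (simp_all add: m_assoc[symmetric])

section \<open>Sequences of unitaries\<close>

lemma c0_UNIV_group: "comm_group (c0 (\<lambda>_. UNIV))"
  by (rule c0_comm_group) auto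

lemma c0_inv:
  assumes "\<And>n. 0 \<in> H n" "\<And>n x y. \<lbrakk>x \<in> H n; y \<in> H n\<rbrakk> \<Longrightarrow> x - y \<in> H n" "x \<in> carrier (c0 H)"
  shows "inv\<^bsub>c0 H\<^esub> x = (\<lambda>n. - x n)"
proof -
  interpret comm_group "c0 H" by (rule c0_comm_group[OF assms(1,2)])
  have "- z \<in> H n" if "z \<in> H n" for n z using assms(2)[OF assms(1) that] by simp
  then show ?thesis
    using assms(3) tendsto_minus[of x 0 sequentially] by (intro inv_equality) (auto simp: c0_def)
qed

lemma c0_divisible:
  assumes x: "x \<in> carrier (c0 (\<lambda>_. UNIV))" and k: "0 < k"
  shows "\<exists>y\<in>carrier (c0 (\<lambda>_. UNIV)). y [^]\<^bsub>c0 (\<lambda>_. UNIV)\<^esub> (k::int) = x"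
proof -
  define y where "y = (\<lambda>n. x n / of_int k)"
  have p: "y [^]\<^bsub>c0 (\<lambda>_. UNIV)\<^esub> (m::nat) = (\<lambda>n. of_nat m * y n)" for m
    by (induction m) (auto simp: nat_pow_def c0_def algebra_simps)
  have "y [^]\<^bsub>c0 (\<lambda>_. UNIV)\<^esub> k = y [^]\<^bsub>c0 (\<lambda>_. UNIV)\<^esub> (nat k)"
    using k by (metis int_pow_int nat_0_le order_less_imp_le)
  also have "\<dots> = x" unfolding p using k by (auto simp: y_def of_nat_nat)
  finally have "y [^]\<^bsub>c0 (\<lambda>_. UNIV)\<^esub> k = x" .
  moreover have "y \<in> carrier (c0 (\<lambda>_. UNIV))"
    using x tendsto_divide[of x 0 sequentially "\<lambda>_. of_int k" "of_int k"] k by (auto simp: c0_def y_def)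
  ultimately show ?thesis by blast
qed

locale cstar_sequence =
  fixes A :: "nat \<Rightarrow> ('a, 'm) cstar_scheme" and \<tau> :: "nat \<Rightarrow> 'a \<Rightarrow> complex"
  assumes tracial: "\<And>n. tracial_cstar_algebra (A n) (\<tau> n)"
    and bounded: "bdd_above (range (\<lambda>n. functional_norm (A n) (\<tau> n)))"
begin

lemma unital: "unital_cstar_algebra (A n)"
  using tracial by (simp add: tracial_cstar_algebra_def)

lemma banach: "tracial_banach_algebra (A n) (\<tau> n)"
  by (rule tracial_cstar_algebra.tracial_banach_algebra[OF tracial])

lemma ring: "ring (A n)"
  using unital by (simp add: unital_cstar_algebra_def)

abbreviation "K n \<equiv> K0_trace (\<tau> n) ` carrier (K0 (A n))"

lemmas K_zero = tracial_cstar_algebra.K0_trace_image_zero[OF tracial]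
lemmas K_diff = tracial_cstar_algebra.K0_trace_image_diff[OF tracial]

lemma K_uminus: "x \<in> K n \<Longrightarrow> - x \<in> K n"
  using K_diff[OF K_zero, of x n] by simp

lemma K_add: "x \<in> K n \<Longrightarrow> y \<in> K n \<Longrightarrow> x + y \<in> K n"
  using K_diff[OF _ K_uminus, of x n y] by simp

definition SU :: "(nat \<Rightarrow> 'a) monoid" where
  "SU = \<lparr>carrier = {u. \<forall>n. u n \<in> unitaries (A n)},
     mult = (\<lambda>u v n. u n \<otimes>\<^bsub>A n\<^esub> v n), one = (\<lambda>n. \<one>\<^bsub>A n\<^esub>)\<rparr>"

lemma SU_simps [simp]:
  "u \<in> carrier SU \<longleftrightarrow> (\<forall>n. u n \<in> unitaries (A n))" "(u \<otimes>\<^bsub>SU\<^esub> v) n = u n \<otimes>\<^bsub>A n\<^esub> v n" "\<one>\<^bsub>SU\<^esub> n = \<one>\<^bsub>A n\<^esub>"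
  by (simp_all add: SU_def)

lemmas unitary = unital_cstar_algebra.unitaries_closed[OF unital] unital_cstar_algebra.unitaries_mult[OF unital]
  unital_cstar_algebra.unitaries_star[OF unital] unital_cstar_algebra.unitaries_one[OF unital]

lemma SU_group: "group SU"
proof (rule groupI)
  show "x \<otimes>\<^bsub>SU\<^esub> y \<in> carrier SU" if "x \<in> carrier SU" "y \<in> carrier SU" for x y using that unitary(2) by simp
  show "\<one>\<^bsub>SU\<^esub> \<in> carrier SU" using unitary(4) by simp
  show "x \<otimes>\<^bsub>SU\<^esub> y \<otimes>\<^bsub>SU\<^esub> z = x \<otimes>\<^bsub>SU\<^esub> (y \<otimes>\<^bsub>SU\<^esub> z)" if "x \<in> carrier SU" "y \<in> carrier SU" "z \<in> carrier SU" for x y z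
  proof
    fix n
    interpret ring "A n" by (rule ring)
    show "(x \<otimes>\<^bsub>SU\<^esub> y \<otimes>\<^bsub>SU\<^esub> z) n = (x \<otimes>\<^bsub>SU\<^esub> (y \<otimes>\<^bsub>SU\<^esub> z)) n" using that unitary(1) by (simp add: m_assoc)
  qed
  show "\<one>\<^bsub>SU\<^esub> \<otimes>\<^bsub>SU\<^esub> x = x" if "x \<in> carrier SU" for x
  proof
    fix n
    interpret ring "A n" by (rule ring)
    show "(\<one>\<^bsub>SU\<^esub> \<otimes>\<^bsub>SU\<^esub> x) n = x n" using that unitary(1) by simp
  qed
  show "\<exists>y\<in>carrier SU. y \<otimes>\<^bsub>SU\<^esub> x = \<one>\<^bsub>SU\<^esub>" if "x \<in> carrier SU" for x
    using that unitary(3) by (intro bexI[of _ "\<lambda>n. star (A n) (x n)"]) (auto simp: unitaries_def fun_eq_iff)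
qed

sublocale SU: group SU by (rule SU_group)

lemma SU_inv:
  assumes "u \<in> carrier SU" shows "(inv\<^bsub>SU\<^esub> u) n = star (A n) (u n)"
proof -
  have "inv\<^bsub>SU\<^esub> u = (\<lambda>n. star (A n) (u n))"
    using assms unitary(3) by (intro SU.inv_equality) (auto simp: unitaries_def fun_eq_iff)
  then show ?thesis by simp
qed

definition dev :: "(nat \<Rightarrow> 'a) \<Rightarrow> nat \<Rightarrow> real" where
  "dev u n = cnorm (A n) (\<one>\<^bsub>A n\<^esub> \<ominus>\<^bsub>A n\<^esub> u n)"

text \<open>The subgroup \<open>N\<close> of the overview; its normality is
  \<open>near_conj\<close>.\<close>

definition near :: "(nat \<Rightarrow> 'a) set" where
  "near = {u \<in> carrier SU. dev u \<longlonglongrightarrow> 0}"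

text \<open>The threshold 1 / 4 is the one of \<open>tlog_mult\<close>. For a sequence in
  \<open>near\<close> it is exceeded finitely often, so the default value is invisible modulo
  finitely supported sequences.\<close>

definition lg :: "(nat \<Rightarrow> 'a) \<Rightarrow> nat \<Rightarrow> complex" where
  "lg u n = (if dev u n \<le> 1 / 4 then tracial_banach_algebra.tlog (A n) (\<tau> n) (u n) / (2 * of_real pi * \<i>) else 0)"

lemma dev_nonneg: "u \<in> carrier SU \<Longrightarrow> 0 \<le> dev u n"
proof -
  assume "u \<in> carrier SU"
  then have "u n \<in> carrier (A n)" using unitary(1) by simp
  then show ?thesis
    unfolding dev_def using unital_cstar_algebra.cnorm_nonneg[OF unital] ring.ring_simprules(4)[OF ring] ring.ring_simprules(6)[OF ring] by metis
qed

lemma near_squeeze: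
  assumes "v \<in> carrier SU" "\<And>n. dev v n \<le> g n" "g \<longlonglongrightarrow> 0" shows "v \<in> near"
proof -
  have "dev v \<longlonglongrightarrow> 0"
    using tendsto_sandwich[of "\<lambda>_. 0" "dev v" sequentially g 0] assms(2,3) dev_nonneg[OF assms(1)] by simp
  then show ?thesis using assms(1) by (simp add: near_def)
qed

lemma near_mult: "u \<in> near \<Longrightarrow> v \<in> near \<Longrightarrow> u \<otimes>\<^bsub>SU\<^esub> v \<in> near"
  using unitary(2) unital_cstar_algebra.unitaries_deviation(1)[OF unital] tendsto_add[of "dev u" 0 sequentially "dev v" 0]
  by (intro near_squeeze[of _ "\<lambda>n. dev u n + dev v n"]) (auto simp: near_def dev_def)

lemma near_inv: "u \<in> near \<Longrightarrow> inv\<^bsub>SU\<^esub> u \<in> near"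
  using unital_cstar_algebra.unitaries_deviation(2)[OF unital]
  by (intro near_squeeze[of _ "dev u"] SU.inv_closed) (auto simp: near_def dev_def SU_inv)

lemma near_conj:
  assumes u: "u \<in> near" and g: "g \<in> carrier SU" shows "g \<otimes>\<^bsub>SU\<^esub> u \<otimes>\<^bsub>SU\<^esub> inv\<^bsub>SU\<^esub> g \<in> near"
proof (rule near_squeeze)
  have uc: "u \<in> carrier SU" using u by (simp add: near_def)
  show "g \<otimes>\<^bsub>SU\<^esub> u \<otimes>\<^bsub>SU\<^esub> inv\<^bsub>SU\<^esub> g \<in> carrier SU" using g uc by (intro SU.m_closed SU.inv_closed)
  show "dev (g \<otimes>\<^bsub>SU\<^esub> u \<otimes>\<^bsub>SU\<^esub> inv\<^bsub>SU\<^esub> g) n \<le> dev u n" for n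
    using unital_cstar_algebra.unitaries_deviation(3)[OF unital] g uc by (simp add: dev_def SU_inv)
  show "dev u \<longlonglongrightarrow> 0" using u by (simp add: near_def)
qed

lemma near_one: "\<one>\<^bsub>SU\<^esub> \<in> near"
proof -
  have "dev \<one>\<^bsub>SU\<^esub> n \<le> 0" for n
  proof -
    interpret tracial_banach_algebra "A n" "\<tau> n" by (rule banach)
    show ?thesis by (simp add: dev_def)
  qed
  then show ?thesis using SU.one_closed by (intro near_squeeze[of _ "\<lambda>_. 0"]) auto
qed

lemma near_eventually:
  assumes "u \<in> near" "0 < e" shows "eventually (\<lambda>n. dev u n \<le> e) sequentially"
  using assms order_tendstoD(2)[of "dev u" 0 sequentially e] by (auto simp: near_def elim: eventually_mono)

text \<open>Here the uniform bound on the norms of the traces enters: the modulus of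
  \<open>lg u n\<close> is at most this bound times the distance of u n from 1.\<close>

lemma lg_null:
  assumes u: "u \<in> near" shows "lg u \<longlonglongrightarrow> 0"
proof -
  obtain T where T: "\<And>n. functional_norm (A n) (\<tau> n) \<le> T" using bounded by (auto simp: bdd_above_def)
  have uc: "u n \<in> carrier (A n)" for n using u unitary(1) by (simp add: near_def)
  have d0: "0 \<le> dev u n" for n using dev_nonneg u by (simp add: near_def)
  have le: "norm (lg u n) \<le> max T 0 * dev u n" for n
  proof (cases "dev u n \<le> 1 / 4")
    case True
    interpret tracial_cstar_algebra "A n" "\<tau> n" by (rule tracial)
    interpret T: tracial_banach_algebra "A n" "\<tau> n" by (rule banach)
    have bd: "cmod (\<tau> n x) \<le> max T 0 * cnorm (A n) x" if "x \<in> carrier (A n)" for x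
      using functional_norm(2)[OF that] mult_right_mono[of "functional_norm (A n) (\<tau> n)" "max T 0" "cnorm (A n) x"]
        T[of n] cnorm_nonneg[OF that] by linarith
    have "cmod (T.tlog (u n)) \<le> 2 * max T 0 * dev u n"
      unfolding dev_def using True by (intro T.tlog_bound uc bd) (auto simp: dev_def)
    moreover have "cmod (lg u n) = cmod (T.tlog (u n)) / (2 * pi)" using True by (simp add: lg_def norm_divide norm_mult)
    moreover have "2 * max T 0 * dev u n / (2 * pi) \<le> max T 0 * dev u n"
      using pi_gt3 d0[of n] mult_left_mono[of 1 pi "max T 0 * dev u n"] by (simp add: divide_simps mult_ac)
    ultimately show ?thesis by (smt (verit) divide_right_mono pi_gt_zero)
  qed (use d0 in \<open>simp add: lg_def\<close>)
  have lim: "(\<lambda>n. max T 0 * dev u n) \<longlonglongrightarrow> 0" using u by (intro tendsto_mult_right_zero) (simp add: near_def)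
  show ?thesis by (rule Lim_null_comparison[OF always_eventually[OF allI[OF le]] lim])
qed

lemma lg_mult:
  assumes u: "u \<in> near" and v: "v \<in> near"
  shows "eventually (\<lambda>n. lg (u \<otimes>\<^bsub>SU\<^esub> v) n = lg u n + lg v n) sequentially"
proof -
  have q: "0 < (1 / 4 :: real)" by simp
  show ?thesis
    using near_eventually[OF u q] near_eventually[OF v q] near_eventually[OF near_mult[OF u v] q]
  proof eventually_elim
    case (elim n)
    interpret T: tracial_banach_algebra "A n" "\<tau> n" by (rule banach)
    have "u n \<in> carrier (A n)" "v n \<in> carrier (A n)" using u v unitary(1) by (auto simp: near_def)
    then show ?case using elim T.tlog_mult[of "u n" "v n"] by (simp add: lg_def add_divide_distrib) (simp add: dev_def add_divide_distrib)
  qed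
qed

lemma lg_conj:
  assumes u: "u \<in> near" and g: "g \<in> carrier SU"
  shows "eventually (\<lambda>n. lg (g \<otimes>\<^bsub>SU\<^esub> u \<otimes>\<^bsub>SU\<^esub> inv\<^bsub>SU\<^esub> g) n = lg u n) sequentially"
proof -
  have q: "0 < (1 / 4 :: real)" by simp
  show ?thesis
    using near_eventually[OF u q] near_eventually[OF near_conj[OF u g] q]
  proof eventually_elim
    case (elim n)
    interpret T: tracial_banach_algebra "A n" "\<tau> n" by (rule banach)
    have "u n \<in> carrier (A n)" "g n \<in> unitaries (A n)" using u g unitary(1) by (auto simp: near_def)
    then show ?case using elim T.tlog_conj[of "u n" "g n" "star (A n) (g n)"] SU_inv[OF g, of n]
      by (simp add: lg_def unitaries_def)
  qed
qed

lemma lg_inv: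
  assumes u: "u \<in> near" shows "eventually (\<lambda>n. lg (inv\<^bsub>SU\<^esub> u) n = - lg u n) sequentially"
proof -
  have "u \<in> carrier SU" using u by (simp add: near_def)
  then have "u \<otimes>\<^bsub>SU\<^esub> inv\<^bsub>SU\<^esub> u = \<one>\<^bsub>SU\<^esub>" by (rule SU.r_inv)
  moreover have "lg \<one>\<^bsub>SU\<^esub> n = 0" for n
    using tracial_banach_algebra.tlog_one[OF banach] by (simp add: lg_def)
  ultimately show ?thesis using lg_mult[OF u near_inv[OF u]] by (auto elim!: eventually_mono simp: add_eq_0_iff)
qed

lemma comm_prod_SU:
  assumes "set ws \<subseteq> carrier SU \<times> carrier SU"
  shows "comm_prod SU ws n = cword (A n) (map (\<lambda>w. (fst w n, snd w n)) ws)"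
  using assms by (induction ws) (auto simp: SU_inv)

text \<open>One list of sequences represents u, so the number of commutators is the same for all n
  and a single \<epsilon> serves almost all of them.\<close>

lemma lg_commutators:
  assumes u: "u \<in> near" "u \<in> SU.comm_prods"
  shows "eventually (\<lambda>n. lg u n \<in> K n) sequentially"
proof -
  obtain ws where ws: "set ws \<subseteq> carrier SU \<times> carrier SU" "u = comm_prod SU ws" using u(2) by (auto simp: SU.comm_prods_def)
  obtain \<epsilon> where \<epsilon>: "\<epsilon> > 0" "\<And>(B :: ('a, 'm) cstar_scheme) t vs. tracial_cstar_algebra B t \<Longrightarrow> length vs = length ws \<Longrightarrow>
    set vs \<subseteq> unitaries B \<times> unitaries B \<Longrightarrow> cnorm B (\<one>\<^bsub>B\<^esub> \<ominus>\<^bsub>B\<^esub> cword B vs) \<le> \<epsilon> \<Longrightarrow>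
    tracial_banach_algebra.tlog B t (cword B vs) / (2 * of_real pi * \<i>) \<in> K0_trace t ` carrier (K0 B)"
    using commutator_log_trace[of "length ws"] by metis
  show ?thesis
    using near_eventually[OF u(1) \<epsilon>(1)]
  proof eventually_elim
    case (elim n)
    have "set (map (\<lambda>w. (fst w n, snd w n)) ws) \<subseteq> unitaries (A n) \<times> unitaries (A n)" using ws(1) by auto
    then show ?case
      using \<epsilon>(2)[OF tracial, of "map (\<lambda>w. (fst w n, snd w n)) ws" n] elim comm_prod_SU[OF ws(1), of n] K_zero
      by (simp add: lg_def dev_def ws(2))
  qed
qed

text \<open>The homomorphism on \<open>N [E, E]\<close> that is \<open>lg\<close> on the first
  factor and trivial on the second, with values modulo sequences that are eventually in K. It is
  given as a relation since u and c are not determined by their product.\<close>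

definition base :: "((nat \<Rightarrow> 'a) \<times> (nat \<Rightarrow> complex)) set" where
  "base = {(v, x). \<exists>u\<in>near. \<exists>c\<in>SU.comm_prods. v = u \<otimes>\<^bsub>SU\<^esub> c \<and> x \<longlonglongrightarrow> 0 \<and>
     eventually (\<lambda>n. x n - lg u n \<in> K n) sequentially}"

lemma baseE:
  assumes "(v, x) \<in> base"
  obtains u c where "u \<in> near" "c \<in> SU.comm_prods" "v = u \<otimes>\<^bsub>SU\<^esub> c" "x \<longlonglongrightarrow> 0"
    "eventually (\<lambda>n. x n - lg u n \<in> K n) sequentially"
  using assms unfolding base_def by blast

lemma near_closed: "u \<in> near \<Longrightarrow> u \<in> carrier SU"
  by (simp add: near_def)

lemma base_subgroup: "subgroup base (SU \<times>\<times> c0 (\<lambda>_. UNIV))"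
proof -
  interpret C: comm_group "c0 (\<lambda>_. UNIV)" by (rule c0_UNIV_group)
  interpret G: group "SU \<times>\<times> c0 (\<lambda>_. UNIV)" by (rule DirProd_group[OF SU_group C.is_group])
  note cc = SU.comm_prods_closed
  have base_closed: "v \<in> carrier SU" "x \<longlonglongrightarrow> 0" if vx: "(v, x) \<in> base" for v x
  proof -
    obtain u c where "u \<in> near" "c \<in> SU.comm_prods" "v = u \<otimes>\<^bsub>SU\<^esub> c" "x \<longlonglongrightarrow> 0"
      "eventually (\<lambda>n. x n - lg u n \<in> K n) sequentially"
      by (rule baseE[OF vx])
    then show "v \<in> carrier SU" "x \<longlonglongrightarrow> 0" using SU.m_closed[OF near_closed cc] by blast+
  qed
  have mult: "(v \<otimes>\<^bsub>SU\<^esub> v', \<lambda>n. x n + x' n) \<in> base" if b: "(v, x) \<in> base" "(v', x') \<in> base" for v x v' x'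
  proof -
    obtain u c where u: "u \<in> near" "c \<in> SU.comm_prods" "v = u \<otimes>\<^bsub>SU\<^esub> c" "x \<longlonglongrightarrow> 0" "eventually (\<lambda>n. x n - lg u n \<in> K n) sequentially"
      by (rule baseE[OF b(1)])
    obtain u' c' where u': "u' \<in> near" "c' \<in> SU.comm_prods" "v' = u' \<otimes>\<^bsub>SU\<^esub> c'" "x' \<longlonglongrightarrow> 0" "eventually (\<lambda>n. x' n - lg u' n \<in> K n) sequentially"
      by (rule baseE[OF b(2)])
    note cl = near_closed[OF u(1)] near_closed[OF u'(1)] cc[OF u(2)] cc[OF u'(2)]
    \<comment> \<open>The product u c u' c' equals (u u') d: moving c past u' conjugates it, and
      products of commutators are closed under conjugation.\<close>
    define d where "d = (inv\<^bsub>SU\<^esub> u' \<otimes>\<^bsub>SU\<^esub> c \<otimes>\<^bsub>SU\<^esub> inv\<^bsub>SU\<^esub> (inv\<^bsub>SU\<^esub> u')) \<otimes>\<^bsub>SU\<^esub> c'"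
    have d: "d \<in> SU.comm_prods"
      unfolding d_def by (rule SU.comm_prods_mult[OF SU.comm_prods_conj[OF SU.inv_closed[OF cl(2)] u(2)] u'(2)])
    have ud: "u' \<otimes>\<^bsub>SU\<^esub> d = c \<otimes>\<^bsub>SU\<^esub> (u' \<otimes>\<^bsub>SU\<^esub> c')"
      unfolding d_def SU.inv_inv[OF cl(2)] using cl by (simp add: SU.m_assoc SU.mult_inv_cancel del: SU_simps)
    have "v \<otimes>\<^bsub>SU\<^esub> v' = (u \<otimes>\<^bsub>SU\<^esub> u') \<otimes>\<^bsub>SU\<^esub> d"
      unfolding u(3) u'(3) using cl cc[OF d] ud by (simp add: SU.m_assoc del: SU_simps)
    moreover have "eventually (\<lambda>n. (x n + x' n) - lg (u \<otimes>\<^bsub>SU\<^esub> u') n \<in> K n) sequentially"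
      using u(5) u'(5) lg_mult[OF u(1) u'(1)]
    proof eventually_elim
      case (elim n)
      then show ?case using K_add[OF elim(1,2)] by (simp add: algebra_simps)
    qed
    ultimately show ?thesis
      unfolding base_def using near_mult[OF u(1) u'(1)] d tendsto_add[OF u(4) u'(4)] by auto
  qed
  have inverse: "(inv\<^bsub>SU\<^esub> v, \<lambda>n. - x n) \<in> base" if b: "(v, x) \<in> base" for v x
  proof -
    obtain u c where u: "u \<in> near" "c \<in> SU.comm_prods" "v = u \<otimes>\<^bsub>SU\<^esub> c" "x \<longlonglongrightarrow> 0" "eventually (\<lambda>n. x n - lg u n \<in> K n) sequentially"
      by (rule baseE[OF b])
    note cl = near_closed[OF u(1)] cc[OF u(2)]
    define d where "d = u \<otimes>\<^bsub>SU\<^esub> inv\<^bsub>SU\<^esub> c \<otimes>\<^bsub>SU\<^esub> inv\<^bsub>SU\<^esub> u"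
    have d: "d \<in> SU.comm_prods" unfolding d_def by (rule SU.comm_prods_conj[OF cl(1) SU.comm_prods_inv[OF u(2)]])
    have "inv\<^bsub>SU\<^esub> v = inv\<^bsub>SU\<^esub> u \<otimes>\<^bsub>SU\<^esub> d"
      unfolding u(3) d_def using cl by (simp add: SU.inv_mult_group SU.m_assoc SU.mult_inv_cancel del: SU_simps)
    moreover have "eventually (\<lambda>n. - x n - lg (inv\<^bsub>SU\<^esub> u) n \<in> K n) sequentially"
      using u(5) lg_inv[OF u(1)]
    proof eventually_elim
      case (elim n)
      then show ?case using K_uminus[OF elim(1)] by (simp add: algebra_simps)
    qed
    ultimately show ?thesis
      unfolding base_def using near_inv[OF u(1)] d tendsto_minus[OF u(4)] by auto
  qed
  have c0c: "x \<in> carrier (c0 (\<lambda>_. UNIV))" if "x \<longlonglongrightarrow> 0" for x using that by (simp add: c0_def)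
  show ?thesis
  proof (rule G.subgroupI)
    show "base \<subseteq> carrier (SU \<times>\<times> c0 (\<lambda>_. UNIV))" using base_closed c0c by auto
    have "(\<one>\<^bsub>SU\<^esub>, lg \<one>\<^bsub>SU\<^esub>) \<in> base"
      unfolding base_def using near_one SU.comm_prods_one lg_null[OF near_one] K_zero
      by (auto intro!: bexI[of _ "\<one>\<^bsub>SU\<^esub>"] simp del: SU_simps)
    then show "base \<noteq> {}" by blast
    fix a assume a: "a \<in> base"
    obtain v x where vx: "a = (v, x)" by (cases a)
    have cl: "v \<in> carrier SU" "x \<in> carrier (c0 (\<lambda>_. UNIV))" using base_closed a c0c by (auto simp: vx)
    have "inv\<^bsub>c0 (\<lambda>_. UNIV)\<^esub> x = (\<lambda>n. - x n)" using cl(2) by (intro c0_inv) auto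
    then show "inv\<^bsub>SU \<times>\<times> c0 (\<lambda>_. UNIV)\<^esub> a \<in> base"
      using inverse a cl by (simp add: vx inv_DirProd[OF SU_group C.is_group] del: SU_simps)
    fix b assume b: "b \<in> base"
    obtain v' x' where vx': "b = (v', x')" by (cases b)
    have "x \<otimes>\<^bsub>c0 (\<lambda>_. UNIV)\<^esub> x' = (\<lambda>n. x n + x' n)" by (simp add: c0_def)
    then show "a \<otimes>\<^bsub>SU \<times>\<times> c0 (\<lambda>_. UNIV)\<^esub> b \<in> base" using mult a b by (simp add: vx vx' del: SU_simps)
  qed
qed

lemma log_relation:
  "\<exists>S. subgroup S (SU \<times>\<times> c0 (\<lambda>_. UNIV)) \<and> (\<forall>u\<in>near. (u, lg u) \<in> S) \<and>
    (\<forall>x. (\<one>\<^bsub>SU\<^esub>, x) \<in> S \<longrightarrow> eventually (\<lambda>n. x n \<in> K n) sequentially) \<and>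
    (\<forall>e\<in>carrier SU. \<exists>d. (e, d) \<in> S)"
proof -
  \<comment> \<open>If u c = 1, then u is itself a product of commutators and close to 1, so
    \<open>lg_commutators\<close> applies. This is the well-definedness of the homomorphism modulo
    K.\<close>
  have 1: "x \<in> {x. eventually (\<lambda>n. x n \<in> K n) sequentially}" if vx: "(\<one>\<^bsub>SU\<^esub>, x) \<in> base" for x
  proof -
    obtain u c where u: "u \<in> near" "c \<in> SU.comm_prods" "\<one>\<^bsub>SU\<^esub> = u \<otimes>\<^bsub>SU\<^esub> c" "x \<longlonglongrightarrow> 0"
      "eventually (\<lambda>n. x n - lg u n \<in> K n) sequentially"
      by (rule baseE[OF vx])
    have "u = inv\<^bsub>SU\<^esub> c" using SU.inv_equality[OF u(3)[symmetric] SU.comm_prods_closed[OF u(2)] near_closed[OF u(1)]] by simp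
    then have "u \<in> SU.comm_prods" using SU.comm_prods_inv[OF u(2)] by simp
    from lg_commutators[OF u(1) this] u(5) have "eventually (\<lambda>n. x n \<in> K n) sequentially"
    proof eventually_elim
      case (elim n)
      then show ?case using K_add[OF elim] by simp
    qed
    then show ?thesis by simp
  qed
  have 2: "(a \<otimes>\<^bsub>SU\<^esub> b \<otimes>\<^bsub>SU\<^esub> inv\<^bsub>SU\<^esub> a \<otimes>\<^bsub>SU\<^esub> inv\<^bsub>SU\<^esub> b, \<one>\<^bsub>c0 (\<lambda>_. UNIV)\<^esub>) \<in> base"
    if ab: "a \<in> carrier SU" "b \<in> carrier SU" for a b
  proof -
    have l: "lg \<one>\<^bsub>SU\<^esub> n = 0" for n
      using tracial_banach_algebra.tlog_one[OF banach] by (simp add: lg_def)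
    note cm = SU.commutator_in_comm_prods[OF ab]
    show ?thesis
      unfolding base_def mem_Collect_eq prod.case
      using near_one cm SU.l_one[OF SU.comm_prods_closed[OF cm]] l K_zero
      by (intro bexI[of _ "\<one>\<^bsub>SU\<^esub>"] bexI[OF _ cm]) (simp_all add: c0_def del: SU_simps)
  qed
  have "\<exists>S. subgroup S (SU \<times>\<times> c0 (\<lambda>_. UNIV)) \<and> base \<subseteq> S \<and>
    (\<forall>x. (\<one>\<^bsub>SU\<^esub>, x) \<in> S \<longrightarrow> x \<in> {x. eventually (\<lambda>n. x n \<in> K n) sequentially}) \<and>
    (\<forall>e\<in>carrier SU. \<exists>d. (e, d) \<in> S)"
    by (rule extend_relation[OF SU_group c0_UNIV_group c0_divisible base_subgroup 1 2])
  then obtain S where S: "subgroup S (SU \<times>\<times> c0 (\<lambda>_. UNIV))" "base \<subseteq> S"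
    "\<forall>x. (\<one>\<^bsub>SU\<^esub>, x) \<in> S \<longrightarrow> eventually (\<lambda>n. x n \<in> K n) sequentially" "\<forall>e\<in>carrier SU. \<exists>d. (e, d) \<in> S"
    by auto
  have "(u, lg u) \<in> S" if u: "u \<in> near" for u
  proof -
    have "(u, lg u) \<in> base"
      unfolding base_def mem_Collect_eq prod.case
      using u SU.comm_prods_one SU.r_one[OF near_closed[OF u]] lg_null[OF u] K_zero
      by (intro bexI[OF _ u] bexI[of _ "\<one>\<^bsub>SU\<^esub>"]) (simp_all del: SU_simps)
    then show ?thesis using S(2) by blast
  qed
  then show ?thesis using S by blast
qed

end

section \<open>Null sequences modulo finitely supported ones\<close>

locale coefficient_sequence =
  fixes H :: "nat \<Rightarrow> complex set"
  assumes zero: "\<And>n. 0 \<in> H n" and diff: "\<And>n x y. \<lbrakk>x \<in> H n; y \<in> H n\<rbrakk> \<Longrightarrow> x - y \<in> H n"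
begin

sublocale C: comm_group "c0 H" by (rule c0_comm_group[OF zero diff])

sublocale N: normal "c00 H" "c0 H" by (rule C.subgroup_imp_normal[OF c00_subgroup[OF zero diff]])

sublocale Q: comm_group "Q H"
  unfolding Q_def by (rule C.abelian_FactGroup[OF c00_subgroup[OF zero diff]])

abbreviation cl :: "(nat \<Rightarrow> complex) \<Rightarrow> (nat \<Rightarrow> complex) set" where "cl x \<equiv> c00 H #>\<^bsub>c0 H\<^esub> x"

text \<open>Cosets are germs at infinity; through this, equations in the quotient are verified for
  all large n only.\<close>

lemma cl_eq:
  assumes x: "x \<in> carrier (c0 H)"
  shows "cl x = {y \<in> carrier (c0 H). eventually (\<lambda>n. y n = x n) sequentially}"
proof (intro equalityI subsetI)
  fix y assume "y \<in> cl x"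
  then obtain h where h: "h \<in> c00 H" "y = h \<otimes>\<^bsub>c0 H\<^esub> x" by (auto simp: r_coset_def)
  have "y \<in> carrier (c0 H)" unfolding h(2) by (rule C.m_closed[OF N.mem_carrier[OF h(1)] x])
  moreover have "eventually (\<lambda>n. h n = 0) sequentially"
    using h(1) by (simp add: c00_def eventually_cofinite flip: cofinite_eq_sequentially)
  then have "eventually (\<lambda>n. y n = x n) sequentially" by (auto simp: h(2) c0_def elim: eventually_mono)
  ultimately show "y \<in> {y \<in> carrier (c0 H). eventually (\<lambda>n. y n = x n) sequentially}" by simp
next
  fix y assume y: "y \<in> {y \<in> carrier (c0 H). eventually (\<lambda>n. y n = x n) sequentially}"
  have "finite {n. y n \<noteq> x n}"
    using y by (simp add: eventually_cofinite flip: cofinite_eq_sequentially)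
  then have "(\<lambda>n. y n - x n) \<in> c00 H" using x y diff by (auto simp: c00_def c0_def)
  moreover have "y = (\<lambda>n. y n - x n) \<otimes>\<^bsub>c0 H\<^esub> x" by (simp add: c0_def)
  ultimately show "y \<in> cl x" unfolding r_coset_def by blast
qed

lemma cl_cong:
  assumes "x \<in> carrier (c0 H)" "y \<in> carrier (c0 H)" "eventually (\<lambda>n. x n = y n) sequentially"
  shows "cl x = cl y"
proof -
  have "x \<in> cl y" using assms by (simp add: cl_eq)
  then show ?thesis using C.repr_independence[of x "c00 H" y] assms(2) N.is_subgroup by simp
qed

sublocale h: group_hom "c0 H" "Q H" cl
  using N.r_coset_hom_Mod by unfold_locales (simp add: Q_def)

lemma Q_carrierE:
  assumes "X \<in> carrier (Q H)" obtains x where "x \<in> carrier (c0 H)" "X = cl x"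
  using assms by (auto simp: Q_def carrier_FactGroup)

lemma add: "x \<in> H n \<Longrightarrow> y \<in> H n \<Longrightarrow> x + y \<in> H n"
  using diff[of x n "- y"] diff[of 0 n y] zero[of n] by simp

lemma c0_mult: "x \<otimes>\<^bsub>c0 H\<^esub> y = (\<lambda>n. x n + y n)"
  by (simp add: c0_def)

end

interpretation UNIV: coefficient_sequence "\<lambda>_. UNIV"
  by unfold_locales auto

context coefficient_sequence
begin

lemma c0_subset: "x \<in> carrier (c0 H) \<Longrightarrow> x \<in> carrier (c0 (\<lambda>_. UNIV))"
  by (simp add: c0_def)

lemma Q_incl_cl:
  assumes x: "x \<in> carrier (c0 H)" shows "Q_incl (cl x) = QC_class x"
proof -
  have "QC_class y = QC_class x" if "y \<in> cl x" for y
    using that x c0_subset by (intro UNIV.cl_cong) (auto simp: cl_eq)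
  moreover have "x \<in> cl x" using x by (simp add: cl_eq)
  ultimately show ?thesis unfolding Q_incl_def by blast
qed

lemma Q_incl_hom: "Q_incl \<in> hom (Q H) QC"
proof (rule homI)
  fix X assume "X \<in> carrier (Q H)"
  then obtain x where x: "x \<in> carrier (c0 H)" "X = cl x" by (rule Q_carrierE)
  then show "Q_incl X \<in> carrier QC" using Q_incl_cl[OF x(1)] UNIV.h.hom_closed[OF c0_subset[OF x(1)]] by simp
  fix Y assume "Y \<in> carrier (Q H)"
  then obtain y where y: "y \<in> carrier (c0 H)" "Y = cl y" by (rule Q_carrierE)
  have "Q_incl (X \<otimes>\<^bsub>Q H\<^esub> Y) = Q_incl (cl (x \<otimes>\<^bsub>c0 H\<^esub> y))" using x y by simp
  also have "\<dots> = QC_class (x \<otimes>\<^bsub>c0 (\<lambda>_. UNIV)\<^esub> y)"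
    using Q_incl_cl[OF C.m_closed[OF x(1) y(1)]] by (simp add: c0_mult UNIV.c0_mult)
  also have "\<dots> = Q_incl X \<otimes>\<^bsub>QC\<^esub> Q_incl Y"
    using UNIV.h.hom_mult[OF c0_subset[OF x(1)] c0_subset[OF y(1)]] Q_incl_cl x y by simp
  finally show "Q_incl (X \<otimes>\<^bsub>Q H\<^esub> Y) = Q_incl X \<otimes>\<^bsub>QC\<^esub> Q_incl Y" .
qed

end

section \<open>The cocycle of the asymptotic homomorphism and its correction by a coboundary\<close>

theorem corollary4p3:
  fixes \<Gamma> :: "'g monoid"
    and A :: "nat \<Rightarrow> 'a cstar"
    and \<tau> :: "nat \<Rightarrow> 'a \<Rightarrow> complex"
    and \<rho> :: "nat \<Rightarrow> 'g \<Rightarrow> 'a"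
  assumes "group \<Gamma>"
    and "\<And>n. tracial_cstar_algebra (A n) (\<tau> n)"
    and "bdd_above (range (\<lambda>n. functional_norm (A n) (\<tau> n)))"
    and "\<And>n. \<rho> n \<in> carrier \<Gamma> \<rightarrow> unitaries (A n)"
    and "\<And>n. \<rho> n \<one>\<^bsub>\<Gamma>\<^esub> = \<one>\<^bsub>A n\<^esub>"
    and "\<And>a b. \<lbrakk>a \<in> carrier \<Gamma>; b \<in> carrier \<Gamma>\<rbrakk> \<Longrightarrow>
           (\<lambda>n. cnorm (A n) (\<rho> n a \<otimes>\<^bsub>A n\<^esub> \<rho> n b \<ominus>\<^bsub>A n\<^esub> \<rho> n (a \<otimes>\<^bsub>\<Gamma>\<^esub> b))) \<longlonglongrightarrow> 0"
  shows "asymp_hom_class \<Gamma> A \<tau> \<rho> \<in>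
           H2_map \<Gamma> QC Q_incl ` carrier (H2 \<Gamma> (Q (\<lambda>n. K0_trace (\<tau> n) ` carrier (K0 (A n)))))"
proof -
  interpret \<Gamma>: group \<Gamma> by (rule assms(1))
  interpret S: cstar_sequence A \<tau> by (rule cstar_sequence.intro[OF assms(2,3)])
  interpret H: coefficient_sequence S.K by (rule coefficient_sequence.intro[OF S.K_zero S.K_diff])
  interpret ZC: comm_group "Z2 \<Gamma> QC" by (rule Z2_comm_group[OF assms(1) UNIV.Q.comm_group_axioms])
  note [simp] = S.near_closed
  define r where "r = (\<lambda>a n. \<rho> n a)"
  have rc: "r a \<in> carrier S.SU" if "a \<in> carrier \<Gamma>" for a using assms(4) that by (auto simp: r_def Pi_iff)
  define u where "u = (\<lambda>a b. r a \<otimes>\<^bsub>S.SU\<^esub> r b \<otimes>\<^bsub>S.SU\<^esub> inv\<^bsub>S.SU\<^esub> r (a \<otimes>\<^bsub>\<Gamma>\<^esub> b))"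
  have un: "u a b n = \<rho> n a \<otimes>\<^bsub>A n\<^esub> \<rho> n b \<otimes>\<^bsub>A n\<^esub> star (A n) (\<rho> n (a \<otimes>\<^bsub>\<Gamma>\<^esub> b))"
    if "a \<in> carrier \<Gamma>" "b \<in> carrier \<Gamma>" for a b n
    using S.SU_inv[OF rc[OF \<Gamma>.m_closed[OF that]], of n] by (simp add: u_def) (simp add: r_def)
  have near: "u a b \<in> S.near" if ab: "a \<in> carrier \<Gamma>" "b \<in> carrier \<Gamma>" for a b
  proof (rule S.near_squeeze[OF _ _ assms(6)[OF ab]])
    show "u a b \<in> carrier S.SU" unfolding u_def using rc ab by (simp del: S.SU_simps)
    have \<rho>: "\<rho> n c \<in> unitaries (A n)" if "c \<in> carrier \<Gamma>" for n c using assms(4) that by (auto simp: Pi_iff)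
    show "S.dev (u a b) n \<le> cnorm (A n) (\<rho> n a \<otimes>\<^bsub>A n\<^esub> \<rho> n b \<ominus>\<^bsub>A n\<^esub> \<rho> n (a \<otimes>\<^bsub>\<Gamma>\<^esub> b))" for n
      unfolding S.dev_def un[OF ab]
      by (rule unital_cstar_algebra.unitaries_deviation(4)[OF S.unital])
        (auto intro!: \<rho> \<Gamma>.m_closed ab S.unitary)
  qed
  let ?d = "defect_seq \<Gamma> A \<tau> \<rho>"
  have d: "eventually (\<lambda>n. ?d a b n = S.lg (u a b) n) sequentially" if ab: "a \<in> carrier \<Gamma>" "b \<in> carrier \<Gamma>" for a b
  proof -
    have q: "0 < (1 / 4 :: real)" by simp
    show ?thesis
      using S.near_eventually[OF near[OF ab] q]
    proof eventually_elim
      case (elim n)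
      interpret tracial_cstar_algebra "A n" "\<tau> n" by (rule assms(2))
      interpret T: tracial_banach_algebra "A n" "\<tau> n" by (rule tracial_banach_algebra)
      have "\<rho> n (a \<otimes>\<^bsub>\<Gamma>\<^esub> b) \<in> unitaries (A n)" using assms(4) \<Gamma>.m_closed[OF ab] by (auto simp: Pi_iff)
      then have e: "\<rho> n a \<otimes>\<^bsub>A n\<^esub> \<rho> n b \<otimes>\<^bsub>A n\<^esub> inv\<^bsub>A n\<^esub> (\<rho> n (a \<otimes>\<^bsub>\<Gamma>\<^esub> b)) = u a b n"
        unfolding un[OF ab] by (simp add: unitaries_inv)
      have uc: "u a b n \<in> carrier (A n)" using S.near_closed[OF near[OF ab]] unitaries_closed by simp
      then have "cnorm (A n) (u a b n \<ominus>\<^bsub>A n\<^esub> \<one>\<^bsub>A n\<^esub>) = S.dev (u a b) n"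
        using T.cnorm_minus_commute[OF uc one_closed] by (simp add: S.dev_def)
      then show ?case unfolding defect_seq_def e Let_def S.lg_def using elim trace_clog[OF uc] by simp
    qed
  qed
  have dc: "?d a b \<in> carrier (c0 (\<lambda>_. UNIV))" if ab: "a \<in> carrier \<Gamma>" "b \<in> carrier \<Gamma>" for a b
    using tendsto_cong[OF d[OF ab], of 0] S.lg_null[OF near[OF ab]] by (simp add: c0_def)
  obtain R where R: "subgroup R (S.SU \<times>\<times> c0 (\<lambda>_. UNIV))" "\<And>u. u \<in> S.near \<Longrightarrow> (u, S.lg u) \<in> R"
    "\<And>x. (\<one>\<^bsub>S.SU\<^esub>, x) \<in> R \<Longrightarrow> eventually (\<lambda>n. x n \<in> S.K n) sequentially"
    "\<forall>e\<in>carrier S.SU. \<exists>d. (e, d) \<in> R"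
    using S.log_relation by auto
  \<comment> \<open>A lift \<gamma> a to null sequences of the value of the extended homomorphism at
    r a. It may be chosen separately for each a, since any 1-cochain has a coboundary.\<close>
  have ex: "\<forall>a. \<exists>x. a \<in> carrier \<Gamma> \<longrightarrow> (r a, x) \<in> R" using R(4) rc by blast
  obtain \<gamma> where "\<forall>a. a \<in> carrier \<Gamma> \<longrightarrow> (r a, \<gamma> a) \<in> R" using choice[OF ex] by (rule exE)
  then have \<gamma>: "(r a, \<gamma> a) \<in> R" if "a \<in> carrier \<Gamma>" for a using that by blast
  have \<gamma>c: "\<gamma> a \<in> carrier (c0 (\<lambda>_. UNIV))" if "a \<in> carrier \<Gamma>" for a
    using subgroup.mem_carrier[OF R(1) \<gamma>[OF that]] by simp
  have cinv: "inv\<^bsub>c0 (\<lambda>_. UNIV)\<^esub> x = (\<lambda>n. - x n)" if "x \<in> carrier (c0 (\<lambda>_. UNIV))" for x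
    by (rule c0_inv[OF _ _ that]) auto
  define \<kappa> where "\<kappa> = (\<lambda>a b n. ?d a b n - (\<gamma> a n - \<gamma> (a \<otimes>\<^bsub>\<Gamma>\<^esub> b) n + \<gamma> b n))"
  \<comment> \<open>R relates u a b both to its logarithm and to the value that \<gamma> prescribes
    for the product of r a, r b and the inverse of r (ab). The difference is therefore related to 1
    and lies eventually in K.\<close>
  have \<kappa>: "eventually (\<lambda>n. \<kappa> a b n \<in> S.K n) sequentially" if ab: "a \<in> carrier \<Gamma>" "b \<in> carrier \<Gamma>" for a b
  proof -
    let ?C = "c0 (\<lambda>_::nat. UNIV :: complex set)"
    note abc = \<Gamma>.m_closed[OF ab]
    note inv = inv_DirProd[OF S.SU_group UNIV.C.is_group]
    have "(u a b, \<lambda>n. \<gamma> a n + \<gamma> b n + - \<gamma> (a \<otimes>\<^bsub>\<Gamma>\<^esub> b) n) = (r a, \<gamma> a) \<otimes>\<^bsub>S.SU \<times>\<times> ?C\<^esub> (r b, \<gamma> b)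
        \<otimes>\<^bsub>S.SU \<times>\<times> ?C\<^esub> inv\<^bsub>S.SU \<times>\<times> ?C\<^esub> (r (a \<otimes>\<^bsub>\<Gamma>\<^esub> b), \<gamma> (a \<otimes>\<^bsub>\<Gamma>\<^esub> b))"
      unfolding inv[OF rc[OF abc] \<gamma>c[OF abc]] cinv[OF \<gamma>c[OF abc]] mult_DirProd UNIV.c0_mult u_def by (rule refl)
    also have "\<dots> \<in> R"
      by (intro subgroup.m_closed[OF R(1)] subgroup.m_inv_closed[OF R(1)] \<gamma> ab abc)
    finally have g: "(u a b, \<lambda>n. \<gamma> a n + \<gamma> b n + - \<gamma> (a \<otimes>\<^bsub>\<Gamma>\<^esub> b) n) \<in> R" .
    have gc: "(\<lambda>n. \<gamma> a n + \<gamma> b n + - \<gamma> (a \<otimes>\<^bsub>\<Gamma>\<^esub> b) n) \<in> carrier ?C"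
      using subgroup.mem_carrier[OF R(1) g] by simp
    have "(u a b, S.lg (u a b)) \<otimes>\<^bsub>S.SU \<times>\<times> ?C\<^esub> inv\<^bsub>S.SU \<times>\<times> ?C\<^esub> (u a b, \<lambda>n. \<gamma> a n + \<gamma> b n + - \<gamma> (a \<otimes>\<^bsub>\<Gamma>\<^esub> b) n) \<in> R"
      by (intro subgroup.m_closed[OF R(1)] subgroup.m_inv_closed[OF R(1)] R(2) near ab g)
    then have "(\<one>\<^bsub>S.SU\<^esub>, \<lambda>n. S.lg (u a b) n + - (\<gamma> a n + \<gamma> b n + - \<gamma> (a \<otimes>\<^bsub>\<Gamma>\<^esub> b) n)) \<in> R"
      unfolding inv[OF S.near_closed[OF near[OF ab]] gc] mult_DirProd cinv[OF gc] UNIV.c0_mult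
        S.SU.r_inv[OF S.near_closed[OF near[OF ab]]] .
    from R(3)[OF this] d[OF ab] show ?thesis
    proof eventually_elim
      case (elim n)
      then show ?case by (simp add: \<kappa>_def algebra_simps)
    qed
  qed
  \<comment> \<open>Finitely many entries are replaced by 0, as an element of \<open>c0 S.K\<close>
    needs every entry in K and not only almost all.\<close>
  define \<kappa>' where "\<kappa>' = (\<lambda>a b n. if \<kappa> a b n \<in> S.K n then \<kappa> a b n else 0)"
  have \<kappa>'eq: "eventually (\<lambda>n. \<kappa>' a b n = \<kappa> a b n) sequentially" if ab: "a \<in> carrier \<Gamma>" "b \<in> carrier \<Gamma>" for a b
    using \<kappa>[OF ab] by eventually_elim (simp add: \<kappa>'_def)
  have \<kappa>'c: "\<kappa>' a b \<in> carrier (c0 S.K)" if ab: "a \<in> carrier \<Gamma>" "b \<in> carrier \<Gamma>" for a b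
  proof -
    have lim: "?d a b \<longlonglongrightarrow> 0" "\<gamma> a \<longlonglongrightarrow> 0" "\<gamma> b \<longlonglongrightarrow> 0" "\<gamma> (a \<otimes>\<^bsub>\<Gamma>\<^esub> b) \<longlonglongrightarrow> 0"
      using dc[OF ab] \<gamma>c[OF ab(1)] \<gamma>c[OF ab(2)] \<gamma>c[OF \<Gamma>.m_closed[OF ab]] by (auto simp: c0_def)
    have "\<kappa> a b \<longlonglongrightarrow> 0 - (0 - 0 + 0)" unfolding \<kappa>_def by (intro tendsto_intros lim)
    then have "\<kappa>' a b \<longlonglongrightarrow> 0" using tendsto_cong[OF \<kappa>'eq[OF ab], of 0] by simp
    moreover have "\<kappa>' a b n \<in> S.K n" for n by (simp only: \<kappa>'_def S.K_zero split: if_split) simp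
    ultimately show ?thesis by (simp add: c0_def)
  qed
  have cocycle: "eventually (\<lambda>n. ?d b c n - ?d (a \<otimes>\<^bsub>\<Gamma>\<^esub> b) c n + ?d a (b \<otimes>\<^bsub>\<Gamma>\<^esub> c) n - ?d a b n = 0) sequentially"
    if abc: "a \<in> carrier \<Gamma>" "b \<in> carrier \<Gamma>" "c \<in> carrier \<Gamma>" for a b c
  proof -
    note ab = \<Gamma>.m_closed[OF abc(1,2)] and bc = \<Gamma>.m_closed[OF abc(2,3)]
    note r = rc[OF abc(1)] rc[OF abc(2)] rc[OF abc(3)] rc[OF ab] rc[OF bc] rc[OF \<Gamma>.m_closed[OF ab abc(3)]]
    let ?w = "r a \<otimes>\<^bsub>S.SU\<^esub> u b c \<otimes>\<^bsub>S.SU\<^esub> inv\<^bsub>S.SU\<^esub> r a"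
    \<comment> \<open>Both sides are r a r b r c times the inverse of r (abc). Applying
      \<open>lg\<close>, which is additive and invariant under conjugation for large n, turns this
      into the cocycle identity with trivial action.\<close>
    have "?w \<otimes>\<^bsub>S.SU\<^esub> u a (b \<otimes>\<^bsub>\<Gamma>\<^esub> c) = u a b \<otimes>\<^bsub>S.SU\<^esub> u (a \<otimes>\<^bsub>\<Gamma>\<^esub> b) c"
      unfolding u_def \<Gamma>.m_assoc[OF abc, symmetric] using r
      by (simp add: S.SU.m_assoc S.SU.mult_inv_cancel del: S.SU_simps)
    then have e: "S.lg (?w \<otimes>\<^bsub>S.SU\<^esub> u a (b \<otimes>\<^bsub>\<Gamma>\<^esub> c)) n = S.lg (u a b \<otimes>\<^bsub>S.SU\<^esub> u (a \<otimes>\<^bsub>\<Gamma>\<^esub> b) c) n" for n by simp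
    show ?thesis
      using d[OF abc(2,3)] d[OF ab abc(3)] d[OF abc(1) bc] d[OF abc(1,2)]
        S.lg_mult[OF S.near_conj[OF near[OF abc(2,3)] r(1)] near[OF abc(1) bc]]
        S.lg_mult[OF near[OF abc(1,2)] near[OF ab abc(3)]] S.lg_conj[OF near[OF abc(2,3)] r(1)]
    proof eventually_elim
      case (elim n)
      then show ?case using e[of n] by (simp add: algebra_simps)
    qed
  qed
  define \<omega> where "\<omega> = (\<lambda>(a, b)\<in>carrier \<Gamma> \<times> carrier \<Gamma>. H.cl (\<kappa>' a b))"
  have \<omega>: "\<omega> \<in> carrier (Z2 \<Gamma> (Q S.K))"
  proof -
    have Hinv: "inv\<^bsub>c0 S.K\<^esub> x = (\<lambda>n. - x n)" if "x \<in> carrier (c0 S.K)" for x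
      by (rule c0_inv[OF S.K_zero S.K_diff that])
    have "H.cl (\<kappa>' b c) \<otimes>\<^bsub>Q S.K\<^esub> inv\<^bsub>Q S.K\<^esub> H.cl (\<kappa>' (a \<otimes>\<^bsub>\<Gamma>\<^esub> b) c) \<otimes>\<^bsub>Q S.K\<^esub> H.cl (\<kappa>' a (b \<otimes>\<^bsub>\<Gamma>\<^esub> c))
        \<otimes>\<^bsub>Q S.K\<^esub> inv\<^bsub>Q S.K\<^esub> H.cl (\<kappa>' a b) = \<one>\<^bsub>Q S.K\<^esub>"
      if abc: "a \<in> carrier \<Gamma>" "b \<in> carrier \<Gamma>" "c \<in> carrier \<Gamma>" for a b c
    proof -
      note ab = \<Gamma>.m_closed[OF abc(1,2)] and bc = \<Gamma>.m_closed[OF abc(2,3)]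
      note k = \<kappa>'c[OF abc(2,3)] \<kappa>'c[OF ab abc(3)] \<kappa>'c[OF abc(1) bc] \<kappa>'c[OF abc(1,2)]
      let ?z = "\<kappa>' b c \<otimes>\<^bsub>c0 S.K\<^esub> inv\<^bsub>c0 S.K\<^esub> \<kappa>' (a \<otimes>\<^bsub>\<Gamma>\<^esub> b) c \<otimes>\<^bsub>c0 S.K\<^esub> \<kappa>' a (b \<otimes>\<^bsub>\<Gamma>\<^esub> c) \<otimes>\<^bsub>c0 S.K\<^esub> inv\<^bsub>c0 S.K\<^esub> \<kappa>' a b"
      have zc: "?z \<in> carrier (c0 S.K)" by (intro H.C.m_closed H.C.inv_closed k)
      have "eventually (\<lambda>n. ?z n = \<one>\<^bsub>c0 S.K\<^esub> n) sequentially"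
        using \<kappa>'eq[OF abc(2,3)] \<kappa>'eq[OF ab abc(3)] \<kappa>'eq[OF abc(1) bc] \<kappa>'eq[OF abc(1,2)] cocycle[OF abc]
      proof eventually_elim
        case (elim n)
        have "?z n = \<kappa> b c n - \<kappa> (a \<otimes>\<^bsub>\<Gamma>\<^esub> b) c n + \<kappa> a (b \<otimes>\<^bsub>\<Gamma>\<^esub> c) n - \<kappa> a b n"
          unfolding Hinv[OF k(2)] Hinv[OF k(4)] H.c0_mult elim(1-4) by simp
        also have "\<dots> = ?d b c n - ?d (a \<otimes>\<^bsub>\<Gamma>\<^esub> b) c n + ?d a (b \<otimes>\<^bsub>\<Gamma>\<^esub> c) n - ?d a b n"
          by (simp add: \<kappa>_def \<Gamma>.m_assoc[OF abc])
        also have "\<dots> = 0" by (rule elim(5))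
        finally show ?case by (simp add: c0_def)
      qed
      then have "H.cl ?z = H.cl \<one>\<^bsub>c0 S.K\<^esub>" by (intro H.cl_cong zc H.C.one_closed)
      then show ?thesis
        unfolding H.h.hom_one using k
        by (simp only: H.h.hom_mult H.h.hom_inv H.C.m_closed H.C.inv_closed)
    qed
    moreover have "H.cl (\<kappa>' a b) \<in> carrier (Q S.K)" if "a \<in> carrier \<Gamma>" "b \<in> carrier \<Gamma>" for a b
      using \<kappa>'c[OF that] by (rule H.h.hom_closed)
    ultimately show ?thesis by (auto simp: \<omega>_def Z2_def)
  qed
  let ?i\<omega> = "\<lambda>x\<in>carrier \<Gamma> \<times> carrier \<Gamma>. Q_incl (\<omega> x)"
  let ?\<omega>C = "\<lambda>(a, b)\<in>carrier \<Gamma> \<times> carrier \<Gamma>. QC_class (?d a b)"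
  note map = H2_map_class[OF assms(1) H.Q.comm_group_axioms UNIV.Q.comm_group_axioms H.Q_incl_hom \<omega>]
  \<comment> \<open>The two cocycles differ by the coboundary of the classes of \<gamma>: for large
    n this is the definition of \<open>\<kappa>\<close>.\<close>
  have "?\<omega>C = coboundary \<Gamma> QC (\<lambda>a. QC_class (\<gamma> a)) \<otimes>\<^bsub>Z2 \<Gamma> QC\<^esub> ?i\<omega>"
  proof
    fix x
    show "?\<omega>C x = (coboundary \<Gamma> QC (\<lambda>a. QC_class (\<gamma> a)) \<otimes>\<^bsub>Z2 \<Gamma> QC\<^esub> ?i\<omega>) x"
    proof (cases "x \<in> carrier \<Gamma> \<times> carrier \<Gamma>")
      case True
      then obtain a b where x: "x = (a, b)" "a \<in> carrier \<Gamma>" "b \<in> carrier \<Gamma>" by auto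
      note ab = \<Gamma>.m_closed[OF x(2,3)]
      note k = H.c0_subset[OF \<kappa>'c[OF x(2,3)]] and g = \<gamma>c[OF x(2)] \<gamma>c[OF x(3)] \<gamma>c[OF ab]
      let ?C = "c0 (\<lambda>_::nat. UNIV :: complex set)"
      let ?z = "(\<gamma> a \<otimes>\<^bsub>?C\<^esub> inv\<^bsub>?C\<^esub> \<gamma> (a \<otimes>\<^bsub>\<Gamma>\<^esub> b) \<otimes>\<^bsub>?C\<^esub> \<gamma> b) \<otimes>\<^bsub>?C\<^esub> \<kappa>' a b"
      have zc: "?z \<in> carrier ?C" by (intro UNIV.C.m_closed UNIV.C.inv_closed k g)
      have "eventually (\<lambda>n. ?d a b n = ?z n) sequentially"
        using \<kappa>'eq[OF x(2,3)]
      proof eventually_elim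
        case (elim n)
        then show ?case unfolding cinv[OF g(3)] UNIV.c0_mult by (simp add: \<kappa>_def)
      qed
      then have "QC_class (?d a b) = QC_class ?z" by (intro UNIV.cl_cong dc x zc)
      also have "\<dots> = (QC_class (\<gamma> a) \<otimes>\<^bsub>QC\<^esub> inv\<^bsub>QC\<^esub> QC_class (\<gamma> (a \<otimes>\<^bsub>\<Gamma>\<^esub> b)) \<otimes>\<^bsub>QC\<^esub> QC_class (\<gamma> b)) \<otimes>\<^bsub>QC\<^esub> QC_class (\<kappa>' a b)"
        using k g by (simp only: UNIV.h.hom_mult UNIV.h.hom_inv UNIV.C.m_closed UNIV.C.inv_closed)
      finally show ?thesis
        using x H.Q_incl_cl[OF \<kappa>'c[OF x(2,3)]] by (simp add: Z2_def coboundary_def \<omega>_def)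
    qed (auto simp: Z2_def)
  qed
  moreover have "coboundary \<Gamma> QC (\<lambda>a. QC_class (\<gamma> a)) \<in> B2 \<Gamma> QC"
    unfolding B2_def using UNIV.h.hom_closed[OF \<gamma>c] by (intro imageI) auto
  ultimately have "?\<omega>C \<in> B2 \<Gamma> QC #>\<^bsub>Z2 \<Gamma> QC\<^esub> ?i\<omega>" unfolding r_coset_def by blast
  then have "H2_class \<Gamma> QC ?\<omega>C = H2_class \<Gamma> QC ?i\<omega>"
    unfolding H2_class_def
    using ZC.repr_independence[OF _ map(2) B2_subgroup[OF assms(1) UNIV.Q.comm_group_axioms]] by simp
  then have "asymp_hom_class \<Gamma> A \<tau> \<rho> = H2_map \<Gamma> QC Q_incl (H2_class \<Gamma> (Q S.K) \<omega>)"
    unfolding asymp_hom_class_def map(1) .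
  moreover have "H2_class \<Gamma> (Q S.K) \<omega> \<in> carrier (H2 \<Gamma> (Q S.K))"
    unfolding H2_def H2_class_def carrier_FactGroup using \<omega> by (rule imageI)
  ultimately show ?thesis by (rule image_eqI)
qed

end
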